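(* Let $\mathbf{s},\mathbf{t},\boldsymbol{\varepsilon},\boldsymbol{\sigma}\in\mathbb{R}^j$ be such that for every $l\in\{1,\dots,j\}$: $s_l+t_l>n_l/2$, $0<\varepsilon_l<s_l+t_l-n_l/2$, and $\sigma_l=\min\{s_l,\,t_l,\,s_l+t_l-n_l/2-\varepsilon_l\}$. Then $$\mathcal{H}^{\mathbf{s}}_{\mathrm{ul}}(\mathbb{R}^n)\cdot\mathcal{H}^{\mathbf{t}}(\mathbb{R}^n)\subset\mathcal{H}^{\boldsymbol{\sigma}}(\mathbb{R}^n),\qquad \mathcal{H}^{\mathbf{s}}(\mathbb{R}^n)\cdot\mathcal{H}^{\mathbf{t}}_{\mathrm{ul}}(\mathbb{R}^n)\subset\mathcal{H}^{\boldsymbol{\sigma}}(\mathbb{R}^n).$$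
   Context: Fix $j\in\{1,\dots,n\}$ and a decomposition $\mathbb{R}^n=\mathbb{R}^{n_1}\times\dots\times\mathbb{R}^{n_j}$ with $n_1,\dots,n_j\ge1$; write $\xi=(\xi_1,\dots,\xi_j)$ accordingly. For $\mathbf{s}=(s_1,\dots,s_j)\in\mathbb{R}^j$ put $\langle\langle\xi\rangle\rangle^{\mathbf{s}}=\prod_{l=1}^j(1+|\xi_l|^2)^{s_l/2}$ and $\mathcal{H}^{\mathbf{s}}(\mathbb{R}^n)=\{u\in\mathcal{S}'(\mathbb{R}^n):\langle\langle D\rangle\rangle^{\mathbf{s}}u\in L^2(\mathbb{R}^n)\}$, $\|u\|_{\mathcal{H}^{\mathbf{s}}}=\|\langle\langle D\rangle\rangle^{\mathbf{s}}u\|_{L^2}$, where $\langle\langle D\rangle\rangle^{\mathbf{s}}$ is the Fourier multiplier with symbol $\langle\langle\xi\rangle\rangle^{\mathbf{s}}$. For $y\in\mathbb{R}^n$, $\tau_y\chi=\chi(\cdot-y)$. $\mathcal{H}^{\mathbf{s}}_{\mathrm{ul}}(\mathbb{R}^n)$ is the set of $u\in\mathcal{D}'(\mathbb{R}^n)$ for which there is $\chi\in\mathcal{C}_0^\infty(\mathbb{R}^n)\smallsetminus\{0\}$ such that $\sup_y\|u\,\tau_y\chi\|_{\mathcal{H}^{\mathbf{s}}}<\infty$ (this does not depend on $\chi$). For subspaces $A,B$ of distributions, $A\cdot B\subset C$ means that $uv\in C$ for all $u\in A$, $v\in B$. The product of $u$, locally in $\mathcal{H}^{\mathbf{s}}$,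 and $v$, locally in $\mathcal{H}^{\mathbf{t}}$, with $s_l+t_l\ge0$ for all $l$, is the distribution $\langle uv,\varphi\rangle=\langle\chi u,\varphi v\rangle$ for $\varphi\in\mathcal{C}_0^\infty(\mathbb{R}^n)$, where $\chi\in\mathcal{C}_0^\infty(\mathbb{R}^n)$ equals $1$ near $\mathrm{supp}\,\varphi$ and the pairing is the bilinear duality between $\mathcal{H}^{\mathbf{s}}$ and $\mathcal{H}^{-\mathbf{s}}\supset\mathcal{H}^{\mathbf{t}}$; it agrees with the continuous extension of pointwise multiplication of Schwartz functions. *)

theory Defs
  imports "HOL-Analysis.Analysis"
begin

section \<open>Test functions, Schwartz functions and distributions\<close>

type_synonym 'n cfun = "(real, 'n) vec \<Rightarrow> complex"
type_synonym 'n cfunctional = "'n cfun \<Rightarrow> complex"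

definition partial :: "'n::finite \<Rightarrow> 'n cfun \<Rightarrow> 'n cfun" where
  "partial i f = (\<lambda>x. frechet_derivative f (at x) (axis i 1))"

text \<open>Multi-indices are lists of coordinate directions. For smooth functions the order is
  irrelevant, so every classical multi-index occurs, possibly several times.\<close>

definition partials :: "'n::finite list \<Rightarrow> 'n cfun \<Rightarrow> 'n cfun" where
  "partials \<alpha> f = foldr partial \<alpha> f"

definition smooth :: "'n::finite cfun \<Rightarrow> bool" where
  "smooth f \<longleftrightarrow> (\<forall>\<alpha> x. partials \<alpha> f differentiable (at x))"

definition supp :: "'n::finite cfun \<Rightarrow> (real ^ 'n) set" where
  "supp f = closure {x. f x \<noteq> 0}"

definition test_functions :: "'n::finite cfun set" where
  "test_functions = {\<phi>. smooth \<phi> \<and> compact (supp \<phi>)}"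

definition schwartz_functions :: "'n::finite cfun set" where
  "schwartz_functions =
     {\<phi>. smooth \<phi> \<and> (\<forall>\<alpha> k. bounded (range (\<lambda>x. (1 + norm x) ^ k * norm (partials \<alpha> \<phi> x))))}"

definition test_seminorm :: "nat \<Rightarrow> 'n::finite cfun \<Rightarrow> real" where
  "test_seminorm N \<phi> = (\<Sum>\<alpha> | length \<alpha> \<le> N. SUP x. norm (partials \<alpha> \<phi> x))"

definition schwartz_seminorm :: "nat \<Rightarrow> 'n::finite cfun \<Rightarrow> real" where
  "schwartz_seminorm N \<phi> =
     (\<Sum>\<alpha> | length \<alpha> \<le> N. SUP x. (1 + norm x) ^ N * norm (partials \<alpha> \<phi> x))"

definition linear_functional_on :: "'n::finite cfun set \<Rightarrow> 'n cfunctional \<Rightarrow> bool" where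
  "linear_functional_on V u \<longleftrightarrow>
     (\<forall>\<phi>\<in>V. \<forall>\<psi>\<in>V. \<forall>a b. u (\<lambda>x. a * \<phi> x + b * \<psi> x) = a * u \<phi> + b * u \<psi>)"

text \<open>Distributions are functionals made extensional outside their space of test functions,
  so that equality of functionals is equality of distributions.\<close>

definition distributions :: "'n::finite cfunctional set" where
  "distributions =
     {u \<in> extensional test_functions. linear_functional_on test_functions u \<and>
        (\<forall>K. compact K \<longrightarrow> (\<exists>C N. \<forall>\<phi>\<in>test_functions.
            supp \<phi> \<subseteq> K \<longrightarrow> norm (u \<phi>) \<le> C * test_seminorm N \<phi>))}"

definition tempered_distributions :: "'n::finite cfunctional set" where
  "tempered_distributions =
     {u \<in> extensional schwartz_functions. linear_functional_on schwartz_functions u \<and>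
        (\<exists>C N. \<forall>\<phi>\<in>schwartz_functions. norm (u \<phi>) \<le> C * schwartz_seminorm N \<phi>)}"

text \<open>The inclusion of tempered distributions into distributions; it is injective because
  test functions are dense in the Schwartz space.\<close>

definition as_distribution :: "'n::finite cfunctional \<Rightarrow> 'n cfunctional" where
  "as_distribution u = restrict u test_functions"

text \<open>For a test function \<open>\<eta>\<close> and a distribution \<open>u\<close>, the compactly supported distribution
  \<open>\<eta>u\<close>, viewed as a tempered distribution (\<open>\<eta>\<phi>\<close> is a test function for Schwartz \<open>\<phi>\<close>).\<close>

definition cutoff :: "'n::finite cfun \<Rightarrow> 'n cfunctional \<Rightarrow> 'n cfunctional" where
  "cutoff \<eta> u = (\<lambda>\<phi>\<in>schwartz_functions. u (\<lambda>x. \<eta> x * \<phi> x))"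

definition translate :: "real ^ 'n \<Rightarrow> 'n::finite cfun \<Rightarrow> 'n cfun" where
  "translate y \<eta> = (\<lambda>x. \<eta> (x - y))"


section \<open>Fourier multipliers\<close>

definition fourier :: "'n::finite cfun \<Rightarrow> 'n cfun" where
  "fourier \<phi> = (\<lambda>\<xi>. LINT x|lborel. cis (- (x \<bullet> \<xi>)) * \<phi> x)"

definition inv_fourier :: "'n::finite cfun \<Rightarrow> 'n cfun" where
  "inv_fourier \<phi> =
     (\<lambda>x. of_real (1 / (2 * pi) ^ CARD('n)) * (LINT \<xi>|lborel. cis (x \<bullet> \<xi>) * \<phi> \<xi>))"

definition distr_fourier :: "'n::finite cfunctional \<Rightarrow> 'n cfunctional" where
  "distr_fourier u = (\<lambda>\<phi>\<in>schwartz_functions. u (fourier \<phi>))"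

definition distr_inv_fourier :: "'n::finite cfunctional \<Rightarrow> 'n cfunctional" where
  "distr_inv_fourier u = (\<lambda>\<phi>\<in>schwartz_functions. u (inv_fourier \<phi>))"

definition distr_times :: "(real ^ 'n \<Rightarrow> real) \<Rightarrow> 'n::finite cfunctional \<Rightarrow> 'n cfunctional" where
  "distr_times m u = (\<lambda>\<phi>\<in>schwartz_functions. u (\<lambda>\<xi>. of_real (m \<xi>) * \<phi> \<xi>))"

definition fourier_multiplier ::
    "(real ^ 'n \<Rightarrow> real) \<Rightarrow> 'n::finite cfunctional \<Rightarrow> 'n cfunctional" where
  "fourier_multiplier m u = distr_inv_fourier (distr_times m (distr_fourier u))"


section \<open>Square-integrable tempered distributions\<close>

definition square_integrable :: "'n::finite cfun \<Rightarrow> bool" where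
  "square_integrable f \<longleftrightarrow>
     f \<in> borel_measurable lborel \<and> integrable lborel (\<lambda>x. (norm (f x))\<^sup>2)"

definition regular_distribution :: "'n::finite cfun \<Rightarrow> 'n cfunctional" where
  "regular_distribution f = (\<lambda>\<phi>\<in>schwartz_functions. LINT x|lborel. f x * \<phi> x)"

definition L2_distributions :: "'n::finite cfunctional set" where
  "L2_distributions = regular_distribution ` {f. square_integrable f}"

text \<open>The density of an \<open>L\<^sup>2\<close> distribution, which is determined up to null sets.\<close>

definition L2_density :: "'n::finite cfunctional \<Rightarrow> 'n cfun" where
  "L2_density u = (SOME f. square_integrable f \<and> regular_distribution f = u)"

definition L2_norm :: "'n::finite cfunctional \<Rightarrow> real" where
  "L2_norm u = sqrt (LINT x|lborel. (norm (L2_density u x))\<^sup>2)"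


section \<open>Sobolev spaces of multiple order\<close>

text \<open>The decomposition of the coordinate space into blocks is a map \<open>b\<close> sending each coordinate
  to the index of its block, so \<open>\<xi>\<^sub>l\<close> consists of the coordinates \<open>i\<close> with \<open>b i = l\<close>.
  All blocks are nonempty iff \<open>b\<close> is surjective.\<close>

definition block_dim :: "('n::finite \<Rightarrow> 'j::finite) \<Rightarrow> 'j \<Rightarrow> nat" where
  "block_dim b l = card {i. b i = l}"

definition weight :: "('n::finite \<Rightarrow> 'j::finite) \<Rightarrow> real ^ 'j \<Rightarrow> real ^ 'n \<Rightarrow> real" where
  "weight b s \<xi> = (\<Prod>l\<in>UNIV. (1 + (\<Sum>i | b i = l. (\<xi> $ i)\<^sup>2)) powr (s $ l / 2))"

definition bessel ::
    "('n::finite \<Rightarrow> 'j::finite) \<Rightarrow> real ^ 'j \<Rightarrow> 'n cfunctional \<Rightarrow> 'n cfunctional" where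
  "bessel b s u = fourier_multiplier (weight b s) u"

definition sobolev :: "('n::finite \<Rightarrow> 'j::finite) \<Rightarrow> real ^ 'j \<Rightarrow> 'n cfunctional set" where
  "sobolev b s = {u \<in> tempered_distributions. bessel b s u \<in> L2_distributions}"

definition sobolev_norm ::
    "('n::finite \<Rightarrow> 'j::finite) \<Rightarrow> real ^ 'j \<Rightarrow> 'n cfunctional \<Rightarrow> real" where
  "sobolev_norm b s u = L2_norm (bessel b s u)"

definition sobolev_ul :: "('n::finite \<Rightarrow> 'j::finite) \<Rightarrow> real ^ 'j \<Rightarrow> 'n cfunctional set" where
  "sobolev_ul b s =
     {u \<in> distributions. \<exists>\<eta>\<in>test_functions. \<eta> \<noteq> (\<lambda>x. 0) \<and>
        (\<forall>y. cutoff (translate y \<eta>) u \<in> sobolev b s) \<and>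
        bdd_above (range (\<lambda>y. sobolev_norm b s (cutoff (translate y \<eta>) u)))}"

definition sobolev_loc :: "('n::finite \<Rightarrow> 'j::finite) \<Rightarrow> real ^ 'j \<Rightarrow> 'n cfunctional set" where
  "sobolev_loc b s = {u \<in> distributions. \<forall>\<eta>\<in>test_functions. cutoff \<eta> u \<in> sobolev b s}"


section \<open>Products\<close>

text \<open>The bilinear duality between the spaces of orders \<open>s\<close> and \<open>-s\<close>. There is no conjugation,
  and since the weight is even it extends \<open>\<integral>fg\<close> from Schwartz functions.\<close>

definition sobolev_pairing ::
    "('n::finite \<Rightarrow> 'j::finite) \<Rightarrow> real ^ 'j \<Rightarrow> 'n cfunctional \<Rightarrow> 'n cfunctional \<Rightarrow> complex" where
  "sobolev_pairing b s f g =
     (LINT x|lborel. L2_density (bessel b s f) x * L2_density (bessel b (- s) g) x)"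

text \<open>\<open>w\<close> is the product of \<open>u\<close>, locally of order \<open>s\<close>, and \<open>v\<close>, locally of order \<open>t\<close>. The defining
  formula is required for every admissible cut-off \<open>\<eta>\<close>; as each test function \<open>\<phi>\<close> has one, there
  is at most one product.\<close>

definition is_product :: "('n::finite \<Rightarrow> 'j::finite) \<Rightarrow> real ^ 'j \<Rightarrow> real ^ 'j \<Rightarrow>
    'n cfunctional \<Rightarrow> 'n cfunctional \<Rightarrow> 'n cfunctional \<Rightarrow> bool" where
  "is_product b s t u v w \<longleftrightarrow>
     (\<forall>l. s $ l + t $ l \<ge> 0) \<and> u \<in> sobolev_loc b s \<and> v \<in> sobolev_loc b t \<and> w \<in> distributions \<and>
     (\<forall>\<phi>\<in>test_functions. \<forall>\<eta>\<in>test_functions.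
        (\<exists>U. open U \<and> supp \<phi> \<subseteq> U \<and> (\<forall>x\<in>U. \<eta> x = 1)) \<longrightarrow>
        w \<phi> = sobolev_pairing b s (cutoff \<eta> u) (cutoff \<phi> v))"

text \<open>\<open>A \<cdot> B \<subseteq> C\<close>: every product is defined and belongs to \<open>C\<close>.\<close>

definition products_in :: "('n::finite \<Rightarrow> 'j::finite) \<Rightarrow> real ^ 'j \<Rightarrow> real ^ 'j \<Rightarrow>
    'n cfunctional set \<Rightarrow> 'n cfunctional set \<Rightarrow> 'n cfunctional set \<Rightarrow> bool" where
  "products_in b s t A B C \<longleftrightarrow> (\<forall>u\<in>A. \<forall>v\<in>B. \<exists>w\<in>C. is_product b s t u v w)"

end

theory Submission
  imports Defs "HOL-Probability.Probability"
begin

text \<open>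
  The product is studied through Fourier transforms. An element of \<open>H\<^sup>s\<close> is the same thing as a
  measurable function \<open>h\<close>, its transform, for which \<open>\<langle>\<langle>\<xi>\<rangle>\<rangle>\<^sup>s h\<close> is square-integrable
  (\<open>sobolev_spectrum\<close>, \<open>of_spectrum_sobolev\<close>); the product with a Schwartz function, and
  of two such distributions, is a convolution of transforms, and the bilinear duality is
  \<open>\<integral> h(\<xi>) k(-\<xi>) d\<xi>\<close> up to a constant (\<open>cutoff_spectrum\<close>, \<open>sobolev_pairing_spectrum\<close>).

  For two elements of global Sobolev spaces the theorem is a weighted convolution estimate.
  By the Cauchy-Schwarz inequality it suffices to bound, uniformly in \<open>\<zeta>\<close>, the integral over \<open>\<xi>\<close>
  of \<open>(\<langle>\<langle>\<zeta>\<rangle>\<rangle>\<^sup>\<sigma> / (\<langle>\<langle>\<xi>\<rangle>\<rangle>\<^sup>s \<langle>\<langle>\<zeta>-\<xi>\<rangle>\<rangle>\<^sup>t))\<^sup>2\<close>.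
  Put \<open>a = n/2 + \<epsilon>\<close> in every block (of dimension \<open>n\<close>). The conditions \<open>\<sigma> \<le> s\<close>, \<open>\<sigma> \<le> t\<close>,
  \<open>\<sigma> \<le> s + t - a\<close> and \<open>a \<le> s + t\<close> bound the contribution of a block by a constant times
  \<open>(1 + |\<xi>|\<^sup>2)\<^bsup>-a\<^esup> + (1 + |\<zeta>-\<xi>|\<^sup>2)\<^bsup>-a\<^esup>\<close>, which is integrable since \<open>a > n/2\<close>
  (\<open>kernel_block\<close>, \<open>kernel_integral\<close>, \<open>bilinear_estimate\<close>).

  A uniformly local \<open>u\<close> has no transform, only its localizations \<open>\<phi>u\<close> have. The product \<open>uv\<close> is
  therefore first a functional on test functions, \<open>\<langle>uv,\<phi>\<rangle>\<close> being the integral of \<open>v\<close> against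
  \<open>\<phi>u\<close>, and it has to be bounded by the norm of \<open>\<phi>\<close> in \<open>H\<^bsup>-\<sigma>\<^esup>\<close>. Let \<open>\<omega>\<close> be a window for \<open>u\<close>
  and \<open>\<theta> = |\<omega>|\<^sup>4\<close>. Averaging over translates gives
  \<open>(\<integral>\<theta>) \<langle>uv,\<phi>\<rangle> = \<integral> \<langle>uv, \<phi> \<tau>\<^sub>y\<theta>\<rangle> dy\<close> (\<open>averaging\<close>, \<open>transform_pairing_average\<close>), and \<open>\<theta>\<close> splits into
  factors localizing \<open>u\<close>, \<open>v\<close> and \<open>\<phi>\<close> separately. The global estimate applies to the three
  localized objects: the norm of the piece of \<open>u\<close> is bounded uniformly in \<open>y\<close>, while the
  squared norms of the pieces of \<open>v\<close> and \<open>\<phi>\<close> integrate over \<open>y\<close> to at most constants times the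
  squared norms of \<open>v\<close> in \<open>H\<^sup>t\<close> and of \<open>\<phi>\<close> in \<open>H\<^bsup>-\<sigma>\<^esup>\<close> (\<open>localization_bound\<close>), so that
  the Cauchy-Schwarz inequality in \<open>y\<close> gives the bound (\<open>transform_pairing_bound\<close>). The Riesz representation
  theorem turns it into an element of \<open>H\<^sup>\<sigma>\<close> (\<open>product_exists\<close>). The estimate is symmetric in the
  two factors, and so the second inclusion is the first one with \<open>s\<close> and \<open>t\<close> exchanged.

  The Fourier analysis needed is inversion on the Schwartz space, Plancherel's inequality and
  injectivity on integrable functions; all come from Gaussian regularization. Square-integrable
  functions get their transforms from the Riesz theorem by duality with Schwartz functions.
\<close>

section \<open>Calculus of smooth, moderate and Schwartz functions\<close>

lemma partial_eqI:
  assumes "\<And>x. (f has_derivative f' x) (at x)"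
  shows "partial i f = (\<lambda>x. f' x (axis i 1))"
  unfolding partial_def using frechet_derivative_at[OF assms] by metis

lemma partials_Nil [simp]: "partials [] f = f"
  and partials_Cons [simp]: "partials (i # \<alpha>) f = partial i (partials \<alpha> f)"
  and partials_append: "partials (\<alpha> @ \<beta>) f = partials \<alpha> (partials \<beta> f)"
  by (auto simp: partials_def)

lemma partials_partial: "partials \<alpha> (partial i f) = partials (\<alpha> @ [i]) f"
  by (simp add: partials_append)

lemma partials_in:
  assumes "f \<in> A" "\<And>g i. g \<in> A \<Longrightarrow> partial i g \<in> A"
  shows "partials \<alpha> f \<in> A"
  by (induction \<alpha>) (auto simp: assms)

text \<open>Every iterated partial derivative of \<open>f\<close> stays in \<open>A\<close>. Thus smoothness, and with
  additional pointwise bounds also moderate growth and rapid decrease, reduces to a closure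
  property of a suitable class of functions.\<close>

lemma smooth_coinduct:
  assumes "f \<in> A" "\<And>g x. g \<in> A \<Longrightarrow> g differentiable (at x)" "\<And>g i. g \<in> A \<Longrightarrow> partial i g \<in> A"
  shows "smooth f"
  unfolding smooth_def using partials_in[of f A] assms by blast

lemma smooth_differentiable: "smooth f \<Longrightarrow> f differentiable (at x)"
  unfolding smooth_def by (metis partials_Nil)

lemma smooth_partial: "smooth f \<Longrightarrow> smooth (partial i f)"
  unfolding smooth_def by (metis partials_append partials_Cons partials_Nil)

lemma smooth_partials: "smooth f \<Longrightarrow> smooth (partials \<alpha> f)"
  by (induction \<alpha>) (auto intro: smooth_partial)

lemma smooth_continuous: "smooth f \<Longrightarrow> continuous_on A f"
  by (meson continuous_at_imp_continuous_on differentiable_imp_continuous_within smooth_differentiable)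

lemma smooth_measurable [measurable_dest]: "smooth f \<Longrightarrow> f \<in> borel_measurable borel"
  by (intro borel_measurable_continuous_onI smooth_continuous)

lemma differentiable_partial:
  "f differentiable (at x) \<Longrightarrow> (f has_derivative f') (at x) \<Longrightarrow> partial i f x = f' (axis i 1)"
  unfolding partial_def using frechet_derivative_at by metis

lemma has_frechet: "f differentiable (at x) \<Longrightarrow> (f has_derivative frechet_derivative f (at x)) (at x)"
  by (simp add: frechet_derivative_works)

lemma partial_add:
  assumes "\<And>x. f differentiable (at x)" "\<And>x. g differentiable (at x)"
  shows "partial i (\<lambda>x. f x + g x) = (\<lambda>x. partial i f x + partial i g x)"
  by (subst partial_eqI[OF has_derivative_add[OF has_frechet has_frechet]]) (auto simp: assms partial_def)

lemma partial_mult: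
  assumes "\<And>x. f differentiable (at x)" "\<And>x. g differentiable (at x)"
  shows "partial i (\<lambda>x. f x * g x) = (\<lambda>x. f x * partial i g x + partial i f x * g x)"
  by (subst partial_eqI[OF has_derivative_mult[OF has_frechet has_frechet]]) (auto simp: assms partial_def)

lemma partial_const: "partial i (\<lambda>x. c) = (\<lambda>x. 0)"
  by (subst partial_eqI[of _ "\<lambda>_ _. 0"]) auto

lemma partial_cnj:
  assumes "\<And>x. f differentiable (at x)"
  shows "partial i (\<lambda>x. cnj (f x)) = (\<lambda>x. cnj (partial i f x))"
  by (subst partial_eqI[OF bounded_linear.has_derivative[OF bounded_linear_cnj has_frechet]])
     (auto simp: assms partial_def)

lemma smooth_const: "smooth (\<lambda>x. c)"
  by (rule smooth_coinduct[of _ "{\<lambda>x. c |c. True}"]) (blast, force, use partial_const in blast)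

lemma smooth_cnj: "smooth f \<Longrightarrow> smooth (\<lambda>x. cnj (f x))"
  apply (rule smooth_coinduct[of _ "{\<lambda>x. cnj (f x) |f. smooth f}"])
    apply blast
  subgoal for g x
    by (auto intro!: differentiableI[OF bounded_linear.has_derivative[OF bounded_linear_cnj has_frechet[OF smooth_differentiable]]])
  subgoal for g i
    using partial_cnj[OF smooth_differentiable] smooth_partial by blast
  done

lemma smooth_add: "smooth f \<Longrightarrow> smooth g \<Longrightarrow> smooth (\<lambda>x. f x + g x)"
  apply (rule smooth_coinduct[of _ "{\<lambda>x. f x + g x |f g. smooth f \<and> smooth g}"])
    apply blast
  subgoal using differentiable_add[OF smooth_differentiable smooth_differentiable] by blast
  subgoal for g i
    using partial_add[OF smooth_differentiable smooth_differentiable] smooth_partial by blast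
  done

text \<open>Products are handled through the additive closure of a set of products, which is what
  the Leibniz rule preserves.\<close>

inductive_set product_sums :: "'n::finite cfun set \<Rightarrow> 'n cfun set \<Rightarrow> 'n cfun set" for F G where
  prod: "f \<in> F \<Longrightarrow> g \<in> G \<Longrightarrow> (\<lambda>x. f x * g x) \<in> product_sums F G"
| add: "p \<in> product_sums F G \<Longrightarrow> q \<in> product_sums F G \<Longrightarrow> (\<lambda>x. p x + q x) \<in> product_sums F G"

lemma product_sums_partial:
  assumes "\<And>f. f \<in> F \<Longrightarrow> smooth f \<and> (\<forall>i. partial i f \<in> F)"
    and "\<And>f. f \<in> G \<Longrightarrow> smooth f \<and> (\<forall>i. partial i f \<in> G)"
    and "p \<in> product_sums F G"
  shows "(\<forall>x. p differentiable (at x)) \<and> partial i p \<in> product_sums F G"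
  using assms(3)
proof induction
  case (prod f g)
  then have d: "\<And>x. f differentiable (at x)" "\<And>x. g differentiable (at x)"
    using assms(1)[of f] assms(2)[of g] smooth_differentiable[of f] smooth_differentiable[of g] by blast+
  show ?case
    unfolding partial_mult[OF d] using d prod assms
    by (auto intro!: differentiable_mult product_sums.intros)
next
  case (add p q)
  then show ?case
    by (subst partial_add) (auto intro!: differentiable_add product_sums.intros)
qed

lemma smooth_mult: "smooth f \<Longrightarrow> smooth g \<Longrightarrow> smooth (\<lambda>x. f x * g x)"
  apply (rule smooth_coinduct[of _ "product_sums (Collect smooth) (Collect smooth)"])
    apply (rule product_sums.prod; simp)
  using product_sums_partial[of "Collect smooth" "Collect smooth"] smooth_partial by blast+

lemma smooth_sum: "(\<And>k. k \<in> S \<Longrightarrow> smooth (f k)) \<Longrightarrow> smooth (\<lambda>x. \<Sum>k\<in>S. f k x)"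
  by (induction S rule: infinite_finite_induct) (auto intro: smooth_add smooth_const)

text \<open>The multipliers of the Schwartz space.\<close>

definition moderate :: "'n::finite cfun \<Rightarrow> bool" where
  "moderate f \<longleftrightarrow> smooth f \<and> (\<forall>\<alpha>. \<exists>k C. \<forall>x. norm (partials \<alpha> f x) \<le> C * (1 + norm x) ^ k)"

lemma moderate_coinduct:
  assumes "f \<in> A" "\<And>g x. g \<in> A \<Longrightarrow> g differentiable (at x)" "\<And>g i. g \<in> A \<Longrightarrow> partial i g \<in> A"
    and "\<And>g. g \<in> A \<Longrightarrow> \<exists>k C. \<forall>x. norm (g x) \<le> C * (1 + norm x) ^ k"
  shows "moderate f"
  unfolding moderate_def using partials_in[of f A] assms smooth_coinduct[of f A] by blast

lemma schwartz_coinduct: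
  assumes "f \<in> A" "\<And>g x. g \<in> A \<Longrightarrow> g differentiable (at x)" "\<And>g i. g \<in> A \<Longrightarrow> partial i g \<in> A"
    and "\<And>g k. g \<in> A \<Longrightarrow> \<exists>C. \<forall>x. (1 + norm x) ^ k * norm (g x) \<le> C"
  shows "f \<in> schwartz_functions"
proof -
  have "bounded (range (\<lambda>x. (1 + norm x) ^ k * norm (partials \<alpha> f x)))" for k \<alpha>
  proof -
    obtain C where C: "\<And>x. (1 + norm x) ^ k * norm (partials \<alpha> f x) \<le> C"
      using assms(4) partials_in[of f A] assms(1,3) by blast
    show ?thesis unfolding bounded_iff using C
      by (intro exI[of _ C]) (auto simp: abs_mult)
  qed
  then show ?thesis
    unfolding schwartz_functions_def using assms smooth_coinduct[of f A] by blast
qed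

lemma schwartz_smooth: "f \<in> schwartz_functions \<Longrightarrow> smooth f"
  by (simp add: schwartz_functions_def)

lemma schwartz_bound:
  assumes "f \<in> schwartz_functions"
  obtains C where "C \<ge> 0" "\<And>x. (1 + norm x) ^ k * norm (partials \<alpha> f x) \<le> C"
proof -
  have "bounded (range (\<lambda>x. (1 + norm x) ^ k * norm (partials \<alpha> f x)))"
    using assms by (simp add: schwartz_functions_def)
  then obtain C where C: "\<And>x. norm ((1 + norm x) ^ k * norm (partials \<alpha> f x)) \<le> C"
    unfolding bounded_iff by auto
  then have "(1 + norm x) ^ k * norm (partials \<alpha> f x) \<le> C" for x
    using C[of x] by (auto simp: abs_mult)
  moreover have "C \<ge> 0" using C[of 0] norm_ge_zero order_trans by blast
  ultimately show ?thesis using that by blast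
qed

lemma schwartz_bound0:
  assumes "f \<in> schwartz_functions"
  obtains C where "C \<ge> 0" "\<And>x. (1 + norm x) ^ k * norm (f x) \<le> C"
  using schwartz_bound[OF assms, of k "[]"] by auto

lemma schwartz_partial: "f \<in> schwartz_functions \<Longrightarrow> partial i f \<in> schwartz_functions"
  unfolding schwartz_functions_def mem_Collect_eq partials_partial by (auto intro: smooth_partial)

lemma moderate_partial: "moderate f \<Longrightarrow> moderate (partial i f)"
  unfolding moderate_def partials_partial by (auto intro: smooth_partial)

lemma moderate_smooth: "moderate f \<Longrightarrow> smooth f" by (simp add: moderate_def)

lemma moderate_growth: "moderate f \<Longrightarrow> \<exists>k C. \<forall>x. norm (f x) \<le> C * (1 + norm x) ^ k"
  unfolding moderate_def by (metis partials_Nil)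

lemma schwartz_moderate: assumes "f \<in> schwartz_functions" shows "moderate f"
proof (rule moderate_coinduct[of _ schwartz_functions])
  fix g :: "'a cfun" assume g: "g \<in> schwartz_functions"
  show "\<exists>k C. \<forall>x. norm (g x) \<le> C * (1 + norm x) ^ k"
    using schwartz_bound0[OF g, of 0] by (metis mult.right_neutral mult_1 power_0)
qed (use assms in \<open>auto intro: schwartz_partial smooth_differentiable schwartz_smooth\<close>)

lemma decay_add:
  assumes "\<exists>C. \<forall>x::real^'n. (1 + norm x) ^ k * norm (f x :: complex) \<le> C"
    "\<exists>C. \<forall>x. (1 + norm x) ^ k * norm (g x) \<le> C"
  shows "\<exists>C. \<forall>x. (1 + norm x) ^ k * norm (f x + g x) \<le> C"
proof -
  obtain C D where "\<And>x. (1 + norm x) ^ k * norm (f x) \<le> C" "\<And>x. (1 + norm x) ^ k * norm (g x) \<le> D"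
    using assms by auto
  moreover have "(1 + norm x) ^ k * norm (f x + g x)
      \<le> (1 + norm x) ^ k * norm (f x) + (1 + norm x) ^ k * norm (g x)" for x
    unfolding distrib_left[symmetric] by (intro mult_left_mono norm_triangle_ineq) auto
  ultimately show ?thesis by (intro exI[of _ "C + D"]) (smt (verit))
qed

text \<open>By the Leibniz rule the derivatives are sums of products of a moderate and a Schwartz function,
  and each such product is rapidly decreasing.\<close>

lemma schwartz_mult_moderate:
  assumes m: "moderate m" and f: "f \<in> schwartz_functions"
  shows "(\<lambda>x. m x * f x) \<in> schwartz_functions"
proof (rule schwartz_coinduct[of _ "product_sums (Collect moderate) schwartz_functions"])
  show "(\<lambda>x. m x * f x) \<in> product_sums (Collect moderate) schwartz_functions"
    using assms by (intro product_sums.prod) auto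
  fix p :: "'a cfun" assume p: "p \<in> product_sums (Collect moderate) schwartz_functions"
  show "p differentiable (at x)" for x
    using product_sums_partial[OF _ _ p] moderate_partial moderate_smooth schwartz_smooth schwartz_partial
    by blast
  show "partial i p \<in> product_sums (Collect moderate) schwartz_functions" for i
    using product_sums_partial[OF _ _ p] moderate_partial moderate_smooth schwartz_smooth schwartz_partial
    by blast
  fix k
  show "\<exists>C. \<forall>x. (1 + norm x) ^ k * norm (p x) \<le> C"
    using p
  proof induction
    case (prod f g)
    then obtain j D where D: "\<And>x. norm (f x) \<le> D * (1 + norm x) ^ j"
      using moderate_growth by blast
    obtain C where C: "\<And>x. (1 + norm x) ^ (j + k) * norm (g x) \<le> C" and C0: "C \<ge> 0"
      using schwartz_bound0 prod by metis
    have D0: "D \<ge> 0" using D[of 0] by (auto intro: order_trans[OF norm_ge_zero])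
    have "(1 + norm x) ^ k * norm (f x * g x) \<le> D * C" for x
    proof -
      have "(1 + norm x) ^ k * norm (f x * g x) \<le> (1 + norm x) ^ k * ((D * (1 + norm x) ^ j) * norm (g x))"
        unfolding norm_mult by (intro mult_left_mono mult_right_mono D) auto
      also have "\<dots> = D * ((1 + norm x) ^ (j + k) * norm (g x))" by (simp add: power_add)
      also have "\<dots> \<le> D * C" by (intro mult_left_mono C D0)
      finally show ?thesis .
    qed
    then show ?case by blast
  qed (rule decay_add)
qed

lemma schwartz_mult: "f \<in> schwartz_functions \<Longrightarrow> g \<in> schwartz_functions
    \<Longrightarrow> (\<lambda>x. f x * g x) \<in> schwartz_functions"
  using schwartz_mult_moderate schwartz_moderate by blast

lemma moderate_const: "moderate (\<lambda>x. c)"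
proof (rule moderate_coinduct[of _ "{\<lambda>x. c |c. True}"])
  fix g :: "'a cfun" assume "g \<in> {\<lambda>x. c |c. True}"
  then obtain c where g: "g = (\<lambda>x. c)" by blast
  show "\<exists>k C. \<forall>x. norm (g x) \<le> C * (1 + norm x) ^ k"
    unfolding g by (rule exI[of _ 0], rule exI[of _ "norm c"]) simp
  show "partial i g \<in> {\<lambda>x. c |c. True}" for i using partial_const g by blast
qed (blast, force)

lemma schwartz_cmult: "f \<in> schwartz_functions \<Longrightarrow> (\<lambda>x. c * f x) \<in> schwartz_functions"
  by (rule schwartz_mult_moderate[OF moderate_const])

lemma schwartz_add: 
  assumes "f \<in> schwartz_functions" "g \<in> schwartz_functions"
  shows "(\<lambda>x. f x + g x) \<in> schwartz_functions"
proof (rule schwartz_coinduct[of _ "{\<lambda>x. f x + g x |f g. f \<in> schwartz_functions \<and> g \<in> schwartz_functions}"])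
  fix p :: "'a cfun"
  assume "p \<in> {\<lambda>x. f x + g x |f g. f \<in> schwartz_functions \<and> g \<in> schwartz_functions}"
  then obtain f g where p: "p = (\<lambda>x. f x + g x)" "f \<in> schwartz_functions" "g \<in> schwartz_functions"
    by blast
  show "p differentiable (at x)" for x
    unfolding p(1) by (intro differentiable_add smooth_differentiable[OF schwartz_smooth] p)
  show "partial i p \<in> {\<lambda>x. f x + g x |f g. f \<in> schwartz_functions \<and> g \<in> schwartz_functions}" for i
    using partial_add[of f g i] smooth_differentiable[OF schwartz_smooth[OF p(2)]]
      smooth_differentiable[OF schwartz_smooth[OF p(3)]] schwartz_partial p by blast
  show "\<exists>C. \<forall>x. (1 + norm x) ^ k * norm (p x) \<le> C" for k
    unfolding p by (rule decay_add) (metis schwartz_bound0 p(2,3))+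
qed (use assms in auto)

lemma schwartz_lin:
  assumes "f \<in> schwartz_functions" "g \<in> schwartz_functions"
  shows "(\<lambda>x. a * f x + c * g x) \<in> schwartz_functions"
  by (intro schwartz_add schwartz_cmult assms)

lemma schwartz_cnj:
  assumes "f \<in> schwartz_functions"
  shows "(\<lambda>x. cnj (f x)) \<in> schwartz_functions"
proof (rule schwartz_coinduct[of _ "{\<lambda>x. cnj (f x) |f. f \<in> schwartz_functions}"])
  fix p :: "'a cfun"
  assume "p \<in> {\<lambda>x. cnj (f x) |f. f \<in> schwartz_functions}"
  then obtain f where p: "p = (\<lambda>x. cnj (f x))" "f \<in> schwartz_functions"
    by blast
  show "p differentiable (at x)" for x
    unfolding p(1) by (intro smooth_differentiable smooth_cnj schwartz_smooth p)
  show "partial i p \<in> {\<lambda>x. cnj (f x) |f. f \<in> schwartz_functions}" for i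
    using partial_cnj[of f i] smooth_differentiable[OF schwartz_smooth[OF p(2)]] schwartz_partial p by blast
  show "\<exists>C. \<forall>x. (1 + norm x) ^ k * norm (p x) \<le> C" for k
    unfolding p complex_mod_cnj by (metis schwartz_bound0 p(2))
qed (use assms in blast)

lemma partial_affine:
  assumes "\<And>x. f differentiable (at x)"
  shows "partial i (\<lambda>x. f (c *\<^sub>R x + d)) = (\<lambda>x. of_real c * partial i f (c *\<^sub>R x + d))"
proof -
  have "((\<lambda>x. f (c *\<^sub>R x + d)) has_derivative (\<lambda>h. frechet_derivative f (at (c *\<^sub>R x + d)) (c *\<^sub>R h))) (at x)" for x
    by (rule has_derivative_compose[OF _ has_frechet[OF assms]]) (auto intro!: derivative_eq_intros)
  note * = partial_eqI[OF this]
  have "linear (frechet_derivative f (at x))" for x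
    using has_derivative_linear[OF has_frechet[OF assms]] .
  then show ?thesis unfolding * unfolding partial_def
    by (simp only: linear_cmul scaleR_conv_of_real[where 'a=complex, symmetric])
qed

lemma differentiable_affine:
  assumes "\<And>x. f differentiable (at x)"
  shows "(\<lambda>x. f (c *\<^sub>R x + d)) differentiable (at x)"
  by (rule differentiableI, rule has_derivative_compose[OF _ has_frechet[OF assms]])
     (auto intro!: derivative_eq_intros)

lemma smooth_affine:
  assumes "smooth f" shows "smooth (\<lambda>x. f (c *\<^sub>R x + d))"
proof (rule smooth_coinduct[of _ "{\<lambda>x. a * f (c *\<^sub>R x + d) |a f. smooth f}"])
  have "(\<lambda>x. f (c *\<^sub>R x + d)) = (\<lambda>x. 1 * f (c *\<^sub>R x + d))" by simp
  then show "(\<lambda>x. f (c *\<^sub>R x + d)) \<in> {\<lambda>x. a * f (c *\<^sub>R x + d) |a f. smooth f}"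
    using assms by blast
  fix p assume "p \<in> {\<lambda>x. a * f (c *\<^sub>R x + d) |a f. smooth f}"
  then obtain a f where p: "p = (\<lambda>x. a * f (c *\<^sub>R x + d))" "smooth f" by blast
  have df: "\<And>x. (\<lambda>x. f (c *\<^sub>R x + d)) differentiable (at x)" 
    by (intro differentiable_affine smooth_differentiable p)
  then show "p differentiable (at x)" for x unfolding p by (intro differentiable_mult) auto
  have "partial i p = (\<lambda>x. (a * of_real c) * partial i f (c *\<^sub>R x + d))" for i
    unfolding p using df
    by (subst partial_mult) (auto simp: partial_const partial_affine smooth_differentiable p)
  then show "partial i p \<in> {\<lambda>x. a * f (c *\<^sub>R x + d) |a f. smooth f}" for i
    using smooth_partial[OF p(2)] by blast
qed

lemma partials_affine:
  assumes "smooth f"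
  shows "partials \<alpha> (\<lambda>x. f (c *\<^sub>R x + d)) = (\<lambda>x. of_real (c ^ length \<alpha>) * partials \<alpha> f (c *\<^sub>R x + d))"
proof (induction \<alpha>)
  case (Cons i \<alpha>)
  have s: "smooth (partials \<alpha> f)" using assms smooth_partials by blast
  have "\<And>x. partials \<alpha> f differentiable at x" using s smooth_differentiable by blast
  note this differentiable_affine[OF this]
  with Cons show ?case
    by (simp add: partial_mult partial_const partial_affine mult_ac)
qed auto

lemma schwartz_affine:
  assumes f: "f \<in> schwartz_functions" and c: "\<bar>c\<bar> = 1"
  shows "(\<lambda>x. f (c *\<^sub>R x + d)) \<in> schwartz_functions"
proof -
  have "bounded (range (\<lambda>x. (1 + norm x) ^ k * norm (partials \<alpha> (\<lambda>x. f (c *\<^sub>R x + d)) x)))" for k \<alpha>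
  proof -
    obtain C where C: "\<And>x. (1 + norm x) ^ k * norm (partials \<alpha> f x) \<le> C" and C0: "C \<ge> 0"
      using schwartz_bound f by metis
    have "norm ((1 + norm x) ^ k * norm (partials \<alpha> (\<lambda>x. f (c *\<^sub>R x + d)) x)) \<le> (1 + norm d) ^ k * C" for x
    proof -
      have "norm x = norm (c *\<^sub>R x + d - d)" using c by simp
      also have "\<dots> \<le> norm (c *\<^sub>R x + d) + norm d" by (rule norm_triangle_ineq4)
      also have "1 + \<dots> \<le> (1 + norm d) * (1 + norm (c *\<^sub>R x + d))"
        by (simp add: algebra_simps)
      finally have "1 + norm x \<le> (1 + norm d) * (1 + norm (c *\<^sub>R x + d))" by simp
      then have "(1 + norm x) ^ k \<le> ((1 + norm d) * (1 + norm (c *\<^sub>R x + d))) ^ k"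
        by (intro power_mono) auto
      then have "(1 + norm x) ^ k * norm (partials \<alpha> f (c *\<^sub>R x + d)) 
          \<le> (1 + norm d) ^ k * ((1 + norm (c *\<^sub>R x + d)) ^ k * norm (partials \<alpha> f (c *\<^sub>R x + d)))"
        by (simp add: power_mult_distrib mult_right_mono mult.assoc[symmetric])
      also have "\<dots> \<le> (1 + norm d) ^ k * C" by (intro mult_left_mono C) auto
      finally show ?thesis
        using c by (simp add: partials_affine[OF schwartz_smooth[OF f]] norm_mult abs_mult power_abs norm_power)
    qed
    then show ?thesis unfolding bounded_iff by blast
  qed
  then show ?thesis
    unfolding schwartz_functions_def using smooth_affine[OF schwartz_smooth[OF f]] by blast
qed

lemma schwartz_reflect: "f \<in> schwartz_functions \<Longrightarrow> (\<lambda>x. f (- x)) \<in> schwartz_functions"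
  using schwartz_affine[of f "-1" 0] by simp

lemma schwartz_translate: "f \<in> schwartz_functions \<Longrightarrow> translate y f \<in> schwartz_functions"
  using schwartz_affine[of f "1" "-y"] by (simp add: translate_def)

subsection \<open>Test functions\<close>

lemma not_in_supp: "x \<notin> supp f \<Longrightarrow> f x = 0"
  unfolding supp_def using closure_subset[of "{x. f x \<noteq> 0}"] by blast

lemma supp_subset_closed: "closed K \<Longrightarrow> (\<And>x. x \<notin> K \<Longrightarrow> f x = 0) \<Longrightarrow> supp f \<subseteq> K"
  unfolding supp_def by (rule closure_minimal) auto

lemma closed_supp [simp]: "closed (supp f)"
  by (simp add: supp_def)

lemma partial_outside:
  assumes "closed K" "\<And>x. x \<notin> K \<Longrightarrow> f x = 0" "x \<notin> K"
  shows "partial i f x = 0"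
proof -
  have "(f has_derivative (\<lambda>_. 0)) (at x)"
    by (rule has_derivative_transform_within_open[of "\<lambda>_. 0" _ _ _ "-K"]) (use assms in auto)
  then show ?thesis by (metis differentiableI differentiable_partial)
qed

lemma partials_outside:
  assumes "closed K" "\<And>x. x \<notin> K \<Longrightarrow> f x = 0" "x \<notin> K"
  shows "partials \<alpha> f x = 0"
  using assms(3) by (induction \<alpha> arbitrary: x) (auto intro: assms partial_outside[OF assms(1)])

lemma test_functionsI:
  assumes "smooth f" "compact K" "\<And>x. x \<notin> K \<Longrightarrow> f x = 0"
  shows "f \<in> test_functions"
proof -
  have "supp f \<subseteq> K" using supp_subset_closed[OF compact_imp_closed[OF assms(2)] assms(3)] .
  then have "compact (supp f)" using compact_Int_closed[OF assms(2) closed_supp, of f] by (simp add: inf.absorb2)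
  then show ?thesis using assms(1) by (simp add: test_functions_def)
qed

lemma test_schwartz: assumes "f \<in> test_functions" shows "f \<in> schwartz_functions"
proof -
  have s: "smooth f" and K: "compact (supp f)" using assms by (auto simp: test_functions_def)
  have "bounded (range (\<lambda>x. (1 + norm x) ^ k * norm (partials \<alpha> f x)))" for k \<alpha>
  proof -
    have "continuous_on (supp f) (\<lambda>x. (1 + norm x) ^ k * norm (partials \<alpha> f x))"
      by (intro continuous_intros smooth_continuous smooth_partials s)
    then have "bounded ((\<lambda>x. (1 + norm x) ^ k * norm (partials \<alpha> f x)) ` supp f)"
      using K compact_continuous_image compact_imp_bounded by blast
    moreover have "range (\<lambda>x. (1 + norm x) ^ k * norm (partials \<alpha> f x))
       \<subseteq> insert 0 ((\<lambda>x. (1 + norm x) ^ k * norm (partials \<alpha> f x)) ` supp f)"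
      using partials_outside[OF closed_supp not_in_supp] by force
    ultimately show ?thesis by (meson bounded_insert bounded_subset)
  qed
  then show ?thesis unfolding schwartz_functions_def using s by blast
qed

lemma test_smooth: "f \<in> test_functions \<Longrightarrow> smooth f"
  by (simp add: test_functions_def)

lemma test_mult_smooth:
  assumes "f \<in> test_functions" "smooth g" shows "(\<lambda>x. f x * g x) \<in> test_functions"
  by (rule test_functionsI[of _ "supp f"])
     (use assms in \<open>auto simp: test_functions_def not_in_supp intro: smooth_mult\<close>)

lemma test_cnj: "f \<in> test_functions \<Longrightarrow> (\<lambda>x. cnj (f x)) \<in> test_functions"
  by (rule test_functionsI[of _ "supp f"]) (auto simp: test_functions_def not_in_supp intro: smooth_cnj)

lemma test_lin:
  assumes "f \<in> test_functions" "g \<in> test_functions"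
  shows "(\<lambda>x. a * f x + c * g x) \<in> test_functions"
  by (rule test_functionsI[of _ "supp f \<union> supp g"])
     (use assms in \<open>auto simp: test_functions_def not_in_supp intro!: smooth_add smooth_mult smooth_const\<close>)

lemma test_zero: "(\<lambda>x. 0) \<in> test_functions"
  by (rule test_functionsI[of _ "{}"]) (auto intro: smooth_const)

lemma test_translate:
  assumes "f \<in> test_functions" shows "translate y f \<in> test_functions"
proof (rule test_functionsI[of _ "(\<lambda>x. x + y) ` supp f"])
  show "smooth (translate y f)"
    using smooth_affine[of f 1 "-y"] assms by (simp add: translate_def test_functions_def)
  show "compact ((\<lambda>x. x + y) ` supp f)"
    using assms by (intro compact_continuous_image) (auto simp: test_functions_def intro!: continuous_intros)
  fix x assume "x \<notin> (\<lambda>x. x + y) ` supp f"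
  then have "x - y \<notin> supp f" by (metis diff_add_cancel image_eqI)
  then show "translate y f x = 0" by (simp add: translate_def not_in_supp)
qed

text \<open>The quotient rule keeps the class of quotients with a denominator that does not vanish on
  a fixed closed set supporting the numerator.\<close>

lemma smooth_quotient:
  assumes K: "closed K" and f: "smooth f" "\<And>x. x \<notin> K \<Longrightarrow> f x = 0"
    and q: "smooth q" "\<And>x. x \<in> K \<Longrightarrow> q x \<noteq> 0"
  shows "smooth (\<lambda>x. f x / q x)"
proof (rule smooth_coinduct[of _ "{\<lambda>x. f x / q x |f q. smooth f \<and> smooth q \<and>
    (\<forall>x. x \<notin> K \<longrightarrow> f x = 0) \<and> (\<forall>x\<in>K. q x \<noteq> 0)}"])
  fix p :: "'a cfun" assume "p \<in> {\<lambda>x. f x / q x |f q. smooth f \<and> smooth q \<and>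
    (\<forall>x. x \<notin> K \<longrightarrow> f x = 0) \<and> (\<forall>x\<in>K. q x \<noteq> 0)}"
  then obtain f q where p: "p = (\<lambda>x. f x / q x)" and f: "smooth f" "\<And>x. x \<notin> K \<Longrightarrow> f x = 0"
    and q: "smooth q" "\<And>x. x \<in> K \<Longrightarrow> q x \<noteq> 0" by blast
  let ?N = "\<lambda>i x. partial i f x * q x + (-1) * (f x * partial i q x)"
  have D: "(p has_derivative (\<lambda>h. if x \<in> K then
      (frechet_derivative f (at x) h * q x - f x * frechet_derivative q (at x) h) / (q x * q x) else 0)) (at x)" for x
  proof (cases "x \<in> K")
    case True
    then show ?thesis unfolding p
      using has_derivative_divide'[OF has_frechet[OF smooth_differentiable[OF f(1)]] 
          has_frechet[OF smooth_differentiable[OF q(1)]] q(2)[OF True]]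
      by (simp add: algebra_simps)
  next
    case False
    have "((\<lambda>x. f x / q x) has_derivative (\<lambda>_. 0)) (at x)"
      by (rule has_derivative_transform_within_open[of "\<lambda>_. 0" _ _ _ "-K"]) (use False K f in auto)
    with False show ?thesis unfolding p by simp
  qed
  then show "p differentiable (at x)" for x by (rule differentiableI)
  have "partial i p = (\<lambda>x. ?N i x / (q x * q x))" for i
    unfolding partial_eqI[OF D] using f(2) partial_outside[OF K f(2)] by (auto simp: partial_def)
  moreover have "smooth (?N i)" for i
    by (intro smooth_add smooth_mult smooth_const f q smooth_partial)
  moreover have "smooth (\<lambda>x. q x * q x)" by (intro smooth_mult q)
  moreover have "\<And>i x. x \<notin> K \<Longrightarrow> ?N i x = 0" using f(2) partial_outside[OF K f(2)] by auto
  ultimately show "partial i p \<in> {\<lambda>x. f x / q x |f q. smooth f \<and> smooth q \<and>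
    (\<forall>x. x \<notin> K \<longrightarrow> f x = 0) \<and> (\<forall>x\<in>K. q x \<noteq> 0)}" for i
    using q(2) by (intro CollectI exI[of _ "?N i"] exI[of _ "\<lambda>x. q x * q x"]) auto
qed (use assms in blast)

subsection \<open>Weights, characters and Gaussians\<close>

definition bracket :: "('n::finite \<Rightarrow> 'j::finite) \<Rightarrow> 'j \<Rightarrow> real ^ 'n \<Rightarrow> real" where
  "bracket b l \<xi> = 1 + (\<Sum>i | b i = l. (\<xi> $ i)\<^sup>2)"

lemma bracket_ge1: "bracket b l \<xi> \<ge> 1"
  unfolding bracket_def by (simp add: sum_nonneg)

lemma bracket_le: "bracket b l \<xi> \<le> (1 + norm \<xi>)\<^sup>2"
proof -
  have "(\<Sum>i | b i = l. (\<xi> $ i)\<^sup>2) \<le> (\<Sum>i\<in>UNIV. (\<xi> $ i)\<^sup>2)"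
    by (intro sum_mono2) auto
  also have "\<dots> = (norm \<xi>)\<^sup>2" by (simp add: norm_vec_def L2_set_def sum_nonneg)
  finally show ?thesis unfolding bracket_def by (simp add: power2_sum add_increasing2)
qed

text \<open>A class closed under partial derivatives that contains weights, characters and polynomials:
  all its members are moderate as soon as the generators are differentiable and grow polynomially.\<close>

inductive_set elementary :: "('n::finite \<Rightarrow> 'j::finite) \<Rightarrow> 'n cfun set" for b where
  const: "(\<lambda>x. c) \<in> elementary b"
| coord: "(\<lambda>x. of_real (x $ i)) \<in> elementary b"
| power: "(\<lambda>x. of_real (bracket b l x powr r)) \<in> elementary b"
| char: "(\<lambda>x. cis (x \<bullet> v)) \<in> elementary b"
| add: "f \<in> elementary b \<Longrightarrow> g \<in> elementary b \<Longrightarrow> (\<lambda>x. f x + g x) \<in> elementary b"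
| mult: "f \<in> elementary b \<Longrightarrow> g \<in> elementary b \<Longrightarrow> (\<lambda>x. f x * g x) \<in> elementary b"

lemma elementary_sum: "(\<And>k. k \<in> S \<Longrightarrow> f k \<in> elementary b) \<Longrightarrow> (\<lambda>x. \<Sum>k\<in>S. f k x) \<in> elementary b"
  by (induction S rule: infinite_finite_induct) (auto intro: elementary.intros)

lemma elementary_prod: "(\<And>k. k \<in> S \<Longrightarrow> f k \<in> elementary b) \<Longrightarrow> (\<lambda>x. \<Prod>k\<in>S. f k x) \<in> elementary b"
  by (induction S rule: infinite_finite_induct) (auto intro: elementary.intros)

lemma has_derivative_bracket:
  "(bracket b l has_derivative (\<lambda>h. \<Sum>i | b i = l. 2 * (x $ i) * (h $ i))) (at x)"
proof -
  have "((\<lambda>x. (x $ i)\<^sup>2) has_derivative (\<lambda>h. 2 * (x $ i) * (h $ i))) (at x)" for i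
    using has_derivative_power[OF bounded_linear.has_derivative[OF bounded_linear_vec_nth has_derivative_ident],
        where n = 2 and x = x and S = UNIV]
    by (simp add: mult_ac)
  from has_derivative_add[OF has_derivative_const[of 1] has_derivative_sum[OF this]]
  show ?thesis unfolding bracket_def[abs_def] by simp
qed

lemma elementary_partial:
  assumes "f \<in> elementary b"
  shows "(\<forall>x. f differentiable (at x)) \<and> (\<forall>i. partial i f \<in> elementary b)"
  using assms
proof induction
  case (const c)
  show ?case by (auto simp: partial_const intro: elementary.intros)
next
  case (coord k)
  have D: "((\<lambda>x. of_real (x $ k)::complex) has_derivative (\<lambda>h. of_real (h $ k))) (at x)" for x :: "real^'a"
    by (rule has_derivative_of_real, rule bounded_linear.has_derivative[OF bounded_linear_vec_nth]) auto
  then show ?case unfolding partial_eqI[OF D]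
    by (auto intro: elementary.intros differentiableI)
next
  case (power l r)
  have D: "((\<lambda>x. of_real (bracket b l x powr r) :: complex) has_derivative
     (\<lambda>h. of_real (r * bracket b l x powr (r - 1) * (\<Sum>i | b i = l. 2 * (x $ i) * (h $ i))))) (at x)" for x
  proof -
    have p: "bracket b l x > 0" using bracket_ge1[of b l x] by linarith
    have "((\<lambda>x. bracket b l x powr r) has_derivative
       (\<lambda>h. (r * bracket b l x powr (r - 1)) * (\<Sum>i | b i = l. 2 * (x $ i) * (h $ i)))) (at x)"
      by (rule has_derivative_compose[OF has_derivative_bracket, of "\<lambda>y. y powr r" "\<lambda>h. (r * bracket b l x powr (r - 1)) * h"])
         (use has_real_derivative_powr[OF p, of r] in \<open>simp add: has_field_derivative_def\<close>)
    from has_derivative_of_real[OF this] show ?thesis .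
  qed
  have "partial i (\<lambda>x. of_real (bracket b l x powr r)) \<in> elementary b" for i
  proof -
    have "partial i (\<lambda>x. of_real (bracket b l x powr r)) =
      (\<lambda>x. of_real r * (of_real (bracket b l x powr (r - 1)) *
         (\<Sum>k | b k = l. (2 * of_real (axis i 1 $ k)) * of_real (x $ k))))"
      unfolding partial_eqI[OF D] by (auto simp: fun_eq_iff mult_ac)
    then show ?thesis by (simp del: of_real_mult)
       (intro elementary.intros elementary_sum)
  qed
  then show ?case using D differentiableI by blast
next
  case (char v)
  have D: "((\<lambda>x. cis (x \<bullet> v)) has_derivative (\<lambda>h. (h \<bullet> v) *\<^sub>R (\<i> * cis (x \<bullet> v)))) (at x)" for x :: "real^'a"
    by (rule has_derivative_cis) (auto intro!: derivative_eq_intros)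
  have "partial i (\<lambda>x. cis (x \<bullet> v)) = (\<lambda>x. (of_real (axis i 1 \<bullet> v) * \<i>) * cis (x \<bullet> v))" for i
    unfolding partial_eqI[OF D] by (auto simp: scaleR_conv_of_real)
  moreover have "(\<lambda>x. (of_real (axis i 1 \<bullet> v) * \<i>) * cis (x \<bullet> v)) \<in> elementary b" for i
    by (intro elementary.intros)
  ultimately show ?case using D[THEN differentiableI] by simp
next
  case (add f g)
  then show ?case using partial_add[of f g] by (auto intro: elementary.intros)
next
  case (mult f g)
  have "(\<lambda>x. f x * partial i g x + partial i f x * g x) \<in> elementary b" for i
    using mult by (intro elementary.add elementary.mult) auto
  with mult show ?case using partial_mult[of f g] by auto
qed

lemma elementary_growth:
  assumes "f \<in> elementary b"
  shows "\<exists>k C. C \<ge> 0 \<and> (\<forall>x. norm (f x) \<le> C * (1 + norm x) ^ k)"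
  using assms
proof induction
  case (const c)
  show ?case by (intro exI[of _ 0] exI[of _ "norm c"]) auto
next
  case (coord i)
  have "norm (of_real (x $ i) :: complex) \<le> 1 * (1 + norm x) ^ 1" for x :: "real^'a"
    using component_le_norm_cart[of x i] by simp
  then show ?case by (metis zero_le_one)
next
  case (power l r)
  have "norm (of_real (bracket b l x powr r) :: complex) \<le> 1 * (1 + norm x) ^ (2 * nat \<lceil>\<bar>r\<bar>\<rceil>)" for x
  proof -
    have "bracket b l x powr r \<le> bracket b l x powr real (nat \<lceil>\<bar>r\<bar>\<rceil>)"
      using bracket_ge1[of b l x] by (intro powr_mono) linarith+
    also have "\<dots> = bracket b l x ^ nat \<lceil>\<bar>r\<bar>\<rceil>"
      using bracket_ge1[of b l x] by (subst powr_realpow) auto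
    also have "\<dots> \<le> ((1 + norm x)\<^sup>2) ^ nat \<lceil>\<bar>r\<bar>\<rceil>"
      using bracket_ge1[of b l x] bracket_le[of b l x] by (intro power_mono) auto
    finally show ?thesis by (simp add: power_mult)
  qed
  then show ?case by (metis zero_le_one)
next
  case (char v)
  show ?case by (intro exI[of _ 0] exI[of _ 1]) auto
next
  case (add f g)
  then obtain k C j D where *: "C \<ge> 0" "D \<ge> 0" "\<And>x. norm (f x) \<le> C * (1 + norm x) ^ k"
    "\<And>x. norm (g x) \<le> D * (1 + norm x) ^ j" by metis
  have "norm (f x + g x) \<le> (C + D) * (1 + norm x) ^ (k + j)" for x
  proof -
    have "C * (1 + norm x) ^ k \<le> C * (1 + norm x) ^ (k + j)"
      "D * (1 + norm x) ^ j \<le> D * (1 + norm x) ^ (k + j)"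
      by (intro mult_left_mono power_increasing *; simp)+
    then show ?thesis using *(3,4)[of x] norm_triangle_ineq[of "f x" "g x"]
      by (simp add: algebra_simps)
  qed
  then show ?case using *(1,2) by (meson add_nonneg_nonneg)
next
  case (mult f g)
  then obtain k C j D where *: "C \<ge> 0" "D \<ge> 0" "\<And>x. norm (f x) \<le> C * (1 + norm x) ^ k"
    "\<And>x. norm (g x) \<le> D * (1 + norm x) ^ j" by metis
  have "norm (f x * g x) \<le> (C * D) * (1 + norm x) ^ (k + j)" for x
    using mult_mono[OF *(3)[of x] *(4)[of x]] * by (simp add: norm_mult power_add mult_ac)
  then show ?case using *(1,2) by (meson mult_nonneg_nonneg)
qed

lemma elementary_moderate: "f \<in> elementary b \<Longrightarrow> moderate f"
  by (rule moderate_coinduct[of _ "elementary b"]) (use elementary_partial elementary_growth in blast)+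

lemma weight_bracket: "weight b s \<xi> = (\<Prod>l\<in>UNIV. bracket b l \<xi> powr (s $ l / 2))"
  by (simp add: weight_def bracket_def)

lemma moderate_weight: "moderate (\<lambda>\<xi>. of_real (weight b s \<xi>))"
  by (rule elementary_moderate[of _ b]) (auto simp: weight_bracket intro!: elementary_prod elementary.power)

lemma moderate_cis: "moderate (\<lambda>x. cis (x \<bullet> v))"
  by (rule elementary_moderate[of _ "\<lambda>_. ()"]) (rule elementary.char)

lemma moderate_coord: "moderate (\<lambda>x. of_real (x $ i))"
  by (rule elementary_moderate[of _ "\<lambda>_. ()"]) (rule elementary.coord)

definition gauss :: "'n::finite cfun" where
  "gauss x = of_real (exp (- (norm x)\<^sup>2 / 2))"

lemma has_derivative_gauss:
  "(gauss has_derivative (\<lambda>h. of_real (- (x \<bullet> h) * exp (- (norm x)\<^sup>2 / 2)))) (at x)"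
  unfolding gauss_def[abs_def]
  by (rule has_derivative_of_real, unfold power2_norm_eq_inner)
     (auto intro!: derivative_eq_intros simp: inner_commute)

lemma power_exp_bound: "\<exists>C. \<forall>r\<ge>0. (1 + r) ^ k * exp (- r\<^sup>2 / 2) \<le> (C::real)"
proof -
  have "(1 + r) ^ k * exp (- r\<^sup>2 / 2) \<le> fact k * exp 2" if "r \<ge> 0" for r :: real
  proof -
    have "(1 + r) ^ k / fact k \<le> exp (1 + r)"
    proof -
      have "(\<lambda>n. (1 + r) ^ n / fact n) sums exp (1 + r)"
        using exp_converges[of "1 + r"] by (simp add: field_simps)
      then show ?thesis
        using sum_le_suminf[of "\<lambda>n. (1 + r) ^ n / fact n" "{k}"] that by (auto simp: sums_iff)
    qed
    then have "(1 + r) ^ k \<le> fact k * exp (1 + r)" by (simp add: field_simps)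
    then have "(1 + r) ^ k * exp (- r\<^sup>2 / 2) \<le> fact k * exp (1 + r) * exp (- r\<^sup>2 / 2)"
      by (intro mult_right_mono) auto
    also have "\<dots> = fact k * exp (1 + r - r\<^sup>2 / 2)" by (simp add: exp_add[symmetric] mult.assoc)
    also have "\<dots> \<le> fact k * exp 2"
    proof -
      have "(r - 1)\<^sup>2 \<ge> 0" by simp
      then have "1 + r - r\<^sup>2 / 2 \<le> 2" by (simp add: power2_eq_square algebra_simps)
      then show ?thesis by simp
    qed
    finally show ?thesis .
  qed
  then show ?thesis by blast
qed

text \<open>The derivatives are products of the Gaussian with moderate functions, so only the decay of the
  Gaussian itself enters.\<close>

lemma gauss_schwartz: "gauss \<in> schwartz_functions"
proof (rule schwartz_coinduct[of _ "{\<lambda>x. m x * gauss x |m. m \<in> elementary (\<lambda>_. ())}"])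
  show "(gauss :: 'a cfun) \<in> {\<lambda>x. m x * gauss x |m. m \<in> elementary (\<lambda>_. ())}"
    using elementary.const[of "1" "\<lambda>_. ()"] by (intro CollectI exI[of _ "\<lambda>x. 1"]) auto
  fix p :: "'a cfun" assume "p \<in> {\<lambda>x. m x * gauss x |m. m \<in> elementary (\<lambda>_. ())}"
  then obtain m where p: "p = (\<lambda>x. m x * gauss x)" and m: "m \<in> elementary (\<lambda>_. ())" by blast
  note mm = elementary_moderate[OF m]
  have d: "\<And>x. m differentiable at x" "\<And>x. (gauss :: 'a cfun) differentiable at x"
    using mm smooth_differentiable moderate_smooth has_derivative_gauss differentiableI by blast+
  show "p differentiable (at x)" for x unfolding p by (intro differentiable_mult d)
  show "partial i p \<in> {\<lambda>x. m x * gauss x |m. m \<in> elementary (\<lambda>_. ())}" for i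
  proof -
    have "partial i p = (\<lambda>x. (partial i m x + m x * (- 1 * of_real (x $ i))) * gauss x)"
      unfolding p partial_mult[OF d] partial_eqI[OF has_derivative_gauss]
      by (auto simp: gauss_def inner_axis algebra_simps)
    moreover have "(\<lambda>x. partial i m x + m x * (- 1 * of_real (x $ i))) \<in> elementary (\<lambda>_. ())"
      using elementary_partial[OF m] by (intro elementary.intros m) auto
    ultimately show ?thesis
      by (intro CollectI exI[of _ "\<lambda>x. partial i m x + m x * (- 1 * of_real (x $ i))"] conjI)
  qed
  show "\<exists>C. \<forall>x. (1 + norm x) ^ k * norm (p x) \<le> C" for k
  proof -
    obtain j D where D: "\<And>x. norm (m x) \<le> D * (1 + norm x) ^ j" using moderate_growth[OF mm] by blast
    have D0: "D \<ge> 0" using D[of 0] by (auto intro: order_trans[OF norm_ge_zero])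
    obtain C where C: "\<And>r::real. r \<ge> 0 \<Longrightarrow> (1 + r) ^ (k + j) * exp (- r\<^sup>2 / 2) \<le> C" using power_exp_bound[of "k + j"] by metis
    have "(1 + norm x) ^ k * norm (p x) \<le> D * C" for x
    proof -
      have "(1 + norm x) ^ k * norm (p x) \<le> (1 + norm x) ^ k * ((D * (1 + norm x) ^ j) * exp (- (norm x)\<^sup>2 / 2))"
        unfolding p norm_mult by (intro mult_left_mono mult_mono D) (auto simp: gauss_def D0)
      also have "\<dots> = D * ((1 + norm x) ^ (k + j) * exp (- (norm x)\<^sup>2 / 2))" by (simp add: power_add)
      also have "\<dots> \<le> D * C" by (intro mult_left_mono C D0) auto
      finally show ?thesis .
    qed
    then show ?thesis by blast
  qed
qed

section \<open>Integration over Euclidean space\<close>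

lemma distr_affine1:
  fixes t :: "'a::euclidean_space"
  assumes "\<bar>c\<bar> = 1"
  shows "distr lborel borel (\<lambda>x. t + c *\<^sub>R x) = lborel"
proof -
  have "c \<noteq> 0" using assms by auto
  from lborel_affine[OF this, of t] show ?thesis using assms by (simp add: density_1)
qed

lemma nn_integral_affine1:
  fixes t :: "'a::euclidean_space"
  assumes "\<bar>c\<bar> = 1" and [measurable]: "f \<in> borel_measurable borel"
  shows "(\<integral>\<^sup>+x. f (t + c *\<^sub>R x) \<partial>lborel) = (\<integral>\<^sup>+x. f x \<partial>lborel)"
  by (subst (2) distr_affine1[OF assms(1), of t, symmetric]) (simp add: nn_integral_distr)

lemma nn_integral_reflect:
  fixes f :: "'a::euclidean_space \<Rightarrow> ennreal"
  assumes "f \<in> borel_measurable borel"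
  shows "(\<integral>\<^sup>+x. f (- x) \<partial>lborel) = (\<integral>\<^sup>+x. f x \<partial>lborel)"
    and "(\<integral>\<^sup>+x. f (t - x) \<partial>lborel) = (\<integral>\<^sup>+x. f x \<partial>lborel)"
    and "(\<integral>\<^sup>+x. f (t + x) \<partial>lborel) = (\<integral>\<^sup>+x. f x \<partial>lborel)"
    and "(\<integral>\<^sup>+x. f (x - t) \<partial>lborel) = (\<integral>\<^sup>+x. f x \<partial>lborel)"
  using nn_integral_affine1[OF _ assms, of "-1" 0] nn_integral_affine1[OF _ assms, of "-1" t]
    nn_integral_affine1[OF _ assms, of 1 t] nn_integral_affine1[OF _ assms, of 1 "-t"] by simp_all

lemma integral_affine:
  fixes f :: "'a::euclidean_space \<Rightarrow> complex"
  assumes c: "c \<noteq> 0" and [measurable]: "f \<in> borel_measurable borel"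
  shows "(LINT x|lborel. f x) = of_real (\<bar>c\<bar> ^ DIM('a)) * (LINT x|lborel. f (t + c *\<^sub>R x))"
  by (subst lborel_affine[OF c, of t], subst integral_density)
     (auto simp: integral_distr scaleR_conv_of_real)

lemma integrable_affine:
  fixes f :: "'a::euclidean_space \<Rightarrow> 'b::{banach, second_countable_topology}"
  assumes c: "c \<noteq> 0" and i: "integrable lborel f"
  shows "integrable lborel (\<lambda>x. f (t + c *\<^sub>R x))"
proof -
  have [measurable]: "f \<in> borel_measurable borel" using i by auto
  have "integrable (density (distr lborel borel (\<lambda>x. t + c *\<^sub>R x)) (\<lambda>_. ennreal (\<bar>c\<bar> ^ DIM('a)))) f"
    using i lborel_affine[OF c, of t] by simp
  then have "integrable lborel (\<lambda>x. \<bar>c\<bar> ^ DIM('a) *\<^sub>R f (t + c *\<^sub>R x))"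
    by (subst (asm) integrable_density) (auto simp: integrable_distr_eq)
  from integrable_scaleR_right[OF this, of "inverse (\<bar>c\<bar> ^ DIM('a))"] show ?thesis using c by simp
qed

lemma integral_reflect:
  fixes f :: "'a::euclidean_space \<Rightarrow> complex"
  assumes "f \<in> borel_measurable borel"
  shows "(LINT x|lborel. f (- x)) = (LINT x|lborel. f x)"
    and "(LINT x|lborel. f (t - x)) = (LINT x|lborel. f x)"
    and "(LINT x|lborel. f (t + x)) = (LINT x|lborel. f x)"
    and "(LINT x|lborel. f (x - t)) = (LINT x|lborel. f x)"
  using integral_affine[OF _ assms, of "-1" 0] integral_affine[OF _ assms, of "-1" t]
    integral_affine[OF _ assms, of 1 t] integral_affine[OF _ assms, of 1 "-t"] by simp_all

lemma Basis_cart: "(Basis :: (real ^ 'n) set) = range (\<lambda>i. axis i 1)"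
  by (auto simp: Basis_vec_def)

lemma inj_axis: "inj (\<lambda>i. axis i (1::real))"
  by (auto simp: inj_on_def axis_eq_axis)

lemma axis_index_axis1: "axis_index (axis i (1::real)) = i"
  by (metis axis_eq_axis axis_in_Basis_iff axis_index one_neq_zero Basis_real_def insertI1)

lemma prod_Basis_cart: "(\<Prod>e\<in>(Basis :: (real ^ 'n) set). g e) = (\<Prod>i\<in>UNIV. g (axis i 1))"
  unfolding Basis_cart using inj_axis by (subst prod.reindex) auto

lemma nn_integral_prod_cart:
  fixes f :: "'n::finite \<Rightarrow> real \<Rightarrow> ennreal"
  assumes [measurable]: "\<And>i. f i \<in> borel_measurable borel"
  shows "(\<integral>\<^sup>+x. (\<Prod>i\<in>UNIV. f i (x $ i)) \<partial>(lborel :: (real ^ 'n) measure))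
     = (\<Prod>i\<in>UNIV. (\<integral>\<^sup>+t. f i t \<partial>lborel))"
  using nn_integral_lborel_prod[of "\<lambda>e :: real ^ 'n. f (axis_index e)"]
  by (simp add: prod_Basis_cart axis_index_axis1 cart_eq_inner_axis)

lemma integral_prod_cart:
  fixes f :: "'n::finite \<Rightarrow> real \<Rightarrow> complex"
  assumes i: "\<And>i. integrable lborel (f i)"
  shows "(LINT x|(lborel :: (real ^ 'n) measure). (\<Prod>i\<in>UNIV. f i (x $ i))) = (\<Prod>i\<in>UNIV. (LINT t|lborel. f i t))"
proof -
  interpret product_sigma_finite "\<lambda>_::real^'n. lborel :: real measure" ..
  have [measurable]: "f i \<in> borel_measurable borel" for i using i by auto
  have "(LINT x|(lborel :: (real ^ 'n) measure). (\<Prod>i\<in>UNIV. f i (x $ i)))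
     = (LINT x|(lborel :: (real ^ 'n) measure). (\<Prod>e\<in>Basis. f (axis_index e) (x \<bullet> e)))"
    by (simp add: prod_Basis_cart axis_index_axis1 cart_eq_inner_axis)
  also have "\<dots> = (LINT x|(\<Pi>\<^sub>M b\<in>(Basis::(real^'n) set). lborel). (\<Prod>e\<in>Basis. f (axis_index e) (x e)))"
    by (subst lborel_eq, subst integral_distr) auto
  also have "\<dots> = (\<Prod>e\<in>(Basis::(real^'n) set). (LINT t|lborel. f (axis_index e) t))"
    by (rule product_integral_prod) (auto intro: i)
  finally show ?thesis by (simp add: prod_Basis_cart axis_index_axis1)
qed

text \<open>Since \<open>(1 + |x|)\<^sup>2 \<le> 2 (1 + x\<^sup>2)\<close>, the integrand is dominated on each half-line by a power of
  \<open>1 + |x|\<close>, which has an explicit primitive.\<close>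

lemma nn_integral_bracket_power:
  assumes p: "p > 1 / 2"
  shows "(\<integral>\<^sup>+x. ennreal ((1 + x\<^sup>2) powr - p) \<partial>(lborel :: real measure)) < \<infinity>"
proof -
  let ?g = "\<lambda>x::real. 2 powr p * (1 + x) powr (- 2 * p)"
  let ?G = "\<lambda>x::real. 2 powr p / (1 - 2 * p) * (1 + x) powr (1 - 2 * p)"
  have le: "(1 + x\<^sup>2) powr - p \<le> ?g \<bar>x\<bar>" for x :: real
  proof -
    have "(1 - \<bar>x\<bar>)\<^sup>2 \<ge> 0" by simp
    then have "(1 + \<bar>x\<bar>)\<^sup>2 / 2 \<le> 1 + x\<^sup>2" by (simp add: power2_eq_square algebra_simps abs_mult_self_eq)
    then have "(1 + x\<^sup>2) powr - p \<le> ((1 + \<bar>x\<bar>)\<^sup>2 / 2) powr - p"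
      using p by (intro powr_mono2') auto
    also have "\<dots> = ((1 + \<bar>x\<bar>)\<^sup>2) powr - p / 2 powr - p" by (simp add: powr_divide)
    also have "((1 + \<bar>x\<bar>)\<^sup>2) powr - p = (1 + \<bar>x\<bar>) powr (- 2 * p)"
      using powr_powr[of "1 + \<bar>x\<bar>" 2 "- p"] by simp
    finally show ?thesis by (simp add: powr_minus divide_inverse mult.commute)
  qed
  have "(\<integral>\<^sup>+x. ennreal (?g x) * indicator {0..} x \<partial>lborel) = ennreal (0 - ?G 0)"
  proof (rule nn_integral_FTC_atLeast)
    fix x :: real assume "0 \<le> x"
    then show "(?G has_real_derivative ?g x) (at x)"
    proof -
      have "((\<lambda>x. (1 + x) powr (1 - 2 * p)) has_real_derivative (1 - 2 * p) * (1 + x) powr (- 2 * p)) (at x)"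
        using \<open>0 \<le> x\<close> by (auto intro!: derivative_eq_intros)
      from DERIV_cmult[OF this, of "2 powr p / (1 - 2 * p)"] show ?thesis using p by simp
    qed
  next
    have "((\<lambda>x. (1 + x) powr (1 - 2 * p)) \<longlongrightarrow> 0) at_top"
      using p by (intro tendsto_neg_powr filterlim_tendsto_add_at_top[OF tendsto_const] filterlim_ident) auto
    from tendsto_mult[OF tendsto_const this, of "2 powr p / (1 - 2 * p)"]
    show "(?G \<longlongrightarrow> 0) at_top" by simp
  qed auto
  then have fin: "(\<integral>\<^sup>+x. ennreal (?g x) * indicator {0..} x \<partial>lborel) < \<infinity>" by simp
  have fin': "(\<integral>\<^sup>+x. ennreal (?g (- x)) * indicator {0..} (- x) \<partial>lborel) < \<infinity>"
    using fin by (subst nn_integral_reflect(1)[of "\<lambda>x. ennreal (?g x) * indicator {0..} x"]) auto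
  have "(\<integral>\<^sup>+x. ennreal ((1 + x\<^sup>2) powr - p) \<partial>(lborel :: real measure))
     \<le> (\<integral>\<^sup>+x. ennreal (?g x) * indicator {0..} x + ennreal (?g (- x)) * indicator {0..} (- x) \<partial>lborel)"
  proof (rule nn_integral_mono)
    fix x :: real
    have "ennreal ((1 + x\<^sup>2) powr - p) \<le> ennreal (?g \<bar>x\<bar>)" by (intro ennreal_leI le)
    also have "\<dots> \<le> ennreal (?g x) * indicator {0..} x + ennreal (?g (- x)) * indicator {0..} (- x)"
      by (cases "x \<ge> 0") (auto simp: abs_if split: split_indicator intro: add_increasing2)
    finally show "ennreal ((1 + x\<^sup>2) powr - p)
      \<le> ennreal (?g x) * indicator {0..} x + ennreal (?g (- x)) * indicator {0..} (- x)" .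
  qed
  also have "\<dots> = (\<integral>\<^sup>+x. ennreal (?g x) * indicator {0..} x \<partial>lborel)
      + (\<integral>\<^sup>+x. ennreal (?g (- x)) * indicator {0..} (- x) \<partial>lborel)"
    by (intro nn_integral_add) auto
  also have "\<dots> < \<infinity>" using fin fin' by (simp add: ennreal_add_eq_top less_top)
  finally show ?thesis .
qed

text \<open>A majorant for rapidly decreasing functions, taken as a product over the coordinates so that
  its integral factorizes into one-dimensional ones.\<close>

definition envelope :: "real ^ 'n::finite \<Rightarrow> real" where
  "envelope x = (\<Prod>i\<in>UNIV. (1 + (x $ i)\<^sup>2) powr - 1)"

lemma integrable_envelope: "integrable lborel (envelope :: real ^ 'n::finite \<Rightarrow> real)"
proof (rule integrableI_nonneg)
  show "(envelope :: real ^ 'n \<Rightarrow> real) \<in> borel_measurable lborel"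
    unfolding envelope_def[abs_def] by measurable
  have "(\<integral>\<^sup>+x. ennreal (envelope x) \<partial>(lborel :: (real ^ 'n) measure))
      = (\<integral>\<^sup>+x. (\<Prod>i\<in>UNIV. ennreal ((1 + (x $ i)\<^sup>2) powr - 1)) \<partial>(lborel :: (real ^ 'n) measure))"
    unfolding envelope_def by (simp add: prod_ennreal)
  also have "\<dots> = (\<Prod>i\<in>(UNIV :: 'n set). (\<integral>\<^sup>+t. ennreal ((1 + t\<^sup>2) powr - 1) \<partial>lborel))"
    by (rule nn_integral_prod_cart) auto
  also have "\<dots> < \<infinity>"
  proof -
    have "(\<Prod>i\<in>(UNIV :: 'n set). I) < \<infinity>" if "I < \<infinity>" for I :: ennreal
      using that by (cases I) (auto simp: ennreal_power)
    then show ?thesis using nn_integral_bracket_power[of 1] by simp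
  qed
  finally show "(\<integral>\<^sup>+x. ennreal (envelope x) \<partial>(lborel :: (real ^ 'n) measure)) < \<infinity>" .
qed (auto simp: envelope_def intro!: prod_nonneg)

lemma envelope_ge: "1 \<le> (1 + norm x) ^ (2 * CARD('n)) * envelope (x :: real ^ 'n::finite)"
proof -
  have "(\<Prod>i\<in>(UNIV::'n set). (1 + (x $ i)\<^sup>2)) \<le> (\<Prod>i\<in>(UNIV::'n set). (1 + norm x)\<^sup>2)"
  proof (intro prod_mono conjI)
    fix i
    have "\<bar>x $ i\<bar> \<le> norm x" by (rule component_le_norm_cart)
    then have "(x $ i)\<^sup>2 \<le> (norm x)\<^sup>2" by (metis abs_norm_cancel abs_le_square_iff)
    then show "1 + (x $ i)\<^sup>2 \<le> (1 + norm x)\<^sup>2" by (simp add: power2_sum add_increasing2)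
  qed auto
  then have "(\<Prod>i\<in>(UNIV::'n set). (1 + (x $ i)\<^sup>2)) \<le> (1 + norm x) ^ (2 * CARD('n))"
    by (simp add: power_mult)
  moreover have "envelope x = inverse (\<Prod>i\<in>(UNIV::'n set). (1 + (x $ i)\<^sup>2))"
    unfolding envelope_def prod_inversef[symmetric]
    by (intro prod.cong refl) (auto simp: powr_minus add_nonneg_nonneg)
  moreover have "(\<Prod>i\<in>(UNIV::'n set). (1 + (x $ i)\<^sup>2)) > 0"
    by (intro prod_pos) (auto simp: add_pos_nonneg)
  ultimately show ?thesis by (simp add: field_simps)
qed

lemma envelope_nonneg: "envelope x \<ge> 0"
  unfolding envelope_def by (intro prod_nonneg) auto

lemma
  fixes f :: "real ^ 'n::finite \<Rightarrow> complex"
  assumes [measurable]: "f \<in> borel_measurable borel"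
    and le: "\<And>x. (1 + norm x) ^ (2 * CARD('n)) * norm (f x) \<le> C"
  shows integrable_decay: "integrable lborel f"
    and integral_decay: "norm (LINT x|lborel. f x) \<le> C * (LINT x|lborel. envelope (x :: real ^ 'n))"
proof -
  have b: "norm (f x) \<le> C * envelope x" for x
  proof -
    have "norm (f x) \<le> norm (f x) * ((1 + norm x) ^ (2 * CARD('n)) * envelope x)"
      using mult_left_mono[OF envelope_ge[of x], of "norm (f x)"] by simp
    also have "\<dots> = ((1 + norm x) ^ (2 * CARD('n)) * norm (f x)) * envelope x" by simp
    also have "\<dots> \<le> C * envelope x" by (intro mult_right_mono le envelope_nonneg)
    finally show ?thesis .
  qed
  show i: "integrable lborel f"
    by (rule Bochner_Integration.integrable_bound[of _ "\<lambda>x. C * envelope x"])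
       (auto intro!: integrable_envelope b order_trans[OF b])
  have "norm (LINT x|lborel. f x) \<le> (LINT x|lborel. norm (f x))" by simp
  also have "\<dots> \<le> (LINT x|lborel. C * envelope (x :: real ^ 'n))"
    by (rule integral_mono) (use i b integrable_envelope in auto)
  finally show "norm (LINT x|lborel. f x) \<le> C * (LINT x|lborel. envelope (x :: real ^ 'n))" by simp
qed

lemma schwartz_measurable: "f \<in> schwartz_functions \<Longrightarrow> f \<in> borel_measurable borel"
  using schwartz_smooth smooth_measurable by blast

lemma schwartz_integrable:
  assumes "f \<in> schwartz_functions" shows "integrable lborel f"
proof -
  obtain C where "\<And>x. (1 + norm x) ^ (2 * CARD('a)) * norm (f x) \<le> C"
    using schwartz_bound0[OF assms] by metis
  then show ?thesis using integrable_decay schwartz_measurable[OF assms] by blast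
qed

lemma measurable_cis [measurable]: "cis \<in> borel_measurable borel"
  by (intro borel_measurable_continuous_onI) (simp add: cis_conv_exp continuous_intros)

lemma integrable_cis:
  fixes f :: "'a::euclidean_space \<Rightarrow> complex"
  assumes "integrable lborel f"
  shows "integrable lborel (\<lambda>x. cis (x \<bullet> v) * f x)"
    and "integrable lborel (\<lambda>x. cis (- (x \<bullet> v)) * f x)"
    and "integrable lborel (\<lambda>x. cis (v \<bullet> x) * f x)"
  by (rule Bochner_Integration.integrable_bound[OF assms]; use assms in \<open>auto simp: norm_mult\<close>)+

lemma integrable_pair_mult:
  fixes f :: "'a::euclidean_space \<Rightarrow> complex" and g :: "'b::euclidean_space \<Rightarrow> complex"
  assumes f: "integrable lborel f" and g: "integrable lborel g"
  shows "integrable (lborel \<Otimes>\<^sub>M lborel) (\<lambda>(x, y). f x * g y)"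
proof (rule lborel_pair.Fubini_integrable)
  have [measurable]: "f \<in> borel_measurable borel" "g \<in> borel_measurable borel" using f g by auto
  show "(\<lambda>(x, y). f x * g y) \<in> borel_measurable (lborel \<Otimes>\<^sub>M lborel)" by measurable
  show "integrable lborel (\<lambda>x. LINT y|lborel. norm (case (x, y) of (x, y) \<Rightarrow> f x * g y))"
    using f by (simp add: norm_mult)
qed (use g in simp)

section \<open>The Fourier transform on the Schwartz space\<close>

lemma measurable_fourier [measurable]:
  assumes [measurable]: "f \<in> borel_measurable borel"
  shows "fourier f \<in> borel_measurable borel"
  unfolding fourier_def[abs_def] by measurable

lemma fourier_bound:
  "integrable lborel f \<Longrightarrow> norm (fourier f \<xi>) \<le> (LINT x|lborel. norm (f x))"
  unfolding fourier_def
  by (rule order_trans[OF integral_norm_bound]) (simp add: norm_mult)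

lemma fourier_multiplication:
  assumes f: "integrable lborel f" and g: "integrable lborel g"
  shows "(LINT \<xi>|lborel. fourier f \<xi> * g \<xi>) = (LINT x|lborel. f x * fourier g x)"
proof -
  have [measurable]: "f \<in> borel_measurable borel" "g \<in> borel_measurable borel" using f g by auto
  have i: "integrable (lborel \<Otimes>\<^sub>M lborel) (\<lambda>(x, y). cis (- (x \<bullet> y)) * (f x * g y))"
    by (rule Bochner_Integration.integrable_bound[OF integrable_pair_mult[OF f g]])
       (auto simp: norm_mult)
  have "(LINT x|lborel. f x * fourier g x) = (LINT x|lborel. (LINT y|lborel. cis (- (x \<bullet> y)) * (f x * g y)))"
    unfolding fourier_def integral_mult_right_zero[symmetric]
    by (intro Bochner_Integration.integral_cong refl) (simp only: mult_ac inner_commute)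
  also have "\<dots> = (LINT y|lborel. (LINT x|lborel. cis (- (x \<bullet> y)) * (f x * g y)))"
    using lborel_pair.Fubini_integral[OF i] by simp
  also have "\<dots> = (LINT \<xi>|lborel. fourier f \<xi> * g \<xi>)"
    unfolding fourier_def integral_mult_left_zero[symmetric]
    by (intro Bochner_Integration.integral_cong refl) (simp only: mult_ac)
  finally show ?thesis by simp
qed

lemma cis_taylor: "norm (cis (- t) - 1 + \<i> * of_real t) \<le> t\<^sup>2"
proof -
  have "norm (cis (- t) - (\<Sum>k\<le>1. (\<i> * of_real (- t)) ^ k / fact k)) \<le> \<bar>- t\<bar> ^ (1 + 1) / fact (1 + 1)"
    using iexp_approx1[of "- t" 1] by (simp add: cis_conv_exp)
  then have "2 * norm (cis (- t) - 1 + \<i> * of_real t) \<le> t * t" by (simp add: algebra_simps)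
  moreover have "t * t \<ge> 0" by simp
  ultimately show ?thesis unfolding power2_eq_square by linarith
qed

text \<open>The second-order Taylor error of the character is at most \<open>(x \<bullet> h)\<^sup>2\<close>, and a Schwartz function has
  a finite second moment; the error of the linear approximation is hence \<open>O(|h|\<^sup>2)\<close>.\<close>

lemma has_derivative_fourier:
  fixes f :: "'n::finite cfun"
  assumes f: "f \<in> schwartz_functions"
  shows "(fourier f has_derivative
    (\<lambda>h. \<Sum>i\<in>UNIV. of_real (h $ i) * fourier (\<lambda>x. (- \<i> * of_real (x $ i)) * f x) \<xi>)) (at \<xi>)"
proof (rule has_derivativeI_sandwich[where e = 1])
  let ?L = "\<lambda>h. \<Sum>i\<in>UNIV. of_real (h $ i) * fourier (\<lambda>x. (- \<i> * of_real (x $ i)) * f x) \<xi>"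
  show "bounded_linear ?L"
    by (intro bounded_linear_sum bounded_linear_mult_const bounded_linear_compose[OF bounded_linear_of_real]
        bounded_linear_vec_nth)
  have [measurable]: "f \<in> borel_measurable borel" using f by (rule schwartz_measurable)
  define D where "D = (LINT x|lborel. (norm x)\<^sup>2 * norm (f x))"
  have co: "(\<lambda>x. of_real (x $ i) * f x) \<in> schwartz_functions" for i
    by (rule schwartz_mult_moderate[OF moderate_coord f])
  have coi: "integrable lborel (\<lambda>x. (- \<i> * of_real (x $ i)) * f x)" for i
    using schwartz_integrable[OF schwartz_cmult[OF co[of i], of "-\<i>"]] by (simp add: mult_ac)
  have i2: "integrable lborel (\<lambda>x. (norm x)\<^sup>2 * norm (f x))"
  proof -
    have "(norm x)\<^sup>2 * norm (f x) = norm (\<Sum>i\<in>UNIV. of_real (x $ i) * (of_real (x $ i) * f x))" for x :: "real^'n"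
    proof -
      have "(\<Sum>i\<in>UNIV. of_real (x $ i) * (of_real (x $ i) * f x)) = of_real ((norm x)\<^sup>2) * f x"
        by (simp add: norm_vec_def L2_set_def sum_nonneg sum_distrib_right power2_eq_square mult.assoc)
      then show ?thesis by (simp add: norm_mult norm_power)
    qed
    moreover have "integrable lborel (\<lambda>x. norm (\<Sum>i\<in>UNIV. of_real (x $ i) * (of_real (x $ i) * f x)))"
      by (intro integrable_norm Bochner_Integration.integrable_sum schwartz_integrable schwartz_mult_moderate[OF moderate_coord] co)
    ultimately show ?thesis by simp
  qed
  have fi: "integrable lborel f" by (rule schwartz_integrable[OF f])
  fix \<eta> :: "real ^ 'n" assume "\<eta> \<noteq> \<xi>"
  define h where "h = \<eta> - \<xi>"
  have L: "?L h = (LINT x|lborel. cis (- (x \<bullet> \<xi>)) * ((- \<i> * of_real (x \<bullet> h)) * f x))"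
  proof -
    have "?L h = (\<Sum>i\<in>UNIV. (LINT x|lborel. of_real (h $ i) * (cis (- (x \<bullet> \<xi>)) * ((- \<i> * of_real (x $ i)) * f x))))"
      unfolding fourier_def by (simp flip: integral_mult_right_zero)
    also have "\<dots> = (LINT x|lborel. (\<Sum>i\<in>UNIV. of_real (h $ i) * (cis (- (x \<bullet> \<xi>)) * ((- \<i> * of_real (x $ i)) * f x))))"
      by (intro Bochner_Integration.integral_sum[symmetric] integrable_mult_right integrable_cis(2) coi)
    also have "\<dots> = (LINT x|lborel. cis (- (x \<bullet> \<xi>)) * ((- \<i> * of_real (x \<bullet> h)) * f x))"
      by (intro Bochner_Integration.integral_cong refl)
         (simp add: inner_vec_def sum_distrib_left sum_distrib_right mult_ac)
    finally show ?thesis .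
  qed
  have Li: "integrable lborel (\<lambda>x. cis (- (x \<bullet> \<xi>)) * ((- \<i> * of_real (x \<bullet> h)) * f x))"
  proof -
    have "integrable lborel (\<lambda>x. (\<Sum>i\<in>UNIV. of_real (h $ i) * (cis (- (x \<bullet> \<xi>)) * ((- \<i> * of_real (x $ i)) * f x))))"
      by (intro Bochner_Integration.integrable_sum integrable_mult_right integrable_cis(2) coi)
    then show ?thesis by (simp add: inner_vec_def sum_distrib_left sum_distrib_right mult_ac)
  qed
  define E where "E x = cis (- (x \<bullet> \<eta>)) * f x - cis (- (x \<bullet> \<xi>)) * f x
      - cis (- (x \<bullet> \<xi>)) * ((- \<i> * of_real (x \<bullet> h)) * f x)" for x
  have Ei: "integrable lborel E"
    unfolding E_def by (intro Bochner_Integration.integrable_diff integrable_cis(2) fi Li)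
  have e1: "(LINT x|lborel. E x) = fourier f \<eta> - fourier f \<xi> - ?L h"
    unfolding L unfolding fourier_def E_def
    by (subst Bochner_Integration.integral_diff Bochner_Integration.integral_diff[OF Bochner_Integration.integrable_diff],
        (rule integrable_cis(2)[OF fi] Li Bochner_Integration.integrable_diff)+)+ (rule refl)
  have e2: "norm (LINT x|lborel. E x) \<le> (LINT x|lborel. norm (E x))"
    by (rule integral_norm_bound)
  have e3: "(LINT x|lborel. norm (E x)) \<le> (LINT x|lborel. (norm h)\<^sup>2 * ((norm x)\<^sup>2 * norm (f x)))"
  proof (rule integral_mono)
    fix x :: "real^'n"
    have "E x = cis (- (x \<bullet> \<xi>)) * (cis (- (x \<bullet> h)) - 1 + \<i> * of_real (x \<bullet> h)) * f x"
      unfolding h_def E_def by (simp add: algebra_simps cis_mult inner_diff_right)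
    then have "norm (E x) = norm (cis (- (x \<bullet> h)) - 1 + \<i> * of_real (x \<bullet> h)) * norm (f x)"
      by (simp add: norm_mult)
    also have "\<dots> \<le> (x \<bullet> h)\<^sup>2 * norm (f x)" by (intro mult_right_mono cis_taylor) auto
    also have "\<dots> \<le> ((norm x)\<^sup>2 * (norm h)\<^sup>2) * norm (f x)"
      using Cauchy_Schwarz_ineq[of x h] by (intro mult_right_mono) (auto simp: power2_norm_eq_inner)
    finally show "norm (E x) \<le> (norm h)\<^sup>2 * ((norm x)\<^sup>2 * norm (f x))" by (simp add: mult_ac)
  qed (auto intro!: i2 integrable_norm Ei)
  have "norm (fourier f \<eta> - fourier f \<xi> - ?L h) \<le> (LINT x|lborel. (norm h)\<^sup>2 * ((norm x)\<^sup>2 * norm (f x)))"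
    by (rule order_trans[OF e2[unfolded e1] e3])
  then have "norm (fourier f \<eta> - fourier f \<xi> - ?L h) \<le> (norm h)\<^sup>2 * D" unfolding D_def by simp
  then show "norm (fourier f \<eta> - fourier f \<xi> - ?L (\<eta> - \<xi>)) / norm (\<eta> - \<xi>)
      \<le> (LINT x|lborel. (norm x)\<^sup>2 * norm (f x)) * norm (\<eta> - \<xi>)"
    using \<open>\<eta> \<noteq> \<xi>\<close> unfolding h_def D_def[symmetric] by (simp add: field_simps power2_eq_square)
next
  show "((\<lambda>\<eta>. (LINT x|lborel. (norm x)\<^sup>2 * norm (f x)) * norm (\<eta> - \<xi>)) \<longlongrightarrow> 0) (at \<xi>)"
    by (auto intro!: tendsto_eq_intros)
qed simp

lemma partial_fourier:
  assumes "f \<in> schwartz_functions"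
  shows "partial i (fourier f) = fourier (\<lambda>x. (- \<i> * of_real (x $ i)) * f x)"
  unfolding partial_eqI[OF has_derivative_fourier[OF assms]]
  by (auto simp: axis_def if_distrib if_distribR sum.delta cong: if_cong)

text \<open>The integral of \<open>f(x + e) - f(x)\<close> vanishes by translation invariance. By the fundamental
  theorem of calculus along the segment and Fubini's theorem it is also the integral over
  \<open>t \<in> [0,1]\<close> of the integrals of the translates by \<open>te\<close> of the partial derivative,
  which all agree.\<close>

lemma integral_partial:
  fixes f :: "'n::finite cfun"
  assumes f: "f \<in> schwartz_functions"
  shows "(LINT x|lborel. partial i f x) = 0"
proof -
  let ?e = "axis i 1 :: real ^ 'n"
  have pS: "partial i f \<in> schwartz_functions" by (rule schwartz_partial[OF f])
  then have pi: "integrable lborel (partial i f)" and [measurable]: "partial i f \<in> borel_measurable borel"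
    by (auto intro: schwartz_integrable schwartz_measurable)
  have [measurable]: "f \<in> borel_measurable borel" by (rule schwartz_measurable[OF f])
  have fi: "integrable lborel f" by (rule schwartz_integrable[OF f])
  define F where "F = (\<lambda>(x, t). indicat_real {0..1} t *\<^sub>R partial i f (x + t *\<^sub>R ?e))"
  have tr: "(LINT x|lborel. norm (partial i f (x + t *\<^sub>R ?e))) = (LINT x|lborel. norm (partial i f x))" for t
  proof -
    have "complex_of_real (LINT x|lborel. norm (partial i f (x + t *\<^sub>R ?e))) = of_real (LINT x|lborel. norm (partial i f x))"
      using integral_reflect(3)[of "\<lambda>x. of_real (norm (partial i f x))" "t *\<^sub>R ?e"]
      by (simp add: add.commute)
    then show ?thesis by (simp only: of_real_eq_iff)
  qed
  have ti: "integrable lborel (\<lambda>x. partial i f (x + t *\<^sub>R ?e))" for t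
    using integrable_affine[OF _ pi, of 1 "t *\<^sub>R ?e"] by (simp add: add.commute)
  have I': "integrable (lborel \<Otimes>\<^sub>M lborel) (\<lambda>(t, x). F (x, t))"
  proof (rule lborel_pair.Fubini_integrable)
    show "(\<lambda>(t, x). F (x, t)) \<in> borel_measurable (lborel \<Otimes>\<^sub>M lborel)" unfolding F_def by measurable
    show "integrable lborel (\<lambda>t. LINT x|lborel. norm (case (t, x) of (t, x) \<Rightarrow> F (x, t)))"
      unfolding F_def using integrable_real_indicator[of "{0..1::real}" lborel]
      by (simp add: norm_scaleR tr)
    show "AE t in lborel. integrable lborel (\<lambda>x. case (t, x) of (t, x) \<Rightarrow> F (x, t))"
      unfolding F_def using ti by (auto intro!: AE_I2 integrable_scaleR_right)
  qed
  have m1: "(LINT t|lborel. (LINT x|lborel. F (x, t))) = (LINT x|lborel. (LINT t|lborel. F (x, t)))"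
    using lborel_pair.Fubini_integral[OF I'] by simp
  have m2: "(LINT x|lborel. F (x, t)) = indicat_real {0..1} t *\<^sub>R (LINT x|lborel. partial i f x)" for t
    unfolding F_def using integral_reflect(3)[of "partial i f" "t *\<^sub>R ?e"] by (simp add: add.commute)
  have m3: "(LINT t|lborel. F (x, t)) = f (x + ?e) - f x" for x
  proof -
    have "(LINT t|lborel. indicat_real {0..1} t *\<^sub>R partial i f (x + t *\<^sub>R ?e)) = f (x + 1 *\<^sub>R ?e) - f (x + 0 *\<^sub>R ?e)"
    proof (rule integral_FTC_Icc[of 0 1 "\<lambda>t. f (x + t *\<^sub>R ?e)"])
      fix t :: real
      have "((\<lambda>t. f (x + t *\<^sub>R ?e)) has_derivative
          (\<lambda>h. frechet_derivative f (at (x + t *\<^sub>R ?e)) (h *\<^sub>R ?e))) (at t within {0..1})"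
        by (rule has_derivative_compose[OF _ has_frechet[OF smooth_differentiable[OF schwartz_smooth[OF f]]]])
           (auto intro!: derivative_eq_intros)
      moreover have "linear (frechet_derivative f (at (x + t *\<^sub>R ?e)))"
        by (rule has_derivative_linear[OF has_frechet[OF smooth_differentiable[OF schwartz_smooth[OF f]]]])
      ultimately show "((\<lambda>t. f (x + t *\<^sub>R ?e)) has_vector_derivative partial i f (x + t *\<^sub>R ?e)) (at t within {0..1})"
        by (simp add: has_vector_derivative_def partial_def linear_cmul)
    next
      show "continuous_on {0..1} (\<lambda>t. partial i f (x + t *\<^sub>R ?e))"
        by (intro continuous_on_compose2[OF smooth_continuous[OF schwartz_smooth[OF pS], of UNIV]] continuous_intros) auto
    qed simp
    then show ?thesis unfolding F_def by simp
  qed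
  have "(LINT t|lborel. indicat_real {0..1::real} t *\<^sub>R (LINT x|lborel. partial i f x))
      = (LINT x|lborel. f (x + ?e) - f x)" using m1 unfolding m2 m3 .
  also have "\<dots> = 0"
    using integral_reflect(3)[of f ?e] integrable_affine[OF _ fi, of 1 ?e] fi by (simp add: add.commute)
  finally have "(LINT t|lborel. indicat_real {0..1::real} t *\<^sub>R (LINT x|lborel. partial i f x)) = 0" .
  moreover have "(LINT t|lborel. indicat_real {0..1::real} t *\<^sub>R c) = c" for c :: complex
    by (subst Bochner_Integration.integral_scaleR_left) auto
  ultimately show ?thesis by simp
qed

text \<open>Integration by parts: the derivative of \<open>x \<mapsto> exp(-i x \<bullet> \<xi>) f(x)\<close> has integral zero.\<close>

lemma fourier_partial:
  assumes f: "f \<in> schwartz_functions"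
  shows "fourier (partial i f) \<xi> = \<i> * of_real (\<xi> $ i) * fourier f \<xi>"
proof -
  let ?c = "\<lambda>x. cis (x \<bullet> (- \<xi>))"
  have cs: "(\<lambda>x. ?c x * f x) \<in> schwartz_functions" by (rule schwartz_mult_moderate[OF moderate_cis f])
  have pc: "partial i ?c = (\<lambda>x. - \<i> * of_real (\<xi> $ i) * ?c x)"
  proof -
    have "(?c has_derivative (\<lambda>h. (h \<bullet> (- \<xi>)) *\<^sub>R (\<i> * ?c x))) (at x)" for x
      by (rule has_derivative_cis) (auto intro!: derivative_eq_intros)
    from partial_eqI[OF this] show ?thesis
      by (auto simp: inner_axis inner_commute[of "axis i 1"] scaleR_conv_of_real)
  qed
  have "0 = (LINT x|lborel. partial i (\<lambda>x. ?c x * f x) x)" using integral_partial[OF cs] by simp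
  also have "partial i (\<lambda>x. ?c x * f x) = (\<lambda>x. ?c x * partial i f x + (- \<i> * of_real (\<xi> $ i)) * (?c x * f x))"
    using partial_mult[OF smooth_differentiable[OF moderate_smooth[OF moderate_cis[of "-\<xi>"]]]
        smooth_differentiable[OF schwartz_smooth[OF f]], of i]
    unfolding pc by (simp only: mult_ac)
  also have "(LINT x|lborel. ?c x * partial i f x + (- \<i> * of_real (\<xi> $ i)) * (?c x * f x))
     = fourier (partial i f) \<xi> + (- \<i> * of_real (\<xi> $ i)) * fourier f \<xi>"
    unfolding fourier_def using integrable_cis(1)[OF schwartz_integrable[OF f], of "-\<xi>"]
      integrable_cis(1)[OF schwartz_integrable[OF schwartz_partial[OF f]], of "-\<xi>" i]
    by (subst Bochner_Integration.integral_add) (auto intro: integrable_mult_right)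
  finally show ?thesis by (simp add: algebra_simps)
qed

lemma seminorm_bound:
  fixes f :: "'n::finite cfun"
  assumes f: "f \<in> schwartz_functions" and "length \<alpha> \<le> N" "k \<le> N"
  shows "(1 + norm x) ^ k * norm (partials \<alpha> f x) \<le> schwartz_seminorm N f"
proof -
  let ?S = "\<lambda>\<alpha>. SUP x. (1 + norm x) ^ N * norm (partials \<alpha> f x)"
  have bdd: "bdd_above (range (\<lambda>x. (1 + norm x) ^ N * norm (partials \<alpha> f x)))" for \<alpha>
  proof -
    obtain C where "\<And>x. (1 + norm x) ^ N * norm (partials \<alpha> f x) \<le> C" using schwartz_bound[OF f, of N \<alpha>] by blast
    then show ?thesis by (intro bdd_aboveI2[of _ _ C]) auto
  qed
  have le: "(1 + norm x) ^ N * norm (partials \<alpha> f x) \<le> ?S \<alpha>" for \<alpha> x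
    by (rule cSUP_upper[OF _ bdd]) simp
  have nn: "?S \<alpha> \<ge> 0" for \<alpha> by (rule order_trans[OF _ le[of 0]]) auto
  have fin: "finite {\<alpha> :: 'n list. length \<alpha> \<le> N}" using finite_lists_length_le[of "UNIV :: 'n set" N] by simp
  have "(1 + norm x) ^ k * norm (partials \<alpha> f x) \<le> (1 + norm x) ^ N * norm (partials \<alpha> f x)"
    using assms by (intro mult_right_mono power_increasing) auto
  also have "\<dots> \<le> ?S \<alpha>" by (rule le)
  also have "\<dots> \<le> schwartz_seminorm N f"
    unfolding schwartz_seminorm_def using assms nn by (intro member_le_sum[OF _ _ fin]) auto
  finally show ?thesis .
qed

lemma fourier_partials_replicate:
  assumes f: "f \<in> schwartz_functions"
  shows "fourier (partials (replicate m i) f) \<xi> = (\<i> * of_real (\<xi> $ i)) ^ m * fourier f \<xi>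
    \<and> partials (replicate m i) f \<in> schwartz_functions"
  by (induction m) (auto simp: f fourier_partial schwartz_partial)

lemma norm_power_le_components:
  fixes \<xi> :: "real ^ 'n::finite"
  shows "(1 + norm \<xi>) ^ m \<le> (1 + CARD('n)) ^ m * (1 + (\<Sum>i\<in>UNIV. \<bar>\<xi> $ i\<bar> ^ m))"
proof -
  define M where "M = Max (insert 1 ((\<lambda>i. \<bar>\<xi> $ i\<bar>) ` UNIV))"
  have M: "1 \<le> M" "\<And>i. \<bar>\<xi> $ i\<bar> \<le> M" unfolding M_def by (rule Max_ge; simp)+
  have "norm \<xi> \<le> (\<Sum>i\<in>UNIV. \<bar>\<xi> $ i\<bar>)" by (rule norm_le_l1_cart)
  also have "\<dots> \<le> (\<Sum>i\<in>(UNIV::'n set). M)" by (intro sum_mono M)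
  finally have "1 + norm \<xi> \<le> (1 + CARD('n)) * M" using M(1) by (simp add: algebra_simps)
  then have "(1 + norm \<xi>) ^ m \<le> ((1 + CARD('n)) * M) ^ m" by (intro power_mono) auto
  also have "\<dots> = (1 + CARD('n)) ^ m * M ^ m" by (simp add: power_mult_distrib)
  also have "M ^ m \<le> 1 + (\<Sum>i\<in>UNIV. \<bar>\<xi> $ i\<bar> ^ m)"
  proof -
    have "M \<in> insert 1 ((\<lambda>i. \<bar>\<xi> $ i\<bar>) ` UNIV)" unfolding M_def by (intro Max_in) auto
    then consider "M = 1" | i where "M = \<bar>\<xi> $ i\<bar>" by auto
    then show ?thesis
    proof cases
      case 2
      have "\<bar>\<xi> $ i\<bar> ^ m \<le> (\<Sum>i\<in>UNIV. \<bar>\<xi> $ i\<bar> ^ m)" by (rule member_le_sum) auto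
      then show ?thesis using 2 by simp
    qed (simp add: sum_nonneg)
  qed
  finally show ?thesis by (simp add: mult_left_mono)
qed

text \<open>Powers of \<open>\<xi>\<close> are absorbed as derivatives of \<open>f\<close>, whose transforms are bounded by their
  integrals. The uniformity in \<open>f\<close> makes Sobolev distributions continuous on the Schwartz space.\<close>

lemma fourier_seminorm_bound:
  "\<exists>C N. C \<ge> 0 \<and> (\<forall>f::'n::finite cfun. f \<in> schwartz_functions \<longrightarrow>
      (\<forall>\<xi>. (1 + norm \<xi>) ^ m * norm (fourier f \<xi>) \<le> C * schwartz_seminorm N f))"
proof -
  define N where "N = max m (2 * CARD('n))"
  define I where "I = (LINT x|lborel. envelope (x :: real ^ 'n))"
  define C where "C = (1 + real CARD('n)) ^ m * ((1 + real CARD('n)) * I)"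
  have I0: "I \<ge> 0" unfolding I_def by (intro Bochner_Integration.integral_nonneg envelope_nonneg)
  have "(1 + norm \<xi>) ^ m * norm (fourier f \<xi>) \<le> C * schwartz_seminorm N f"
    if f: "f \<in> schwartz_functions" for f :: "'n cfun" and \<xi>
  proof -
    have b: "norm (fourier (partials \<alpha> f) \<xi>) \<le> I * schwartz_seminorm N f"
      if "length \<alpha> \<le> N" "partials \<alpha> f \<in> schwartz_functions" for \<alpha>
    proof -
      have "norm (LINT x|lborel. cis (- (x \<bullet> \<xi>)) * partials \<alpha> f x)
        \<le> schwartz_seminorm N f * (LINT x|lborel. envelope (x :: real ^ 'n))"
        using seminorm_bound[OF f that(1), of "2 * CARD('n)"] schwartz_measurable[OF that(2)]
        by (intro integral_decay) (auto simp: norm_mult N_def)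
      then show ?thesis unfolding fourier_def I_def by (simp add: mult.commute)
    qed
    have "(1 + norm \<xi>) ^ m * norm (fourier f \<xi>)
        \<le> ((1 + real CARD('n)) ^ m * (1 + (\<Sum>i\<in>UNIV. \<bar>\<xi> $ i\<bar> ^ m))) * norm (fourier f \<xi>)"
      using norm_power_le_components[of \<xi> m] by (intro mult_right_mono) auto
    also have "\<dots> = (1 + real CARD('n)) ^ m * (norm (fourier f \<xi>) + (\<Sum>i\<in>UNIV. norm (fourier (partials (replicate m i) f) \<xi>)))"
      using fourier_partials_replicate[OF f]
      by (simp add: norm_mult norm_power algebra_simps sum_distrib_left)
    also have "\<dots> \<le> (1 + real CARD('n)) ^ m * (I * schwartz_seminorm N f + (\<Sum>i\<in>(UNIV :: 'n set). I * schwartz_seminorm N f))"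
      using b[of "[]"] b[of "replicate m _"] fourier_partials_replicate[OF f] f
      by (intro mult_left_mono add_mono sum_mono) (auto simp: N_def)
    also have "\<dots> = C * schwartz_seminorm N f" by (simp add: C_def algebra_simps)
    finally show ?thesis .
  qed
  moreover have "C \<ge> 0" using I0 unfolding C_def by auto
  ultimately show ?thesis by blast
qed

lemma fourier_schwartz:
  assumes f: "f \<in> schwartz_functions" shows "fourier f \<in> schwartz_functions"
proof (rule schwartz_coinduct[of _ "fourier ` schwartz_functions"])
  fix g :: "'a cfun" assume "g \<in> fourier ` schwartz_functions"
  then obtain f where g: "g = fourier f" and f: "f \<in> schwartz_functions" by blast
  show "g differentiable (at x)" for x unfolding g by (rule differentiableI[OF has_derivative_fourier[OF f]])
  have "(\<lambda>x. (- \<i> * of_real (x $ i)) * f x) \<in> schwartz_functions" for i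
    using schwartz_cmult[OF schwartz_mult_moderate[OF moderate_coord f, of i], of "-\<i>"] by (simp add: mult_ac)
  then show "partial i g \<in> fourier ` schwartz_functions" for i unfolding g partial_fourier[OF f] by blast
  show "\<exists>C. \<forall>x. (1 + norm x) ^ k * norm (g x) \<le> C" for k
  proof -
    obtain C N where "\<forall>f::'a cfun. f \<in> schwartz_functions \<longrightarrow>
      (\<forall>\<xi>. (1 + norm \<xi>) ^ k * norm (fourier f \<xi>) \<le> C * schwartz_seminorm N f)"
      using fourier_seminorm_bound by blast
    then show ?thesis using f unfolding g by blast
  qed
qed (use f in blast)

lemma measurable_cnj [measurable]: "cnj \<in> borel_measurable borel"
  by (intro borel_measurable_continuous_onI continuous_on_cnj continuous_on_id)

lemma cis_sum: "finite S \<Longrightarrow> cis (\<Sum>i\<in>S. f i) = (\<Prod>i\<in>S. cis (f i))"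
  by (induction S rule: finite_induct) (auto simp: cis_mult[symmetric])

lemma gauss_prod: "gauss x = (\<Prod>i\<in>UNIV. of_real (exp (- (x $ i)\<^sup>2 / 2)))"
proof -
  have "- (norm x)\<^sup>2 / 2 = (\<Sum>i\<in>UNIV. - (x $ i)\<^sup>2 / 2)"
    by (simp add: norm_vec_def L2_set_def sum_nonneg sum_negf sum_divide_distrib)
  then show ?thesis by (simp add: gauss_def exp_sum)
qed

text \<open>This is the characteristic function of the standard normal distribution.\<close>

lemma integral_gauss_1d:
  "integrable lborel (\<lambda>t::real. cis (- (t * s)) * of_real (exp (- t\<^sup>2 / 2)))"
  "(LINT t|lborel. cis (- (t * s)) * of_real (exp (- t\<^sup>2 / 2))) = of_real (sqrt (2 * pi) * exp (- s\<^sup>2 / 2))"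
proof -
  have e: "exp (- t\<^sup>2 / 2) = sqrt (2 * pi) * std_normal_density t" for t :: real
    by (simp add: std_normal_density_def)
  have "integrable lborel (\<lambda>t. complex_of_real (exp (- t\<^sup>2 / 2)))"
    unfolding e by (intro integrable_of_real integrable_mult_right integrable_normal_density) auto
  then show "integrable lborel (\<lambda>t::real. cis (- (t * s)) * of_real (exp (- t\<^sup>2 / 2)))"
    by (rule Bochner_Integration.integrable_bound) (auto simp: norm_mult)
  have "of_real (exp (- s\<^sup>2 / 2)) = char std_normal_distribution (- s)"
    by (simp add: char_std_normal_distribution)
  also have "\<dots> = (LINT t|lborel. std_normal_density t *\<^sub>R cis (- (t * s)))"
    unfolding char_def by (subst integral_density) (auto simp: normal_density_nonneg cis_conv_exp mult_ac)
  finally have A: "of_real (exp (- s\<^sup>2 / 2)) = (LINT t|lborel. std_normal_density t *\<^sub>R cis (- (t * s)))" .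
  have "of_real (sqrt (2 * pi)) * of_real (exp (- s\<^sup>2 / 2))
      = (LINT t|lborel. of_real (sqrt (2 * pi)) * (std_normal_density t *\<^sub>R cis (- (t * s))))"
    unfolding A by (rule integral_mult_right_zero[symmetric])
  also have "\<dots> = (LINT t|lborel. cis (- (t * s)) * of_real (exp (- t\<^sup>2 / 2)))"
    unfolding e by (intro Bochner_Integration.integral_cong refl) (simp add: scaleR_conv_of_real mult_ac)
  finally show "(LINT t|lborel. cis (- (t * s)) * of_real (exp (- t\<^sup>2 / 2))) = of_real (sqrt (2 * pi) * exp (- s\<^sup>2 / 2))"
    by simp
qed

lemma fourier_gauss:
  "fourier gauss (\<xi> :: real ^ 'n::finite) = of_real (sqrt (2 * pi) ^ CARD('n)) * gauss \<xi>"
proof -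
  have "fourier gauss \<xi> = (LINT x|(lborel :: (real ^ 'n) measure).
      (\<Prod>i\<in>UNIV. cis (- (x $ i * \<xi> $ i)) * of_real (exp (- (x $ i)\<^sup>2 / 2))))"
    unfolding fourier_def gauss_prod inner_vec_def
    by (simp add: cis_sum prod.distrib flip: sum_negf)
  also have "\<dots> = (\<Prod>i\<in>UNIV. of_real (sqrt (2 * pi) * exp (- (\<xi> $ i)\<^sup>2 / 2)))"
    using integral_prod_cart[of "\<lambda>i t. cis (- (t * \<xi> $ i)) * of_real (exp (- t\<^sup>2 / 2))", OF integral_gauss_1d(1)]
    by (simp only: integral_gauss_1d(2))
  also have "\<dots> = of_real (sqrt (2 * pi) ^ CARD('n)) * gauss \<xi>"
    by (simp add: gauss_prod prod.distrib)
  finally show ?thesis .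
qed

lemma gauss_measurable [measurable]: "gauss \<in> borel_measurable borel"
  using schwartz_measurable[OF gauss_schwartz] .

lemma integral_gauss: "(LINT x|lborel. gauss (x :: real ^ 'n::finite)) = of_real (sqrt (2 * pi) ^ CARD('n))"
  using fourier_gauss[of "0 :: real ^ 'n"] by (simp add: fourier_def gauss_def)

lemma integrable_gauss_scale:
  assumes "a > 0" shows "integrable lborel (\<lambda>x::real ^ 'n::finite. gauss (a *\<^sub>R x))"
  using integrable_affine[of a gauss 0] schwartz_integrable[OF gauss_schwartz] assms by simp

lemma fourier_gauss_scale:
  assumes a: "a > 0"
  shows "fourier (\<lambda>y. gauss (a *\<^sub>R y)) (v :: real ^ 'n::finite)
    = of_real (sqrt (2 * pi) ^ CARD('n) / a ^ CARD('n)) * gauss (inverse a *\<^sub>R v)"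
proof -
  have "of_real (sqrt (2 * pi) ^ CARD('n)) * gauss (inverse a *\<^sub>R v) = fourier gauss (inverse a *\<^sub>R v)"
    by (simp add: fourier_gauss)
  also have "\<dots> = of_real (\<bar>a\<bar> ^ CARD('n)) *
      (LINT y|lborel. cis (- ((0 + a *\<^sub>R y) \<bullet> (inverse a *\<^sub>R v))) * gauss (0 + a *\<^sub>R y))"
    unfolding fourier_def
    using integral_affine[of a "\<lambda>y. cis (- (y \<bullet> (inverse a *\<^sub>R v))) * gauss y" 0] a by simp
  also have "\<dots> = of_real (a ^ CARD('n)) * fourier (\<lambda>y. gauss (a *\<^sub>R y)) v"
    unfolding fourier_def using a by (simp add: mult.assoc[symmetric])
  finally show ?thesis using a by (simp add: field_simps)
qed

text \<open>Damping the inversion integral by a wide Gaussian amounts to convolving \<open>f\<close> with a narrow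
  one. Letting \<open>a\<close> tend to zero yields the inversion formula and, when the transform vanishes,
  injectivity.\<close>

lemma fourier_gauss_modulated:
  assumes a: "a > 0" and f: "integrable lborel f"
  shows "(LINT \<xi>|lborel. fourier f \<xi> * (cis (x \<bullet> \<xi>) * gauss (a *\<^sub>R \<xi>)))
    = of_real (sqrt (2 * pi) ^ CARD('n) / a ^ CARD('n)) *
      (LINT y|lborel. f y * gauss (inverse a *\<^sub>R (y - (x :: real ^ 'n::finite))))"
proof -
  have "fourier (\<lambda>\<xi>. cis (x \<bullet> \<xi>) * gauss (a *\<^sub>R \<xi>)) y = fourier (\<lambda>\<xi>. gauss (a *\<^sub>R \<xi>)) (y - x)" for y
    unfolding fourier_def
    by (intro Bochner_Integration.integral_cong refl)
       (simp add: cis_mult mult.assoc[symmetric] inner_diff_right inner_commute)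
  then have "(LINT \<xi>|lborel. fourier f \<xi> * (cis (x \<bullet> \<xi>) * gauss (a *\<^sub>R \<xi>)))
     = (LINT y|lborel. f y * fourier (\<lambda>\<xi>. gauss (a *\<^sub>R \<xi>)) (y - x))"
    using fourier_multiplication[OF f integrable_cis(3)[OF integrable_gauss_scale[OF a], of x]] by simp
  also have "\<dots> = (LINT y|lborel. of_real (sqrt (2 * pi) ^ CARD('n) / a ^ CARD('n)) *
      (f y * gauss (inverse a *\<^sub>R (y - x))))"
    unfolding fourier_gauss_scale[OF a] by (intro Bochner_Integration.integral_cong refl) (simp only: mult_ac)
  finally show ?thesis by simp
qed

lemma norm_gauss_le: "norm (gauss x) \<le> 1"
  by (simp add: gauss_def)

lemma gauss_approximate_identity:
  fixes f :: "real ^ 'n::finite \<Rightarrow> complex"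
  assumes [measurable]: "f \<in> borel_measurable borel" and c: "isCont f x" and b: "\<And>y. norm (f y) \<le> B"
  shows "(\<lambda>m. LINT z|lborel. f (x + inverse (real (Suc m)) *\<^sub>R z) * gauss z)
      \<longlonglongrightarrow> of_real (sqrt (2 * pi) ^ CARD('n)) * f x"
proof -
  have "(\<lambda>m. LINT z|lborel. f (x + inverse (real (Suc m)) *\<^sub>R z) * gauss z) \<longlonglongrightarrow> (LINT z|lborel. f x * gauss (z :: real ^ 'n))"
  proof (rule integral_dominated_convergence[where w = "\<lambda>z :: real ^ 'n. B * norm (gauss z)"])
    show "integrable lborel (\<lambda>z::real^'n. B * norm (gauss z))"
      using schwartz_integrable[OF gauss_schwartz] by auto
    show "AE z in lborel. (\<lambda>m. f (x + inverse (real (Suc m)) *\<^sub>R z) * gauss z) \<longlonglongrightarrow> f x * gauss z"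
    proof (intro AE_I2 tendsto_mult tendsto_const)
      fix z :: "real ^ 'n"
      have "(\<lambda>m. x + inverse (real (Suc m)) *\<^sub>R z) \<longlonglongrightarrow> x + 0 *\<^sub>R z"
        by (intro tendsto_add tendsto_const tendsto_scaleR LIMSEQ_inverse_real_of_nat)
      then show "(\<lambda>m. f (x + inverse (real (Suc m)) *\<^sub>R z)) \<longlonglongrightarrow> f x"
        using isCont_tendsto_compose[OF c] by simp
    qed
  qed (auto simp: norm_mult intro!: mult_right_mono b)
  then show ?thesis by (simp add: integral_gauss mult.commute)
qed

lemma sqrt_2pi_power: "(sqrt (2 * pi) ^ n) * (sqrt (2 * pi) ^ n) = (2 * pi) ^ n"
  using power_mult_distrib[of "sqrt (2 * pi)" "sqrt (2 * pi)" n] by simp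

lemma inv_fourier_conv: "inv_fourier f x = of_real (1 / (2 * pi) ^ CARD('n)) * fourier f (- (x :: real ^ 'n::finite))"
  unfolding inv_fourier_def fourier_def by (simp add: inner_commute)

lemma inv_fourier_fourier:
  fixes f :: "'n::finite cfun"
  assumes f: "f \<in> schwartz_functions"
  shows "inv_fourier (fourier f) = f"
proof
  fix x :: "real ^ 'n"
  let ?a = "\<lambda>m. inverse (real (Suc m))"
  let ?c = "sqrt (2 * pi) ^ CARD('n)"
  have [measurable]: "f \<in> borel_measurable borel" by (rule schwartz_measurable[OF f])
  have fi: "integrable lborel f" and Fi: "integrable lborel (fourier f)"
    by (auto intro: schwartz_integrable f fourier_schwartz)
  have [measurable]: "fourier f \<in> borel_measurable borel" by measurable
  obtain B where B: "\<And>y. norm (f y) \<le> B" using schwartz_bound0[OF f, of 0] by auto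
  have L1: "(\<lambda>m. LINT \<xi>|lborel. fourier f \<xi> * (cis (x \<bullet> \<xi>) * gauss (?a m *\<^sub>R \<xi>)))
      \<longlonglongrightarrow> (LINT \<xi>|lborel. fourier f \<xi> * (cis (x \<bullet> \<xi>) * gauss (0 *\<^sub>R \<xi>)))"
  proof (rule integral_dominated_convergence[where w = "\<lambda>\<xi>. norm (fourier f \<xi>)"])
    show "AE \<xi> in lborel. (\<lambda>m. fourier f \<xi> * (cis (x \<bullet> \<xi>) * gauss (?a m *\<^sub>R \<xi>)))
        \<longlonglongrightarrow> fourier f \<xi> * (cis (x \<bullet> \<xi>) * gauss (0 *\<^sub>R \<xi>))"
    proof (intro AE_I2 tendsto_mult tendsto_const)
      fix \<xi> :: "real ^ 'n"
      have "(\<lambda>m. ?a m *\<^sub>R \<xi>) \<longlonglongrightarrow> 0 *\<^sub>R \<xi>"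
        by (intro tendsto_const tendsto_scaleR LIMSEQ_inverse_real_of_nat)
      moreover have "isCont gauss (0 *\<^sub>R \<xi>)"
        by (rule differentiable_imp_continuous_within[OF smooth_differentiable[OF schwartz_smooth[OF gauss_schwartz]]])
      ultimately show "(\<lambda>m. gauss (?a m *\<^sub>R \<xi>)) \<longlonglongrightarrow> gauss (0 *\<^sub>R \<xi>)"
        using isCont_tendsto_compose by blast
    qed
  qed (use Fi in \<open>auto simp: norm_mult intro!: mult_left_le norm_gauss_le\<close>)
  have eq: "(LINT \<xi>|lborel. fourier f \<xi> * (cis (x \<bullet> \<xi>) * gauss (?a m *\<^sub>R \<xi>)))
      = of_real ?c * (LINT z|lborel. f (x + ?a m *\<^sub>R z) * gauss z)" for m
  proof -
    have "(LINT y|lborel. f y * gauss (inverse (?a m) *\<^sub>R (y - x)))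
      = of_real (\<bar>?a m\<bar> ^ CARD('n)) * (LINT z|lborel. f (x + ?a m *\<^sub>R z) * gauss z)"
      using integral_affine[of "?a m" "\<lambda>y. f y * gauss (inverse (?a m) *\<^sub>R (y - x))" x] by simp
    then show ?thesis
      by (subst fourier_gauss_modulated[OF _ fi]) (auto simp del: of_nat_Suc)
  qed
  have L2: "(\<lambda>m. of_real ?c * (LINT z|lborel. f (x + ?a m *\<^sub>R z) * gauss z))
      \<longlonglongrightarrow> of_real ?c * (of_real ?c * f x)"
    by (intro tendsto_mult tendsto_const gauss_approximate_identity[OF _ _ B]
        differentiable_imp_continuous_within[OF smooth_differentiable[OF schwartz_smooth[OF f]]]) auto
  have "(LINT \<xi>|lborel. fourier f \<xi> * (cis (x \<bullet> \<xi>) * gauss (0 *\<^sub>R \<xi>))) = of_real ?c * (of_real ?c * f x)"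
    by (rule LIMSEQ_unique[OF L1[unfolded eq] L2])
  then have "(LINT \<xi>|lborel. cis (x \<bullet> \<xi>) * fourier f \<xi>) = of_real (?c * ?c) * f x"
    by (simp add: gauss_def mult_ac)
  then show "inv_fourier (fourier f) x = f x"
    unfolding inv_fourier_def sqrt_2pi_power by simp
qed

lemma fourier_reflect:
  assumes [measurable]: "f \<in> borel_measurable borel"
  shows "fourier (\<lambda>x. f (- x)) \<xi> = fourier f (- \<xi>)"
  unfolding fourier_def using integral_reflect(1)[of "\<lambda>x. cis (x \<bullet> \<xi>) * f x"] by simp

lemma inv_fourier_schwartz: "f \<in> schwartz_functions \<Longrightarrow> inv_fourier f \<in> schwartz_functions"
  unfolding inv_fourier_conv[abs_def] by (intro schwartz_cmult schwartz_reflect fourier_schwartz)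

lemma fourier_cmult: "fourier (\<lambda>x. c * f x) \<xi> = c * fourier f \<xi>"
  unfolding fourier_def by (simp add: mult.left_commute)

lemma fourier_inv_fourier:
  fixes f :: "'n::finite cfun"
  assumes f: "f \<in> schwartz_functions"
  shows "fourier (inv_fourier f) = f"
proof
  fix x
  have [measurable]: "fourier f \<in> borel_measurable borel" by (intro measurable_fourier schwartz_measurable f)
  have "fourier (inv_fourier f) x = inv_fourier (fourier f) x"
    unfolding inv_fourier_conv[abs_def] fourier_cmult by (simp add: fourier_reflect)
  then show "fourier (inv_fourier f) x = f x" using inv_fourier_fourier[OF f] by simp
qed

lemma inv_fourier_lin:
  assumes "f \<in> schwartz_functions" "g \<in> schwartz_functions"
  shows "inv_fourier (\<lambda>x. a * f x + c * g x) \<xi> = a * inv_fourier f \<xi> + c * inv_fourier g \<xi>"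
proof -
  have "fourier (\<lambda>x. a * f x + c * g x) (- \<xi>) =
      (LINT x|lborel. a * (cis (- (x \<bullet> - \<xi>)) * f x) + c * (cis (- (x \<bullet> - \<xi>)) * g x))"
    unfolding fourier_def by (intro Bochner_Integration.integral_cong refl) (simp add: algebra_simps)
  also have "\<dots> = a * fourier f (- \<xi>) + c * fourier g (- \<xi>)"
    unfolding fourier_def
    by (subst Bochner_Integration.integral_add[OF integrable_mult_right[OF integrable_cis(2)] integrable_mult_right[OF integrable_cis(2)]])
       (simp_all add: schwartz_integrable assms)
  finally show ?thesis unfolding inv_fourier_conv by (simp add: algebra_simps add_divide_distrib)
qed

text \<open>No constant appears because the inverse transform carries the factor \<open>(2\<pi>)\<^bsup>-n\<^esup>\<close>.\<close>

lemma inv_fourier_mult: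
  assumes f: "f \<in> schwartz_functions" and g: "g \<in> schwartz_functions"
  shows "inv_fourier (\<lambda>x. f x * g x) \<xi> = (LINT \<eta>|lborel. inv_fourier f (\<xi> - \<eta>) * inv_fourier g \<eta>)"
proof -
  let ?c = "complex_of_real (1 / (2 * pi) ^ CARD('a))"
  have [measurable]: "f \<in> borel_measurable borel" by (intro schwartz_measurable f)
  have "inv_fourier (\<lambda>x. f x * g x) \<xi> = ?c * (LINT x|lborel. fourier (inv_fourier g) x * (cis (x \<bullet> \<xi>) * f x))"
    unfolding fourier_inv_fourier[OF g] unfolding inv_fourier_def by (simp add: mult_ac inner_commute)
  also have "\<dots> = ?c * (LINT \<eta>|lborel. inv_fourier g \<eta> * fourier (\<lambda>x. cis (x \<bullet> \<xi>) * f x) \<eta>)"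
    by (subst fourier_multiplication)
       (auto intro!: schwartz_integrable inv_fourier_schwartz g integrable_cis(1) f)
  also have "\<dots> = (LINT \<eta>|lborel. ?c * (inv_fourier g \<eta> * fourier (\<lambda>x. cis (x \<bullet> \<xi>) * f x) \<eta>))"
    by simp
  also have "\<dots> = (LINT \<eta>|lborel. inv_fourier f (\<xi> - \<eta>) * inv_fourier g \<eta>)"
  proof (intro Bochner_Integration.integral_cong refl)
    fix \<eta>
    have "fourier (\<lambda>x. cis (x \<bullet> \<xi>) * f x) \<eta> = fourier f (- (\<xi> - \<eta>))"
      unfolding fourier_def
      by (intro Bochner_Integration.integral_cong refl)
         (simp add: cis_mult mult.assoc[symmetric] inner_diff_right inner_commute)
    then show "?c * (inv_fourier g \<eta> * fourier (\<lambda>x. cis (x \<bullet> \<xi>) * f x) \<eta>) = inv_fourier f (\<xi> - \<eta>) * inv_fourier g \<eta>"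
      unfolding inv_fourier_conv[of f] by (simp add: mult_ac)
  qed
  finally show ?thesis .
qed

section \<open>Plancherel's inequality and injectivity of the Fourier transform\<close>

text \<open>The squared \<open>L\<^sup>2\<close> norm as an extended real, meaningful before integrability is known.\<close>

definition L2sq_nn :: "('a::euclidean_space \<Rightarrow> complex) \<Rightarrow> ennreal" where
  "L2sq_nn f = (\<integral>\<^sup>+x. ennreal ((norm (f x))\<^sup>2) \<partial>lborel)"

lemma norm_integral_le_nn:
  fixes f :: "'a \<Rightarrow> complex"
  shows "ennreal (norm (integral\<^sup>L M f)) \<le> (\<integral>\<^sup>+x. ennreal (norm (f x)) \<partial>M)"
proof (cases "integrable M f")
  case True
  then show ?thesis by (rule integral_norm_bound_ennreal)
qed (simp add: not_integrable_integral_eq)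

text \<open>The integral of \<open>|k\<^sup>\<and>(y)|\<^sup>2\<close> damped by a Gaussian is the double integral of
  \<open>k(\<eta>) k'(x) g(x + \<eta>)\<close>, where \<open>k'(x)\<close> is the conjugate of \<open>k(-x)\<close> and the positive function \<open>g\<close>
  has total mass \<open>(2\<pi>)\<^sup>n\<close>. From \<open>2|k k'| \<le> |k|\<^sup>2 + |k'|\<^sup>2\<close> it is at most that mass times the squared
  norm of \<open>k\<close>, and Fatou's lemma removes the damping.\<close>

lemma plancherel_inequality:
  fixes k :: "'n::finite cfun"
  assumes k: "integrable lborel k"
  shows "L2sq_nn (fourier k) \<le> ennreal ((2 * pi) ^ CARD('n)) * L2sq_nn k"
proof -
  let ?c = "sqrt (2 * pi) ^ CARD('n)"
  have [measurable]: "k \<in> borel_measurable borel" using k by auto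
  define K where "K = fourier k"
  have [measurable]: "K \<in> borel_measurable borel" unfolding K_def by measurable
  obtain B where B: "\<And>y. norm (K y) \<le> B" unfolding K_def using fourier_bound[OF k] by blast
  have main: "(\<integral>\<^sup>+y. ennreal ((norm (K y))\<^sup>2 * exp (- (norm (a *\<^sub>R y))\<^sup>2 / 2)) \<partial>lborel) 
      \<le> ennreal ((2 * pi) ^ CARD('n)) * L2sq_nn k" if a: "a > 0" for a
  proof -
    define G where "G = (\<lambda>y::real^'n. gauss (a *\<^sub>R y))"
    define g where "g = (\<lambda>v::real^'n. ?c / a ^ CARD('n) * exp (- (norm (inverse a *\<^sub>R v))\<^sup>2 / 2))"
    have [measurable]: "G \<in> borel_measurable borel" "g \<in> borel_measurable borel" unfolding G_def g_def by measurable
    have Gi: "integrable lborel G" unfolding G_def by (rule integrable_gauss_scale[OF a])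
    have FG: "fourier G v = of_real (g v)" for v
      unfolding G_def fourier_gauss_scale[OF a] g_def by (simp add: gauss_def)
    have g0: "g v \<ge> 0" for v using a by (simp add: g_def)
    have gi: "integrable lborel g"
    proof -
      have "integrable lborel (\<lambda>v::real^'n. complex_of_real (?c / a ^ CARD('n)) * gauss (inverse a *\<^sub>R v))"
        using integrable_gauss_scale[of "inverse a"] a by auto
      then have "integrable lborel (\<lambda>v. complex_of_real (g v))"
        by (simp add: g_def gauss_def)
      from integrable_Re[OF this] show ?thesis by simp
    qed
    have gI: "(\<integral>\<^sup>+v. ennreal (g v) \<partial>lborel) = ennreal ((2 * pi) ^ CARD('n))"
    proof -
      have "complex_of_real (LINT v|lborel. g v) = (LINT v|lborel. complex_of_real (?c / a ^ CARD('n)) * gauss (inverse a *\<^sub>R (v::real^'n)))"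
        unfolding integral_complex_of_real[symmetric] by (simp add: g_def gauss_def)
      also have "\<dots> = of_real (?c / a ^ CARD('n)) * (of_real (\<bar>a\<bar> ^ CARD('n)) * (LINT v|lborel. gauss (inverse a *\<^sub>R (0 + a *\<^sub>R (v::real^'n)))))"
        using integral_affine[of a "\<lambda>v::real^'n. gauss (inverse a *\<^sub>R v)" 0] a by simp
      also have "\<dots> = of_real (?c * ?c)" using a by (simp add: integral_gauss)
      finally have "(LINT v|lborel. g v) = (2 * pi) ^ CARD('n)" unfolding sqrt_2pi_power of_real_eq_iff .
      then show ?thesis using nn_integral_eq_integral[OF gi] g0 by simp
    qed
    define k' where "k' = (\<lambda>x. cnj (k (- x)))"
    have k'i: "integrable lborel k'"
      unfolding k'_def using integrable_affine[of "-1" k 0] k by auto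
    have [measurable]: "k' \<in> borel_measurable borel" using k'i by auto
    have Fk': "fourier k' y = cnj (K y)" for y
    proof -
      have "fourier k' y = (LINT x|lborel. cis (x \<bullet> y) * cnj (k x))"
        unfolding fourier_def k'_def using integral_reflect(1)[of "\<lambda>x. cis (x \<bullet> y) * cnj (k x)"] by simp
      also have "\<dots> = (LINT x|lborel. cnj (cis (- (x \<bullet> y)) * k x))" by (simp add: cis_cnj)
      finally show ?thesis unfolding K_def fourier_def by (simp only: Bochner_Integration.integral_cnj)
    qed
    have GKi: "integrable lborel (\<lambda>y. G y * cnj (K y))"
    proof (rule Bochner_Integration.integrable_bound[of _ "\<lambda>y. norm (G y) * B"])
      have "norm (G y) * norm (K y) \<le> norm (G y) * B" for y by (intro mult_left_mono B) auto
      then show "AE y in lborel. norm (G y * cnj (K y)) \<le> norm (norm (G y) * B)"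
        using order_trans[OF norm_ge_zero B] by (simp add: norm_mult abs_mult)
    qed (use Gi in auto)
    have KGKi: "integrable lborel (\<lambda>y. K y * (G y * cnj (K y)))"
    proof (rule Bochner_Integration.integrable_bound[of _ "\<lambda>y. B * norm (G y * cnj (K y))"])
      have "norm (K y) * norm (G y * cnj (K y)) \<le> B * norm (G y * cnj (K y))" for y by (intro mult_right_mono B) auto
      then show "AE y in lborel. norm (K y * (G y * cnj (K y))) \<le> norm (B * norm (G y * cnj (K y)))"
        using order_trans[OF norm_ge_zero B] by (simp add: norm_mult[of "K _"] abs_mult)
    qed (use GKi in auto)
    define J where "J = (LINT y|lborel. K y * (G y * cnj (K y)))"
    have KGK: "K y * (G y * cnj (K y)) = of_real ((norm (K y))\<^sup>2 * exp (- (norm (a *\<^sub>R y))\<^sup>2 / 2))" for y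
      unfolding G_def gauss_def using complex_norm_square[of "K y"] by (simp add: mult_ac del: norm_scaleR)
    have "(\<integral>\<^sup>+y. ennreal ((norm (K y))\<^sup>2 * exp (- (norm (a *\<^sub>R y))\<^sup>2 / 2)) \<partial>lborel) = ennreal (norm J)"
    proof -
      have i: "integrable lborel (\<lambda>y. (norm (K y))\<^sup>2 * exp (- (norm (a *\<^sub>R y))\<^sup>2 / 2))"
        using integrable_Re[OF KGKi] unfolding KGK by (simp del: norm_scaleR)
      have "J = of_real (LINT y|lborel. (norm (K y))\<^sup>2 * exp (- (norm (a *\<^sub>R y))\<^sup>2 / 2))"
        unfolding J_def KGK by (rule integral_complex_of_real)
      then have "norm J = (LINT y|lborel. (norm (K y))\<^sup>2 * exp (- (norm (a *\<^sub>R y))\<^sup>2 / 2))"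
        by (simp del: norm_scaleR)
      then show ?thesis using nn_integral_eq_integral[OF i] by (simp del: norm_scaleR)
    qed
    also have "J = (LINT \<eta>|lborel. k \<eta> * (LINT x|lborel. k' x * of_real (g (x + \<eta>))))"
    proof -
      have "J = (LINT \<eta>|lborel. k \<eta> * fourier (\<lambda>y. G y * cnj (K y)) \<eta>)"
        unfolding J_def using fourier_multiplication[OF k GKi] by (simp add: K_def)
      moreover have "fourier (\<lambda>y. G y * cnj (K y)) \<eta> = (LINT x|lborel. k' x * of_real (g (x + \<eta>)))" for \<eta>
      proof -
        have "fourier (\<lambda>y. G y * cnj (K y)) \<eta> = (LINT y|lborel. fourier k' y * (cis (- (y \<bullet> \<eta>)) * G y))"
          unfolding Fk' unfolding fourier_def by (simp add: mult_ac)
        also have "\<dots> = (LINT x|lborel. k' x * fourier (\<lambda>y. cis (- (y \<bullet> \<eta>)) * G y) x)"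
          by (rule fourier_multiplication[OF k'i integrable_cis(2)[OF Gi]])
        also have "fourier (\<lambda>y. cis (- (y \<bullet> \<eta>)) * G y) = (\<lambda>x. fourier G (x + \<eta>))"
          unfolding fourier_def
          by (intro ext Bochner_Integration.integral_cong refl)
             (simp add: cis_mult mult.assoc[symmetric] inner_add_right)
        finally show ?thesis unfolding FG .
      qed
      ultimately show ?thesis by simp
    qed
    also have "ennreal (norm (LINT \<eta>|lborel. k \<eta> * (LINT x|lborel. k' x * of_real (g (x + \<eta>)))))
       \<le> (\<integral>\<^sup>+\<eta>. (\<integral>\<^sup>+x. ennreal (norm (k \<eta>)) * ennreal (norm (k' x)) * ennreal (g (x + \<eta>)) \<partial>lborel) \<partial>lborel)"
    proof (rule order_trans[OF norm_integral_le_nn], rule nn_integral_mono)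
      fix \<eta>
      have "ennreal (norm (k \<eta> * (LINT x|lborel. k' x * of_real (g (x + \<eta>)))))
        \<le> ennreal (norm (k \<eta>)) * (\<integral>\<^sup>+x. ennreal (norm (k' x * of_real (g (x + \<eta>)))) \<partial>lborel)"
        unfolding norm_mult[of "k \<eta>"] ennreal_mult[OF norm_ge_zero norm_ge_zero]
        by (intro mult_left_mono norm_integral_le_nn) auto
      also have "\<dots> = (\<integral>\<^sup>+x. ennreal (norm (k \<eta>)) * ennreal (norm (k' x)) * ennreal (g (x + \<eta>)) \<partial>lborel)"
        by (subst nn_integral_cmult[symmetric]) (auto simp: norm_mult g0 ennreal_mult mult.assoc)
      finally show "ennreal (norm (k \<eta> * (LINT x|lborel. k' x * of_real (g (x + \<eta>)))))
        \<le> (\<integral>\<^sup>+x. ennreal (norm (k \<eta>)) * ennreal (norm (k' x)) * ennreal (g (x + \<eta>)) \<partial>lborel)" .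
    qed
    also have "\<dots> \<le> ennreal ((2 * pi) ^ CARD('n)) * L2sq_nn k"
    proof -
      let ?I = "\<integral>\<^sup>+\<eta>. (\<integral>\<^sup>+x. ennreal (norm (k \<eta>)) * ennreal (norm (k' x)) * ennreal (g (x + \<eta>)) \<partial>lborel) \<partial>lborel"
      have N2k': "L2sq_nn k' = L2sq_nn k"
        unfolding L2sq_nn_def k'_def using nn_integral_reflect(1)[of "\<lambda>x. ennreal ((norm (k x))\<^sup>2)"] by simp
      have "2 * ?I = (\<integral>\<^sup>+\<eta>. (\<integral>\<^sup>+x. (2 * ennreal (norm (k \<eta>)) * ennreal (norm (k' x))) * ennreal (g (x + \<eta>)) \<partial>lborel) \<partial>lborel)"
        by (simp add: nn_integral_cmult[symmetric] mult.assoc)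
      also have "\<dots> \<le> (\<integral>\<^sup>+\<eta>. (\<integral>\<^sup>+x. (ennreal ((norm (k \<eta>))\<^sup>2) + ennreal ((norm (k' x))\<^sup>2)) * ennreal (g (x + \<eta>)) \<partial>lborel) \<partial>lborel)"
        by (intro nn_integral_mono mult_right_mono)
           (auto simp: ennreal_power[symmetric] intro!: sum_of_squares_ge_ennreal)
      also have "\<dots> = (\<integral>\<^sup>+\<eta>. (\<integral>\<^sup>+x. ennreal ((norm (k \<eta>))\<^sup>2) * ennreal (g (x + \<eta>)) \<partial>lborel) \<partial>lborel)
         + (\<integral>\<^sup>+\<eta>. (\<integral>\<^sup>+x. ennreal ((norm (k' x))\<^sup>2) * ennreal (g (x + \<eta>)) \<partial>lborel) \<partial>lborel)"
        by (simp add: distrib_right nn_integral_add)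
      also have "(\<integral>\<^sup>+\<eta>. (\<integral>\<^sup>+x. ennreal ((norm (k' x))\<^sup>2) * ennreal (g (x + \<eta>)) \<partial>lborel) \<partial>lborel)
        = (\<integral>\<^sup>+x. (\<integral>\<^sup>+\<eta>. ennreal ((norm (k' x))\<^sup>2) * ennreal (g (x + \<eta>)) \<partial>lborel) \<partial>lborel)"
        by (rule lborel_pair.Fubini') measurable
      also have "\<dots> = L2sq_nn k' * ennreal ((2 * pi) ^ CARD('n))"
        unfolding L2sq_nn_def
        by (simp add: nn_integral_cmult nn_integral_multc nn_integral_reflect(3)[of "\<lambda>x. ennreal (g x)"] gI)
      also have "(\<integral>\<^sup>+\<eta>. (\<integral>\<^sup>+x. ennreal ((norm (k \<eta>))\<^sup>2) * ennreal (g (x + \<eta>)) \<partial>lborel) \<partial>lborel) = L2sq_nn k * ennreal ((2 * pi) ^ CARD('n))"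
        unfolding L2sq_nn_def
        by (simp add: nn_integral_cmult nn_integral_multc add.commute[of _ "_ :: real ^ 'n"]
            nn_integral_reflect(3)[of "\<lambda>x. ennreal (g x)"] gI)
      finally have "2 * ?I \<le> 2 * (ennreal ((2 * pi) ^ CARD('n)) * L2sq_nn k)"
        unfolding N2k' by (simp add: mult_2 mult.commute)
      then show ?thesis by (subst (asm) ennreal_mult_le_mult_iff) auto
    qed
    finally show ?thesis .
  qed
  have "L2sq_nn K = (\<integral>\<^sup>+y. liminf (\<lambda>m. ennreal ((norm (K y))\<^sup>2 * exp (- (norm (inverse (real (Suc m)) *\<^sub>R y))\<^sup>2 / 2))) \<partial>lborel)"
    unfolding L2sq_nn_def
  proof (intro nn_integral_cong)
    fix y :: "real ^ 'n"
    have "(\<lambda>m. ennreal ((norm (K y))\<^sup>2 * exp (- (norm (inverse (real (Suc m)) *\<^sub>R y))\<^sup>2 / 2)))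
        \<longlonglongrightarrow> ennreal ((norm (K y))\<^sup>2 * exp (- (norm (0 *\<^sub>R y))\<^sup>2 / 2))"
      by (intro tendsto_ennrealI tendsto_mult tendsto_const tendsto_exp tendsto_divide tendsto_minus tendsto_power
          tendsto_norm tendsto_scaleR LIMSEQ_inverse_real_of_nat) auto
    then show "ennreal ((norm (K y))\<^sup>2) = liminf (\<lambda>m. ennreal ((norm (K y))\<^sup>2 * exp (- (norm (inverse (real (Suc m)) *\<^sub>R y))\<^sup>2 / 2)))"
      using lim_imp_Liminf[OF trivial_limit_sequentially] by fastforce
  qed
  also have "\<dots> \<le> liminf (\<lambda>m. \<integral>\<^sup>+y. ennreal ((norm (K y))\<^sup>2 * exp (- (norm (inverse (real (Suc m)) *\<^sub>R y))\<^sup>2 / 2)) \<partial>lborel)"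
    by (rule nn_integral_liminf) measurable
  also have "\<dots> \<le> ennreal ((2 * pi) ^ CARD('n)) * L2sq_nn k"
    by (intro order_trans[OF Liminf_le_Limsup Limsup_bounded] always_eventually allI main) auto
  finally show ?thesis unfolding K_def .
qed

text \<open>Indicators of closed sets are bounded limits of continuous functions. So the measures with the
  positive and the negative part of \<open>h\<close> as densities agree on closed sets, hence everywhere.\<close>

lemma density_zero:
  fixes h :: "'a::euclidean_space \<Rightarrow> real"
  assumes h: "integrable lborel h"
    and z: "\<And>\<psi>. continuous_on UNIV \<psi> \<Longrightarrow> (\<And>x. \<bar>\<psi> x\<bar> \<le> 1) \<Longrightarrow> (LINT x|lborel. \<psi> x * h x) = 0"
  shows "AE x in lborel. h x = 0"
proof -
  have [measurable]: "h \<in> borel_measurable borel" using h by auto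
  have C0: "(LINT x|lborel. indicator C x * h x) = 0" if C: "closed C" "C \<noteq> {}" for C
  proof -
    have [measurable]: "C \<in> sets borel" using C by auto
    let ?p = "\<lambda>m x. max 0 (1 - real m * infdist x C)"
    have L: "(\<lambda>m. LINT x|lborel. ?p m x * h x) \<longlonglongrightarrow> (LINT x|lborel. indicator C x * h x)"
    proof (rule integral_dominated_convergence[where w = "\<lambda>x. norm (h x)"])
      show "AE x in lborel. (\<lambda>m. ?p m x * h x) \<longlonglongrightarrow> indicator C x * h x"
      proof (intro AE_I2 tendsto_mult tendsto_const)
        fix x
        show "(\<lambda>m. ?p m x) \<longlonglongrightarrow> indicator C x"
        proof (cases "x \<in> C")
          case False
          then have d: "infdist x C > 0" using C in_closed_iff_infdist_zero[of C x] infdist_nonneg[of x C] by fastforce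
          obtain M where M: "real M * infdist x C > 1" using ex_less_of_nat_mult[OF d] by blast
          have "\<forall>\<^sub>F m in sequentially. ?p m x = 0"
          proof (rule eventually_sequentiallyI[of M])
            fix m assume "M \<le> m"
            then have "real M * infdist x C \<le> real m * infdist x C" using d by (intro mult_right_mono) auto
            then show "?p m x = 0" using M by simp
          qed
          then show ?thesis using False by (simp add: tendsto_eventually)
        qed simp
      qed
      show "AE x in lborel. norm (?p m x * h x) \<le> norm (h x)" for m
        by (intro AE_I2) (auto simp: abs_mult infdist_nonneg intro!: mult_left_le_one_le)
      have [measurable]: "(\<lambda>x. infdist x C) \<in> borel_measurable borel"
        by (intro borel_measurable_continuous_onI continuous_intros)
      show "(\<lambda>x. ?p m x * h x) \<in> borel_measurable lborel" for m by measurable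
    qed (use h in auto)
    have "(LINT x|lborel. ?p m x * h x) = 0" for m
    proof (rule z)
      show "continuous_on UNIV (?p m)" by (intro continuous_intros)
      show "\<bar>?p m x\<bar> \<le> 1" for x using infdist_nonneg[of x C] by (auto simp: max_def)
    qed
    from L[unfolded this] show ?thesis by (simp add: LIMSEQ_const_iff)
  qed
  let ?P = "\<lambda>x. ennreal (h x)" let ?N = "\<lambda>x. ennreal (- h x)"
  have fin: "(\<integral>\<^sup>+x. ?P x \<partial>lborel) < \<infinity>" "(\<integral>\<^sup>+x. ?N x \<partial>lborel) < \<infinity>"
    using h by (auto simp: real_integrable_def less_top)
  have E: "emeasure (density lborel ?P) UNIV \<noteq> \<top>"
    using fin by (subst emeasure_density) auto
  have "density lborel ?P = density lborel ?N"
  proof (rule measure_eqI_generator_eq[where E = "Collect closed" and \<Omega> = UNIV and A = "\<lambda>_. UNIV"])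
    fix C :: "'a set" assume "C \<in> Collect closed"
    then have C: "closed C" and [measurable]: "C \<in> sets borel" by auto
    show "emeasure (density lborel ?P) C = emeasure (density lborel ?N) C"
    proof (cases "C = {}")
      case False
      have i: "integrable lborel (\<lambda>x. indicator C x * h x)" using integrable_real_mult_indicator[OF _ h, of C] by (simp add: mult.commute)
      have "(\<integral>\<^sup>+x. ennreal (indicator C x * h x) \<partial>lborel) < \<infinity>" "(\<integral>\<^sup>+x. ennreal (- (indicator C x * h x)) \<partial>lborel) < \<infinity>"
        using i by (auto simp: real_integrable_def less_top)
      moreover have "enn2real (\<integral>\<^sup>+x. ennreal (indicator C x * h x) \<partial>lborel) = enn2real (\<integral>\<^sup>+x. ennreal (- (indicator C x * h x)) \<partial>lborel)"
        using C0[OF C False] unfolding real_lebesgue_integral_def[OF i] by simp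
      ultimately have "(\<integral>\<^sup>+x. ennreal (indicator C x * h x) \<partial>lborel) = (\<integral>\<^sup>+x. ennreal (- (indicator C x * h x)) \<partial>lborel)"
        by (simp only: infinity_ennreal_def) (metis ennreal_enn2real)
      moreover have "(\<integral>\<^sup>+x. ?P x * indicator C x \<partial>lborel) = (\<integral>\<^sup>+x. ennreal (indicator C x * h x) \<partial>lborel)"
        "(\<integral>\<^sup>+x. ?N x * indicator C x \<partial>lborel) = (\<integral>\<^sup>+x. ennreal (- (indicator C x * h x)) \<partial>lborel)"
        by (intro nn_integral_cong; simp split: split_indicator)+
      ultimately show ?thesis by (simp add: emeasure_density)
    qed simp
  qed (use E in \<open>auto simp: Int_stable_def borel_eq_closed\<close>)
  then have "AE x in lborel. ?P x = ?N x"
    by (subst (asm) finite_density_unique) (use fin in auto)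
  then show ?thesis
  proof (rule AE_mp, intro AE_I2 impI)
    fix x assume "?P x = ?N x"
    then show "h x = 0" by (cases "h x \<ge> 0") (auto simp: ennreal_neg ennreal_eq_0_iff)
  qed
qed

text \<open>All convolutions of \<open>k\<close> with Gaussians vanish. Moving the Gaussian to a bounded continuous test
  function and letting it concentrate shows that \<open>k\<close> integrates to zero against that function.\<close>

lemma fourier_injective:
  fixes k :: "'n::finite cfun"
  assumes k: "integrable lborel k" and z: "\<And>\<xi>. fourier k \<xi> = 0"
  shows "AE x in lborel. k x = 0"
proof -
  have [measurable]: "k \<in> borel_measurable borel" using k by auto
  have main: "(LINT x|lborel. of_real (\<psi> x) * k x) = 0"
    if c: "continuous_on UNIV \<psi>" and b: "\<And>x. \<bar>\<psi> x\<bar> \<le> 1" for \<psi> :: "real ^ 'n \<Rightarrow> real"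
  proof -
    let ?a = "\<lambda>m. inverse (real (Suc m))"
    let ?c = "complex_of_real (sqrt (2 * pi) ^ CARD('n))"
    define p where "p = (\<lambda>x. complex_of_real (\<psi> x))"
    have pc: "isCont p x" for x using c unfolding p_def by (auto simp: continuous_on_eq_continuous_at)
    have pb: "norm (p x) \<le> 1" for x using b by (simp add: p_def)
    have [measurable]: "p \<in> borel_measurable borel"
      unfolding p_def by (intro borel_measurable_continuous_onI continuous_on_of_real c)
    have zero: "(LINT y|lborel. k y * (LINT w|lborel. p (y + ?a m *\<^sub>R w) * gauss w)) = 0" for m
    proof -
      let ?b = "real (Suc m)"
      have e: "of_real (?a m ^ CARD('n)) * (LINT w|lborel. p (y + ?a m *\<^sub>R w) * gauss w) = (LINT z|lborel. p z * gauss (?b *\<^sub>R (z - y)))" for y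
        using integral_affine[of "?a m" "\<lambda>z. p z * gauss (?b *\<^sub>R (z - y))" y] by (simp del: of_nat_Suc)
      have gg: "gauss (?b *\<^sub>R (z - y)) = gauss (?b *\<^sub>R (y - z))" for y z :: "real ^ 'n"
        by (simp add: gauss_def norm_minus_commute)
      have i: "integrable (lborel \<Otimes>\<^sub>M lborel) (\<lambda>(y, z). k y * (p z * gauss (?b *\<^sub>R (z - y))))"
      proof (rule lborel_pair.Fubini_integrable)
        have gi: "integrable lborel (\<lambda>z. gauss (?b *\<^sub>R (z - y)))" for y :: "real ^ 'n"
          using integrable_affine[OF _ schwartz_integrable[OF gauss_schwartz], of ?b "- ?b *\<^sub>R y"]
          by (simp add: scaleR_diff_right del: of_nat_Suc)
        have bi: "integrable lborel (\<lambda>z. p z * gauss (?b *\<^sub>R (z - y)))" for y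
          by (rule Bochner_Integration.integrable_bound[OF gi[of y]])
             (simp, intro AE_I2, simp only: norm_mult mult_left_le_one_le pb norm_ge_zero)
        show "AE y in lborel. integrable lborel (\<lambda>z. case (y, z) of (y, z) \<Rightarrow> k y * (p z * gauss (?b *\<^sub>R (z - y))))"
          using bi by auto
        let ?M = "\<lambda>y. LINT z|lborel. norm (p z * gauss (?b *\<^sub>R (z - y)))"
        define M where "M = (LINT z|lborel. norm (gauss (?b *\<^sub>R (z :: real ^ 'n))))"
        have M: "?M y \<le> M" for y
        proof -
          have i1: "integrable lborel (\<lambda>z. norm (gauss (?b *\<^sub>R (z - y))))"
            by (intro integrable_norm gi)
          have "?M y \<le> (LINT z|lborel. norm (gauss (?b *\<^sub>R (z - y))))"
            by (rule integral_mono[OF integrable_norm[OF bi] i1]) (simp only: norm_mult mult_left_le_one_le pb norm_ge_zero)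
          also have "complex_of_real \<dots> = of_real M"
            unfolding M_def integral_complex_of_real[symmetric]
            by (rule integral_reflect(4)[of "\<lambda>z. of_real (norm (gauss (?b *\<^sub>R z)))"]) measurable
          then have "(LINT z|lborel. norm (gauss (?b *\<^sub>R (z - y)))) = M" by (simp only: of_real_eq_iff)
          finally show ?thesis by simp
        qed
        have M0: "?M y \<ge> 0" for y by simp
        show "integrable lborel (\<lambda>y. LINT z|lborel. norm (case (y, z) of (y, z) \<Rightarrow> k y * (p z * gauss (?b *\<^sub>R (z - y)))))"
        proof (rule Bochner_Integration.integrable_bound[of _ "\<lambda>y. norm (k y) * M"])
          show "AE y in lborel. norm (LINT z|lborel. norm (case (y, z) of (y, z) \<Rightarrow> k y * (p z * gauss (?b *\<^sub>R (z - y))))) \<le> norm (norm (k y) * M)"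
            using M M0 order_trans[OF M0 M] by (auto simp: norm_mult abs_mult simp del: of_nat_Suc intro!: mult_left_mono)
        qed (use k in auto)
      qed measurable
      have "of_real (?a m ^ CARD('n)) * (LINT y|lborel. k y * (LINT w|lborel. p (y + ?a m *\<^sub>R w) * gauss w))
         = (LINT y|lborel. of_real (?a m ^ CARD('n)) * (k y * (LINT w|lborel. p (y + ?a m *\<^sub>R w) * gauss w)))"
        by (rule integral_mult_right_zero[symmetric])
      also have "\<dots> = (LINT y|lborel. (LINT z|lborel. k y * (p z * gauss (?b *\<^sub>R (z - y)))))"
      proof (intro Bochner_Integration.integral_cong refl)
        fix y
        have "of_real (?a m ^ CARD('n)) * (k y * (LINT w|lborel. p (y + ?a m *\<^sub>R w) * gauss w))
          = k y * (of_real (?a m ^ CARD('n)) * (LINT w|lborel. p (y + ?a m *\<^sub>R w) * gauss w))"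
          by (rule mult.left_commute)
        also have "\<dots> = k y * (LINT z|lborel. p z * gauss (?b *\<^sub>R (z - y)))" unfolding e ..
        also have "\<dots> = (LINT z|lborel. k y * (p z * gauss (?b *\<^sub>R (z - y))))"
          by (rule integral_mult_right_zero[symmetric])
        finally show "of_real (?a m ^ CARD('n)) * (k y * (LINT w|lborel. p (y + ?a m *\<^sub>R w) * gauss w))
          = (LINT z|lborel. k y * (p z * gauss (?b *\<^sub>R (z - y))))" .
      qed
      also have "\<dots> = (LINT z|lborel. (LINT y|lborel. k y * (p z * gauss (?b *\<^sub>R (z - y)))))"
        using lborel_pair.Fubini_integral[OF i] by simp
      also have "\<dots> = (LINT z|lborel. p z * (LINT y|lborel. k y * gauss (?b *\<^sub>R (y - z))))"
      proof (intro Bochner_Integration.integral_cong refl)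
        fix z
        have "(LINT y|lborel. k y * (p z * gauss (?b *\<^sub>R (z - y)))) = (LINT y|lborel. p z * (k y * gauss (?b *\<^sub>R (y - z))))"
          by (intro Bochner_Integration.integral_cong refl, subst gg) (rule mult.left_commute)
        also have "\<dots> = p z * (LINT y|lborel. k y * gauss (?b *\<^sub>R (y - z)))"
          by (rule integral_mult_right_zero)
        finally show "(LINT y|lborel. k y * (p z * gauss (?b *\<^sub>R (z - y)))) = p z * (LINT y|lborel. k y * gauss (?b *\<^sub>R (y - z)))" .
      qed
      also have "\<dots> = 0"
      proof -
        have "of_real (sqrt (2 * pi) ^ CARD('n) / ?a m ^ CARD('n)) * (LINT y|lborel. k y * gauss (inverse (?a m) *\<^sub>R (y - z))) = 0" for z
          by (subst fourier_gauss_modulated[OF _ k, symmetric]) (auto simp: z)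
        then have "(LINT y|lborel. k y * gauss (?b *\<^sub>R (y - z))) = 0" for z by (simp del: of_nat_Suc)
        then show ?thesis by simp
      qed
      finally show ?thesis by (simp del: of_nat_Suc)
    qed
    have "(\<lambda>m. LINT y|lborel. k y * (LINT w|lborel. p (y + ?a m *\<^sub>R w) * gauss w)) \<longlonglongrightarrow> (LINT y|lborel. k y * (?c * p y))"
    proof (rule integral_dominated_convergence[where w = "\<lambda>y. norm (k y) * (LINT w|lborel. norm (gauss (w :: real ^ 'n)))"])
      show "AE y in lborel. (\<lambda>m. k y * (LINT w|lborel. p (y + ?a m *\<^sub>R w) * gauss w)) \<longlonglongrightarrow> k y * (?c * p y)"
        by (intro AE_I2 tendsto_mult tendsto_const gauss_approximate_identity[OF _ pc pb]) auto
      show "AE y in lborel. norm (k y * (LINT w|lborel. p (y + ?a m *\<^sub>R w) * gauss w)) \<le> norm (k y) * (LINT w|lborel. norm (gauss (w :: real ^ 'n)))" for m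
      proof (intro AE_I2)
        fix y :: "real ^ 'n"
        have "norm (LINT w|lborel. p (y + ?a m *\<^sub>R w) * gauss w) \<le> (LINT w|lborel. norm (gauss (w :: real ^ 'n)))"
        proof (rule Bochner_Integration.integral_norm_bound_integral)
          have gi: "integrable lborel (gauss :: 'n cfun)" by (rule schwartz_integrable[OF gauss_schwartz])
          then show "integrable lborel (\<lambda>w :: real ^ 'n. norm (gauss w))" by simp
          show "integrable lborel (\<lambda>w. p (y + ?a m *\<^sub>R w) * gauss w)"
            by (rule Bochner_Integration.integrable_bound[OF gi])
               (simp, intro AE_I2, simp only: norm_mult mult_left_le_one_le pb norm_ge_zero)
          show "norm (p (y + ?a m *\<^sub>R w) * gauss w) \<le> norm (gauss w)" for w
            by (simp only: norm_mult mult_left_le_one_le pb norm_ge_zero)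
        qed
        then show "norm (k y * (LINT w|lborel. p (y + ?a m *\<^sub>R w) * gauss w)) \<le> norm (k y) * (LINT w|lborel. norm (gauss (w :: real ^ 'n)))"
          unfolding norm_mult by (intro mult_left_mono) auto
      qed
    qed (use k in auto)
    then have "(LINT y|lborel. k y * (?c * p y)) = 0" unfolding zero by (simp add: LIMSEQ_const_iff)
    moreover have "(LINT y|lborel. k y * (?c * p y)) = (LINT y|lborel. ?c * (p y * k y))"
      by (intro Bochner_Integration.integral_cong refl) (simp only: mult_ac)
    ultimately have "?c * (LINT y|lborel. p y * k y) = 0" using integral_mult_right_zero by metis
    then show ?thesis by (simp add: p_def)
  qed
  have "AE x in lborel. Re (k x) = 0" "AE x in lborel. Im (k x) = 0"
  proof -
    have pk: "integrable lborel (\<lambda>x. of_real (\<psi> x) * k x)"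
      if "continuous_on UNIV \<psi>" "\<And>x. \<bar>\<psi> x\<bar> \<le> 1" for \<psi> :: "real ^ 'n \<Rightarrow> real"
    proof (rule Bochner_Integration.integrable_bound[OF k])
      have [measurable]: "\<psi> \<in> borel_measurable borel" by (intro borel_measurable_continuous_onI that)
      show "(\<lambda>x. of_real (\<psi> x) * k x) \<in> borel_measurable lborel" by measurable
    qed (use that in \<open>auto simp: norm_mult intro!: mult_left_le_one_le\<close>)
    show "AE x in lborel. Re (k x) = 0"
    proof (rule density_zero)
      fix \<psi> :: "real ^ 'n \<Rightarrow> real" assume *: "continuous_on UNIV \<psi>" "\<And>x. \<bar>\<psi> x\<bar> \<le> 1"
      show "(LINT x|lborel. \<psi> x * Re (k x)) = 0"
        using integral_Re[OF pk[OF *]] main[OF *] by simp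
    qed (use k in auto)
    show "AE x in lborel. Im (k x) = 0"
    proof (rule density_zero)
      fix \<psi> :: "real ^ 'n \<Rightarrow> real" assume *: "continuous_on UNIV \<psi>" "\<And>x. \<bar>\<psi> x\<bar> \<le> 1"
      show "(LINT x|lborel. \<psi> x * Im (k x)) = 0"
        using integral_Im[OF pk[OF *]] main[OF *] by simp
    qed (use k in auto)
  qed
  then show ?thesis by eventually_elim (simp add: complex_eq_iff)
qed

section \<open>The Hilbert space of square-integrable functions\<close>

text \<open>Finite-valued companion of the extended squared norm; the two agree on square-integrable
  functions, whereas a divergent integral has the value zero here.\<close>

definition L2sq :: "'n::finite cfun \<Rightarrow> real" where
  "L2sq f = (LINT x|lborel. (norm (f x))\<^sup>2)"

lemma sqi_measurable: "square_integrable f \<Longrightarrow> f \<in> borel_measurable borel"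
  by (simp add: square_integrable_def)

lemma square_integrable_iff: "square_integrable f \<longleftrightarrow> f \<in> borel_measurable borel \<and> L2sq_nn f < \<infinity>"
  unfolding square_integrable_def L2sq_nn_def by (auto simp: integrable_iff_bounded)

lemma L2sq_nn_L2sq: "square_integrable f \<Longrightarrow> L2sq_nn f = ennreal (L2sq f)"
  unfolding L2sq_nn_def L2sq_def square_integrable_def by (intro nn_integral_eq_integral) auto

lemma L2sq_nonneg [simp]: "L2sq f \<ge> 0"
  unfolding L2sq_def by (intro Bochner_Integration.integral_nonneg) auto

lemma L2sq_nn_le_iff: "square_integrable f \<Longrightarrow> c \<ge> 0 \<Longrightarrow> L2sq_nn f \<le> ennreal c \<longleftrightarrow> L2sq f \<le> c"
  by (simp add: L2sq_nn_L2sq)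

lemma sqi_mult_integrable:
  assumes f: "square_integrable f" and g: "square_integrable g"
  shows "integrable lborel (\<lambda>x. f x * g x)"
proof (rule Bochner_Integration.integrable_bound[of _ "\<lambda>x. (norm (f x))\<^sup>2 + (norm (g x))\<^sup>2"])
  show "integrable lborel (\<lambda>x. (norm (f x))\<^sup>2 + (norm (g x))\<^sup>2)"
    using assms by (auto simp: square_integrable_def)
  show "(\<lambda>x. f x * g x) \<in> borel_measurable lborel" using assms by (auto simp: square_integrable_def)
  have "norm (f x) * norm (g x) \<le> (norm (f x))\<^sup>2 + (norm (g x))\<^sup>2" for x
  proof -
    have "2 * (norm (f x) * norm (g x)) \<le> (norm (f x))\<^sup>2 + (norm (g x))\<^sup>2"
      using sum_squares_bound[of "norm (f x)" "norm (g x)"] by simp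
    moreover have "0 \<le> norm (f x) * norm (g x)" by simp
    ultimately show ?thesis by linarith
  qed
  then show "AE x in lborel. norm (f x * g x) \<le> norm ((norm (f x))\<^sup>2 + (norm (g x))\<^sup>2)"
    by (intro AE_I2) (simp add: norm_mult)
qed

lemma nn_CS:
  fixes f g :: "'a::euclidean_space \<Rightarrow> complex"
  assumes [measurable]: "f \<in> borel_measurable borel" "g \<in> borel_measurable borel"
  shows "(\<integral>\<^sup>+x. ennreal (norm (f x) * norm (g x)) \<partial>lborel)\<^sup>2 \<le> L2sq_nn f * L2sq_nn g"
  using Cauchy_Schwarz_nn_integral[of "\<lambda>x. ennreal (norm (f x))" lborel "\<lambda>x. ennreal (norm (g x))"]
  unfolding L2sq_nn_def by (simp add: ennreal_mult ennreal_power)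

lemma sqi_CS:
  assumes f: "square_integrable f" and g: "square_integrable g"
  shows "(norm (LINT x|lborel. f x * g x))\<^sup>2 \<le> L2sq f * L2sq g"
proof -
  have "ennreal ((norm (LINT x|lborel. f x * g x))\<^sup>2) = (ennreal (norm (LINT x|lborel. f x * g x)))\<^sup>2"
    by (simp add: ennreal_power)
  also have "\<dots> \<le> (\<integral>\<^sup>+x. ennreal (norm (f x) * norm (g x)) \<partial>lborel)\<^sup>2"
    using norm_integral_le_nn[of lborel "\<lambda>x. f x * g x"] by (intro power_mono_ennreal) (simp add: norm_mult)
  also have "\<dots> \<le> L2sq_nn f * L2sq_nn g" by (intro nn_CS sqi_measurable assms)
  also have "\<dots> = ennreal (L2sq f * L2sq g)" by (simp add: L2sq_nn_L2sq assms ennreal_mult)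
  finally show ?thesis by simp
qed

lemma sqi_cmult: "square_integrable f \<Longrightarrow> square_integrable (\<lambda>x. c * f x)"
  by (auto simp: square_integrable_def norm_mult power_mult_distrib)

lemma sqi_cnj: "square_integrable f \<Longrightarrow> square_integrable (\<lambda>x. cnj (f x))"
  by (auto simp: square_integrable_def)

lemma L2sq_expand:
  assumes f: "square_integrable f" and g: "square_integrable g"
  shows "square_integrable (\<lambda>x. f x + z * g x)"
    "L2sq (\<lambda>x. f x + z * g x) = L2sq f + (norm z)\<^sup>2 * L2sq g + 2 * Re (z * (LINT x|lborel. g x * cnj (f x)))"
proof -
  have e: "(norm (f x + z * g x))\<^sup>2 = (norm (f x))\<^sup>2 + (norm z)\<^sup>2 * (norm (g x))\<^sup>2 + 2 * Re (z * (g x * cnj (f x)))" for x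
    using complex_norm_square[of "f x + z * g x"]
    unfolding cmod_power2 norm_mult power_mult_distrib by (simp add: power2_eq_square algebra_simps)
  have i: "integrable lborel (\<lambda>x. g x * cnj (f x))" by (intro sqi_mult_integrable g sqi_cnj f)
  have i1: "integrable lborel (\<lambda>x. (norm (f x))\<^sup>2)" and i2: "integrable lborel (\<lambda>x. (norm (g x))\<^sup>2)"
    using assms by (auto simp: square_integrable_def)
  have i3: "integrable lborel (\<lambda>x. Re (z * (g x * cnj (f x))))"
    by (intro integrable_Re integrable_mult_right i)
  show "square_integrable (\<lambda>x. f x + z * g x)"
  proof -
    have "integrable lborel (\<lambda>x. (norm (f x))\<^sup>2 + (norm z)\<^sup>2 * (norm (g x))\<^sup>2 + 2 * Re (z * (g x * cnj (f x))))"
      by (intro Bochner_Integration.integrable_add i1 integrable_mult_right i2 i3)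
    moreover have [measurable]: "f \<in> borel_measurable borel" "g \<in> borel_measurable borel"
      using assms by (auto simp: square_integrable_def)
    have "(\<lambda>x. f x + z * g x) \<in> borel_measurable lborel" by measurable
    ultimately show ?thesis unfolding square_integrable_def e by blast
  qed
  have "L2sq (\<lambda>x. f x + z * g x) = L2sq f + (norm z)\<^sup>2 * L2sq g + 2 * (LINT x|lborel. Re (z * (g x * cnj (f x))))"
    unfolding L2sq_def e
    by (subst Bochner_Integration.integral_add, (intro Bochner_Integration.integrable_add i1 integrable_mult_right i2 i3)+)
       (subst Bochner_Integration.integral_add, (intro i1 integrable_mult_right i2)+, simp only: integral_mult_right_zero)
  also have "(LINT x|lborel. Re (z * (g x * cnj (f x)))) = Re (z * (LINT x|lborel. g x * cnj (f x)))"
    unfolding integral_mult_right_zero[symmetric] by (rule integral_Re[OF integrable_mult_right[OF i]])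
  finally show "L2sq (\<lambda>x. f x + z * g x) = L2sq f + (norm z)\<^sup>2 * L2sq g + 2 * Re (z * (LINT x|lborel. g x * cnj (f x)))" .
qed

lemma L2sq_cmult: "L2sq (\<lambda>x. c * f x) = (norm c)\<^sup>2 * L2sq f"
  unfolding L2sq_def by (simp add: norm_mult power_mult_distrib)

lemma L2sq_cnj: "L2sq (\<lambda>x. cnj (f x)) = L2sq f"
  unfolding L2sq_def by simp

lemma sqi_diff: "square_integrable f \<Longrightarrow> square_integrable g \<Longrightarrow> square_integrable (\<lambda>x. f x - g x)"
  using L2sq_expand(1)[of f g "-1"] by simp

lemma sqi_lin: "square_integrable f \<Longrightarrow> square_integrable g \<Longrightarrow> square_integrable (\<lambda>x. a * f x + b * g x)"
  using L2sq_expand(1)[of "\<lambda>x. a * f x" g b] by (simp add: sqi_cmult)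

lemma parallelogram:
  assumes f: "square_integrable f" and g: "square_integrable g"
  shows "L2sq (\<lambda>x. f x - g x) = 2 * L2sq f + 2 * L2sq g - 4 * L2sq (\<lambda>x. 1/2 * f x + 1/2 * g x)"
proof -
  have "L2sq (\<lambda>x. 1/2 * f x + 1/2 * g x) = L2sq (\<lambda>x. 1/2 * (f x + 1 * g x))" by (simp add: distrib_left)
  also have "\<dots> = 1 / 4 * L2sq (\<lambda>x. f x + 1 * g x)" unfolding L2sq_cmult by (simp add: power2_eq_square)
  finally show ?thesis
    using L2sq_expand(2)[OF assms, of 1] L2sq_expand(2)[OF assms, of "-1"] by simp
qed

lemma schwartz_sqi: "f \<in> schwartz_functions \<Longrightarrow> square_integrable f"
proof -
  assume f: "f \<in> schwartz_functions"
  have "integrable lborel (\<lambda>x. f x * cnj (f x))"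
    by (intro schwartz_integrable schwartz_mult schwartz_cnj f)
  moreover have "Re (f x * cnj (f x)) = (norm (f x))\<^sup>2" for x
    unfolding cmod_power2 by (simp add: power2_eq_square)
  ultimately have "integrable lborel (\<lambda>x. (norm (f x))\<^sup>2)"
    using integrable_Re[of lborel "\<lambda>x. f x * cnj (f x)"] by simp
  then show "square_integrable f" using schwartz_measurable[OF f] by (simp add: square_integrable_def)
qed

text \<open>Geometric decay of the increments makes the sequence converge almost everywhere, and
  Fatou's lemma transfers the Cauchy bound to the pointwise limit.\<close>

lemma L2_complete:
  fixes f :: "nat \<Rightarrow> 'n::finite cfun"
  assumes f: "\<And>k. square_integrable (f k)"
    and c: "\<And>k m. k \<le> m \<Longrightarrow> L2sq_nn (\<lambda>x. f m x - f k x) \<le> ennreal ((1/8) ^ k)"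
  obtains g where "square_integrable g" "\<And>k. L2sq_nn (\<lambda>x. g x - f k x) \<le> ennreal ((1/8) ^ k)"
proof -
  have [measurable]: "f k \<in> borel_measurable borel" for k using sqi_measurable[OF f] .
  define g where "g = (\<lambda>x. lim (\<lambda>m. f m x))"
  have [measurable]: "g \<in> borel_measurable borel" unfolding g_def by measurable
  (* The factors 2 ^ k leave a summable 4 ^ - k, yet where the weighted sum is finite they force the
     increments to decay geometrically. *)
  let ?d = "\<lambda>k x. ennreal (2 ^ k) * ennreal ((norm (f (Suc k) x - f k x))\<^sup>2)"
  have "(\<integral>\<^sup>+x. (\<Sum>k. ?d k x) \<partial>lborel) = (\<Sum>k. ennreal (2 ^ k) * L2sq_nn (\<lambda>x. f (Suc k) x - f k x))"
    unfolding L2sq_nn_def by (subst nn_integral_suminf) (auto simp: nn_integral_cmult)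
  also have "\<dots> \<le> (\<Sum>k. ennreal ((1/4) ^ k))"
  proof (intro suminf_le)
    fix k
    have "ennreal (2 ^ k) * L2sq_nn (\<lambda>x. f (Suc k) x - f k x) \<le> ennreal (2 ^ k) * ennreal ((1/8) ^ k)"
      by (intro mult_left_mono c) auto
    also have "\<dots> = ennreal (2 ^ k * (1/8) ^ k)" by (simp add: ennreal_mult)
    also have "(2 ^ k * (1/8) ^ k :: real) = (1/4) ^ k" by (simp flip: power_mult_distrib)
    finally show "ennreal (2 ^ k) * L2sq_nn (\<lambda>x. f (Suc k) x - f k x) \<le> ennreal ((1/4) ^ k)" .
  qed auto
  also have "\<dots> < \<infinity>"
    by (subst suminf_ennreal2) (auto intro!: summable_geometric)
  finally have "AE x in lborel. (\<Sum>k. ?d k x) \<noteq> \<infinity>"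
    by (intro nn_integral_noteq_infinite) auto
  then have conv: "AE x in lborel. (\<lambda>m. f m x) \<longlonglongrightarrow> g x"
  proof (rule AE_mp, intro AE_I2 impI)
    fix x assume fin: "(\<Sum>k. ?d k x) \<noteq> \<infinity>"
    then obtain B where B: "(\<Sum>k. ?d k x) = ennreal B" "B \<ge> 0" by (cases "\<Sum>k. ?d k x") auto
    have le: "norm (f (Suc k) x - f k x) \<le> sqrt B * (1 / sqrt 2) ^ k" for k
    proof -
      have "?d k x \<le> (\<Sum>k. ?d k x)" using sum_le_suminf[of "\<lambda>k. ?d k x" "{k}"] by simp
      then have "ennreal (2 ^ k * (norm (f (Suc k) x - f k x))\<^sup>2) \<le> ennreal B"
        unfolding B(1) by (simp add: ennreal_mult)
      then have "2 ^ k * (norm (f (Suc k) x - f k x))\<^sup>2 \<le> B" using B(2) by simp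
      then have "(norm (f (Suc k) x - f k x))\<^sup>2 \<le> B / 2 ^ k" by (simp add: field_simps)
      from real_sqrt_le_mono[OF this] show ?thesis
        by (simp add: real_sqrt_divide real_sqrt_power power_divide)
    qed
    have "summable (\<lambda>k. sqrt B * (1 / sqrt 2) ^ k)" by (intro summable_mult summable_geometric) auto
    then have "summable (\<lambda>k. f (Suc k) x - f k x)" by (rule summable_comparison_test'[OF _ le])
    then have "convergent (\<lambda>n. \<Sum>k<n. f (Suc k) x - f k x)" by (simp add: summable_iff_convergent)
    then have "convergent (\<lambda>n. f n x - f 0 x)" using sum_lessThan_telescope[of "\<lambda>k. f k x"] by simp
    then have "convergent (\<lambda>n. f n x)" using convergent_diff_const_right_iff by blast
    then show "(\<lambda>m. f m x) \<longlonglongrightarrow> g x" unfolding g_def by (simp add: convergent_LIMSEQ_iff)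
  qed
  have N: "L2sq_nn (\<lambda>x. g x - f k x) \<le> ennreal ((1/8) ^ k)" for k
  proof -
    have "L2sq_nn (\<lambda>x. g x - f k x) = (\<integral>\<^sup>+x. liminf (\<lambda>m. ennreal ((norm (f m x - f k x))\<^sup>2)) \<partial>lborel)"
      unfolding L2sq_nn_def
    proof (rule nn_integral_cong_AE, rule AE_mp[OF conv], intro AE_I2 impI)
      fix x assume "(\<lambda>m. f m x) \<longlonglongrightarrow> g x"
      then have "(\<lambda>m. ennreal ((norm (f m x - f k x))\<^sup>2)) \<longlonglongrightarrow> ennreal ((norm (g x - f k x))\<^sup>2)"
        by (intro tendsto_ennrealI tendsto_power tendsto_norm tendsto_diff tendsto_const)
      then show "ennreal ((norm (g x - f k x))\<^sup>2) = liminf (\<lambda>m. ennreal ((norm (f m x - f k x))\<^sup>2))"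
        by (rule lim_imp_Liminf[OF trivial_limit_sequentially, symmetric])
    qed
    also have "\<dots> \<le> liminf (\<lambda>m. \<integral>\<^sup>+x. ennreal ((norm (f m x - f k x))\<^sup>2) \<partial>lborel)"
      by (rule nn_integral_liminf) measurable
    also have "\<dots> \<le> ennreal ((1/8) ^ k)"
    proof (rule order_trans[OF Liminf_le_Limsup Limsup_bounded])
      show "\<forall>\<^sub>F m in sequentially. (\<integral>\<^sup>+x. ennreal ((norm (f m x - f k x))\<^sup>2) \<partial>lborel) \<le> ennreal ((1/8) ^ k)"
        using c[of k] unfolding L2sq_nn_def by (intro eventually_sequentiallyI[of k]) auto
    qed auto
    finally show ?thesis .
  qed
  have "square_integrable (\<lambda>x. g x - f 0 x)"
    unfolding square_integrable_iff
  proof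
    show "L2sq_nn (\<lambda>x. g x - f 0 x) < \<infinity>" using le_less_trans[OF N[of 0] ennreal_less_top] by simp
  qed measurable
  from sqi_lin[OF this f[of 0], of 1 1] have "square_integrable g" by simp
  with N that show ?thesis by blast
qed

text \<open>Riesz representation on a subspace, without completing it: a minimizing sequence in \<open>V\<close> of
  the squared norm minus twice the real part of \<open>L\<close> is Cauchy by the parallelogram law, and the
  first variation at its limit identifies \<open>L\<close>. The last conclusion records that the representing
  function is, up to conjugation, a limit of elements of \<open>V\<close>; it yields density results.\<close>

lemma L2_riesz:
  fixes V :: "'n::finite cfun set"
  assumes V: "\<And>\<phi>. \<phi> \<in> V \<Longrightarrow> square_integrable \<phi>" and ne: "V \<noteq> {}"
    and cl: "\<And>\<phi> \<psi> a b. \<phi> \<in> V \<Longrightarrow> \<psi> \<in> V \<Longrightarrow> (\<lambda>x. a * \<phi> x + b * \<psi> x) \<in> V"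
    and lin: "\<And>\<phi> \<psi> a b. \<phi> \<in> V \<Longrightarrow> \<psi> \<in> V \<Longrightarrow> L (\<lambda>x. a * \<phi> x + b * \<psi> x) = a * L \<phi> + b * L \<psi>"
    and bnd: "\<And>\<phi>. \<phi> \<in> V \<Longrightarrow> (norm (L \<phi>))\<^sup>2 \<le> C * L2sq \<phi>" and C: "C \<ge> 0"
  obtains f where "square_integrable f" "L2sq f \<le> C" "\<And>\<phi>. \<phi> \<in> V \<Longrightarrow> L \<phi> = (LINT x|lborel. f x * \<phi> x)"
    "\<And>k::nat. \<exists>\<phi>\<in>V. L2sq (\<lambda>x. f x - cnj (\<phi> x)) \<le> (1/8) ^ k"
proof -
  define J where "J = (\<lambda>\<phi>. L2sq \<phi> - 2 * Re (L \<phi>))"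
  have J_lower: "J \<phi> \<ge> - C" if "\<phi> \<in> V" for \<phi>
  proof -
    have "(2 * norm (L \<phi>))\<^sup>2 \<le> 4 * (C * L2sq \<phi>)" using bnd[OF that] by (simp add: power_mult_distrib)
    also have "\<dots> \<le> (C + L2sq \<phi>)\<^sup>2"
      using zero_le_power2[of "C - L2sq \<phi>"] by (simp add: power2_eq_square algebra_simps)
    finally have "2 * norm (L \<phi>) \<le> C + L2sq \<phi>" by (rule power2_le_imp_le) (simp add: C)
    moreover have "Re (L \<phi>) \<le> norm (L \<phi>)" by (rule complex_Re_le_cmod)
    ultimately show ?thesis by (simp add: J_def)
  qed
  define m where "m = Inf (J ` V)"
  have bdd: "bdd_below (J ` V)" by (rule bdd_belowI2[of V "- C" J]) (rule J_lower)
  have m_le: "m \<le> J \<phi>" if "\<phi> \<in> V" for \<phi> unfolding m_def using that bdd by (intro cInf_lower) auto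
  have "\<exists>\<phi>\<in>V. J \<phi> < m + (1/8) ^ k / 4" for k :: nat
  proof -
    have "Inf (J ` V) < m + (1/8) ^ k / 4" unfolding m_def by simp
    then show ?thesis using cInf_less_iff[of "J ` V"] ne bdd by auto
  qed
  then obtain \<phi> where \<phi>: "\<And>k::nat. \<phi> k \<in> V" "\<And>k. J (\<phi> k) < m + (1/8) ^ k / 4" by metis
  have s: "square_integrable (\<phi> k)" for k using V \<phi>(1) by blast
  have "L2sq_nn (\<lambda>x. \<phi> n x - \<phi> k x) \<le> ennreal ((1/8) ^ k)" if "k \<le> n" for k n
  proof -
    let ?h = "\<lambda>x. 1/2 * \<phi> n x + 1/2 * \<phi> k x"
    have "L2sq (\<lambda>x. \<phi> n x - \<phi> k x) = 2 * J (\<phi> n) + 2 * J (\<phi> k) - 4 * J ?h"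
      unfolding J_def parallelogram[OF s s] lin[OF \<phi>(1) \<phi>(1)] by (simp add: algebra_simps)
    also have "\<dots> \<le> (1/8) ^ n / 2 + (1/8) ^ k / 2"
      using m_le[OF cl[OF \<phi>(1)[of n] \<phi>(1)[of k]], of "1/2" "1/2"] \<phi>(2)[of n] \<phi>(2)[of k] by simp
    also have "\<dots> \<le> (1/8) ^ k"
    proof -
      have "(1/8::real) ^ n \<le> (1/8) ^ k" by (rule power_decreasing[OF that]) auto
      then show ?thesis by linarith
    qed
    finally show ?thesis by (subst L2sq_nn_le_iff) (auto intro: sqi_diff s)
  qed
  then obtain g where g: "square_integrable g" "\<And>k. L2sq_nn (\<lambda>x. g x - \<phi> k x) \<le> ennreal ((1/8) ^ k)"
    using L2_complete[of \<phi>] s by blast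
  have gl: "L2sq (\<lambda>x. g x - \<phi> k x) \<le> (1/8) ^ k" for k
    using g(2)[of k] by (subst (asm) L2sq_nn_le_iff) (auto intro: sqi_diff g s)
  have "L \<psi> = (LINT x|lborel. \<psi> x * cnj (g x))" if \<psi>: "\<psi> \<in> V" for \<psi>
  proof -
    define E where "E = (LINT x|lborel. \<psi> x * cnj (g x)) - L \<psi>"
    define e where "e = (\<lambda>k. (LINT x|lborel. \<psi> x * cnj (\<phi> k x)) - L \<psi>)"
    have tz: "(\<lambda>k. (1/8::real) ^ k) \<longlonglongrightarrow> 0" by (intro LIMSEQ_power_zero) simp
    have "(\<lambda>k. (norm (E - e k))\<^sup>2) \<longlonglongrightarrow> 0"
    proof (rule tendsto_sandwich[OF _ _ tendsto_const tendsto_mult_right_zero[OF tz, of "L2sq \<psi>"]])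
      show "\<forall>\<^sub>F k in sequentially. (norm (E - e k))\<^sup>2 \<le> L2sq \<psi> * (1/8) ^ k"
      proof (intro always_eventually allI)
        fix k
        have "E - e k = (LINT x|lborel. \<psi> x * cnj (g x - \<phi> k x))"
          unfolding E_def e_def
          using Bochner_Integration.integral_diff[OF sqi_mult_integrable[OF V[OF \<psi>] sqi_cnj[OF g(1)]] sqi_mult_integrable[OF V[OF \<psi>] sqi_cnj[OF s[of k]]]]
          by (simp add: right_diff_distrib)
        then have "(norm (E - e k))\<^sup>2 \<le> L2sq \<psi> * L2sq (\<lambda>x. cnj (g x - \<phi> k x))"
          using sqi_CS[OF V[OF \<psi>] sqi_cnj[OF sqi_diff[OF g(1) s[of k]]]] by simp
        also have "\<dots> \<le> L2sq \<psi> * (1/8) ^ k" unfolding L2sq_cnj by (intro mult_left_mono gl) auto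
        finally show "(norm (E - e k))\<^sup>2 \<le> L2sq \<psi> * (1/8) ^ k" .
      qed
    qed auto
    then have "(\<lambda>k. norm (E - e k)) \<longlonglongrightarrow> 0"
      using tendsto_real_sqrt[of "\<lambda>k. (norm (E - e k))\<^sup>2" 0 sequentially] by simp
    then have lim: "e \<longlonglongrightarrow> E"
      by (subst LIM_zero_iff[symmetric], subst tendsto_norm_zero_iff[symmetric]) (simp add: norm_minus_commute)
    have pos: "(norm z)\<^sup>2 * L2sq \<psi> + 2 * Re (z * E) \<ge> 0" for z
    proof (rule tendsto_le[OF trivial_limit_sequentially])
      show "(\<lambda>k. (norm z)\<^sup>2 * L2sq \<psi> + 2 * Re (z * e k)) \<longlonglongrightarrow> (norm z)\<^sup>2 * L2sq \<psi> + 2 * Re (z * E)"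
        by (intro tendsto_intros lim)
      show "(\<lambda>k. - ((1/8::real) ^ k / 4)) \<longlonglongrightarrow> 0" using tendsto_minus[OF tendsto_divide[OF tz tendsto_const[of 4]]] by simp
      show "\<forall>\<^sub>F k in sequentially. - ((1/8::real) ^ k / 4) \<le> (norm z)\<^sup>2 * L2sq \<psi> + 2 * Re (z * e k)"
      proof (intro always_eventually allI)
        fix k
        have "(\<lambda>x. \<phi> k x + z * \<psi> x) \<in> V" using cl[OF \<phi>(1)[of k] \<psi>, of 1 z] by simp
        from m_le[OF this]
        have "m \<le> J (\<phi> k) + (norm z)\<^sup>2 * L2sq \<psi> + 2 * Re (z * e k)"
          using lin[OF \<phi>(1)[of k] \<psi>, of 1 z]
          unfolding J_def e_def L2sq_expand(2)[OF s V[OF \<psi>]] by (simp add: algebra_simps)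
        then show "- ((1/8::real) ^ k / 4) \<le> (norm z)\<^sup>2 * L2sq \<psi> + 2 * Re (z * e k)" using \<phi>(2)[of k] by simp
      qed
    qed
    (* For z = - t * cnj E the quadratic form is t |E|^2 (t L2sq psi - 2), negative for small t
       unless E = 0. *)
    define t where "t = 1 / (L2sq \<psi> + 1)"
    have t: "t > 0" "t * L2sq \<psi> < 1" by (auto simp: t_def add_nonneg_pos)
    have "0 \<le> (norm (- of_real t * cnj E))\<^sup>2 * L2sq \<psi> + 2 * Re ((- of_real t * cnj E) * E)" by (rule pos)
    also have "(- of_real t * cnj E) * E = - of_real (t * (norm E)\<^sup>2)"
      using complex_norm_square[of E] by (simp add: mult_ac)
    also have "(norm (- of_real t * cnj E))\<^sup>2 * L2sq \<psi> + 2 * Re (- of_real (t * (norm E)\<^sup>2))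
      = t * (norm E)\<^sup>2 * (t * L2sq \<psi> - 2)"
      using t(1) by (simp add: norm_mult power2_eq_square algebra_simps)
    finally have "E = 0" using t by (auto simp: zero_le_mult_iff mult_le_0_iff)
    then show ?thesis by (simp add: E_def)
  qed note rep = this
  have "L2sq g \<le> C"
  proof (rule tendsto_le[OF trivial_limit_sequentially _ tendsto_const])
    show "(\<lambda>k. (1/8::real) ^ k + C) \<longlonglongrightarrow> C" using tendsto_add[OF LIMSEQ_power_zero[of "1/8::real"] tendsto_const[of C]] by simp
    show "\<forall>\<^sub>F k in sequentially. L2sq g \<le> (1/8) ^ k + C"
    proof (intro always_eventually allI)
      fix k
      have "L2sq (\<lambda>x. g x + (-1) * \<phi> k x) = L2sq g + J (\<phi> k)"
        unfolding L2sq_expand(2)[OF g(1) s] J_def rep[OF \<phi>(1)] by simp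
      then show "L2sq g \<le> (1/8) ^ k + C" using gl[of k] J_lower[OF \<phi>(1)[of k]] by simp
    qed
  qed
  moreover have "\<exists>\<phi>\<in>V. L2sq (\<lambda>x. cnj (g x) - cnj (\<phi> x)) \<le> (1/8) ^ k" for k
    using gl[of k] L2sq_cnj[of "\<lambda>x. g x - \<phi> k x"] by (intro bexI[OF _ \<phi>(1)[of k]]) simp
  ultimately show ?thesis
    using that[of "\<lambda>x. cnj (g x)"] sqi_cnj[OF g(1)] rep by (simp add: L2sq_cnj mult.commute)
qed

text \<open>Multiplication by a Gaussian makes \<open>f\<close> integrable, and its transform at \<open>\<xi>\<close> is the integral of
  \<open>f\<close> against a modulated Gaussian, a Schwartz function.\<close>

lemma L2_unique:
  assumes f: "square_integrable f" and z: "\<And>\<phi>. \<phi> \<in> schwartz_functions \<Longrightarrow> (LINT x|lborel. f x * \<phi> x) = 0"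
  shows "AE x in lborel. f x = 0"
proof -
  have "AE x in lborel. f x * gauss x = 0"
  proof (rule fourier_injective)
    show "integrable lborel (\<lambda>x. f x * gauss x)"
      by (intro sqi_mult_integrable f schwartz_sqi gauss_schwartz)
    fix \<xi> :: "real ^ 'a"
    have "(\<lambda>x. cis (x \<bullet> (- \<xi>)) * gauss x) \<in> schwartz_functions"
      by (intro schwartz_mult_moderate moderate_cis gauss_schwartz)
    from z[OF this] show "fourier (\<lambda>x. f x * gauss x) \<xi> = 0" unfolding fourier_def by (simp add: mult_ac)
  qed
  then show ?thesis by eventually_elim (simp add: gauss_def)
qed

lemma L2_unique2:
  assumes f: "square_integrable f" "square_integrable g"
    and z: "\<And>\<phi>. \<phi> \<in> schwartz_functions \<Longrightarrow> (LINT x|lborel. f x * \<phi> x) = (LINT x|lborel. g x * \<phi> x)"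
  shows "AE x in lborel. f x = g x"
proof -
  have "AE x in lborel. f x - g x = 0"
  proof (rule L2_unique[OF sqi_diff[OF f]])
    fix \<phi> :: "'a cfun" assume p: "\<phi> \<in> schwartz_functions"
    show "(LINT x|lborel. (f x - g x) * \<phi> x) = 0"
      using Bochner_Integration.integral_diff[OF sqi_mult_integrable[OF f(1) schwartz_sqi[OF p]] sqi_mult_integrable[OF f(2) schwartz_sqi[OF p]]] z[OF p]
      by (simp add: left_diff_distrib)
  qed
  then show ?thesis by eventually_elim simp
qed

lemma L2sq_cong_AE:
  assumes "square_integrable f" "square_integrable g" "AE x in lborel. f x = g x"
  shows "L2sq f = L2sq g"
  unfolding L2sq_def using assms by (intro Bochner_Integration.integral_cong_AE) (auto simp: square_integrable_def)

lemma schwartz_zero: "(\<lambda>x. 0) \<in> schwartz_functions"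
  using schwartz_cmult[OF gauss_schwartz, of 0] by simp

lemma schwartz_riesz:
  fixes L :: "'n::finite cfun \<Rightarrow> complex"
  assumes lin: "\<And>\<phi> \<psi> a b. \<phi> \<in> schwartz_functions \<Longrightarrow> \<psi> \<in> schwartz_functions \<Longrightarrow> L (\<lambda>x. a * \<phi> x + b * \<psi> x) = a * L \<phi> + b * L \<psi>"
    and bnd: "\<And>\<phi>. \<phi> \<in> schwartz_functions \<Longrightarrow> (norm (L \<phi>))\<^sup>2 \<le> C * L2sq \<phi>" and C: "C \<ge> 0"
  obtains f where "square_integrable f" "L2sq f \<le> C" "\<And>\<phi>. \<phi> \<in> schwartz_functions \<Longrightarrow> L \<phi> = (LINT x|lborel. f x * \<phi> x)"
    "\<And>k::nat. \<exists>\<phi>\<in>schwartz_functions. L2sq (\<lambda>x. f x - \<phi> x) \<le> (1/8) ^ k"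
proof -
  have ne: "schwartz_functions \<noteq> ({} :: 'n cfun set)" using schwartz_zero by blast
  show ?thesis
  proof (rule L2_riesz[of schwartz_functions L C, OF schwartz_sqi ne schwartz_lin lin bnd C])
    fix f
    assume f: "square_integrable f" "L2sq f \<le> C" "\<And>\<phi>. \<phi> \<in> schwartz_functions \<Longrightarrow> L \<phi> = (LINT x|lborel. f x * \<phi> x)"
      and a: "\<And>k::nat. \<exists>\<phi>\<in>schwartz_functions. L2sq (\<lambda>x. f x - cnj (\<phi> x)) \<le> (1/8) ^ k"
    have "\<exists>\<phi>\<in>schwartz_functions. L2sq (\<lambda>x. f x - \<phi> x) \<le> (1/8) ^ k" for k :: nat
    proof -
      obtain \<phi> where "\<phi> \<in> schwartz_functions" "L2sq (\<lambda>x. f x - cnj (\<phi> x)) \<le> (1/8) ^ k" using a[of k] by auto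
      then show ?thesis by (intro bexI[of _ "\<lambda>x. cnj (\<phi> x)"] schwartz_cnj)
    qed
    note d = this
    show thesis by (rule that[of f]) (use f d in blast)+
  qed
qed

lemma integral_lin_right:
  assumes "square_integrable f" "square_integrable \<phi>" "square_integrable \<psi>"
  shows "(LINT x|lborel. f x * (a * \<phi> x + b * \<psi> x)) = a * (LINT x|lborel. f x * \<phi> x) + b * (LINT x|lborel. f x * \<psi> x)"
proof -
  have "(LINT x|lborel. f x * (a * \<phi> x + b * \<psi> x)) = (LINT x|lborel. a * (f x * \<phi> x) + b * (f x * \<psi> x))"
    by (intro Bochner_Integration.integral_cong refl) (simp add: algebra_simps)
  also have "\<dots> = a * (LINT x|lborel. f x * \<phi> x) + b * (LINT x|lborel. f x * \<psi> x)"
    by (subst Bochner_Integration.integral_add[OF integrable_mult_right[OF sqi_mult_integrable] integrable_mult_right[OF sqi_mult_integrable]])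
       (simp_all add: assms)
  finally show ?thesis .
qed

text \<open>Representing the functional given by \<open>g\<close> itself returns \<open>g\<close> almost everywhere, together with an
  approximating sequence of Schwartz functions.\<close>

lemma L2_density:
  assumes g: "square_integrable g"
  shows "\<exists>\<phi>\<in>schwartz_functions. L2sq (\<lambda>x. g x - \<phi> x) \<le> (1/8) ^ (k::nat)"
proof (rule schwartz_riesz[of "\<lambda>\<phi>. LINT x|lborel. g x * \<phi> x" "L2sq g",
      OF integral_lin_right[OF g schwartz_sqi schwartz_sqi] sqi_CS[OF g schwartz_sqi] L2sq_nonneg])
  fix f
  assume f: "square_integrable f" "\<And>\<phi>. \<phi> \<in> schwartz_functions \<Longrightarrow> (LINT x|lborel. g x * \<phi> x) = (LINT x|lborel. f x * \<phi> x)"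
    and a: "\<And>k::nat. \<exists>\<phi>\<in>schwartz_functions. L2sq (\<lambda>x. f x - \<phi> x) \<le> (1/8) ^ k"
  have "AE x in lborel. f x = g x" using L2_unique2[OF f(1) g] f(2) by simp
  moreover obtain \<phi> where p: "\<phi> \<in> schwartz_functions" "L2sq (\<lambda>x. f x - \<phi> x) \<le> (1/8) ^ k" using a by blast
  ultimately have "L2sq (\<lambda>x. f x - \<phi> x) = L2sq (\<lambda>x. g x - \<phi> x)"
    by (intro L2sq_cong_AE sqi_diff schwartz_sqi f g) auto
  with p show ?thesis by auto
qed

lemma L2sq_dual:
  assumes g: "square_integrable g" and C: "C \<ge> 0"
    and bnd: "\<And>\<phi>. \<phi> \<in> schwartz_functions \<Longrightarrow> (norm (LINT x|lborel. g x * \<phi> x))\<^sup>2 \<le> C * L2sq \<phi>"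
  shows "L2sq g \<le> C"
proof (rule schwartz_riesz[of "\<lambda>\<phi>. LINT x|lborel. g x * \<phi> x" C,
      OF integral_lin_right[OF g schwartz_sqi schwartz_sqi] bnd C])
  fix f
  assume f: "square_integrable f" "L2sq f \<le> C" "\<And>\<phi>. \<phi> \<in> schwartz_functions \<Longrightarrow> (LINT x|lborel. g x * \<phi> x) = (LINT x|lborel. f x * \<phi> x)"
  have "AE x in lborel. f x = g x" using L2_unique2[OF f(1) g] f(3) by simp
  with f show ?thesis using L2sq_cong_AE[OF f(1) g] by simp
qed

section \<open>The Fourier transform on square-integrable functions\<close>

lemma plancherel_schwartz:
  fixes \<phi> :: "'n::finite cfun"
  assumes p: "\<phi> \<in> schwartz_functions"
  shows "L2sq (fourier \<phi>) \<le> (2 * pi) ^ CARD('n) * L2sq \<phi>"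
proof -
  have "L2sq_nn (fourier \<phi>) \<le> ennreal ((2 * pi) ^ CARD('n) * L2sq \<phi>)"
    using plancherel_inequality[OF schwartz_integrable[OF p]] by (simp add: L2sq_nn_L2sq schwartz_sqi p ennreal_mult)
  then show ?thesis by (subst (asm) L2sq_nn_le_iff) (auto intro: schwartz_sqi fourier_schwartz p)
qed

lemma L2sq_reflect:
  assumes "square_integrable f"
  shows "square_integrable (\<lambda>x. f (- x))" "L2sq (\<lambda>x. f (- x)) = L2sq f"
proof -
  have m: "f \<in> borel_measurable borel" using assms by (rule sqi_measurable)
  have N: "L2sq_nn (\<lambda>x. f (- x)) = L2sq_nn f"
    unfolding L2sq_nn_def using nn_integral_reflect(1)[of "\<lambda>x. ennreal ((norm (f x))\<^sup>2)"] m by simp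
  then show s: "square_integrable (\<lambda>x. f (- x))"
    using assms m unfolding square_integrable_iff by (auto intro: measurable_compose[OF _ m])
  show "L2sq (\<lambda>x. f (- x)) = L2sq f" using N L2sq_nn_L2sq[OF s] L2sq_nn_L2sq[OF assms] by simp
qed

lemma plancherel_inv:
  fixes \<phi> :: "'n::finite cfun"
  assumes p: "\<phi> \<in> schwartz_functions"
  shows "L2sq (inv_fourier \<phi>) \<le> L2sq \<phi>"
proof -
  let ?c = "(2 * pi) ^ CARD('n) :: real"
  have c: "?c > 0" by simp
  have i: "square_integrable (inv_fourier \<phi>)" by (intro schwartz_sqi inv_fourier_schwartz p)
  have "L2sq (inv_fourier \<phi>) = (1 / ?c)\<^sup>2 * L2sq (\<lambda>x. fourier \<phi> (- x))"
    unfolding inv_fourier_conv[abs_def] L2sq_cmult by (simp add: norm_mult norm_divide norm_power)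
  also have "\<dots> \<le> (1 / ?c)\<^sup>2 * (?c * L2sq \<phi>)"
    using plancherel_schwartz[OF p] by (simp add: L2sq_reflect(2)[OF schwartz_sqi[OF fourier_schwartz[OF p]]] mult_left_mono)
  also have "\<dots> = 1 / ?c * L2sq \<phi>" using c by (simp add: power2_eq_square field_simps)
  also have "\<dots> \<le> 1 * L2sq \<phi>"
  proof (intro mult_right_mono)
    have "?c \<ge> 1" using pi_gt3 by (intro one_le_power) simp
    then show "1 / ?c \<le> 1" by simp
  qed simp
  finally show ?thesis by simp
qed

text \<open>The transform of \<open>f\<close> is the representing function of \<open>\<phi> \<mapsto> \<integral> f \<phi>\<^sup>\<and>\<close>, which is bounded by
  Plancherel's inequality.\<close>

lemma L2_fourier:
  fixes f :: "'n::finite cfun"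
  assumes f: "square_integrable f"
  obtains g where "square_integrable g" "L2sq g \<le> (2 * pi) ^ CARD('n) * L2sq f"
    "\<And>\<phi>. \<phi> \<in> schwartz_functions \<Longrightarrow> (LINT x|lborel. f x * fourier \<phi> x) = (LINT x|lborel. g x * \<phi> x)"
proof (rule schwartz_riesz[of "\<lambda>\<phi>. LINT x|lborel. f x * fourier \<phi> x" "(2 * pi) ^ CARD('n) * L2sq f"])
  fix \<phi> \<psi> :: "'n cfun" and a b assume p: "\<phi> \<in> schwartz_functions" "\<psi> \<in> schwartz_functions"
  have "fourier (\<lambda>x. a * \<phi> x + b * \<psi> x) \<xi> = a * fourier \<phi> \<xi> + b * fourier \<psi> \<xi>" for \<xi>
    using inv_fourier_lin[OF p, of a b "- \<xi>"] unfolding inv_fourier_conv by (simp add: add_divide_distrib[symmetric])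
  then show "(LINT x|lborel. f x * fourier (\<lambda>x. a * \<phi> x + b * \<psi> x) x) =
      a * (LINT x|lborel. f x * fourier \<phi> x) + b * (LINT x|lborel. f x * fourier \<psi> x)"
    by (simp add: integral_lin_right f schwartz_sqi fourier_schwartz p)
next
  fix \<phi> :: "'n cfun" assume p: "\<phi> \<in> schwartz_functions"
  have "(norm (LINT x|lborel. f x * fourier \<phi> x))\<^sup>2 \<le> L2sq f * L2sq (fourier \<phi>)"
    by (intro sqi_CS f schwartz_sqi fourier_schwartz p)
  also have "\<dots> \<le> L2sq f * ((2 * pi) ^ CARD('n) * L2sq \<phi>)" by (intro mult_left_mono plancherel_schwartz p) auto
  finally show "(norm (LINT x|lborel. f x * fourier \<phi> x))\<^sup>2 \<le> (2 * pi) ^ CARD('n) * L2sq f * L2sq \<phi>" by (simp add: mult_ac)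
qed (use that in auto)

lemma L2_inv_fourier:
  fixes g :: "'n::finite cfun"
  assumes g: "square_integrable g"
  obtains f where "square_integrable f" "L2sq f \<le> L2sq g"
    "\<And>\<phi>. \<phi> \<in> schwartz_functions \<Longrightarrow> (LINT x|lborel. g x * inv_fourier \<phi> x) = (LINT x|lborel. f x * \<phi> x)"
proof (rule schwartz_riesz[of "\<lambda>\<phi>. LINT x|lborel. g x * inv_fourier \<phi> x" "L2sq g"])
  fix \<phi> \<psi> :: "'n cfun" and a b assume p: "\<phi> \<in> schwartz_functions" "\<psi> \<in> schwartz_functions"
  show "(LINT x|lborel. g x * inv_fourier (\<lambda>x. a * \<phi> x + b * \<psi> x) x) =
      a * (LINT x|lborel. g x * inv_fourier \<phi> x) + b * (LINT x|lborel. g x * inv_fourier \<psi> x)"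
    by (simp add: inv_fourier_lin[OF p] integral_lin_right g schwartz_sqi inv_fourier_schwartz p)
next
  fix \<phi> :: "'n cfun" assume p: "\<phi> \<in> schwartz_functions"
  have "(norm (LINT x|lborel. g x * inv_fourier \<phi> x))\<^sup>2 \<le> L2sq g * L2sq (inv_fourier \<phi>)"
    by (intro sqi_CS g schwartz_sqi inv_fourier_schwartz p)
  also have "\<dots> \<le> L2sq g * L2sq \<phi>" by (intro mult_left_mono plancherel_inv p) auto
  finally show "(norm (LINT x|lborel. g x * inv_fourier \<phi> x))\<^sup>2 \<le> L2sq g * L2sq \<phi>" .
qed (use that in auto)

text \<open>For Schwartz \<open>g\<close> the formula is the assumption on \<open>f\<close>. Both sides are
  continuous in \<open>g\<close>, so it passes to \<open>L\<^sup>2\<close> limits.\<close>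

lemma L2_parseval:
  fixes f g :: "'n::finite cfun"
  assumes f: "square_integrable f" and f': "square_integrable f'"
    and ff: "\<And>\<phi>. \<phi> \<in> schwartz_functions \<Longrightarrow> (LINT x|lborel. f x * \<phi> x) = (LINT x|lborel. f' x * inv_fourier \<phi> x)"
    and g: "square_integrable g" and g': "square_integrable g'"
    and gg: "\<And>\<phi>. \<phi> \<in> schwartz_functions \<Longrightarrow> (LINT x|lborel. g x * \<phi> x) = (LINT x|lborel. g' x * inv_fourier \<phi> x)"
  shows "(LINT x|lborel. f x * g x) = of_real (1 / (2 * pi) ^ CARD('n)) * (LINT \<xi>|lborel. f' \<xi> * g' (- \<xi>))"
proof -
  let ?c = "complex_of_real (1 / (2 * pi) ^ CARD('n))"
  define r where "r = (\<lambda>\<xi>. ?c * g' (- \<xi>))"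
  have r: "square_integrable r" unfolding r_def by (intro sqi_cmult L2sq_reflect(1) g')
  have [measurable]: "g' \<in> borel_measurable borel" using g' by (rule sqi_measurable)
  define D where "D = (LINT x|lborel. f x * g x) - (LINT \<xi>|lborel. f' \<xi> * r \<xi>)"
  have b: "norm D \<le> (sqrt (L2sq f) + sqrt (L2sq f')) * sqrt ((1/8) ^ k)" for k :: nat
  proof -
    obtain \<phi> where p: "\<phi> \<in> schwartz_functions" and le: "L2sq (\<lambda>x. g x - \<phi> x) \<le> (1/8) ^ k"
      using L2_density[OF g] by blast
    have sp: "square_integrable \<phi>" and sip: "square_integrable (inv_fourier \<phi>)"
      by (auto intro: schwartz_sqi inv_fourier_schwartz p)
    (* By duality the transforms are as close as the functions. *)
    have le2: "L2sq (\<lambda>\<xi>. r \<xi> - inv_fourier \<phi> \<xi>) \<le> L2sq (\<lambda>x. g x - \<phi> x)"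
    proof (rule L2sq_dual)
      fix \<psi> :: "'n cfun" assume q: "\<psi> \<in> schwartz_functions"
      have iq: "inv_fourier \<psi> \<in> schwartz_functions" by (rule inv_fourier_schwartz[OF q])
      have 1: "(LINT \<xi>|lborel. r \<xi> * \<psi> \<xi>) = (LINT x|lborel. g x * inv_fourier \<psi> x)"
      proof -
        have "inv_fourier (inv_fourier \<psi>) \<xi> = ?c * \<psi> (- \<xi>)" for \<xi>
          unfolding inv_fourier_conv[of "inv_fourier \<psi>"] fourier_inv_fourier[OF q] ..
        then have "(LINT x|lborel. g x * inv_fourier \<psi> x) = (LINT \<xi>|lborel. g' \<xi> * (?c * \<psi> (- \<xi>)))"
          using gg[OF iq] by simp
        also have "\<dots> = (LINT \<xi>|lborel. r \<xi> * \<psi> \<xi>)"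
          unfolding r_def using integral_reflect(1)[of "\<lambda>\<xi>. g' \<xi> * (?c * \<psi> (- \<xi>))"] schwartz_measurable[OF q]
          by (simp add: mult_ac)
        finally show ?thesis by simp
      qed
      have 2: "(LINT \<xi>|lborel. inv_fourier \<phi> \<xi> * \<psi> \<xi>) = (LINT x|lborel. \<phi> x * inv_fourier \<psi> x)"
      proof -
        have "(LINT \<xi>|lborel. fourier (inv_fourier \<psi>) \<xi> * inv_fourier \<phi> \<xi>) = (LINT x|lborel. inv_fourier \<psi> x * fourier (inv_fourier \<phi>) x)"
          by (intro fourier_multiplication schwartz_integrable inv_fourier_schwartz p q)
        then show ?thesis by (simp add: fourier_inv_fourier p q mult.commute)
      qed
      have "(LINT \<xi>|lborel. (r \<xi> - inv_fourier \<phi> \<xi>) * \<psi> \<xi>) = (LINT x|lborel. (g x - \<phi> x) * inv_fourier \<psi> x)"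
        unfolding left_diff_distrib
        by (subst (1 2) Bochner_Integration.integral_diff)
           (auto intro!: sqi_mult_integrable r g schwartz_sqi inv_fourier_schwartz p q simp: 1 2)
      then have "(norm (LINT \<xi>|lborel. (r \<xi> - inv_fourier \<phi> \<xi>) * \<psi> \<xi>))\<^sup>2 \<le> L2sq (\<lambda>x. g x - \<phi> x) * L2sq (inv_fourier \<psi>)"
        using sqi_CS[OF sqi_diff[OF g sp] schwartz_sqi[OF iq]] by simp
      also have "\<dots> \<le> L2sq (\<lambda>x. g x - \<phi> x) * L2sq \<psi>" by (intro mult_left_mono plancherel_inv q) auto
      finally show "(norm (LINT \<xi>|lborel. (r \<xi> - inv_fourier \<phi> \<xi>) * \<psi> \<xi>))\<^sup>2 \<le> L2sq (\<lambda>x. g x - \<phi> x) * L2sq \<psi>" .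
    qed (auto intro!: sqi_diff r sip)
    have D: "D = (LINT x|lborel. f x * (g x - \<phi> x)) - (LINT \<xi>|lborel. f' \<xi> * (r \<xi> - inv_fourier \<phi> \<xi>))"
    proof -
      have "(LINT x|lborel. f x * (g x - \<phi> x)) = (LINT x|lborel. f x * g x) - (LINT x|lborel. f x * \<phi> x)"
        unfolding right_diff_distrib
        by (rule Bochner_Integration.integral_diff[OF sqi_mult_integrable[OF f g] sqi_mult_integrable[OF f sp]])
      moreover have "(LINT \<xi>|lborel. f' \<xi> * (r \<xi> - inv_fourier \<phi> \<xi>)) = (LINT x|lborel. f' x * r x) - (LINT x|lborel. f' x * inv_fourier \<phi> x)"
        unfolding right_diff_distrib
        by (rule Bochner_Integration.integral_diff[OF sqi_mult_integrable[OF f' r] sqi_mult_integrable[OF f' sip]])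
      ultimately show ?thesis unfolding D_def ff[OF p] by simp
    qed
    have CS: "norm (LINT x|lborel. u x * v x) \<le> sqrt (L2sq u) * sqrt ((1/8) ^ k)"
      if "square_integrable u" "square_integrable v" "L2sq v \<le> (1/8) ^ k" for u v :: "'n cfun"
    proof -
      have "(norm (LINT x|lborel. u x * v x))\<^sup>2 \<le> L2sq u * L2sq v" by (rule sqi_CS) fact+
      also have "\<dots> \<le> L2sq u * (1/8) ^ k" by (intro mult_left_mono that) auto
      finally show ?thesis by (simp add: real_le_rsqrt flip: real_sqrt_mult)
    qed
    have "norm D \<le> norm (LINT x|lborel. f x * (g x - \<phi> x)) + norm (LINT \<xi>|lborel. f' \<xi> * (r \<xi> - inv_fourier \<phi> \<xi>))"
      unfolding D by (rule norm_triangle_ineq4)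
    also have "\<dots> \<le> sqrt (L2sq f) * sqrt ((1/8) ^ k) + sqrt (L2sq f') * sqrt ((1/8) ^ k)"
      using le le2 by (intro add_mono CS f f' sqi_diff g sp r sip) auto
    finally show ?thesis by (simp add: distrib_right)
  qed
  have "(\<lambda>k. (sqrt (L2sq f) + sqrt (L2sq f')) * sqrt ((1/8::real) ^ k)) \<longlonglongrightarrow> (sqrt (L2sq f) + sqrt (L2sq f')) * sqrt 0"
    by (intro tendsto_mult tendsto_const tendsto_real_sqrt LIMSEQ_power_zero) auto
  then have "norm D \<le> 0"
    using b by (intro tendsto_lowerbound[of "\<lambda>k. (sqrt (L2sq f) + sqrt (L2sq f')) * sqrt ((1/8::real) ^ k)" _ sequentially]) auto
  then have "(LINT x|lborel. f x * g x) = (LINT \<xi>|lborel. f' \<xi> * r \<xi>)" by (simp add: D_def)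
  also have "\<dots> = (LINT \<xi>|lborel. ?c * (f' \<xi> * g' (- \<xi>)))"
    unfolding r_def by (intro Bochner_Integration.integral_cong refl) (rule mult.left_commute)
  also have "\<dots> = ?c * (LINT \<xi>|lborel. f' \<xi> * g' (- \<xi>))" by (rule integral_mult_right_zero)
  finally show ?thesis .
qed

section \<open>Weights\<close>

lemma weight_pos: "weight b s \<xi> > 0"
proof -
  have "bracket b l \<xi> > 0" for l using bracket_ge1[of b l \<xi>] by linarith
  then show ?thesis unfolding weight_bracket by (intro prod_pos) (simp add: less_imp_neq[symmetric])
qed

lemma weight_nonneg [simp]: "weight b s \<xi> \<ge> 0"
  using weight_pos[of b s \<xi>] by simp

lemma weight_add: "weight b (s + t) \<xi> = weight b s \<xi> * weight b t \<xi>"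
  unfolding weight_bracket by (simp add: powr_add add_divide_distrib prod.distrib)

lemma weight_zero: "weight b 0 \<xi> = 1"
proof -
  have "bracket b l \<xi> \<noteq> 0" for l using bracket_ge1[of b l \<xi>] by linarith
  then show ?thesis unfolding weight_bracket by simp
qed

lemma weight_minus: "weight b s \<xi> * weight b (- s) \<xi> = 1"
  using weight_add[of b s "- s" \<xi>] by (simp add: weight_zero)

lemma weight_even: "weight b s (- \<xi>) = weight b s \<xi>"
  by (simp add: weight_def)

lemma weight_mono: "(\<And>l. s $ l \<le> t $ l) \<Longrightarrow> weight b s \<xi> \<le> weight b t \<xi>"
  unfolding weight_bracket by (intro prod_mono conjI powr_mono bracket_ge1) (auto simp: divide_right_mono)

lemma measurable_weight [measurable]: "weight b s \<in> borel_measurable borel"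
proof -
  have "(\<lambda>\<xi>. Re (of_real (weight b s \<xi>))) \<in> borel_measurable borel"
    by (intro measurable_compose[OF smooth_measurable[OF moderate_smooth[OF moderate_weight]]]) simp
  then show ?thesis by simp
qed

lemma bracket_peetre: "bracket b l \<xi> \<le> 2 * bracket b l (\<xi> - \<eta>) * bracket b l \<eta>"
proof -
  define A where "A = (\<Sum>i | b i = l. ((\<xi> - \<eta>) $ i)\<^sup>2)"
  define B where "B = (\<Sum>i | b i = l. (\<eta> $ i)\<^sup>2)"
  have "A \<ge> 0" "B \<ge> 0" unfolding A_def B_def by (auto intro: sum_nonneg)
  have "(\<Sum>i | b i = l. (\<xi> $ i)\<^sup>2) \<le> (\<Sum>i | b i = l. 2 * ((\<xi> - \<eta>) $ i)\<^sup>2 + 2 * (\<eta> $ i)\<^sup>2)"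
  proof (intro sum_mono)
    fix i
    have "0 \<le> ((\<xi> - \<eta>) $ i - \<eta> $ i)\<^sup>2" by simp
    then show "(\<xi> $ i)\<^sup>2 \<le> 2 * ((\<xi> - \<eta>) $ i)\<^sup>2 + 2 * (\<eta> $ i)\<^sup>2" by (simp add: power2_eq_square algebra_simps)
  qed
  also have "\<dots> = 2 * A + 2 * B" unfolding A_def B_def by (simp add: sum.distrib sum_distrib_left)
  finally have "bracket b l \<xi> \<le> 1 + 2 * A + 2 * B" unfolding bracket_def by simp
  also have "\<dots> \<le> 2 * (1 + A) * (1 + B)" using \<open>A \<ge> 0\<close> \<open>B \<ge> 0\<close> by (simp add: algebra_simps)
  finally show ?thesis unfolding A_def B_def bracket_def .
qed

lemma bracket_even: "bracket b l (- \<xi>) = bracket b l \<xi>"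
  by (simp add: bracket_def)

text \<open>Peetre's inequality; a negative exponent is reduced to a positive one by exchanging the two
  points.\<close>

lemma bracket_powr_peetre:
  "bracket b l \<xi> powr r \<le> 2 powr \<bar>r\<bar> * bracket b l (\<xi> - \<eta>) powr \<bar>r\<bar> * bracket b l \<eta> powr r"
proof -
  have pos: "bracket b l \<zeta> > 0" for \<zeta> using bracket_ge1[of b l \<zeta>] by linarith
  have nn: "0 \<le> bracket b l \<zeta>" for \<zeta> using pos[of \<zeta>] by simp
  show ?thesis
  proof (cases "r \<ge> 0")
    case True
    then have "bracket b l \<xi> powr r \<le> (2 * bracket b l (\<xi> - \<eta>) * bracket b l \<eta>) powr r"
      using bracket_peetre nn by (intro powr_mono2) auto
    then show ?thesis using True nn by (simp add: powr_mult)
  next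
    case False
    have "bracket b l \<eta> powr (- r) \<le> (2 * bracket b l (\<eta> - \<xi>) * bracket b l \<xi>) powr (- r)"
      using bracket_peetre nn False by (intro powr_mono2) auto
    also have "bracket b l (\<eta> - \<xi>) = bracket b l (\<xi> - \<eta>)" using bracket_even[of b l "\<xi> - \<eta>"] by simp
    finally have "bracket b l \<eta> powr (- r) \<le> 2 powr (- r) * bracket b l (\<xi> - \<eta>) powr (- r) * bracket b l \<xi> powr (- r)"
      using nn by (simp add: powr_mult)
    then have i: "inverse (bracket b l \<eta> powr r) \<le> (2 powr (- r) * bracket b l (\<xi> - \<eta>) powr (- r)) * inverse (bracket b l \<xi> powr r)"
      by (simp add: powr_minus)
    have "x \<le> m * y" if "inverse y \<le> m * inverse x" "x > 0" "y > 0" for x y m :: real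
      using that by (simp add: field_simps)
    from this[OF i] show ?thesis using pos[of \<xi>] pos[of \<eta>] False by simp
  qed
qed

definition abs_vec :: "real ^ 'j \<Rightarrow> real ^ 'j" where "abs_vec s = (\<chi> l. \<bar>s $ l\<bar>)"

lemma weight_peetre:
  obtains P where "P > 0" "\<And>\<xi> \<eta>. weight b s \<xi> \<le> P * weight b (abs_vec s) (\<xi> - \<eta>) * weight b s \<eta>"
proof -
  define P where "P = (\<Prod>l\<in>(UNIV::'b set). (2::real) powr \<bar>s $ l / 2\<bar>)"
  have "weight b s \<xi> \<le> P * weight b (abs_vec s) (\<xi> - \<eta>) * weight b s \<eta>" for \<xi> \<eta>
  proof -
    have "weight b s \<xi> \<le> (\<Prod>l\<in>UNIV. 2 powr \<bar>s $ l / 2\<bar> * bracket b l (\<xi> - \<eta>) powr \<bar>s $ l / 2\<bar> * bracket b l \<eta> powr (s $ l / 2))"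
      unfolding weight_bracket by (intro prod_mono conjI bracket_powr_peetre) auto
    also have "\<dots> = P * weight b (abs_vec s) (\<xi> - \<eta>) * weight b s \<eta>"
      unfolding weight_bracket P_def abs_vec_def by (simp add: prod.distrib)
    finally show ?thesis .
  qed
  moreover have "P > 0" unfolding P_def by (intro prod_pos) auto
  ultimately show ?thesis using that by blast
qed

section \<open>Weighted square-integrable functions and convolution\<close>

definition weighted_sq :: "('n::finite \<Rightarrow> 'j::finite) \<Rightarrow> real ^ 'j \<Rightarrow> 'n cfun \<Rightarrow> ennreal" where
  "weighted_sq b s h = L2sq_nn (\<lambda>\<xi>. of_real (weight b s \<xi>) * h \<xi>)"

definition weighted_L2 :: "('n::finite \<Rightarrow> 'j::finite) \<Rightarrow> real ^ 'j \<Rightarrow> 'n cfun \<Rightarrow> bool" where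
  "weighted_L2 b s h \<longleftrightarrow> h \<in> borel_measurable borel \<and> weighted_sq b s h < \<infinity>"

lemma weighted_L2_measurable: "weighted_L2 b s h \<Longrightarrow> h \<in> borel_measurable borel"
  by (simp add: weighted_L2_def)

lemma weighted_L2_sqi: "weighted_L2 b s h \<longleftrightarrow> square_integrable (\<lambda>\<xi>. of_real (weight b s \<xi>) * h \<xi>)"
proof
  assume "weighted_L2 b s h"
  then show "square_integrable (\<lambda>\<xi>. of_real (weight b s \<xi>) * h \<xi>)"
    unfolding weighted_L2_def square_integrable_iff weighted_sq_def by auto
next
  assume a: "square_integrable (\<lambda>\<xi>. of_real (weight b s \<xi>) * h \<xi>)"
  then have m: "(\<lambda>\<xi>. of_real (weight b s \<xi>) * h \<xi>) \<in> borel_measurable borel" by (rule sqi_measurable)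
  have "(\<lambda>\<xi>. of_real (weight b (- s) \<xi>) * (of_real (weight b s \<xi>) * h \<xi>)) \<in> borel_measurable borel"
    by (intro borel_measurable_times m) measurable
  moreover have "of_real (weight b (- s) \<xi>) * (of_real (weight b s \<xi>) * h \<xi>) = h \<xi>" for \<xi>
  proof -
    have "of_real (weight b (- s) \<xi>) * (of_real (weight b s \<xi>) * h \<xi>) = of_real (weight b s \<xi> * weight b (- s) \<xi>) * h \<xi>"
      by simp
    then show ?thesis unfolding weight_minus by simp
  qed
  ultimately show "weighted_L2 b s h" using a unfolding weighted_L2_def square_integrable_iff weighted_sq_def by simp
qed

lemma weighted_sq_mono:
  assumes "\<And>l. s $ l \<le> t $ l" shows "weighted_sq b s h \<le> weighted_sq b t h"
  unfolding weighted_sq_def L2sq_nn_def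
  by (intro nn_integral_mono ennreal_leI power_mono) (auto simp: norm_mult intro!: mult_right_mono weight_mono assms)

lemma weighted_L2_mono: "weighted_L2 b t h \<Longrightarrow> (\<And>l. s $ l \<le> t $ l) \<Longrightarrow> weighted_L2 b s h"
  using weighted_sq_mono[of s t b h] unfolding weighted_L2_def by (auto intro: le_less_trans)

lemma weighted_sq_L2sq: "weighted_L2 b s h \<Longrightarrow> weighted_sq b s h = ennreal (L2sq (\<lambda>\<xi>. of_real (weight b s \<xi>) * h \<xi>))"
  unfolding weighted_sq_def weighted_L2_sqi by (rule L2sq_nn_L2sq)

lemma schwartz_weight: "\<psi> \<in> schwartz_functions \<Longrightarrow> (\<lambda>\<xi>. of_real (weight b s \<xi>) * \<psi> \<xi>) \<in> schwartz_functions"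
  by (rule schwartz_mult_moderate[OF moderate_weight])

lemma schwartz_weighted_L2: "\<psi> \<in> schwartz_functions \<Longrightarrow> weighted_L2 b s \<psi>"
  unfolding weighted_L2_sqi by (intro schwartz_sqi schwartz_weight)

lemma weighted_sq_reflect:
  assumes [measurable]: "h \<in> borel_measurable borel"
  shows "weighted_sq b s (\<lambda>\<xi>. h (- \<xi>)) = weighted_sq b s h"
  unfolding weighted_sq_def L2sq_nn_def
  using nn_integral_reflect(1)[of "\<lambda>\<xi>. ennreal ((norm (of_real (weight b s \<xi>) * h \<xi>))\<^sup>2)"] by (simp add: weight_even)

lemma weighted_L2_reflect: "weighted_L2 b s h \<Longrightarrow> weighted_L2 b s (\<lambda>\<xi>. h (- \<xi>))"
  unfolding weighted_L2_def using weighted_sq_reflect[of h b s] by (auto intro: measurable_compose[rotated])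

lemma weight_cancel: "(of_real (weight b s \<xi>) * x) * (of_real (weight b (- s) \<xi>) * y) = (x * y :: complex)"
proof -
  have "(of_real (weight b s \<xi>) * x) * (of_real (weight b (- s) \<xi>) * y) = of_real (weight b s \<xi> * weight b (- s) \<xi>) * (x * y)"
    by simp
  then show ?thesis unfolding weight_minus by simp
qed

lemma weighted_L2_pair_integrable:
  assumes "weighted_L2 b s h" "weighted_L2 b (- s) k"
  shows "integrable lborel (\<lambda>\<xi>. h \<xi> * k \<xi>)"
  using sqi_mult_integrable[OF assms[unfolded weighted_L2_sqi]] unfolding weight_cancel .

lemma weighted_L2_pair_CS:
  assumes [measurable]: "h \<in> borel_measurable borel" "k \<in> borel_measurable borel"
  shows "(\<integral>\<^sup>+\<xi>. ennreal (norm (h \<xi>) * norm (k \<xi>)) \<partial>lborel)\<^sup>2 \<le> weighted_sq b s h * weighted_sq b (- s) k"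
proof -
  have "norm (of_real (weight b s \<xi>) * h \<xi>) * norm (of_real (weight b (- s) \<xi>) * k \<xi>) = norm (h \<xi>) * norm (k \<xi>)" for \<xi>
    using weight_cancel[of b s \<xi> "h \<xi>" "k \<xi>"] by (metis norm_mult)
  then show ?thesis
    unfolding weighted_sq_def using nn_CS[of "\<lambda>\<xi>. of_real (weight b s \<xi>) * h \<xi>" "\<lambda>\<xi>. of_real (weight b (- s) \<xi>) * k \<xi>"] by simp
qed

definition conv :: "'n::finite cfun \<Rightarrow> 'n cfun \<Rightarrow> 'n cfun" where
  "conv h j = (\<lambda>\<eta>. LINT \<xi>|lborel. h \<xi> * j (\<eta> - \<xi>))"

text \<open>The convolution of absolute values always exists. Bounding its weighted norm gives at once the
  absolute convergence of the convolution and the bound for its norm.\<close>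

definition absconv :: "'n::finite cfun \<Rightarrow> 'n cfun \<Rightarrow> real ^ 'n \<Rightarrow> ennreal" where
  "absconv h j \<eta> = (\<integral>\<^sup>+\<xi>. ennreal (norm (h \<xi>) * norm (j (\<eta> - \<xi>))) \<partial>lborel)"

definition weighted_sq_nn :: "('n::finite \<Rightarrow> 'j::finite) \<Rightarrow> real ^ 'j \<Rightarrow> (real ^ 'n \<Rightarrow> ennreal) \<Rightarrow> ennreal" where
  "weighted_sq_nn b s A = (\<integral>\<^sup>+\<eta>. (ennreal (weight b s \<eta>) * A \<eta>)\<^sup>2 \<partial>lborel)"

lemma measurable_absconv [measurable]:
  assumes [measurable]: "h \<in> borel_measurable borel" "j \<in> borel_measurable borel"
  shows "absconv h j \<in> borel_measurable borel"
  unfolding absconv_def[abs_def] by measurable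

lemma measurable_conv [measurable]:
  assumes [measurable]: "h \<in> borel_measurable borel" "j \<in> borel_measurable borel"
  shows "conv h j \<in> borel_measurable borel"
  unfolding conv_def[abs_def] by measurable

lemma norm_conv_le: "ennreal (norm (conv h j \<eta>)) \<le> absconv h j \<eta>"
  unfolding conv_def absconv_def using norm_integral_le_nn[of lborel "\<lambda>\<xi>. h \<xi> * j (\<eta> - \<xi>)"] by (simp add: norm_mult)

lemma weighted_sq_conv_le: "weighted_sq b s (conv h j) \<le> weighted_sq_nn b s (absconv h j)"
  unfolding weighted_sq_def L2sq_nn_def weighted_sq_nn_def
proof (intro nn_integral_mono)
  fix \<eta>
  have "ennreal ((norm (of_real (weight b s \<eta>) * conv h j \<eta>))\<^sup>2) = (ennreal (weight b s \<eta>) * ennreal (norm (conv h j \<eta>)))\<^sup>2"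
    by (simp add: norm_mult ennreal_mult ennreal_power[symmetric])
  also have "\<dots> \<le> (ennreal (weight b s \<eta>) * absconv h j \<eta>)\<^sup>2"
    by (intro power_mono_ennreal mult_left_mono norm_conv_le) auto
  finally show "ennreal ((norm (of_real (weight b s \<eta>) * conv h j \<eta>))\<^sup>2) \<le> (ennreal (weight b s \<eta>) * absconv h j \<eta>)\<^sup>2" .
qed

lemma weighted_L2_conv:
  assumes "h \<in> borel_measurable borel" "j \<in> borel_measurable borel" "weighted_sq_nn b s (absconv h j) < \<infinity>"
  shows "weighted_L2 b s (conv h j)"
  unfolding weighted_L2_def using assms le_less_trans[OF weighted_sq_conv_le] by auto

lemma ennreal_square_finite: "x\<^sup>2 \<le> y \<Longrightarrow> y < \<infinity> \<Longrightarrow> x < (\<infinity>::ennreal)"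
  by (cases x) (auto simp: top_unique less_top[symmetric])

lemma absconv_pair_finite:
  assumes [measurable]: "h \<in> borel_measurable borel" "j \<in> borel_measurable borel" "\<psi> \<in> borel_measurable borel"
    and fin: "weighted_sq_nn b s (absconv h j) < \<infinity>" "weighted_sq b (- s) \<psi> < \<infinity>"
  shows "(\<integral>\<^sup>+\<eta>. absconv h j \<eta> * ennreal (norm (\<psi> \<eta>)) \<partial>lborel) < \<infinity>"
proof (rule ennreal_square_finite)
  have e: "absconv h j \<eta> * ennreal (norm (\<psi> \<eta>)) = (ennreal (weight b s \<eta>) * absconv h j \<eta>) * ennreal (norm (of_real (weight b (- s) \<eta>) * \<psi> \<eta>))" for \<eta>
  proof -
    have "ennreal (weight b s \<eta>) * ennreal (weight b (- s) \<eta>) = 1"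
      using weight_minus[of b s \<eta>] by (simp add: ennreal_mult[symmetric])
    then have "absconv h j \<eta> * ennreal (norm (\<psi> \<eta>)) = (ennreal (weight b s \<eta>) * ennreal (weight b (- s) \<eta>)) * (absconv h j \<eta> * ennreal (norm (\<psi> \<eta>)))"
      by simp
    also have "\<dots> = (ennreal (weight b s \<eta>) * absconv h j \<eta>) * (ennreal (weight b (- s) \<eta>) * ennreal (norm (\<psi> \<eta>)))"
      by (simp only: mult_ac)
    finally show ?thesis by (simp add: norm_mult ennreal_mult)
  qed
  have "(\<integral>\<^sup>+\<eta>. absconv h j \<eta> * ennreal (norm (\<psi> \<eta>)) \<partial>lborel)\<^sup>2 \<le>
     (\<integral>\<^sup>+\<eta>. (ennreal (weight b s \<eta>) * absconv h j \<eta>)\<^sup>2 \<partial>lborel) * (\<integral>\<^sup>+\<eta>. (ennreal (norm (of_real (weight b (- s) \<eta>) * \<psi> \<eta>)))\<^sup>2 \<partial>lborel)"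
    unfolding e by (rule Cauchy_Schwarz_nn_integral) measurable
  also have "\<dots> = weighted_sq_nn b s (absconv h j) * weighted_sq b (- s) \<psi>" unfolding weighted_sq_nn_def weighted_sq_def L2sq_nn_def by (simp add: ennreal_power)
  finally show "(\<integral>\<^sup>+\<eta>. absconv h j \<eta> * ennreal (norm (\<psi> \<eta>)) \<partial>lborel)\<^sup>2 \<le> weighted_sq_nn b s (absconv h j) * weighted_sq b (- s) \<psi>" .
  show "weighted_sq_nn b s (absconv h j) * weighted_sq b (- s) \<psi> < \<infinity>" using fin by (simp add: ennreal_mult_less_top)
qed

lemma conv_fubini:
  assumes [measurable]: "h \<in> borel_measurable borel" "j \<in> borel_measurable borel" "\<psi> \<in> borel_measurable borel"
    and fin: "weighted_sq_nn b s (absconv h j) < \<infinity>" "weighted_sq b (- s) \<psi> < \<infinity>"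
  shows "(LINT \<eta>|lborel. conv h j \<eta> * \<psi> \<eta>) = (LINT \<xi>|lborel. h \<xi> * (LINT \<eta>|lborel. j (\<eta> - \<xi>) * \<psi> \<eta>))"
proof -
  have i: "integrable (lborel \<Otimes>\<^sub>M lborel) (\<lambda>(\<eta>, \<xi>). h \<xi> * j (\<eta> - \<xi>) * \<psi> \<eta>)"
  proof (rule integrableI_bounded)
    have "(\<integral>\<^sup>+p. ennreal (norm (case p of (\<eta>, \<xi>) \<Rightarrow> h \<xi> * j (\<eta> - \<xi>) * \<psi> \<eta>)) \<partial>(lborel \<Otimes>\<^sub>M lborel))
      = (\<integral>\<^sup>+\<eta>. (\<integral>\<^sup>+\<xi>. ennreal (norm (h \<xi>) * norm (j (\<eta> - \<xi>))) * ennreal (norm (\<psi> \<eta>)) \<partial>lborel) \<partial>lborel)"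
      by (subst lborel.nn_integral_fst[symmetric]) (auto simp: norm_mult ennreal_mult)
    also have "\<dots> = (\<integral>\<^sup>+\<eta>. absconv h j \<eta> * ennreal (norm (\<psi> \<eta>)) \<partial>lborel)"
      unfolding absconv_def by (simp add: nn_integral_multc)
    also have "\<dots> < \<infinity>" by (rule absconv_pair_finite[OF assms])
    finally show "(\<integral>\<^sup>+p. ennreal (norm (case p of (\<eta>, \<xi>) \<Rightarrow> h \<xi> * j (\<eta> - \<xi>) * \<psi> \<eta>)) \<partial>(lborel \<Otimes>\<^sub>M lborel)) < \<infinity>" .
  qed measurable
  have "(LINT \<eta>|lborel. conv h j \<eta> * \<psi> \<eta>) = (LINT \<eta>|lborel. (LINT \<xi>|lborel. h \<xi> * j (\<eta> - \<xi>) * \<psi> \<eta>))"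
    unfolding conv_def by simp
  also have "\<dots> = (LINT \<xi>|lborel. (LINT \<eta>|lborel. h \<xi> * j (\<eta> - \<xi>) * \<psi> \<eta>))"
    using lborel_pair.Fubini_integral[OF i] by simp
  also have "\<dots> = (LINT \<xi>|lborel. h \<xi> * (LINT \<eta>|lborel. j (\<eta> - \<xi>) * \<psi> \<eta>))"
    by (simp add: mult.assoc)
  finally show ?thesis .
qed

text \<open>Peetre's inequality moves the weight onto \<open>h\<close> at the cost of a weight on \<open>j\<close>, which remains
  integrable; then it is Young's inequality for a convolution with an integrable function.\<close>

lemma absconv_schwartz_bound:
  fixes b :: "'n::finite \<Rightarrow> 'j::finite" and j :: "'n cfun"
  assumes j: "j \<in> schwartz_functions"
  obtains C where "C \<ge> 0" "\<And>h. h \<in> borel_measurable borel \<Longrightarrow> weighted_sq_nn b s (absconv h j) \<le> ennreal C * weighted_sq b s h"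
proof -
  have [measurable]: "j \<in> borel_measurable borel" by (rule schwartz_measurable[OF j])
  obtain P where P: "P > 0" "\<And>\<xi> \<eta>. weight b s \<xi> \<le> P * weight b (abs_vec s) (\<xi> - \<eta>) * weight b s \<eta>"
    using weight_peetre by blast
  define J where "J = (\<lambda>\<zeta>. P * weight b (abs_vec s) \<zeta> * norm (j \<zeta>))"
  have [measurable]: "J \<in> borel_measurable borel" unfolding J_def by measurable
  have J0: "J \<zeta> \<ge> 0" for \<zeta> using P(1) by (simp add: J_def)
  have Ji: "integrable lborel J"
    unfolding J_def mult.assoc
    using schwartz_integrable[OF schwartz_weight[OF j, of b "abs_vec s"], THEN integrable_norm]
    by (intro integrable_mult_right) (simp add: norm_mult)
  define I where "I = (LINT \<zeta>|lborel. J \<zeta>)"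
  have I: "(\<integral>\<^sup>+\<zeta>. ennreal (J \<zeta>) \<partial>lborel) = ennreal I"
    unfolding I_def by (rule nn_integral_eq_integral[OF Ji]) (simp add: J0)
  have I0: "I \<ge> 0" unfolding I_def by (intro Bochner_Integration.integral_nonneg J0)
  have "weighted_sq_nn b s (absconv h j) \<le> ennreal (I * I) * weighted_sq b s h" if [measurable]: "h \<in> borel_measurable borel" for h
  proof -
    let ?f = "\<lambda>\<xi>. norm (of_real (weight b s \<xi>) * h \<xi>)"
    have le: "(ennreal (weight b s \<eta>) * absconv h j \<eta>)\<^sup>2 \<le> ennreal I * (\<integral>\<^sup>+\<xi>. ennreal ((?f \<xi>)\<^sup>2) * ennreal (J (\<eta> - \<xi>)) \<partial>lborel)" for \<eta>
    proof -
      have "ennreal (weight b s \<eta>) * absconv h j \<eta> = (\<integral>\<^sup>+\<xi>. ennreal (weight b s \<eta>) * ennreal (norm (h \<xi>) * norm (j (\<eta> - \<xi>))) \<partial>lborel)"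
        unfolding absconv_def by (simp add: nn_integral_cmult)
      also have "\<dots> \<le> (\<integral>\<^sup>+\<xi>. ennreal (?f \<xi> * sqrt (J (\<eta> - \<xi>))) * ennreal (sqrt (J (\<eta> - \<xi>))) \<partial>lborel)"
      proof (intro nn_integral_mono)
        fix \<xi>
        have "weight b s \<eta> * (norm (h \<xi>) * norm (j (\<eta> - \<xi>))) \<le> (P * weight b (abs_vec s) (\<eta> - \<xi>) * weight b s \<xi>) * (norm (h \<xi>) * norm (j (\<eta> - \<xi>)))"
          by (intro mult_right_mono P) auto
        also have "\<dots> = ?f \<xi> * J (\<eta> - \<xi>)" by (simp add: J_def norm_mult)
        also have "\<dots> = (?f \<xi> * sqrt (J (\<eta> - \<xi>))) * sqrt (J (\<eta> - \<xi>))" by (simp add: J0)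
        finally show "ennreal (weight b s \<eta>) * ennreal (norm (h \<xi>) * norm (j (\<eta> - \<xi>))) \<le> ennreal (?f \<xi> * sqrt (J (\<eta> - \<xi>))) * ennreal (sqrt (J (\<eta> - \<xi>)))"
          by (simp add: ennreal_mult[symmetric] J0 ennreal_leI)
      qed
      finally have "(ennreal (weight b s \<eta>) * absconv h j \<eta>)\<^sup>2 \<le> (\<integral>\<^sup>+\<xi>. ennreal (?f \<xi> * sqrt (J (\<eta> - \<xi>))) * ennreal (sqrt (J (\<eta> - \<xi>))) \<partial>lborel)\<^sup>2"
        by (rule power_mono_ennreal)
      also have "\<dots> \<le> (\<integral>\<^sup>+\<xi>. (ennreal (?f \<xi> * sqrt (J (\<eta> - \<xi>))))\<^sup>2 \<partial>lborel) * (\<integral>\<^sup>+\<xi>. (ennreal (sqrt (J (\<eta> - \<xi>))))\<^sup>2 \<partial>lborel)"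
        by (rule Cauchy_Schwarz_nn_integral) measurable
      also have "(\<integral>\<^sup>+\<xi>. (ennreal (sqrt (J (\<eta> - \<xi>))))\<^sup>2 \<partial>lborel) = ennreal I"
        using nn_integral_reflect(2)[of "\<lambda>\<zeta>. ennreal (J \<zeta>)" \<eta>] by (simp add: ennreal_power J0 I)
      also have "(\<integral>\<^sup>+\<xi>. (ennreal (?f \<xi> * sqrt (J (\<eta> - \<xi>))))\<^sup>2 \<partial>lborel) = (\<integral>\<^sup>+\<xi>. ennreal ((?f \<xi>)\<^sup>2) * ennreal (J (\<eta> - \<xi>)) \<partial>lborel)"
        by (intro nn_integral_cong) (simp add: ennreal_power power_mult_distrib J0 ennreal_mult)
      finally show ?thesis by (simp add: mult.commute)
    qed
    have "weighted_sq_nn b s (absconv h j) \<le> (\<integral>\<^sup>+\<eta>. ennreal I * (\<integral>\<^sup>+\<xi>. ennreal ((?f \<xi>)\<^sup>2) * ennreal (J (\<eta> - \<xi>)) \<partial>lborel) \<partial>lborel)"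
      unfolding weighted_sq_nn_def by (intro nn_integral_mono le)
    also have "\<dots> = ennreal I * (\<integral>\<^sup>+\<eta>. (\<integral>\<^sup>+\<xi>. ennreal ((?f \<xi>)\<^sup>2) * ennreal (J (\<eta> - \<xi>)) \<partial>lborel) \<partial>lborel)"
      by (intro nn_integral_cmult) measurable
    also have "(\<integral>\<^sup>+\<eta>. (\<integral>\<^sup>+\<xi>. ennreal ((?f \<xi>)\<^sup>2) * ennreal (J (\<eta> - \<xi>)) \<partial>lborel) \<partial>lborel)
       = (\<integral>\<^sup>+\<xi>. (\<integral>\<^sup>+\<eta>. ennreal ((?f \<xi>)\<^sup>2) * ennreal (J (\<eta> - \<xi>)) \<partial>lborel) \<partial>lborel)"
      by (rule lborel_pair.Fubini') measurable
    also have "\<dots> = (\<integral>\<^sup>+\<xi>. ennreal ((?f \<xi>)\<^sup>2) * ennreal I \<partial>lborel)"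
      using nn_integral_reflect(4)[of "\<lambda>\<zeta>. ennreal (J \<zeta>)"] by (simp add: nn_integral_cmult I)
    also have "\<dots> = weighted_sq b s h * ennreal I" unfolding weighted_sq_def L2sq_nn_def by (intro nn_integral_multc) measurable
    finally show ?thesis using I0 by (simp add: ennreal_mult mult_ac)
  qed
  then show ?thesis using that[of "I * I"] I0 by simp
qed

section \<open>Sobolev spaces on the Fourier side\<close>

text \<open>\<open>h\<close> is the Fourier transform of \<open>T\<close>: inversion in the test function gives
  \<open>T(\<phi>) = T\<^sup>\<and>(inv_fourier \<phi>)\<close>. Sobolev regularity becomes a weighted integrability
  condition, and distributions are replaced by functions.\<close>

definition has_spectrum :: "('n::finite \<Rightarrow> 'j::finite) \<Rightarrow> real ^ 'j \<Rightarrow> 'n cfunctional \<Rightarrow> 'n cfun \<Rightarrow> bool" where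
  "has_spectrum b s T h \<longleftrightarrow> weighted_L2 b s h \<and> (\<forall>\<phi>\<in>schwartz_functions. T \<phi> = (LINT \<xi>|lborel. h \<xi> * inv_fourier \<phi> \<xi>))"

text \<open>With the weight of the smaller of the two orders both functions are square-integrable, and
  Schwartz functions separate those.\<close>

lemma spectrum_unique:
  assumes h: "has_spectrum b s T h" and k: "has_spectrum b t T k"
  shows "AE \<xi> in lborel. h \<xi> = k \<xi>"
proof -
  define m where "m = (\<chi> l. min (s $ l) (t $ l))"
  have hm: "weighted_L2 b m h" and km: "weighted_L2 b m k"
    using weighted_L2_mono[of b s h m] weighted_L2_mono[of b t k m] h k by (simp_all add: has_spectrum_def m_def)
  have "AE \<xi> in lborel. of_real (weight b m \<xi>) * h \<xi> = of_real (weight b m \<xi>) * k \<xi>"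
  proof (rule L2_unique2[OF hm[unfolded weighted_L2_sqi] km[unfolded weighted_L2_sqi]])
    fix \<psi> :: "'a cfun" assume p: "\<psi> \<in> schwartz_functions"
    let ?q = "\<lambda>\<xi>. of_real (weight b m \<xi>) * \<psi> \<xi>"
    have q: "?q \<in> schwartz_functions" by (rule schwartz_weight[OF p])
    have "(LINT \<xi>|lborel. h \<xi> * ?q \<xi>) = (LINT \<xi>|lborel. k \<xi> * ?q \<xi>)"
    proof -
      have "T (fourier ?q) = (LINT \<xi>|lborel. h \<xi> * inv_fourier (fourier ?q) \<xi>)"
        using h fourier_schwartz[OF q] unfolding has_spectrum_def by blast
      moreover have "T (fourier ?q) = (LINT \<xi>|lborel. k \<xi> * inv_fourier (fourier ?q) \<xi>)"
        using k fourier_schwartz[OF q] unfolding has_spectrum_def by blast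
      ultimately show ?thesis unfolding inv_fourier_fourier[OF q] by simp
    qed
    then show "(LINT \<xi>|lborel. of_real (weight b m \<xi>) * h \<xi> * \<psi> \<xi>) = (LINT \<xi>|lborel. of_real (weight b m \<xi>) * k \<xi> * \<psi> \<xi>)"
      by (simp add: mult_ac)
  qed
  then show ?thesis
  proof eventually_elim
    case (elim \<xi>)
    then show ?case using weight_pos[of b m \<xi>] by simp
  qed
qed

lemma bessel_apply:
  assumes p: "\<phi> \<in> schwartz_functions"
  shows "bessel b s T \<phi> = T (fourier (\<lambda>\<xi>. of_real (weight b s \<xi>) * inv_fourier \<phi> \<xi>))"
  unfolding bessel_def fourier_multiplier_def distr_inv_fourier_def distr_times_def distr_fourier_def
  using p by (simp add: inv_fourier_schwartz schwartz_weight)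

lemma bessel_spectrum:
  assumes h: "has_spectrum b s T h" and p: "\<phi> \<in> schwartz_functions"
  shows "bessel b s T \<phi> = (LINT \<xi>|lborel. (of_real (weight b s \<xi>) * h \<xi>) * inv_fourier \<phi> \<xi>)"
proof -
  have q: "(\<lambda>\<xi>. of_real (weight b s \<xi>) * inv_fourier \<phi> \<xi>) \<in> schwartz_functions"
    by (intro schwartz_weight inv_fourier_schwartz p)
  have "bessel b s T \<phi> = (LINT \<xi>|lborel. h \<xi> * (of_real (weight b s \<xi>) * inv_fourier \<phi> \<xi>))"
    using h fourier_schwartz[OF q] unfolding bessel_apply[OF p] has_spectrum_def by (simp add: inv_fourier_fourier[OF q])
  then show ?thesis by (simp add: mult_ac)
qed

lemma L2_density_spec:
  assumes "u \<in> L2_distributions"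
  shows "square_integrable (L2_density u)" "\<And>\<phi>. \<phi> \<in> schwartz_functions \<Longrightarrow> u \<phi> = (LINT x|lborel. L2_density u x * \<phi> x)"
proof -
  have "\<exists>f. square_integrable f \<and> regular_distribution f = u"
    using assms unfolding L2_distributions_def by blast
  then have *: "square_integrable (L2_density u) \<and> regular_distribution (L2_density u) = u"
    unfolding L2_density_def by (rule someI_ex)
  then show "square_integrable (L2_density u)" by blast
  fix \<phi> :: "'a cfun" assume "\<phi> \<in> schwartz_functions"
  then show "u \<phi> = (LINT x|lborel. L2_density u x * \<phi> x)"
  proof -
    have "u \<phi> = regular_distribution (L2_density u) \<phi>" using * by simp
    then show ?thesis using \<open>\<phi> \<in> schwartz_functions\<close> by (simp add: regular_distribution_def)
  qed
qed

text \<open>Divide the Fourier transform of the \<open>L\<^sup>2\<close> density of \<open>\<langle>\<langle>D\<rangle>\<rangle>\<^sup>s T\<close> by the weight.\<close>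

lemma sobolev_spectrum:
  fixes b :: "'n::finite \<Rightarrow> 'j::finite"
  assumes T: "T \<in> sobolev b s"
  obtains h where "has_spectrum b s T h" "weighted_sq b s h \<le> ennreal ((2 * pi) ^ CARD('n) * (sobolev_norm b s T)\<^sup>2)"
proof -
  define f where "f = L2_density (bessel b s T)"
  have f: "square_integrable f" "\<And>\<phi>. \<phi> \<in> schwartz_functions \<Longrightarrow> bessel b s T \<phi> = (LINT x|lborel. f x * \<phi> x)"
    unfolding f_def using L2_density_spec T by (auto simp: sobolev_def)
  obtain g where g: "square_integrable g" "L2sq g \<le> (2 * pi) ^ CARD('n) * L2sq f"
    "\<And>\<phi>. \<phi> \<in> schwartz_functions \<Longrightarrow> (LINT x|lborel. f x * fourier \<phi> x) = (LINT x|lborel. g x * \<phi> x)"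
    by (rule L2_fourier[OF f(1)], rule that) (assumption | blast)+
  define h where "h = (\<lambda>\<xi>. of_real (weight b (- s) \<xi>) * g \<xi>)"
  have wh: "(\<lambda>\<xi>. of_real (weight b s \<xi>) * h \<xi>) = g"
    unfolding h_def using weight_minus[of b s] by (simp add: mult.assoc[symmetric] flip: of_real_mult)
  have "weighted_L2 b s h" unfolding weighted_L2_sqi wh by (rule g(1))
  moreover have "T \<phi> = (LINT \<xi>|lborel. h \<xi> * inv_fourier \<phi> \<xi>)" if p: "\<phi> \<in> schwartz_functions" for \<phi>
  proof -
    let ?q = "\<lambda>\<xi>. of_real (weight b (- s) \<xi>) * inv_fourier \<phi> \<xi>"
    have q: "?q \<in> schwartz_functions" by (intro schwartz_weight inv_fourier_schwartz p)
    have "(\<lambda>\<xi>. of_real (weight b s \<xi>) * ?q \<xi>) = inv_fourier \<phi>"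
      using weight_minus[of b s] by (simp add: mult.assoc[symmetric] flip: of_real_mult)
    then have "T \<phi> = bessel b s T (fourier ?q)"
      unfolding bessel_apply[OF fourier_schwartz[OF q]] inv_fourier_fourier[OF q] by (simp add: fourier_inv_fourier p)
    also have "\<dots> = (LINT x|lborel. g x * ?q x)" using f(2)[OF fourier_schwartz[OF q]] g(3)[OF q] by simp
    finally show ?thesis unfolding h_def by (simp add: mult_ac)
  qed
  ultimately have "has_spectrum b s T h" by (simp add: has_spectrum_def)
  moreover have "weighted_sq b s h \<le> ennreal ((2 * pi) ^ CARD('n) * (sobolev_norm b s T)\<^sup>2)"
  proof -
    have "(sobolev_norm b s T)\<^sup>2 = L2sq f"
      unfolding sobolev_norm_def L2_norm_def f_def[symmetric] L2sq_def[symmetric] by simp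
    then show ?thesis unfolding weighted_sq_def wh using g(1,2) by (subst L2sq_nn_le_iff) auto
  qed
  ultimately show ?thesis using that by blast
qed

lemma spectrum_norm:
  fixes b :: "'n::finite \<Rightarrow> 'j::finite"
  assumes T: "T \<in> sobolev b s" and h: "has_spectrum b s T h"
  shows "weighted_sq b s h \<le> ennreal ((2 * pi) ^ CARD('n) * (sobolev_norm b s T)\<^sup>2)"
proof -
  obtain k where k: "has_spectrum b s T k" "weighted_sq b s k \<le> ennreal ((2 * pi) ^ CARD('n) * (sobolev_norm b s T)\<^sup>2)"
    using sobolev_spectrum[OF T] .
  have "weighted_sq b s h = weighted_sq b s k"
    unfolding weighted_sq_def L2sq_nn_def using spectrum_unique[OF h k(1)] by (intro nn_integral_cong_AE) auto
  then show ?thesis using k(2) by simp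
qed

lemma weight_growth:
  obtains D k where "D \<ge> 0" "\<And>\<xi>. weight b s \<xi> \<le> D * (1 + norm \<xi>) ^ k"
proof -
  obtain k D where D: "\<And>\<xi>. norm (complex_of_real (weight b s \<xi>)) \<le> D * (1 + norm \<xi>) ^ k"
    using moderate_growth[OF moderate_weight[of b s]] by blast
  have "D \<ge> 0" using D[of 0] order_trans[OF weight_nonneg[of b s 0], of D] by simp
  then show ?thesis using that[of D k] D by simp
qed

lemma envelope_le1: "envelope x \<le> 1"
  unfolding envelope_def by (intro prod_le_1) (auto simp: powr_minus inverse_le_1_iff)

text \<open>Weights grow polynomially and transforms decrease faster, with constants controlled by a
  seminorm.\<close>

lemma weighted_sq_inv_fourier_bound:
  fixes b :: "'n::finite \<Rightarrow> 'j::finite"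
  obtains A N where "A \<ge> 0"
    "\<And>\<phi>. \<phi> \<in> schwartz_functions \<Longrightarrow> weighted_sq b s (inv_fourier \<phi>) \<le> ennreal ((A * schwartz_seminorm N \<phi>)\<^sup>2)"
proof -
  obtain D k where D: "D \<ge> 0" "\<And>\<xi>. weight b s \<xi> \<le> D * (1 + norm \<xi>) ^ k" using weight_growth[of b s] by blast
  obtain C N where C: "C \<ge> 0" "\<And>\<phi>::'n cfun. \<And>\<xi>. \<phi> \<in> schwartz_functions \<Longrightarrow>
      (1 + norm \<xi>) ^ (k + 2 * CARD('n)) * norm (fourier \<phi> \<xi>) \<le> C * schwartz_seminorm N \<phi>"
    using fourier_seminorm_bound[of "k + 2 * CARD('n)"] by blast
  define I where "I = (LINT x|lborel. envelope (x :: real ^ 'n))"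
  have I0: "I \<ge> 0" unfolding I_def by (intro Bochner_Integration.integral_nonneg envelope_nonneg)
  define A where "A = D * C * sqrt I"
  have "weighted_sq b s (inv_fourier \<phi>) \<le> ennreal ((A * schwartz_seminorm N \<phi>)\<^sup>2)" if p: "\<phi> \<in> schwartz_functions" for \<phi>
  proof -
    let ?S = "schwartz_seminorm N \<phi>"
    have pt: "(norm (of_real (weight b s \<xi>) * inv_fourier \<phi> \<xi>))\<^sup>2 \<le> (D * C * ?S)\<^sup>2 * envelope \<xi>" for \<xi>
    proof -
      have "norm (inv_fourier \<phi> \<xi>) \<le> norm (fourier \<phi> (- \<xi>))"
      proof -
        have "(1::real) \<le> (2 * pi) ^ CARD('n)" using pi_gt3 by (intro one_le_power) simp
        then have "norm (complex_of_real (1 / (2 * pi) ^ CARD('n))) \<le> 1" unfolding norm_of_real by simp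
        then show ?thesis unfolding inv_fourier_conv norm_mult by (intro mult_left_le_one_le norm_ge_zero)
      qed
      then have "norm (of_real (weight b s \<xi>) * inv_fourier \<phi> \<xi>) \<le> (D * (1 + norm \<xi>) ^ k) * norm (fourier \<phi> (- \<xi>))"
        unfolding norm_mult using D by (intro mult_mono) auto
      also have "\<dots> \<le> (D * (1 + norm \<xi>) ^ k) * norm (fourier \<phi> (- \<xi>)) * ((1 + norm \<xi>) ^ (2 * CARD('n)) * envelope \<xi>)"
        using mult_left_mono[OF envelope_ge[of \<xi>], of "(D * (1 + norm \<xi>) ^ k) * norm (fourier \<phi> (- \<xi>))"] D(1) by simp
      also have "\<dots> = D * ((1 + norm (- \<xi>)) ^ (k + 2 * CARD('n)) * norm (fourier \<phi> (- \<xi>))) * envelope \<xi>"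
        by (simp add: power_add)
      also have "\<dots> \<le> D * (C * ?S) * envelope \<xi>"
        by (intro mult_right_mono mult_left_mono C(2) p D envelope_nonneg)
      finally have "(norm (of_real (weight b s \<xi>) * inv_fourier \<phi> \<xi>))\<^sup>2 \<le> (D * (C * ?S) * envelope \<xi>)\<^sup>2"
        by (intro power_mono) auto
      also have "\<dots> = (D * C * ?S)\<^sup>2 * (envelope \<xi> * envelope \<xi>)" by (simp add: power2_eq_square mult_ac)
      also have "\<dots> \<le> (D * C * ?S)\<^sup>2 * envelope \<xi>"
        using envelope_le1[of \<xi>] envelope_nonneg[of \<xi>] by (intro mult_left_mono mult_left_le) auto
      finally show ?thesis .
    qed
    have "weighted_sq b s (inv_fourier \<phi>) \<le> (\<integral>\<^sup>+\<xi>. ennreal ((D * C * ?S)\<^sup>2 * envelope \<xi>) \<partial>(lborel :: (real ^ 'n) measure))"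
      unfolding weighted_sq_def L2sq_nn_def by (intro nn_integral_mono ennreal_leI pt)
    also have "\<dots> = ennreal (LINT \<xi>|lborel. (D * C * ?S)\<^sup>2 * envelope (\<xi> :: real ^ 'n))"
      by (intro nn_integral_eq_integral integrable_mult_right integrable_envelope) (simp add: envelope_nonneg)
    also have "(LINT \<xi>|lborel. (D * C * ?S)\<^sup>2 * envelope (\<xi> :: real ^ 'n)) = (A * ?S)\<^sup>2"
      using I0 by (simp add: A_def I_def[symmetric] power_mult_distrib)
    finally show ?thesis .
  qed
  then show ?thesis using that[of A N] D(1) C(1) I0 by (simp add: A_def)
qed

definition of_spectrum :: "'n::finite cfun \<Rightarrow> 'n cfunctional" where
  "of_spectrum h = (\<lambda>\<phi>\<in>schwartz_functions. LINT \<xi>|lborel. h \<xi> * inv_fourier \<phi> \<xi>)"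

lemma seminorm_nonneg: "\<phi> \<in> schwartz_functions \<Longrightarrow> schwartz_seminorm N \<phi> \<ge> 0"
  using seminorm_bound[of \<phi> "[]" N 0 0] by (auto intro: order_trans[OF norm_ge_zero])

text \<open>Continuity is the Cauchy-Schwarz inequality between the weights of orders \<open>s\<close> and \<open>-s\<close>; the
  \<open>L\<^sup>2\<close> density is the inverse transform of the weighted function.\<close>

lemma of_spectrum_sobolev:
  fixes b :: "'n::finite \<Rightarrow> 'j::finite"
  assumes h: "weighted_L2 b s h"
  shows "of_spectrum h \<in> sobolev b s" "has_spectrum b s (of_spectrum h) h"
proof -
  show hs: "has_spectrum b s (of_spectrum h) h" using h by (simp add: has_spectrum_def of_spectrum_def)
  have i: "integrable lborel (\<lambda>\<xi>. h \<xi> * inv_fourier \<phi> \<xi>)" if "\<phi> \<in> schwartz_functions" for \<phi>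
    by (intro weighted_L2_pair_integrable[OF h] schwartz_weighted_L2 inv_fourier_schwartz that)
  have lin: "linear_functional_on schwartz_functions (of_spectrum h)"
    unfolding linear_functional_on_def
  proof (intro ballI allI)
    fix \<phi> \<psi> :: "'n cfun" and a c assume p: "\<phi> \<in> schwartz_functions" "\<psi> \<in> schwartz_functions"
    have "(LINT \<xi>|lborel. h \<xi> * inv_fourier (\<lambda>x. a * \<phi> x + c * \<psi> x) \<xi>)
      = (LINT \<xi>|lborel. a * (h \<xi> * inv_fourier \<phi> \<xi>) + c * (h \<xi> * inv_fourier \<psi> \<xi>))"
      unfolding inv_fourier_lin[OF p] by (intro Bochner_Integration.integral_cong refl) (simp add: algebra_simps)
    also have "\<dots> = a * (LINT \<xi>|lborel. h \<xi> * inv_fourier \<phi> \<xi>) + c * (LINT \<xi>|lborel. h \<xi> * inv_fourier \<psi> \<xi>)"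
      by (subst Bochner_Integration.integral_add[OF integrable_mult_right[OF i] integrable_mult_right[OF i]]) (simp_all add: p)
    finally show "of_spectrum h (\<lambda>x. a * \<phi> x + c * \<psi> x) = a * of_spectrum h \<phi> + c * of_spectrum h \<psi>"
      unfolding of_spectrum_def using p schwartz_lin[OF p] by simp
  qed
  obtain A N where A: "A \<ge> 0" "\<And>\<phi>. \<phi> \<in> schwartz_functions \<Longrightarrow> weighted_sq b (- s) (inv_fourier \<phi>) \<le> ennreal ((A * schwartz_seminorm N \<phi>)\<^sup>2)"
    using weighted_sq_inv_fourier_bound[of b "- s"] by blast
  define H where "H = L2sq (\<lambda>\<xi>. of_real (weight b s \<xi>) * h \<xi>)"
  have bnd: "norm (of_spectrum h \<phi>) \<le> (sqrt H * A) * schwartz_seminorm N \<phi>" if p: "\<phi> \<in> schwartz_functions" for \<phi>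
  proof -
    have mh: "h \<in> borel_measurable borel" by (rule weighted_L2_measurable[OF h])
    have mp: "inv_fourier \<phi> \<in> borel_measurable borel" by (intro schwartz_measurable inv_fourier_schwartz p)
    have "ennreal ((norm (of_spectrum h \<phi>))\<^sup>2) = (ennreal (norm (LINT \<xi>|lborel. h \<xi> * inv_fourier \<phi> \<xi>)))\<^sup>2"
      using p by (simp add: of_spectrum_def ennreal_power)
    also have "\<dots> \<le> (\<integral>\<^sup>+\<xi>. ennreal (norm (h \<xi>) * norm (inv_fourier \<phi> \<xi>)) \<partial>lborel)\<^sup>2"
      using norm_integral_le_nn[of lborel "\<lambda>\<xi>. h \<xi> * inv_fourier \<phi> \<xi>"] by (intro power_mono_ennreal) (simp add: norm_mult)
    also have "\<dots> \<le> weighted_sq b s h * weighted_sq b (- s) (inv_fourier \<phi>)" by (rule weighted_L2_pair_CS[OF mh mp])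
    also have "\<dots> \<le> ennreal H * ennreal ((A * schwartz_seminorm N \<phi>)\<^sup>2)"
      unfolding weighted_sq_L2sq[OF h] H_def by (intro mult_left_mono A p) auto
    also have "\<dots> = ennreal (H * (A * schwartz_seminorm N \<phi>)\<^sup>2)" by (simp add: ennreal_mult H_def)
    finally have "(norm (of_spectrum h \<phi>))\<^sup>2 \<le> H * (A * schwartz_seminorm N \<phi>)\<^sup>2" by (simp add: H_def)
    then have "norm (of_spectrum h \<phi>) \<le> sqrt (H * (A * schwartz_seminorm N \<phi>)\<^sup>2)" by (rule real_le_rsqrt)
    also have "\<dots> = (sqrt H * A) * schwartz_seminorm N \<phi>"
      using A(1) seminorm_nonneg[OF p, of N] by (simp add: real_sqrt_mult)
    finally show ?thesis .
  qed
  have t: "of_spectrum h \<in> tempered_distributions"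
    unfolding tempered_distributions_def using lin bnd by (auto simp: of_spectrum_def)
  obtain f where f: "square_integrable f" "L2sq f \<le> L2sq (\<lambda>\<xi>. of_real (weight b s \<xi>) * h \<xi>)"
    "\<And>\<phi>. \<phi> \<in> schwartz_functions \<Longrightarrow> (LINT x|lborel. (of_real (weight b s x) * h x) * inv_fourier \<phi> x) = (LINT x|lborel. f x * \<phi> x)"
    by (rule L2_inv_fourier[OF h[unfolded weighted_L2_sqi]], rule that) (assumption | blast)+
  have "regular_distribution f = bessel b s (of_spectrum h)"
  proof
    fix \<phi> :: "'n cfun"
    show "regular_distribution f \<phi> = bessel b s (of_spectrum h) \<phi>"
    proof (cases "\<phi> \<in> schwartz_functions")
      case True
      then show ?thesis using bessel_spectrum[OF hs True] f(3)[OF True] by (simp add: regular_distribution_def)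
    next
      case False
      then show ?thesis by (simp add: regular_distribution_def bessel_def fourier_multiplier_def distr_inv_fourier_def)
    qed
  qed
  moreover have "regular_distribution f \<in> L2_distributions" unfolding L2_distributions_def using f(1) by simp
  ultimately show "of_spectrum h \<in> sobolev b s" using t by (simp add: sobolev_def)
qed

text \<open>Up to the factor \<open>(2\<pi>)\<^bsup>-n\<^esup>\<close> the pairing \<open>\<integral> TU\<close> in terms of the transforms of \<open>T\<close> and \<open>U\<close>; the
  reflection is there because nothing is conjugated.\<close>

definition transform_pairing :: "'n::finite cfun \<Rightarrow> 'n cfun \<Rightarrow> complex" where
  "transform_pairing h k = (LINT \<xi>|lborel. h \<xi> * k (- \<xi>))"

lemma sobolev_pairing_spectrum:
  fixes b :: "'n::finite \<Rightarrow> 'j::finite"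
  assumes T: "T \<in> sobolev b s" "has_spectrum b s T h" and U: "U \<in> sobolev b (- s)" "has_spectrum b (- s) U k"
  shows "sobolev_pairing b s T U = of_real (1 / (2 * pi) ^ CARD('n)) * transform_pairing h k"
proof -
  have "sobolev_pairing b s T U = of_real (1 / (2 * pi) ^ CARD('n)) *
      (LINT \<xi>|lborel. (of_real (weight b s \<xi>) * h \<xi>) * (of_real (weight b (- s) (- \<xi>)) * k (- \<xi>)))"
    unfolding sobolev_pairing_def
  proof (rule L2_parseval)
    have B: "bessel b s T \<in> L2_distributions" "bessel b (- s) U \<in> L2_distributions" using T U by (auto simp: sobolev_def)
    show "square_integrable (L2_density (bessel b s T))" "square_integrable (L2_density (bessel b (- s) U))"
      by (intro L2_density_spec B)+
    show "square_integrable (\<lambda>\<xi>. of_real (weight b s \<xi>) * h \<xi>)" "square_integrable (\<lambda>\<xi>. of_real (weight b (- s) \<xi>) * k \<xi>)"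
      using T U unfolding has_spectrum_def weighted_L2_sqi by auto
    fix \<phi> :: "'n cfun" assume p: "\<phi> \<in> schwartz_functions"
    show "(LINT x|lborel. L2_density (bessel b s T) x * \<phi> x) = (LINT x|lborel. of_real (weight b s x) * h x * inv_fourier \<phi> x)"
      using L2_density_spec(2)[OF B(1) p] bessel_spectrum[OF T(2) p] by simp
    show "(LINT x|lborel. L2_density (bessel b (- s) U) x * \<phi> x) = (LINT x|lborel. of_real (weight b (- s) x) * k x * inv_fourier \<phi> x)"
      using L2_density_spec(2)[OF B(2) p] bessel_spectrum[OF U(2) p] by simp
  qed
  then show ?thesis unfolding weight_even weight_cancel transform_pairing_def .
qed

section \<open>The bilinear estimate\<close>

lemma powr_comparable:
  fixes x y :: real
  assumes "x > 0" "y > 0" "x \<le> 4 * y" "y \<le> 4 * x"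
  shows "x powr r \<le> 4 powr \<bar>r\<bar> * y powr r"
proof (cases "r \<ge> 0")
  case True
  then have "x powr r \<le> (4 * y) powr r" using assms by (intro powr_mono2) auto
  then show ?thesis using True assms by (simp add: powr_mult)
next
  case False
  then have "x powr r \<le> (y / 4) powr r" using assms by (intro powr_mono2') auto
  also have "\<dots> = 4 powr \<bar>r\<bar> * y powr r" using False assms by (simp add: powr_divide powr_minus field_simps)
  finally show ?thesis .
qed

text \<open>By the triangle inequality the two largest of the three quantities are comparable. If they
  are \<open>B\<close> and \<open>D\<close>, the left-hand side is of size \<open>B\<^bsup>\<sigma>-t\<^esup> A\<^bsup>-s\<^esup>\<close>, and the exponent \<open>\<sigma> - t \<le> 0\<close>
  allows \<open>B\<close> to be replaced by \<open>A\<close>. If they are \<open>A\<close> and \<open>B\<close>, then \<open>1 \<le> D \<le> A\<close> bounds it by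
  \<open>A\<close> to the power \<open>max \<sigma> 0 - s - t\<close>. The resulting exponents are at most \<open>-a\<close>.\<close>

lemma kernel_ordered:
  fixes A B D :: real
  assumes 1: "1 \<le> A" "1 \<le> B" "1 \<le> D" and tri: "D \<le> 2 * (A + B)" "B \<le> 2 * (A + D)" and AB: "A \<le> B"
    and e: "\<sigma> \<le> t" "\<sigma> \<le> s + t - a" "a \<le> s + t"
  shows "D powr \<sigma> * A powr (- s) * B powr (- t) \<le> 4 powr (\<bar>\<sigma>\<bar> + \<bar>t\<bar>) * A powr (- a)"
proof (cases "A \<le> D")
  case True
  have "D \<le> 2 * A + 2 * B" "B \<le> 2 * A + 2 * D" using tri by (simp_all add: distrib_left)
  then have "D \<le> 4 * B" "B \<le> 4 * D" using AB True by linarith+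
  then have "D powr \<sigma> \<le> 4 powr \<bar>\<sigma>\<bar> * B powr \<sigma>"
    using 1 by (intro powr_comparable) auto
  then have "D powr \<sigma> * A powr (- s) * B powr (- t) \<le> (4 powr \<bar>\<sigma>\<bar> * B powr \<sigma>) * A powr (- s) * B powr (- t)"
    by (intro mult_right_mono) auto
  also have "\<dots> = 4 powr \<bar>\<sigma>\<bar> * (B powr (\<sigma> - t) * A powr (- s))"
    using 1 by (simp add: powr_diff powr_minus divide_inverse)
  also have "\<dots> \<le> 4 powr \<bar>\<sigma>\<bar> * (A powr (\<sigma> - t) * A powr (- s))"
    using 1 AB e by (intro mult_left_mono mult_right_mono powr_mono2') auto
  also have "\<dots> = 4 powr \<bar>\<sigma>\<bar> * A powr (\<sigma> - t - s)" by (simp add: powr_add[symmetric])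
  also have "\<dots> \<le> 4 powr (\<bar>\<sigma>\<bar> + \<bar>t\<bar>) * A powr (- a)"
    using 1 e by (intro mult_mono powr_mono) auto
  finally show ?thesis .
next
  case False
  have D: "D powr \<sigma> \<le> A powr (max \<sigma> 0)"
  proof (cases "\<sigma> \<ge> 0")
    case True
    then show ?thesis using False 1 by (auto intro!: powr_mono2)
  next
    case False
    then have "D powr \<sigma> \<le> D powr 0" using 1 by (intro powr_mono) auto
    then show ?thesis using False 1 by simp
  qed
  have "B powr (- t) \<le> 4 powr \<bar>- t\<bar> * A powr (- t)"
  proof (rule powr_comparable)
    have "B \<le> 2 * A + 2 * D" using tri by (simp add: distrib_left)
    then show "B \<le> 4 * A" using False by linarith
  qed (use 1 AB in linarith)+
  then have B: "B powr (- t) \<le> 4 powr \<bar>t\<bar> * A powr (- t)" by simp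
  have "D powr \<sigma> * A powr (- s) * B powr (- t) \<le> A powr (max \<sigma> 0) * A powr (- s) * (4 powr \<bar>t\<bar> * A powr (- t))"
    by (intro mult_mono D B) auto
  also have "\<dots> = 4 powr \<bar>t\<bar> * A powr (max \<sigma> 0 - s - t)"
    using 1 by (simp add: powr_diff powr_minus divide_inverse mult_ac)
  also have "\<dots> \<le> 4 powr (\<bar>\<sigma>\<bar> + \<bar>t\<bar>) * A powr (- a)"
    using 1 e by (intro mult_mono powr_mono) auto
  finally show ?thesis .
qed

lemma kernel_block:
  fixes A B D :: real
  assumes 1: "1 \<le> A" "1 \<le> B" "1 \<le> D" and tri: "D \<le> 2 * (A + B)" "A \<le> 2 * (B + D)" "B \<le> 2 * (A + D)"
    and e: "\<sigma> \<le> s" "\<sigma> \<le> t" "\<sigma> \<le> s + t - a" "a \<le> s + t"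
  shows "D powr \<sigma> * A powr (- s) * B powr (- t) \<le> 4 powr (\<bar>\<sigma>\<bar> + \<bar>s\<bar> + \<bar>t\<bar>) * (A powr (- a) + B powr (- a))"
proof (cases "A \<le> B")
  case True
  have "D powr \<sigma> * A powr (- s) * B powr (- t) \<le> 4 powr (\<bar>\<sigma>\<bar> + \<bar>t\<bar>) * A powr (- a)"
    by (rule kernel_ordered) (use assms True in auto)
  also have "\<dots> \<le> 4 powr (\<bar>\<sigma>\<bar> + \<bar>s\<bar> + \<bar>t\<bar>) * (A powr (- a) + B powr (- a))"
    by (intro mult_mono powr_mono) auto
  finally show ?thesis .
next
  case False
  have "D powr \<sigma> * B powr (- t) * A powr (- s) \<le> 4 powr (\<bar>\<sigma>\<bar> + \<bar>s\<bar>) * B powr (- a)"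
    by (rule kernel_ordered) (use assms False in \<open>auto simp: add.commute\<close>)
  also have "\<dots> \<le> 4 powr (\<bar>\<sigma>\<bar> + \<bar>s\<bar> + \<bar>t\<bar>) * (A powr (- a) + B powr (- a))"
    by (intro mult_mono powr_mono) auto
  finally show ?thesis by (simp add: mult_ac)
qed

lemma bracket_triangle: "bracket b l (\<xi> + \<eta>) \<le> 2 * (bracket b l \<xi> + bracket b l \<eta>)"
proof -
  have "(\<Sum>i | b i = l. ((\<xi> + \<eta>) $ i)\<^sup>2) \<le> (\<Sum>i | b i = l. 2 * (\<xi> $ i)\<^sup>2 + 2 * (\<eta> $ i)\<^sup>2)"
  proof (intro sum_mono)
    fix i
    have "0 \<le> (\<xi> $ i - \<eta> $ i)\<^sup>2" by simp
    then show "((\<xi> + \<eta>) $ i)\<^sup>2 \<le> 2 * (\<xi> $ i)\<^sup>2 + 2 * (\<eta> $ i)\<^sup>2" by (simp add: power2_eq_square algebra_simps)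
  qed
  then show ?thesis unfolding bracket_def by (simp add: sum.distrib sum_distrib_left[symmetric])
qed

text \<open>Distributing the exponent evenly over the \<open>n\<close> coordinates of the block leaves \<open>a/n\<close> on each,
  so that \<open>a > n/2\<close> becomes one-dimensional integrability.\<close>

lemma bracket_coordinates:
  fixes b :: "'n::finite \<Rightarrow> 'j::finite"
  assumes n: "block_dim b l > 0" and a: "a \<ge> 0"
  shows "bracket b l \<xi> powr (- a) \<le> (\<Prod>i | b i = l. (1 + (\<xi> $ i)\<^sup>2) powr (- (a / real (block_dim b l))))"
proof -
  let ?p = "a / real (block_dim b l)"
  have pos: "bracket b l \<xi> > 0" using bracket_ge1[of b l \<xi>] by linarith
  have "bracket b l \<xi> powr (- a) = (bracket b l \<xi> powr (- ?p)) ^ block_dim b l"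
    using n pos by (simp add: powr_power)
  also have "\<dots> = (\<Prod>i | b i = l. bracket b l \<xi> powr (- ?p))" by (simp add: block_dim_def)
  also have "\<dots> \<le> (\<Prod>i | b i = l. (1 + (\<xi> $ i)\<^sup>2) powr (- ?p))"
  proof (intro prod_mono conjI)
    fix i assume "i \<in> {i. b i = l}"
    then have "(\<xi> $ i)\<^sup>2 \<le> (\<Sum>i | b i = l. (\<xi> $ i)\<^sup>2)" by (intro member_le_sum) auto
    then show "bracket b l \<xi> powr (- ?p) \<le> (1 + (\<xi> $ i)\<^sup>2) powr (- ?p)"
      using a unfolding bracket_def by (intro powr_mono2') (auto simp: add_pos_nonneg)
  qed auto
  finally show ?thesis .
qed

lemma prod_blocks:
  fixes b :: "'n::finite \<Rightarrow> 'j::finite" and f :: "'n \<Rightarrow> 'a::comm_monoid_mult"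
  shows "(\<Prod>l\<in>UNIV. \<Prod>i | b i = l. f i) = (\<Prod>i\<in>UNIV. f i)"
  using prod.group[of "UNIV :: 'n set" "UNIV :: 'j set" b f] by simp

text \<open>Blockwise the kernel is at most a constant times \<open>P\<^sub>l + R\<^sub>l\<close>, where \<open>P\<^sub>l\<close> decays in \<open>\<xi>\<close> and
  \<open>R\<^sub>l\<close> in \<open>\<zeta> - \<xi>\<close>. Expanding the product over the blocks gives one term for each set \<open>X\<close> of
  blocks, namely those where \<open>P\<^sub>l\<close> is chosen; it is bounded by a product of functions of single
  coordinates, and its integral does not depend on \<open>\<zeta>\<close> by translation and reflection.\<close>

lemma kernel_integral:
  fixes b :: "'n::finite \<Rightarrow> 'j::finite" and s t \<sigma> a :: "real ^ 'j"
  assumes n: "\<And>l. block_dim b l > 0"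
    and e: "\<And>l. \<sigma> $ l \<le> s $ l" "\<And>l. \<sigma> $ l \<le> t $ l" "\<And>l. \<sigma> $ l \<le> s $ l + t $ l - a $ l" "\<And>l. a $ l \<le> s $ l + t $ l"
    and a: "\<And>l. a $ l > real (block_dim b l) / 2"
  obtains M where "M \<ge> 0"
    "\<And>\<zeta>. (\<integral>\<^sup>+\<xi>. ennreal ((weight b \<sigma> \<zeta> * weight b (- s) \<xi> * weight b (- t) (\<zeta> - \<xi>))\<^sup>2) \<partial>lborel) \<le> ennreal M"
proof -
  define C where "C = (\<Prod>l\<in>(UNIV::'j set). (4::real) powr (\<bar>\<sigma> $ l\<bar> + \<bar>s $ l\<bar> + \<bar>t $ l\<bar>))"
  define p where "p = (\<lambda>i. a $ (b i) / real (block_dim b (b i)))"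
  define q where "q = (\<lambda>i x. ennreal ((1 + x\<^sup>2) powr (- p i)))"
  define I where "I = (\<Prod>i\<in>UNIV. (\<integral>\<^sup>+x. q i x \<partial>(lborel :: real measure)))"
  have a0: "a $ l \<ge> 0" for l using a[of l] by (smt (verit) of_nat_0_le_iff divide_nonneg_nonneg)
  have p: "p i > 1 / 2" for i using a[of "b i"] n[of "b i"] unfolding p_def by (simp add: field_simps)
  have [measurable]: "q i \<in> borel_measurable borel" for i unfolding q_def by measurable
  have fin: "I < \<infinity>"
  proof -
    have "(\<Prod>i\<in>F. (\<integral>\<^sup>+x. q i x \<partial>(lborel :: real measure))) < \<infinity>" if "finite F" for F
      using that by (induction F rule: finite_induct)
        (auto simp: ennreal_mult_less_top q_def intro!: nn_integral_bracket_power[OF p, unfolded infinity_ennreal_def])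
    then show ?thesis unfolding I_def by simp
  qed
  have pt: "(weight b \<sigma> \<zeta> * weight b (- s) \<xi> * weight b (- t) (\<zeta> - \<xi>))\<^sup>2
     \<le> C * (\<Prod>l\<in>UNIV. bracket b l \<xi> powr (- (a $ l)) + bracket b l (\<zeta> - \<xi>) powr (- (a $ l)))" for \<xi> \<zeta>
  proof -
    have sq: "(weight b r \<eta>)\<^sup>2 = (\<Prod>l\<in>UNIV. bracket b l \<eta> powr (r $ l))" for r \<eta>
    proof -
      have "(weight b r \<eta>)\<^sup>2 = weight b (r + r) \<eta>" unfolding weight_add power2_eq_square ..
      then show ?thesis unfolding weight_bracket by simp
    qed
    have "(weight b \<sigma> \<zeta> * weight b (- s) \<xi> * weight b (- t) (\<zeta> - \<xi>))\<^sup>2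
       = (\<Prod>l\<in>UNIV. bracket b l \<zeta> powr (\<sigma> $ l) * bracket b l \<xi> powr (- (s $ l)) * bracket b l (\<zeta> - \<xi>) powr (- (t $ l)))"
      unfolding power_mult_distrib sq by (simp add: prod.distrib)
    also have "\<dots> \<le> (\<Prod>l\<in>UNIV. 4 powr (\<bar>\<sigma> $ l\<bar> + \<bar>s $ l\<bar> + \<bar>t $ l\<bar>) *
        (bracket b l \<xi> powr (- (a $ l)) + bracket b l (\<zeta> - \<xi>) powr (- (a $ l))))"
    proof (intro prod_mono conjI kernel_block bracket_ge1 e)
      fix l
      show "bracket b l \<zeta> \<le> 2 * (bracket b l \<xi> + bracket b l (\<zeta> - \<xi>))" using bracket_triangle[of b l \<xi> "\<zeta> - \<xi>"] by simp
      show "bracket b l \<xi> \<le> 2 * (bracket b l (\<zeta> - \<xi>) + bracket b l \<zeta>)"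
        using bracket_triangle[of b l "- (\<zeta> - \<xi>)" \<zeta>] unfolding bracket_even by simp
      show "bracket b l (\<zeta> - \<xi>) \<le> 2 * (bracket b l \<xi> + bracket b l \<zeta>)"
        using bracket_triangle[of b l "- \<xi>" \<zeta>] unfolding bracket_even by simp
    qed auto
    finally show ?thesis unfolding C_def by (simp add: prod.distrib)
  qed
  have C0: "C \<ge> 0" unfolding C_def by (intro prod_nonneg) auto
  have main: "(\<integral>\<^sup>+\<xi>. ennreal ((weight b \<sigma> \<zeta> * weight b (- s) \<xi> * weight b (- t) (\<zeta> - \<xi>))\<^sup>2) \<partial>lborel)
     \<le> ennreal C * (\<Sum>X\<in>(UNIV :: 'j set set). I)" for \<zeta>
  proof -
    define r where "r = (\<lambda>X i x. if b i \<in> X then q i x else q i (\<zeta> $ i - x))"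
    have [measurable]: "r X i \<in> borel_measurable borel" for X i unfolding r_def by (cases "b i \<in> X") auto
    have le: "ennreal ((weight b \<sigma> \<zeta> * weight b (- s) \<xi> * weight b (- t) (\<zeta> - \<xi>))\<^sup>2)
       \<le> ennreal C * (\<Sum>X\<in>UNIV. \<Prod>i\<in>UNIV. r X i (\<xi> $ i))" for \<xi>
    proof -
      let ?P = "\<lambda>l. ennreal (bracket b l \<xi> powr (- (a $ l)))" let ?R = "\<lambda>l. ennreal (bracket b l (\<zeta> - \<xi>) powr (- (a $ l)))"
      have P: "?P l \<le> (\<Prod>i | b i = l. q i (\<xi> $ i))" for l
      proof -
        have "?P l \<le> ennreal (\<Prod>i | b i = l. (1 + (\<xi> $ i)\<^sup>2) powr (- (a $ l / real (block_dim b l))))"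
          by (intro ennreal_leI bracket_coordinates n a0)
        also have "\<dots> = (\<Prod>i | b i = l. q i (\<xi> $ i))"
          unfolding q_def p_def by (subst prod_ennreal[symmetric]) (auto intro!: prod.cong)
        finally show ?thesis .
      qed
      have R: "?R l \<le> (\<Prod>i | b i = l. q i ((\<zeta> - \<xi>) $ i))" for l
      proof -
        have "?R l \<le> ennreal (\<Prod>i | b i = l. (1 + ((\<zeta> - \<xi>) $ i)\<^sup>2) powr (- (a $ l / real (block_dim b l))))"
          by (intro ennreal_leI bracket_coordinates n a0)
        also have "\<dots> = (\<Prod>i | b i = l. q i ((\<zeta> - \<xi>) $ i))"
          unfolding q_def p_def by (subst prod_ennreal[symmetric]) (auto intro!: prod.cong)
        finally show ?thesis .
      qed
      have "ennreal ((weight b \<sigma> \<zeta> * weight b (- s) \<xi> * weight b (- t) (\<zeta> - \<xi>))\<^sup>2)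
        \<le> ennreal (C * (\<Prod>l\<in>UNIV. bracket b l \<xi> powr (- (a $ l)) + bracket b l (\<zeta> - \<xi>) powr (- (a $ l))))"
        by (intro ennreal_leI pt)
      also have "\<dots> = ennreal C * (\<Prod>l\<in>UNIV. ?P l + ?R l)"
        by (subst ennreal_mult) (auto simp: C0 prod_nonneg prod_ennreal[symmetric])
      also have "(\<Prod>l\<in>UNIV. ?P l + ?R l) = (\<Sum>X\<in>Pow UNIV. (\<Prod>l\<in>X. ?P l) * (\<Prod>l\<in>UNIV - X. ?R l))"
        by (rule prod_add) simp
      also have "\<dots> \<le> (\<Sum>X\<in>UNIV. \<Prod>i\<in>UNIV. r X i (\<xi> $ i))"
        unfolding Pow_UNIV
      proof (intro sum_mono)
        fix X :: "'j set"
        have "(\<Prod>l\<in>X. ?P l) * (\<Prod>l\<in>UNIV - X. ?R l)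
           \<le> (\<Prod>l\<in>X. \<Prod>i | b i = l. q i (\<xi> $ i)) * (\<Prod>l\<in>UNIV - X. \<Prod>i | b i = l. q i ((\<zeta> - \<xi>) $ i))"
          by (intro mult_mono prod_mono_ennreal P R) auto
        also have "\<dots> = (\<Prod>l\<in>X. \<Prod>i | b i = l. r X i (\<xi> $ i)) * (\<Prod>l\<in>UNIV - X. \<Prod>i | b i = l. r X i (\<xi> $ i))"
          unfolding r_def by (intro arg_cong2[of _ _ _ _ "(*)"] prod.cong refl) auto
        also have "\<dots> = (\<Prod>l\<in>UNIV. \<Prod>i | b i = l. r X i (\<xi> $ i))"
          by (subst mult.commute, rule prod.subset_diff[symmetric]) auto
        also have "\<dots> = (\<Prod>i\<in>UNIV. r X i (\<xi> $ i))" by (rule prod_blocks)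
        finally show "(\<Prod>l\<in>X. ?P l) * (\<Prod>l\<in>UNIV - X. ?R l) \<le> (\<Prod>i\<in>UNIV. r X i (\<xi> $ i))" .
      qed
      finally show ?thesis by (simp add: mult_left_mono)
    qed
    have "(\<integral>\<^sup>+\<xi>. ennreal ((weight b \<sigma> \<zeta> * weight b (- s) \<xi> * weight b (- t) (\<zeta> - \<xi>))\<^sup>2) \<partial>lborel)
       \<le> (\<integral>\<^sup>+\<xi>. ennreal C * (\<Sum>X\<in>UNIV. \<Prod>i\<in>UNIV. r X i (\<xi> $ i)) \<partial>(lborel :: (real ^ 'n) measure))"
      by (intro nn_integral_mono le)
    also have "\<dots> = ennreal C * (\<Sum>X\<in>UNIV. (\<integral>\<^sup>+\<xi>. (\<Prod>i\<in>UNIV. r X i (\<xi> $ i)) \<partial>(lborel :: (real ^ 'n) measure)))"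
      by (subst nn_integral_cmult) (auto simp: nn_integral_sum)
    also have "\<dots> = ennreal C * (\<Sum>X\<in>(UNIV :: 'j set set). I)"
    proof (intro arg_cong2[of _ _ _ _ "(*)"] sum.cong refl)
      fix X
      have "(\<integral>\<^sup>+x. r X i x \<partial>lborel) = (\<integral>\<^sup>+x. q i x \<partial>lborel)" for i
        unfolding r_def using nn_integral_reflect(2)[of "q i" "\<zeta> $ i"] by (cases "b i \<in> X") auto
      then show "(\<integral>\<^sup>+\<xi>. (\<Prod>i\<in>UNIV. r X i (\<xi> $ i)) \<partial>(lborel :: (real ^ 'n) measure)) = I"
        unfolding I_def by (subst nn_integral_prod_cart) auto
    qed
    finally show ?thesis .
  qed
  have "ennreal C * (\<Sum>X\<in>(UNIV :: 'j set set). I) < \<infinity>"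
    using fin by (simp add: ennreal_mult_less_top of_nat_less_top power_less_top_ennreal)
  then obtain M where M: "ennreal C * (\<Sum>X\<in>(UNIV :: 'j set set). I) = ennreal M" "M \<ge> 0"
    by (cases "ennreal C * (\<Sum>X\<in>(UNIV :: 'j set set). I)") auto
  show ?thesis by (rule that[OF M(2)], unfold M(1)[symmetric], rule main)
qed

text \<open>The Cauchy-Schwarz inequality against the kernel leaves the convolution of the squared weighted
  functions, whose integral is the product of the integrals.\<close>

lemma bilinear_estimate:
  fixes b :: "'n::finite \<Rightarrow> 'j::finite"
  assumes M: "\<And>\<zeta>. (\<integral>\<^sup>+\<xi>. ennreal ((weight b \<sigma> \<zeta> * weight b (- s) \<xi> * weight b (- t) (\<zeta> - \<xi>))\<^sup>2) \<partial>lborel) \<le> ennreal M"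
    and [measurable]: "h \<in> borel_measurable borel" "k \<in> borel_measurable borel"
  shows "weighted_sq_nn b \<sigma> (absconv h k) \<le> ennreal M * (weighted_sq b s h * weighted_sq b t k)"
proof -
  let ?f = "\<lambda>\<xi>. norm (of_real (weight b s \<xi>) * h \<xi>)" let ?g = "\<lambda>\<xi>. norm (of_real (weight b t \<xi>) * k \<xi>)"
  let ?K = "\<lambda>\<zeta> \<xi>. weight b \<sigma> \<zeta> * weight b (- s) \<xi> * weight b (- t) (\<zeta> - \<xi>)"
  have le: "(ennreal (weight b \<sigma> \<zeta>) * absconv h k \<zeta>)\<^sup>2 \<le> ennreal M * (\<integral>\<^sup>+\<xi>. ennreal ((?f \<xi>)\<^sup>2) * ennreal ((?g (\<zeta> - \<xi>))\<^sup>2) \<partial>lborel)" for \<zeta>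
  proof -
    have pt: "weight b \<sigma> \<zeta> * (norm (h \<xi>) * norm (k (\<zeta> - \<xi>))) = ?K \<zeta> \<xi> * (?f \<xi> * ?g (\<zeta> - \<xi>))" for \<xi>
    proof -
      have "?K \<zeta> \<xi> * (?f \<xi> * ?g (\<zeta> - \<xi>)) = weight b \<sigma> \<zeta> * (weight b s \<xi> * weight b (- s) \<xi>) * (weight b t (\<zeta> - \<xi>) * weight b (- t) (\<zeta> - \<xi>)) * (norm (h \<xi>) * norm (k (\<zeta> - \<xi>)))"
        by (simp add: norm_mult)
      from this[unfolded weight_minus] show ?thesis by (simp only: mult_1_right)
    qed
    have "ennreal (weight b \<sigma> \<zeta>) * absconv h k \<zeta> = (\<integral>\<^sup>+\<xi>. ennreal (?K \<zeta> \<xi>) * ennreal (?f \<xi> * ?g (\<zeta> - \<xi>)) \<partial>lborel)"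
      unfolding absconv_def
    proof -
      have "ennreal (weight b \<sigma> \<zeta>) * ennreal (norm (h \<xi>) * norm (k (\<zeta> - \<xi>))) = ennreal (?K \<zeta> \<xi>) * ennreal (?f \<xi> * ?g (\<zeta> - \<xi>))" for \<xi>
        by (simp only: ennreal_mult[symmetric] weight_nonneg mult_nonneg_nonneg norm_ge_zero pt)
      then show "ennreal (weight b \<sigma> \<zeta>) * (\<integral>\<^sup>+\<xi>. ennreal (norm (h \<xi>) * norm (k (\<zeta> - \<xi>))) \<partial>lborel)
        = (\<integral>\<^sup>+\<xi>. ennreal (?K \<zeta> \<xi>) * ennreal (?f \<xi> * ?g (\<zeta> - \<xi>)) \<partial>lborel)"
        by (subst nn_integral_cmult[symmetric]) auto
    qed
    then have "(ennreal (weight b \<sigma> \<zeta>) * absconv h k \<zeta>)\<^sup>2 \<le> (\<integral>\<^sup>+\<xi>. (ennreal (?K \<zeta> \<xi>))\<^sup>2 \<partial>lborel) * (\<integral>\<^sup>+\<xi>. (ennreal (?f \<xi> * ?g (\<zeta> - \<xi>)))\<^sup>2 \<partial>lborel)"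
      by (simp only:) (rule Cauchy_Schwarz_nn_integral; measurable)
    also have "(\<integral>\<^sup>+\<xi>. (ennreal (?K \<zeta> \<xi>))\<^sup>2 \<partial>lborel) = (\<integral>\<^sup>+\<xi>. ennreal ((?K \<zeta> \<xi>)\<^sup>2) \<partial>lborel)"
      by (simp add: ennreal_power)
    also have "(\<integral>\<^sup>+\<xi>. (ennreal (?f \<xi> * ?g (\<zeta> - \<xi>)))\<^sup>2 \<partial>lborel) = (\<integral>\<^sup>+\<xi>. ennreal ((?f \<xi>)\<^sup>2) * ennreal ((?g (\<zeta> - \<xi>))\<^sup>2) \<partial>lborel)"
      by (intro nn_integral_cong) (simp only: ennreal_power mult_nonneg_nonneg norm_ge_zero power_mult_distrib ennreal_mult zero_le_power2)
    also have "(\<integral>\<^sup>+\<xi>. ennreal ((?K \<zeta> \<xi>)\<^sup>2) \<partial>lborel) * (\<integral>\<^sup>+\<xi>. ennreal ((?f \<xi>)\<^sup>2) * ennreal ((?g (\<zeta> - \<xi>))\<^sup>2) \<partial>lborel)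
       \<le> ennreal M * (\<integral>\<^sup>+\<xi>. ennreal ((?f \<xi>)\<^sup>2) * ennreal ((?g (\<zeta> - \<xi>))\<^sup>2) \<partial>lborel)"
      by (intro mult_right_mono M) auto
    finally show ?thesis .
  qed
  have "weighted_sq_nn b \<sigma> (absconv h k) \<le> (\<integral>\<^sup>+\<zeta>. ennreal M * (\<integral>\<^sup>+\<xi>. ennreal ((?f \<xi>)\<^sup>2) * ennreal ((?g (\<zeta> - \<xi>))\<^sup>2) \<partial>lborel) \<partial>lborel)"
    unfolding weighted_sq_nn_def by (intro nn_integral_mono le)
  also have "\<dots> = ennreal M * (\<integral>\<^sup>+\<zeta>. (\<integral>\<^sup>+\<xi>. ennreal ((?f \<xi>)\<^sup>2) * ennreal ((?g (\<zeta> - \<xi>))\<^sup>2) \<partial>lborel) \<partial>lborel)"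
    by (intro nn_integral_cmult) measurable
  also have "(\<integral>\<^sup>+\<zeta>. (\<integral>\<^sup>+\<xi>. ennreal ((?f \<xi>)\<^sup>2) * ennreal ((?g (\<zeta> - \<xi>))\<^sup>2) \<partial>lborel) \<partial>lborel)
     = (\<integral>\<^sup>+\<xi>. (\<integral>\<^sup>+\<zeta>. ennreal ((?f \<xi>)\<^sup>2) * ennreal ((?g (\<zeta> - \<xi>))\<^sup>2) \<partial>lborel) \<partial>lborel)"
    by (rule lborel_pair.Fubini') measurable
  also have "\<dots> = (\<integral>\<^sup>+\<xi>. ennreal ((?f \<xi>)\<^sup>2) * weighted_sq b t k \<partial>lborel)"
    unfolding weighted_sq_def L2sq_nn_def
    by (intro nn_integral_cong, subst nn_integral_cmult) (use nn_integral_reflect(4)[of "\<lambda>\<zeta>. ennreal ((?g \<zeta>)\<^sup>2)"] in auto)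
  also have "\<dots> = weighted_sq b s h * weighted_sq b t k" unfolding weighted_sq_def[of b s] L2sq_nn_def by (intro nn_integral_multc) measurable
  finally show ?thesis .
qed

section \<open>Localization\<close>

lemma cutoff_cutoff:
  assumes "\<psi> \<in> schwartz_functions"
  shows "cutoff \<psi> (cutoff \<kappa> u) = cutoff (\<lambda>x. \<kappa> x * \<psi> x) u"
  unfolding cutoff_def by (intro ext) (auto simp: schwartz_mult assms mult.assoc)

text \<open>Multiplication by \<open>\<kappa>\<close> acts on transforms as convolution with \<open>(2\<pi>)\<^bsup>-n\<^esup>\<close> times the transform
  of \<open>\<kappa>\<close>, which is the reflected inverse transform.\<close>

lemma cutoff_spectrum:
  assumes T: "has_spectrum b s T h" and c: "\<kappa> \<in> schwartz_functions"
  shows "has_spectrum b s (cutoff \<kappa> T) (conv h (\<lambda>\<zeta>. inv_fourier \<kappa> (- \<zeta>)))"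
    and "weighted_sq_nn b s (absconv h (\<lambda>\<zeta>. inv_fourier \<kappa> (- \<zeta>))) < \<infinity>"
proof -
  let ?j = "\<lambda>\<zeta>. inv_fourier \<kappa> (- \<zeta>)"
  have h: "weighted_L2 b s h" using T by (simp add: has_spectrum_def)
  have hm: "h \<in> borel_measurable borel" by (rule weighted_L2_measurable[OF h])
  have j: "?j \<in> schwartz_functions" by (intro schwartz_reflect inv_fourier_schwartz c)
  obtain C where C: "C \<ge> 0" "\<And>h. h \<in> borel_measurable borel \<Longrightarrow> weighted_sq_nn b s (absconv h ?j) \<le> ennreal C * weighted_sq b s h"
    using absconv_schwartz_bound[OF j] by blast
  show fin: "weighted_sq_nn b s (absconv h ?j) < \<infinity>"
    using le_less_trans[OF C(2)[OF hm]] h by (simp add: weighted_L2_def ennreal_mult_less_top)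
  show "has_spectrum b s (cutoff \<kappa> T) (conv h ?j)"
    unfolding has_spectrum_def
  proof (intro conjI ballI)
    show "weighted_L2 b s (conv h ?j)" by (rule weighted_L2_conv[OF hm schwartz_measurable[OF j] fin])
    fix \<phi> :: "'a cfun" assume p: "\<phi> \<in> schwartz_functions"
    have "cutoff \<kappa> T \<phi> = (LINT \<xi>|lborel. h \<xi> * inv_fourier (\<lambda>x. \<kappa> x * \<phi> x) \<xi>)"
      using T schwartz_mult[OF c p] p by (simp add: cutoff_def has_spectrum_def)
    also have "\<dots> = (LINT \<xi>|lborel. h \<xi> * (LINT \<eta>|lborel. ?j (\<eta> - \<xi>) * inv_fourier \<phi> \<eta>))"
      unfolding inv_fourier_mult[OF c p] by simp
    also have "\<dots> = (LINT \<eta>|lborel. conv h ?j \<eta> * inv_fourier \<phi> \<eta>)"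
    proof (rule conv_fubini[symmetric, OF hm schwartz_measurable[OF j] _ fin])
      show "weighted_sq b (- s) (inv_fourier \<phi>) < \<infinity>" "inv_fourier \<phi> \<in> borel_measurable borel"
        using schwartz_weighted_L2[OF inv_fourier_schwartz[OF p], of b "- s"] by (auto simp: weighted_L2_def)
    qed
    finally show "cutoff \<kappa> T \<phi> = (LINT \<eta>|lborel. conv h ?j \<eta> * inv_fourier \<phi> \<eta>)" .
  qed
qed

lemma spectrum_sobolev:
  assumes "T \<in> extensional schwartz_functions" "has_spectrum b s T h"
  shows "T \<in> sobolev b s"
proof -
  have "T = of_spectrum h"
    using assms unfolding of_spectrum_def has_spectrum_def by (intro extensionalityI[OF assms(1)]) auto
  then show ?thesis using of_spectrum_sobolev(1)[of b s h] assms(2) by (simp add: has_spectrum_def)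
qed

lemma cutoff_extensional: "cutoff \<kappa> T \<in> extensional schwartz_functions"
  by (simp add: cutoff_def)

text \<open>For a fixed frequency the windowed transform is, as a function of the window position, the
  Fourier transform of an integrable function, so Plancherel's inequality in the window position
  reduces the bound to a convolution with the rapidly decreasing kernel. The two signs serve
  windows applied to distributions, where the kernel is reflected, and to test functions.\<close>

lemma localization_bound:
  fixes b :: "'n::finite \<Rightarrow> 'j::finite" and j :: "'n cfun"
  assumes j: "j \<in> schwartz_functions"
  obtains C where "C \<ge> 0" "\<And>h. weighted_L2 b t h \<Longrightarrow>
    (\<integral>\<^sup>+y. weighted_sq b t (conv h (\<lambda>\<zeta>. cis (y \<bullet> \<zeta>) * j \<zeta>)) \<partial>lborel) \<le> ennreal C * weighted_sq b t h"
    "\<And>h. weighted_L2 b t h \<Longrightarrow>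
    (\<integral>\<^sup>+y. weighted_sq b t (conv h (\<lambda>\<zeta>. cis (- (y \<bullet> \<zeta>)) * j \<zeta>)) \<partial>lborel) \<le> ennreal C * weighted_sq b t h"
proof -
  have [measurable]: "j \<in> borel_measurable borel" by (rule schwartz_measurable[OF j])
  obtain P where P: "P > 0" "\<And>\<xi> \<eta>. weight b t \<xi> \<le> P * weight b (abs_vec t) (\<xi> - \<eta>) * weight b t \<eta>"
    using weight_peetre by blast
  define J where "J = L2sq (\<lambda>\<zeta>. of_real (weight b (abs_vec t) \<zeta>) * j \<zeta>)"
  define C where "C = (2 * pi) ^ CARD('n) * (P\<^sup>2 * J)"
  have C0: "C \<ge> 0" using P(1) by (simp add: C_def J_def)
  have J: "(\<integral>\<^sup>+\<zeta>. ennreal ((norm (of_real (weight b (abs_vec t) \<zeta>) * j \<zeta>))\<^sup>2) \<partial>lborel) = ennreal J"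
    unfolding J_def using L2sq_nn_L2sq[OF schwartz_sqi[OF schwartz_weight[OF j]]] by (simp add: L2sq_nn_def)
  have plus: "(\<integral>\<^sup>+y. weighted_sq b t (conv h (\<lambda>\<zeta>. cis (y \<bullet> \<zeta>) * j \<zeta>)) \<partial>lborel) \<le> ennreal C * weighted_sq b t h"
    and meas: "(\<lambda>y. weighted_sq b t (conv h (\<lambda>\<zeta>. cis (y \<bullet> \<zeta>) * j \<zeta>))) \<in> borel_measurable borel"
    if h: "weighted_L2 b t h" for h
  proof -
    have [measurable]: "h \<in> borel_measurable borel" by (rule weighted_L2_measurable[OF h])
    show "(\<lambda>y. weighted_sq b t (conv h (\<lambda>\<zeta>. cis (y \<bullet> \<zeta>) * j \<zeta>))) \<in> borel_measurable borel"
      unfolding weighted_sq_def L2sq_nn_def conv_def by measurable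
    let ?w = "\<lambda>\<eta>. ennreal ((weight b t \<eta>)\<^sup>2)"
    let ?k = "\<lambda>\<eta> \<xi>. h \<xi> * j (\<eta> - \<xi>)"
    have nc: "norm (conv h (\<lambda>\<zeta>. cis (y \<bullet> \<zeta>) * j \<zeta>) \<eta>) = norm (fourier (?k \<eta>) y)" for y \<eta>
    proof -
      have "conv h (\<lambda>\<zeta>. cis (y \<bullet> \<zeta>) * j \<zeta>) \<eta> = (LINT \<xi>|lborel. cis (y \<bullet> \<eta>) * (cis (- (\<xi> \<bullet> y)) * ?k \<eta> \<xi>))"
        unfolding conv_def
      proof (intro Bochner_Integration.integral_cong refl)
        fix \<xi>
        have "cis (y \<bullet> (\<eta> - \<xi>)) = cis (y \<bullet> \<eta>) * cis (- (\<xi> \<bullet> y))"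
          by (simp add: cis_mult inner_diff_right inner_commute)
        then show "h \<xi> * (cis (y \<bullet> (\<eta> - \<xi>)) * j (\<eta> - \<xi>)) = cis (y \<bullet> \<eta>) * (cis (- (\<xi> \<bullet> y)) * ?k \<eta> \<xi>)"
          by simp
      qed
      also have "\<dots> = cis (y \<bullet> \<eta>) * fourier (?k \<eta>) y" unfolding fourier_def by (rule integral_mult_right_zero)
      finally show ?thesis by (simp add: norm_mult)
    qed
    have ki: "integrable lborel (?k \<eta>)" for \<eta>
    proof (rule weighted_L2_pair_integrable[OF h])
      have "(\<lambda>\<xi>. j (\<eta> - \<xi>)) \<in> schwartz_functions" using schwartz_affine[OF j, of "-1" \<eta>] by simp
      then show "weighted_L2 b (- t) (\<lambda>\<xi>. j (\<eta> - \<xi>))" by (rule schwartz_weighted_L2)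
    qed
    have "(\<integral>\<^sup>+y. weighted_sq b t (conv h (\<lambda>\<zeta>. cis (y \<bullet> \<zeta>) * j \<zeta>)) \<partial>lborel)
       = (\<integral>\<^sup>+y. (\<integral>\<^sup>+\<eta>. ?w \<eta> * ennreal ((norm (fourier (?k \<eta>) y))\<^sup>2) \<partial>lborel) \<partial>lborel)"
      unfolding weighted_sq_def L2sq_nn_def norm_mult nc by (simp add: power_mult_distrib ennreal_mult)
    also have "\<dots> = (\<integral>\<^sup>+\<eta>. (\<integral>\<^sup>+y. ?w \<eta> * ennreal ((norm (fourier (?k \<eta>) y))\<^sup>2) \<partial>lborel) \<partial>lborel)"
      unfolding fourier_def by (rule lborel_pair.Fubini') measurable
    also have "\<dots> \<le> (\<integral>\<^sup>+\<eta>. ?w \<eta> * (ennreal ((2 * pi) ^ CARD('n)) * L2sq_nn (?k \<eta>)) \<partial>lborel)"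
    proof (intro nn_integral_mono)
      fix \<eta>
      have "(\<integral>\<^sup>+y. ?w \<eta> * ennreal ((norm (fourier (?k \<eta>) y))\<^sup>2) \<partial>lborel) = ?w \<eta> * L2sq_nn (fourier (?k \<eta>))"
        unfolding L2sq_nn_def by (rule nn_integral_cmult) measurable
      also have "\<dots> \<le> ?w \<eta> * (ennreal ((2 * pi) ^ CARD('n)) * L2sq_nn (?k \<eta>))"
        by (intro mult_left_mono plancherel_inequality ki) auto
      finally show "(\<integral>\<^sup>+y. ?w \<eta> * ennreal ((norm (fourier (?k \<eta>) y))\<^sup>2) \<partial>lborel) \<le> ?w \<eta> * (ennreal ((2 * pi) ^ CARD('n)) * L2sq_nn (?k \<eta>))" .
    qed
    also have "\<dots> \<le> (\<integral>\<^sup>+\<eta>. ennreal ((2 * pi) ^ CARD('n)) * (\<integral>\<^sup>+\<xi>. ennreal ((norm (of_real (weight b t \<xi>) * h \<xi>))\<^sup>2) *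
        (ennreal (P\<^sup>2) * ennreal ((norm (of_real (weight b (abs_vec t) (\<eta> - \<xi>)) * j (\<eta> - \<xi>)))\<^sup>2)) \<partial>lborel) \<partial>lborel)"
    proof (intro nn_integral_mono)
      fix \<eta>
      have "?w \<eta> * (ennreal ((2 * pi) ^ CARD('n)) * L2sq_nn (?k \<eta>)) = ennreal ((2 * pi) ^ CARD('n)) * (\<integral>\<^sup>+\<xi>. ?w \<eta> * ennreal ((norm (?k \<eta> \<xi>))\<^sup>2) \<partial>lborel)"
        unfolding L2sq_nn_def by (subst nn_integral_cmult) (auto simp: mult_ac)
      also have "\<dots> \<le> ennreal ((2 * pi) ^ CARD('n)) * (\<integral>\<^sup>+\<xi>. ennreal ((norm (of_real (weight b t \<xi>) * h \<xi>))\<^sup>2) *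
        (ennreal (P\<^sup>2) * ennreal ((norm (of_real (weight b (abs_vec t) (\<eta> - \<xi>)) * j (\<eta> - \<xi>)))\<^sup>2)) \<partial>lborel)"
      proof (intro mult_left_mono nn_integral_mono)
        fix \<xi>
        have "weight b t \<eta> * norm (?k \<eta> \<xi>) \<le> (P * weight b (abs_vec t) (\<eta> - \<xi>) * weight b t \<xi>) * norm (?k \<eta> \<xi>)"
          by (intro mult_right_mono P) auto
        also have "\<dots> = norm (of_real (weight b t \<xi>) * h \<xi>) * (P * norm (of_real (weight b (abs_vec t) (\<eta> - \<xi>)) * j (\<eta> - \<xi>)))"
          by (simp add: norm_mult)
        finally have "(weight b t \<eta> * norm (?k \<eta> \<xi>))\<^sup>2 \<le> (norm (of_real (weight b t \<xi>) * h \<xi>) * (P * norm (of_real (weight b (abs_vec t) (\<eta> - \<xi>)) * j (\<eta> - \<xi>))))\<^sup>2"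
          by (intro power_mono) auto
        then show "?w \<eta> * ennreal ((norm (?k \<eta> \<xi>))\<^sup>2) \<le> ennreal ((norm (of_real (weight b t \<xi>) * h \<xi>))\<^sup>2) *
          (ennreal (P\<^sup>2) * ennreal ((norm (of_real (weight b (abs_vec t) (\<eta> - \<xi>)) * j (\<eta> - \<xi>)))\<^sup>2))"
          by (simp only: power_mult_distrib ennreal_mult[symmetric] zero_le_power2 mult_nonneg_nonneg ennreal_leI)
      qed auto
      finally show "?w \<eta> * (ennreal ((2 * pi) ^ CARD('n)) * L2sq_nn (?k \<eta>)) \<le> ennreal ((2 * pi) ^ CARD('n)) * (\<integral>\<^sup>+\<xi>. ennreal ((norm (of_real (weight b t \<xi>) * h \<xi>))\<^sup>2) *
        (ennreal (P\<^sup>2) * ennreal ((norm (of_real (weight b (abs_vec t) (\<eta> - \<xi>)) * j (\<eta> - \<xi>)))\<^sup>2)) \<partial>lborel)" .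
    qed
    also have "\<dots> = ennreal ((2 * pi) ^ CARD('n)) * (\<integral>\<^sup>+\<eta>. (\<integral>\<^sup>+\<xi>. ennreal ((norm (of_real (weight b t \<xi>) * h \<xi>))\<^sup>2) *
        (ennreal (P\<^sup>2) * ennreal ((norm (of_real (weight b (abs_vec t) (\<eta> - \<xi>)) * j (\<eta> - \<xi>)))\<^sup>2)) \<partial>lborel) \<partial>lborel)"
      by (rule nn_integral_cmult) measurable
    also have "(\<integral>\<^sup>+\<eta>. (\<integral>\<^sup>+\<xi>. ennreal ((norm (of_real (weight b t \<xi>) * h \<xi>))\<^sup>2) *
        (ennreal (P\<^sup>2) * ennreal ((norm (of_real (weight b (abs_vec t) (\<eta> - \<xi>)) * j (\<eta> - \<xi>)))\<^sup>2)) \<partial>lborel) \<partial>lborel)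
      = (\<integral>\<^sup>+\<xi>. (\<integral>\<^sup>+\<eta>. ennreal ((norm (of_real (weight b t \<xi>) * h \<xi>))\<^sup>2) *
        (ennreal (P\<^sup>2) * ennreal ((norm (of_real (weight b (abs_vec t) (\<eta> - \<xi>)) * j (\<eta> - \<xi>)))\<^sup>2)) \<partial>lborel) \<partial>lborel)"
      by (rule lborel_pair.Fubini') measurable
    also have "\<dots> = (\<integral>\<^sup>+\<xi>. ennreal ((norm (of_real (weight b t \<xi>) * h \<xi>))\<^sup>2) * (ennreal (P\<^sup>2) * ennreal J) \<partial>lborel)"
    proof (intro nn_integral_cong)
      fix \<xi> :: "real ^ 'n"
      have "(\<integral>\<^sup>+\<eta>. ennreal ((norm (of_real (weight b (abs_vec t) (\<eta> - \<xi>)) * j (\<eta> - \<xi>)))\<^sup>2) \<partial>lborel) = ennreal J"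
        using nn_integral_reflect(4)[of "\<lambda>\<zeta>. ennreal ((norm (of_real (weight b (abs_vec t) \<zeta>) * j \<zeta>))\<^sup>2)" \<xi>] J by simp
      then show "(\<integral>\<^sup>+\<eta>. ennreal ((norm (of_real (weight b t \<xi>) * h \<xi>))\<^sup>2) *
        (ennreal (P\<^sup>2) * ennreal ((norm (of_real (weight b (abs_vec t) (\<eta> - \<xi>)) * j (\<eta> - \<xi>)))\<^sup>2)) \<partial>lborel)
        = ennreal ((norm (of_real (weight b t \<xi>) * h \<xi>))\<^sup>2) * (ennreal (P\<^sup>2) * ennreal J)"
        by (simp add: nn_integral_cmult)
    qed
    also have "\<dots> = weighted_sq b t h * (ennreal (P\<^sup>2) * ennreal J)" unfolding weighted_sq_def L2sq_nn_def by (rule nn_integral_multc) measurable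
    also have "ennreal ((2 * pi) ^ CARD('n)) * (weighted_sq b t h * (ennreal (P\<^sup>2) * ennreal J)) = ennreal C * weighted_sq b t h"
      unfolding C_def J_def by (simp add: ennreal_mult mult_ac)
    finally show "(\<integral>\<^sup>+y. weighted_sq b t (conv h (\<lambda>\<zeta>. cis (y \<bullet> \<zeta>) * j \<zeta>)) \<partial>lborel) \<le> ennreal C * weighted_sq b t h" .
  qed
  have minus: "(\<integral>\<^sup>+y. weighted_sq b t (conv h (\<lambda>\<zeta>. cis (- (y \<bullet> \<zeta>)) * j \<zeta>)) \<partial>lborel) \<le> ennreal C * weighted_sq b t h" if h: "weighted_L2 b t h" for h
    using plus[OF h] nn_integral_reflect(1)[OF meas[OF h]] by simp
  show ?thesis by (rule that[OF C0 plus minus])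
qed

lemma inv_fourier_translate:
  assumes "\<kappa> \<in> schwartz_functions"
  shows "inv_fourier (translate y \<kappa>) \<zeta> = cis (y \<bullet> \<zeta>) * inv_fourier \<kappa> \<zeta>"
proof -
  have [measurable]: "\<kappa> \<in> borel_measurable borel" by (rule schwartz_measurable[OF assms])
  have "(LINT x|lborel. cis (x \<bullet> \<zeta>) * \<kappa> (x - y)) = (LINT x|lborel. cis ((x - y) \<bullet> \<zeta> + y \<bullet> \<zeta>) * \<kappa> (x - y))"
    by (simp add: inner_diff_left)
  also have "\<dots> = (LINT x|lborel. cis (x \<bullet> \<zeta> + y \<bullet> \<zeta>) * \<kappa> x)"
    using integral_reflect(4)[of "\<lambda>x. cis (x \<bullet> \<zeta> + y \<bullet> \<zeta>) * \<kappa> x" y] by simp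
  also have "\<dots> = (LINT x|lborel. cis (y \<bullet> \<zeta>) * (cis (x \<bullet> \<zeta>) * \<kappa> x))"
    by (intro Bochner_Integration.integral_cong refl) (simp add: cis_mult[symmetric] mult_ac)
  also have "\<dots> = cis (y \<bullet> \<zeta>) * (LINT x|lborel. cis (x \<bullet> \<zeta>) * \<kappa> x)" by (rule integral_mult_right_zero)
  finally show ?thesis unfolding inv_fourier_def translate_def inner_commute[of \<zeta>] by (simp only: mult.left_commute)
qed

text \<open>On the Fourier side all the functions \<open>\<tau>\<^sub>y\<theta> \<cdot> \<phi>\<close> have one common integrable majorant, which
  makes the average over \<open>y\<close> a matter of Fubini's theorem.\<close>

lemma averaging:
  fixes b :: "'n::finite \<Rightarrow> 'j::finite" and \<theta> \<phi> :: "'n cfun"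
  assumes W: "has_spectrum b \<sigma> W H" and th: "\<theta> \<in> test_functions" and ph: "\<phi> \<in> test_functions"
    and R: "\<And>x y. \<phi> x \<noteq> 0 \<Longrightarrow> \<theta> (x - y) \<noteq> 0 \<Longrightarrow> norm y < R"
  shows "integrable lborel (\<lambda>y. indicat_real (ball 0 R) y *\<^sub>R W (\<lambda>x. translate y \<theta> x * \<phi> x))"
    and "(LINT y|lborel. indicat_real (ball 0 R) y *\<^sub>R W (\<lambda>x. translate y \<theta> x * \<phi> x)) = (LINT x|lborel. \<theta> x) * W \<phi>"
proof -
  let ?I = "indicat_real (ball 0 R) :: real ^ 'n \<Rightarrow> real"
  have [measurable]: "?I \<in> borel_measurable borel" by (intro borel_measurable_indicator) simp
  have tS: "\<theta> \<in> schwartz_functions" and pS: "\<phi> \<in> schwartz_functions" using th ph test_schwartz by blast+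
  have [measurable]: "\<theta> \<in> borel_measurable borel" "\<phi> \<in> borel_measurable borel" using tS pS schwartz_measurable by blast+
  have H: "weighted_L2 b \<sigma> H" using W by (simp add: has_spectrum_def)
  have [measurable]: "H \<in> borel_measurable borel" by (rule weighted_L2_measurable[OF H])
  let ?c = "complex_of_real (1 / (2 * pi) ^ CARD('n))"
  define g where "g = (\<lambda>y \<zeta>. ?c * (LINT x|lborel. cis (x \<bullet> \<zeta>) * (\<theta> (x - y) * \<phi> x)))"
  have gm [measurable]: "(\<lambda>(y, \<zeta>). g y \<zeta>) \<in> borel_measurable (lborel \<Otimes>\<^sub>M lborel)" unfolding g_def by measurable
  have [measurable]: "(\<lambda>x. g (fst x) (snd x)) \<in> borel_measurable (lborel \<Otimes>\<^sub>M lborel)"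
    using gm by (simp add: case_prod_beta')
  have g: "g y \<zeta> = inv_fourier (\<lambda>x. translate y \<theta> x * \<phi> x) \<zeta>" for y \<zeta> unfolding g_def inv_fourier_def translate_def by (simp add: inner_commute[of \<zeta>])
  have tpS: "(\<lambda>x. translate y \<theta> x * \<phi> x) \<in> schwartz_functions" for y
    by (intro schwartz_mult schwartz_translate tS pS)
  have Wt: "W (\<lambda>x. translate y \<theta> x * \<phi> x) = (LINT \<zeta>|lborel. H \<zeta> * g y \<zeta>)" for y
    using W tpS unfolding has_spectrum_def g by blast
  let ?p = "inv_fourier \<phi>" and ?t = "inv_fourier \<theta>"
  have iS: "?p \<in> schwartz_functions" "?t \<in> schwartz_functions" by (auto intro: inv_fourier_schwartz tS pS)
  have [measurable]: "?p \<in> borel_measurable borel" "?t \<in> borel_measurable borel" using iS schwartz_measurable by blast+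
  have maj: "ennreal (norm (g y \<zeta>)) \<le> absconv ?p ?t \<zeta>" for y \<zeta>
  proof -
    have "g y \<zeta> = (LINT \<eta>|lborel. cis (y \<bullet> (\<zeta> - \<eta>)) * ?t (\<zeta> - \<eta>) * ?p \<eta>)"
      unfolding g inv_fourier_mult[OF schwartz_translate[OF tS] pS] inv_fourier_translate[OF tS] ..
    then have "ennreal (norm (g y \<zeta>)) \<le> (\<integral>\<^sup>+\<eta>. ennreal (norm (cis (y \<bullet> (\<zeta> - \<eta>)) * ?t (\<zeta> - \<eta>) * ?p \<eta>)) \<partial>lborel)"
      using norm_integral_le_nn by metis
    then show ?thesis unfolding absconv_def by (simp add: norm_mult mult.commute)
  qed
  have X: "(\<integral>\<^sup>+\<zeta>. absconv ?p ?t \<zeta> * ennreal (norm (H \<zeta>)) \<partial>lborel) < \<infinity>"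
  proof (rule absconv_pair_finite[of _ _ _ b "- \<sigma>"])
    obtain C where "C \<ge> 0" and C: "\<And>h. h \<in> borel_measurable borel \<Longrightarrow> weighted_sq_nn b (- \<sigma>) (absconv h ?t) \<le> ennreal C * weighted_sq b (- \<sigma>) h"
      using absconv_schwartz_bound[OF iS(2), of b "- \<sigma>"] by blast
    show "weighted_sq_nn b (- \<sigma>) (absconv ?p ?t) < \<infinity>"
      using le_less_trans[OF C[of ?p]] schwartz_weighted_L2[OF iS(1), of b "- \<sigma>"] by (simp add: weighted_L2_def ennreal_mult_less_top)
  qed (use H in \<open>auto simp: weighted_L2_def\<close>)
  have vol: "(\<integral>\<^sup>+y. ennreal (?I y) \<partial>lborel) < \<infinity>"
    using emeasure_lborel_ball_finite[of "0 :: real ^ 'n" R] by (simp add: ennreal_indicator)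
  have im: "(\<lambda>(y, \<zeta>). ?I y *\<^sub>R (H \<zeta> * g y \<zeta>)) \<in> borel_measurable (lborel \<Otimes>\<^sub>M lborel)"
  proof -
    have 1: "?I \<in> borel_measurable lborel" by (intro borel_measurable_indicator) simp
    have 2: "H \<in> borel_measurable lborel" by simp
    show ?thesis unfolding case_prod_beta'
      by (intro borel_measurable_scaleR borel_measurable_times measurable_compose[OF measurable_fst 1]
          measurable_compose[OF measurable_snd 2] gm[unfolded case_prod_beta'])
  qed
  then have im2: "(\<lambda>q. ennreal (norm (case q of (y, \<zeta>) \<Rightarrow> ?I y *\<^sub>R (H \<zeta> * g y \<zeta>)))) \<in> borel_measurable (lborel \<Otimes>\<^sub>M lborel)"
    by (intro measurable_compose[OF _ measurable_ennreal] measurable_compose[OF _ borel_measurable_norm])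
  have i: "integrable (lborel \<Otimes>\<^sub>M lborel) (\<lambda>(y, \<zeta>). ?I y *\<^sub>R (H \<zeta> * g y \<zeta>))"
  proof (rule integrableI_bounded)
    have "(\<integral>\<^sup>+q. ennreal (norm (case q of (y, \<zeta>) \<Rightarrow> ?I y *\<^sub>R (H \<zeta> * g y \<zeta>))) \<partial>(lborel \<Otimes>\<^sub>M lborel))
       = (\<integral>\<^sup>+y. (\<integral>\<^sup>+\<zeta>. ennreal (norm (?I y *\<^sub>R (H \<zeta> * g y \<zeta>))) \<partial>lborel) \<partial>lborel)"
      using lborel.nn_integral_fst[OF im2] by simp
    also have "\<dots> \<le> (\<integral>\<^sup>+y. (\<integral>\<^sup>+\<zeta>. ennreal (?I y) * (absconv ?p ?t \<zeta> * ennreal (norm (H \<zeta>))) \<partial>lborel) \<partial>lborel)"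
    proof (intro nn_integral_mono)
      fix y \<zeta> :: "real ^ 'n"
      have "ennreal (norm (?I y *\<^sub>R (H \<zeta> * g y \<zeta>))) = ennreal (?I y) * (ennreal (norm (g y \<zeta>)) * ennreal (norm (H \<zeta>)))"
        by (simp add: norm_mult ennreal_mult mult_ac)
      also have "\<dots> \<le> ennreal (?I y) * (absconv ?p ?t \<zeta> * ennreal (norm (H \<zeta>)))"
        by (intro mult_left_mono mult_right_mono maj) auto
      finally show "ennreal (norm (?I y *\<^sub>R (H \<zeta> * g y \<zeta>))) \<le> ennreal (?I y) * (absconv ?p ?t \<zeta> * ennreal (norm (H \<zeta>)))" .
    qed
    also have "\<dots> = (\<integral>\<^sup>+y. ennreal (?I y) \<partial>lborel) * (\<integral>\<^sup>+\<zeta>. absconv ?p ?t \<zeta> * ennreal (norm (H \<zeta>)) \<partial>lborel)"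
      by (simp add: nn_integral_cmult nn_integral_multc)
    also have "\<dots> < \<infinity>" using vol X by (simp add: ennreal_mult_less_top)
    finally show "(\<integral>\<^sup>+q. ennreal (norm (case q of (y, \<zeta>) \<Rightarrow> ?I y *\<^sub>R (H \<zeta> * g y \<zeta>))) \<partial>(lborel \<Otimes>\<^sub>M lborel)) < \<infinity>" .
  qed (rule im)
  have eq: "?I y *\<^sub>R W (\<lambda>x. translate y \<theta> x * \<phi> x) = (LINT \<zeta>|lborel. ?I y *\<^sub>R (H \<zeta> * g y \<zeta>))" for y
    unfolding Wt by simp
  show "integrable lborel (\<lambda>y. ?I y *\<^sub>R W (\<lambda>x. translate y \<theta> x * \<phi> x))"
    unfolding eq using lborel_pair.integrable_fst'[OF i] by simp
  have inner: "(LINT y|lborel. ?I y *\<^sub>R g y \<zeta>) = (LINT x|lborel. \<theta> x) * ?p \<zeta>" for \<zeta>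
  proof -
    obtain B where B: "\<And>x. norm (\<theta> x) \<le> B" using schwartz_bound0[OF tS, of 0] by auto
    have B0: "B \<ge> 0" using order_trans[OF norm_ge_zero B] .
    have i2: "integrable (lborel \<Otimes>\<^sub>M lborel) (\<lambda>(y, x). ?I y *\<^sub>R (cis (x \<bullet> \<zeta>) * (\<theta> (x - y) * \<phi> x)))"
    proof (rule Bochner_Integration.integrable_bound)
      have "integrable lborel (\<lambda>y. complex_of_real (?I y * B))"
        using emeasure_lborel_ball_finite[of "0 :: real ^ 'n" R] by (intro integrable_of_real integrable_mult_left) (simp add: less_top)
      from integrable_pair_mult[OF this schwartz_integrable[OF pS]]
      show "integrable (lborel \<Otimes>\<^sub>M lborel) (\<lambda>(y, x). complex_of_real (?I y * B) * \<phi> x)" .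
      show "AE q in lborel \<Otimes>\<^sub>M lborel. norm (case q of (y, x) \<Rightarrow> ?I y *\<^sub>R (cis (x \<bullet> \<zeta>) * (\<theta> (x - y) * \<phi> x))) \<le> norm (case q of (y, x) \<Rightarrow> complex_of_real (?I y * B) * \<phi> x)"
        using B B0 by (intro AE_I2) (auto simp: norm_mult mult.assoc intro!: mult_left_mono mult_right_mono split: prod.split)
    qed measurable
    have "(LINT y|lborel. ?I y *\<^sub>R g y \<zeta>) = (LINT y|lborel. ?c * (LINT x|lborel. ?I y *\<^sub>R (cis (x \<bullet> \<zeta>) * (\<theta> (x - y) * \<phi> x))))"
      unfolding g_def by (intro Bochner_Integration.integral_cong refl) simp
    also have "\<dots> = ?c * (LINT y|lborel. (LINT x|lborel. ?I y *\<^sub>R (cis (x \<bullet> \<zeta>) * (\<theta> (x - y) * \<phi> x))))"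
      by (rule integral_mult_right_zero)
    also have "(LINT y|lborel. (LINT x|lborel. ?I y *\<^sub>R (cis (x \<bullet> \<zeta>) * (\<theta> (x - y) * \<phi> x))))
       = (LINT x|lborel. (LINT y|lborel. ?I y *\<^sub>R (cis (x \<bullet> \<zeta>) * (\<theta> (x - y) * \<phi> x))))"
      using lborel_pair.Fubini_integral[OF i2] by simp
    also have "\<dots> = (LINT x|lborel. (LINT x|lborel. \<theta> x) * (cis (x \<bullet> \<zeta>) * \<phi> x))"
    proof (intro Bochner_Integration.integral_cong refl)
      fix x
      have "(LINT y|lborel. ?I y *\<^sub>R (cis (x \<bullet> \<zeta>) * (\<theta> (x - y) * \<phi> x))) = (LINT y|lborel. (cis (x \<bullet> \<zeta>) * \<phi> x) * \<theta> (x - y))"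
      proof (intro Bochner_Integration.integral_cong refl)
        fix y
        (* R is so large that the ball contains every y for which the product is nonzero. *)
        show "?I y *\<^sub>R (cis (x \<bullet> \<zeta>) * (\<theta> (x - y) * \<phi> x)) = (cis (x \<bullet> \<zeta>) * \<phi> x) * \<theta> (x - y)"
          using R[of x y] by (cases "\<phi> x = 0 \<or> \<theta> (x - y) = 0") (auto simp: mult_ac)
      qed
      also have "\<dots> = (cis (x \<bullet> \<zeta>) * \<phi> x) * (LINT x|lborel. \<theta> x)"
        using integral_reflect(2)[of \<theta> x] by simp
      finally show "(LINT y|lborel. ?I y *\<^sub>R (cis (x \<bullet> \<zeta>) * (\<theta> (x - y) * \<phi> x))) = (LINT x|lborel. \<theta> x) * (cis (x \<bullet> \<zeta>) * \<phi> x)"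
        by (simp add: mult_ac)
    qed
    also have "\<dots> = (LINT x|lborel. \<theta> x) * (LINT x|lborel. cis (x \<bullet> \<zeta>) * \<phi> x)" by (rule integral_mult_right_zero)
    finally show ?thesis unfolding inv_fourier_def by (simp add: mult_ac inner_commute[of \<zeta>])
  qed
  have "(LINT y|lborel. ?I y *\<^sub>R W (\<lambda>x. translate y \<theta> x * \<phi> x)) = (LINT y|lborel. (LINT \<zeta>|lborel. ?I y *\<^sub>R (H \<zeta> * g y \<zeta>)))"
    unfolding eq ..
  also have "\<dots> = (LINT \<zeta>|lborel. (LINT y|lborel. ?I y *\<^sub>R (H \<zeta> * g y \<zeta>)))"
    using lborel_pair.Fubini_integral[OF i] by simp
  also have "\<dots> = (LINT \<zeta>|lborel. (LINT x|lborel. \<theta> x) * (H \<zeta> * ?p \<zeta>))"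
  proof (intro Bochner_Integration.integral_cong refl)
    fix \<zeta>
    have "(LINT y|lborel. ?I y *\<^sub>R (H \<zeta> * g y \<zeta>)) = (LINT y|lborel. H \<zeta> * (?I y *\<^sub>R g y \<zeta>))"
      by (intro Bochner_Integration.integral_cong refl) simp
    also have "\<dots> = H \<zeta> * (LINT y|lborel. ?I y *\<^sub>R g y \<zeta>)" by (rule integral_mult_right_zero)
    finally show "(LINT y|lborel. ?I y *\<^sub>R (H \<zeta> * g y \<zeta>)) = (LINT x|lborel. \<theta> x) * (H \<zeta> * ?p \<zeta>)"
      unfolding inner by (simp add: mult_ac)
  qed
  also have "\<dots> = (LINT x|lborel. \<theta> x) * (LINT \<zeta>|lborel. H \<zeta> * ?p \<zeta>)" by (rule integral_mult_right_zero)
  finally show "(LINT y|lborel. ?I y *\<^sub>R W (\<lambda>x. translate y \<theta> x * \<phi> x)) = (LINT x|lborel. \<theta> x) * W \<phi>"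
    using W pS unfolding has_spectrum_def by simp
qed

section \<open>Products on the Fourier side\<close>

lemma conv_commute:
  assumes [measurable]: "h \<in> borel_measurable borel" "k \<in> borel_measurable borel"
  shows "conv h k = conv k h"
proof
  fix \<eta>
  show "conv h k \<eta> = conv k h \<eta>"
    unfolding conv_def using integral_reflect(2)[of "\<lambda>\<xi>. h \<xi> * k (\<eta> - \<xi>)" \<eta>] by (simp add: mult.commute)
qed

lemma absconv_commute:
  assumes [measurable]: "h \<in> borel_measurable borel" "k \<in> borel_measurable borel"
  shows "absconv h k = absconv k h"
proof
  fix \<eta>
  show "absconv h k \<eta> = absconv k h \<eta>"
    unfolding absconv_def using nn_integral_reflect(2)[of "\<lambda>\<xi>. ennreal (norm (h \<xi>) * norm (k (\<eta> - \<xi>)))" \<eta>]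
    by (simp add: mult.commute)
qed

lemma transform_pairing_commute:
  assumes [measurable]: "h \<in> borel_measurable borel" "k \<in> borel_measurable borel"
  shows "transform_pairing h k = transform_pairing k h"
  unfolding transform_pairing_def using integral_reflect(1)[of "\<lambda>\<xi>. h \<xi> * k (- \<xi>)"] by (simp add: mult.commute)

lemma transform_pairing_cong_AE:
  assumes "AE \<xi> in lborel. h \<xi> = h' \<xi>" and [measurable]: "h \<in> borel_measurable borel" "h' \<in> borel_measurable borel" "k \<in> borel_measurable borel"
  shows "transform_pairing h k = transform_pairing h' k"
  unfolding transform_pairing_def using assms(1) by (intro Bochner_Integration.integral_cong_AE) auto

lemma has_spectrum_mono: "has_spectrum b t T h \<Longrightarrow> (\<And>l. s $ l \<le> t $ l) \<Longrightarrow> has_spectrum b s T h"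
  unfolding has_spectrum_def using weighted_L2_mono by blast

lemma has_spectrum_weighted_L2: "has_spectrum b t T h \<Longrightarrow> weighted_L2 b t h"
  by (simp add: has_spectrum_def)

lemma has_spectrum_measurable: "has_spectrum b t T h \<Longrightarrow> h \<in> borel_measurable borel"
  using has_spectrum_weighted_L2 weighted_L2_measurable by blast

lemma weighted_L2_sum:
  assumes "finite Y" "\<And>y. y \<in> Y \<Longrightarrow> weighted_L2 b s (h y)"
  shows "weighted_L2 b s (\<lambda>\<xi>. \<Sum>y\<in>Y. h y \<xi>)"
  using assms
proof (induction Y rule: finite_induct)
  case empty
  then show ?case using schwartz_weighted_L2[OF schwartz_zero] by simp
next
  case (insert y Y)
  then have "square_integrable (\<lambda>\<xi>. 1 * (of_real (weight b s \<xi>) * h y \<xi>) + 1 * (of_real (weight b s \<xi>) * (\<Sum>y\<in>Y. h y \<xi>)))"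
    by (intro sqi_lin) (auto simp: weighted_L2_sqi[symmetric])
  then show ?case unfolding weighted_L2_sqi using insert by (simp add: distrib_left)
qed

lemma has_spectrum_sum:
  fixes b :: "'n::finite \<Rightarrow> 'j::finite" and h :: "'a \<Rightarrow> 'n cfun"
  assumes Y: "finite Y" and T: "\<And>y. y \<in> Y \<Longrightarrow> has_spectrum b s (T y) (h y)"
    and T0: "\<And>\<phi>. \<phi> \<in> schwartz_functions \<Longrightarrow> T0 \<phi> = (\<Sum>y\<in>Y. T y \<phi>)"
  shows "has_spectrum b s T0 (\<lambda>\<xi>. \<Sum>y\<in>Y. h y \<xi>)"
  unfolding has_spectrum_def
proof (intro conjI ballI)
  show "weighted_L2 b s (\<lambda>\<xi>. \<Sum>y\<in>Y. h y \<xi>)" by (intro weighted_L2_sum Y has_spectrum_weighted_L2[OF T])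
  fix \<phi> :: "'n cfun" assume p: "\<phi> \<in> schwartz_functions"
  have i: "integrable lborel (\<lambda>\<xi>. h y \<xi> * inv_fourier \<phi> \<xi>)" if "y \<in> Y" for y
    by (intro weighted_L2_pair_integrable[OF has_spectrum_weighted_L2[OF T[OF that]]] schwartz_weighted_L2 inv_fourier_schwartz p)
  have "T0 \<phi> = (\<Sum>y\<in>Y. LINT \<xi>|lborel. h y \<xi> * inv_fourier \<phi> \<xi>)"
    unfolding T0[OF p] using T p by (intro sum.cong refl) (simp add: has_spectrum_def)
  also have "\<dots> = (LINT \<xi>|lborel. (\<Sum>y\<in>Y. h y \<xi> * inv_fourier \<phi> \<xi>))"
    using i by (intro Bochner_Integration.integral_sum[symmetric]) auto
  finally show "T0 \<phi> = (LINT \<xi>|lborel. (\<Sum>y\<in>Y. h y \<xi>) * inv_fourier \<phi> \<xi>)" by (simp add: sum_distrib_right)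
qed

lemma spectrum_CS:
  assumes W: "has_spectrum b s W H" and p: "\<psi> \<in> schwartz_functions"
  shows "(ennreal (norm (W \<psi>)))\<^sup>2 \<le> weighted_sq b s H * weighted_sq b (- s) (inv_fourier \<psi>)"
proof -
  have "ennreal (norm (W \<psi>)) \<le> (\<integral>\<^sup>+\<xi>. ennreal (norm (H \<xi>) * norm (inv_fourier \<psi> \<xi>)) \<partial>lborel)"
    using W p norm_integral_le_nn[of lborel "\<lambda>\<xi>. H \<xi> * inv_fourier \<psi> \<xi>"] by (simp add: has_spectrum_def norm_mult)
  then have "(ennreal (norm (W \<psi>)))\<^sup>2 \<le> (\<integral>\<^sup>+\<xi>. ennreal (norm (H \<xi>) * norm (inv_fourier \<psi> \<xi>)) \<partial>lborel)\<^sup>2"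
    by (rule power_mono_ennreal)
  also have "\<dots> \<le> weighted_sq b s H * weighted_sq b (- s) (inv_fourier \<psi>)"
    by (intro weighted_L2_pair_CS has_spectrum_measurable[OF W] schwartz_measurable inv_fourier_schwartz p)
  finally show ?thesis .
qed

text \<open>The weighted convolution estimate in a form that is symmetric in the two factors, so that
  every consequence can also be used with \<open>s\<close> and \<open>t\<close> exchanged.\<close>

locale product_estimate =
  fixes b :: "'n::finite \<Rightarrow> 'j::finite" and s t \<sigma> :: "real ^ 'j" and M :: real
  assumes M0: "M \<ge> 0" and st: "\<And>l. 0 \<le> s $ l + t $ l"
    and est: "\<And>h k. h \<in> borel_measurable borel \<Longrightarrow> k \<in> borel_measurable borel \<Longrightarrow>
        weighted_sq_nn b \<sigma> (absconv h k) \<le> ennreal M * (weighted_sq b s h * weighted_sq b t k)"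
begin

lemma swap: "product_estimate b t s \<sigma> M"
proof
  show "0 \<le> t $ l + s $ l" for l using st[of l] by simp
  fix h k :: "'n cfun" assume "h \<in> borel_measurable borel" "k \<in> borel_measurable borel"
  then show "weighted_sq_nn b \<sigma> (absconv h k) \<le> ennreal M * (weighted_sq b t h * weighted_sq b s k)"
    using est[of k h] absconv_commute[of h k] by (simp add: mult.commute)
qed (rule M0)

lemma t_ge: "(- s) $ l \<le> t $ l"
  using st[of l] by simp

lemma product_finite:
  assumes "weighted_L2 b s h" "weighted_L2 b t k" shows "weighted_sq_nn b \<sigma> (absconv h k) < \<infinity>"
  using le_less_trans[OF est[of h k]] assms by (auto simp: weighted_L2_def ennreal_mult_less_top)

lemma product_spectrum:
  assumes "weighted_L2 b s h" "weighted_L2 b t k"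
  shows "weighted_L2 b \<sigma> (conv h k)" "has_spectrum b \<sigma> (of_spectrum (conv h k)) (conv h k)"
proof -
  show "weighted_L2 b \<sigma> (conv h k)"
    using assms weighted_L2_conv[OF _ _ product_finite[OF assms]] by (auto simp: weighted_L2_def)
  then show "has_spectrum b \<sigma> (of_spectrum (conv h k)) (conv h k)" by (rule of_spectrum_sobolev)
qed

text \<open>Pairing a localized factor with the other one is evaluating the product at the cut-off.\<close>

lemma transform_pairing_cutoff:
  assumes U: "has_spectrum b s U h" and k: "weighted_L2 b t k" and c: "\<kappa> \<in> schwartz_functions"
    and h': "has_spectrum b r (cutoff \<kappa> U) h'"
  shows "transform_pairing h' k = of_spectrum (conv h k) \<kappa>"
proof -
  let ?j = "\<lambda>\<zeta>. inv_fourier \<kappa> (- \<zeta>)"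
  have h: "weighted_L2 b s h" by (rule has_spectrum_weighted_L2[OF U])
  have [measurable]: "h \<in> borel_measurable borel" "k \<in> borel_measurable borel" "h' \<in> borel_measurable borel"
    using h k has_spectrum_measurable[OF h'] by (auto simp: weighted_L2_def)
  have iS: "inv_fourier \<kappa> \<in> schwartz_functions" by (rule inv_fourier_schwartz[OF c])
  have [measurable]: "inv_fourier \<kappa> \<in> borel_measurable borel" by (rule schwartz_measurable[OF iS])
  note cs = cutoff_spectrum[OF U c]
  have mj: "?j \<in> borel_measurable borel" by measurable
  have "weighted_L2 b (- s) k" by (rule weighted_L2_mono[OF k t_ge])
  then have kr: "weighted_L2 b (- s) (\<lambda>\<xi>. k (- \<xi>))" by (rule weighted_L2_reflect)
  have "transform_pairing h' k = transform_pairing (conv h ?j) k"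
    by (intro transform_pairing_cong_AE spectrum_unique[OF h' cs(1)] measurable_conv mj) measurable
  also have "\<dots> = (LINT \<xi>|lborel. h \<xi> * (LINT \<eta>|lborel. ?j (\<eta> - \<xi>) * k (- \<eta>)))"
    unfolding transform_pairing_def by (rule conv_fubini[OF _ mj _ cs(2)]) (use kr in \<open>auto simp: weighted_L2_def\<close>)
  also have "\<dots> = (LINT \<xi>|lborel. h \<xi> * (LINT \<eta>|lborel. k (\<eta> - \<xi>) * inv_fourier \<kappa> \<eta>))"
  proof -
    have "(LINT \<eta>|lborel. ?j (\<eta> - \<xi>) * k (- \<eta>)) = (LINT \<eta>|lborel. k (\<eta> - \<xi>) * inv_fourier \<kappa> \<eta>)" for \<xi>
      using integral_reflect(2)[of "\<lambda>\<eta>. k (\<eta> - \<xi>) * inv_fourier \<kappa> \<eta>" \<xi>] by (simp add: mult.commute)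
    then show ?thesis by (simp only:)
  qed
  also have "\<dots> = (LINT \<eta>|lborel. conv h k \<eta> * inv_fourier \<kappa> \<eta>)"
  proof -
    have fin: "weighted_sq b (- \<sigma>) (inv_fourier \<kappa>) < \<infinity>" using schwartz_weighted_L2[OF iS, of b "- \<sigma>"] by (simp add: weighted_L2_def)
    show ?thesis by (rule conv_fubini[symmetric, OF _ _ _ product_finite[OF h k] fin]) measurable
  qed
  finally show ?thesis using c by (simp add: of_spectrum_def)
qed

lemma transform_pairing_cutoff_right:
  assumes h: "weighted_L2 b s h" and V: "has_spectrum b t V k" and c: "\<kappa> \<in> schwartz_functions"
    and k': "has_spectrum b r (cutoff \<kappa> V) k'"
  shows "transform_pairing h k' = of_spectrum (conv h k) \<kappa>"
proof -
  interpret S: product_estimate b t s \<sigma> M by (rule swap)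
  have "h \<in> borel_measurable borel" "k \<in> borel_measurable borel" "k' \<in> borel_measurable borel"
    using h has_spectrum_measurable V k' by (auto simp: weighted_L2_def)
  then show ?thesis
    using S.transform_pairing_cutoff[OF V h c k'] transform_pairing_commute[of h k'] conv_commute[of h k] by simp
qed

end

section \<open>Uniformly local spaces\<close>

lemma distribution_sum:
  assumes u: "linear_functional_on test_functions u" and Y: "finite Y" and f: "\<And>y. y \<in> Y \<Longrightarrow> f y \<in> test_functions"
  shows "u (\<lambda>x. \<Sum>y\<in>Y. f y x) = (\<Sum>y\<in>Y. u (f y)) \<and> (\<lambda>x. \<Sum>y\<in>Y. f y x) \<in> test_functions"
  using Y f
proof (induction Y rule: finite_induct)
  case empty
  have "u (\<lambda>x. 0 * 0 + 0 * 0) = 0 * u (\<lambda>x. 0) + 0 * u (\<lambda>x. 0)"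
    by (rule u[unfolded linear_functional_on_def, rule_format, OF test_zero test_zero])
  then show ?case by (simp add: test_zero)
next
  case (insert y Y)
  have "u (\<lambda>x. 1 * f y x + 1 * (\<Sum>y\<in>Y. f y x)) = 1 * u (f y) + 1 * u (\<lambda>x. \<Sum>y\<in>Y. f y x)"
    by (rule u[unfolded linear_functional_on_def, rule_format]) (use insert in auto)
  moreover have "(\<lambda>x. 1 * f y x + 1 * (\<Sum>y\<in>Y. f y x)) \<in> test_functions"
    using insert by (intro test_lin) auto
  ultimately show ?case using insert by simp
qed

text \<open>A nonzero window can be inverted near any compact set after summing finitely many
  translates of its modulus squared.\<close>

lemma window_decomposition:
  fixes \<omega> \<phi> :: "'n::finite cfun"
  assumes w: "\<omega> \<in> test_functions" "\<omega> x0 \<noteq> 0" and p: "\<phi> \<in> test_functions"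
  obtains Y \<Phi> where "finite Y" "\<And>y. \<Phi> y \<in> test_functions" "\<And>x. \<phi> x = (\<Sum>y\<in>Y. translate y \<omega> x * \<Phi> y x)"
proof -
  have K: "compact (supp \<phi>)" using p by (simp add: test_functions_def)
  have sw: "smooth \<omega>" by (rule test_smooth[OF w(1)])
  have st: "smooth (translate y \<omega>)" for y by (rule test_smooth[OF test_translate[OF w(1)]])
  let ?U = "\<lambda>y. {x. translate y \<omega> x \<noteq> 0}"
  have "open (?U y)" for y
    using smooth_continuous[OF st, of UNIV] by (intro open_Collect_neq continuous_on_const) auto
  moreover have "supp \<phi> \<subseteq> (\<Union>y\<in>UNIV. ?U y)"
  proof
    fix x
    have "translate (x - x0) \<omega> x \<noteq> 0" using w(2) by (simp add: translate_def)
    then show "x \<in> (\<Union>y\<in>UNIV. ?U y)" by blast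
  qed
  ultimately obtain Y where Y: "finite Y" "supp \<phi> \<subseteq> (\<Union>y\<in>Y. ?U y)"
    using compactE_image[OF K, of UNIV ?U] by metis
  define Q where "Q = (\<lambda>x. \<Sum>y\<in>Y. translate y \<omega> x * cnj (translate y \<omega> x))"
  have Qs: "smooth Q" unfolding Q_def by (intro smooth_sum smooth_mult smooth_cnj st)
  have Q0: "Q x \<noteq> 0" if "x \<in> supp \<phi>" for x
  proof -
    obtain y where y: "y \<in> Y" "translate y \<omega> x \<noteq> 0" using Y(2) \<open>x \<in> supp \<phi>\<close> by blast
    have "Q x = of_real (\<Sum>y\<in>Y. (norm (translate y \<omega> x))\<^sup>2)"
      unfolding Q_def of_real_sum by (intro sum.cong refl) (simp only: complex_norm_square)
    moreover have "(\<Sum>y\<in>Y. (norm (translate y \<omega> x))\<^sup>2) > 0"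
      using y Y(1) by (intro sum_pos2[of _ y]) auto
    ultimately show ?thesis by (metis of_real_eq_0_iff less_irrefl)
  qed
  define q where "q = (\<lambda>x. \<phi> x / Q x)"
  have qt: "q \<in> test_functions"
    unfolding q_def
  proof (rule test_functionsI[OF _ K])
    show "smooth (\<lambda>x. \<phi> x / Q x)"
      by (rule smooth_quotient[OF closed_supp test_smooth[OF p] _ Qs Q0]) (auto simp: not_in_supp)
  qed (simp add: not_in_supp)
  show ?thesis
  proof (rule that[OF Y(1)])
    show "(\<lambda>x. q x * cnj (translate y \<omega> x)) \<in> test_functions" for y
      by (intro test_mult_smooth qt smooth_cnj st)
    fix x
    have "(\<Sum>y\<in>Y. translate y \<omega> x * (q x * cnj (translate y \<omega> x))) = q x * Q x"
      unfolding Q_def by (simp add: sum_distrib_left mult_ac)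
    also have "\<dots> = \<phi> x"
      using Q0[of x] not_in_supp[of x \<phi>] by (cases "x \<in> supp \<phi>") (auto simp: q_def)
    finally show "\<phi> x = (\<Sum>y\<in>Y. translate y \<omega> x * (q x * cnj (translate y \<omega> x)))" by simp
  qed
qed

text \<open>This transfers Sobolev regularity from the windows \<open>w y\<close> to \<open>\<phi>\<close>.\<close>

lemma cutoff_sum:
  assumes u: "linear_functional_on test_functions u" and Y: "finite Y"
    and w: "\<And>y. y \<in> Y \<Longrightarrow> w y \<in> test_functions" and P: "\<And>y. \<Phi> y \<in> test_functions"
    and p: "\<And>x. \<phi> x = (\<Sum>y\<in>Y. w y x * \<Phi> y x)" and g: "g \<in> schwartz_functions"
  shows "cutoff \<phi> u g = (\<Sum>y\<in>Y. cutoff (\<Phi> y) (cutoff (w y) u) g)"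
proof -
  have "cutoff \<phi> u g = u (\<lambda>x. \<Sum>y\<in>Y. (w y x * \<Phi> y x) * g x)"
    using g by (simp add: cutoff_def p sum_distrib_right)
  also have "\<dots> = (\<Sum>y\<in>Y. u (\<lambda>x. (w y x * \<Phi> y x) * g x))"
    using distribution_sum[OF u Y, of "\<lambda>y x. (w y x * \<Phi> y x) * g x"]
      test_mult_smooth[OF test_mult_smooth[OF w test_smooth[OF P]] schwartz_smooth[OF g]] by blast
  also have "\<dots> = (\<Sum>y\<in>Y. cutoff (\<Phi> y) (cutoff (w y) u) g)"
    unfolding cutoff_cutoff[OF test_schwartz[OF P]] using g by (simp add: cutoff_def)
  finally show ?thesis .
qed

lemma nn_CS_pointwise:
  fixes A F G :: "'a::euclidean_space \<Rightarrow> ennreal"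
  assumes [measurable]: "F \<in> borel_measurable borel" "G \<in> borel_measurable borel"
    and fin: "\<And>y. F y < \<infinity>" "\<And>y. G y < \<infinity>" and le: "\<And>y. (A y)\<^sup>2 \<le> F y * G y"
  shows "(\<integral>\<^sup>+y. A y \<partial>lborel)\<^sup>2 \<le> (\<integral>\<^sup>+y. F y \<partial>lborel) * (\<integral>\<^sup>+y. G y \<partial>lborel)"
proof -
  let ?f = "\<lambda>y. ennreal (sqrt (enn2real (F y)))" let ?g = "\<lambda>y. ennreal (sqrt (enn2real (G y)))"
  have f: "(?f y)\<^sup>2 = F y" and g: "(?g y)\<^sup>2 = G y" for y
    using fin[of y] by (simp_all add: ennreal_power)
  have "A y \<le> ?f y * ?g y" for y
  proof (rule ccontr)
    assume "\<not> A y \<le> ?f y * ?g y"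
    then have "?f y * ?g y < A y" by simp
    moreover have "(?f y * ?g y)\<^sup>2 \<ge> (A y)\<^sup>2" using le[of y] by (simp add: power_mult_distrib f g)
    ultimately show False
    proof -
      assume a: "?f y * ?g y < A y" and b: "(A y)\<^sup>2 \<le> (?f y * ?g y)\<^sup>2"
      have ft: "?f y * ?g y < \<top>" by (simp add: ennreal_mult_less_top)
      have "(A y)\<^sup>2 < \<top>" using b ft by (metis ennreal_mult_less_top le_less_trans power2_eq_square)
      then have "A y < \<top>" by (cases "A y") (auto simp: power2_eq_square)
      then obtain p q where pq: "A y = ennreal p" "p \<ge> 0" "?f y * ?g y = ennreal q" "q \<ge> 0"
        using ft by (metis less_top ennreal_cases)
      have "q < p" using a pq by (simp add: ennreal_less_iff)
      moreover have "p\<^sup>2 \<le> q\<^sup>2" using b unfolding pq(1,3) using pq(2,4) by (simp add: ennreal_power)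
      ultimately show False using pq(2,4) power2_le_imp_le[of p q] by simp
    qed
  qed
  then have "(\<integral>\<^sup>+y. A y \<partial>lborel)\<^sup>2 \<le> (\<integral>\<^sup>+y. ?f y * ?g y \<partial>lborel)\<^sup>2"
    by (intro power_mono_ennreal nn_integral_mono)
  also have "\<dots> \<le> (\<integral>\<^sup>+y. (?f y)\<^sup>2 \<partial>lborel) * (\<integral>\<^sup>+y. (?g y)\<^sup>2 \<partial>lborel)"
    by (rule Cauchy_Schwarz_nn_integral) measurable
  finally show ?thesis unfolding f g .
qed

text \<open>\<open>u\<close> is uniformly local of order \<open>s\<close> with window \<open>\<omega>\<close> and bound \<open>B\<close>, and \<open>V\<close> has order \<open>t\<close> with
  transform \<open>k\<close>.\<close>

locale ul_product = product_estimate b s t \<sigma> M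
  for b :: "'n::finite \<Rightarrow> 'j::finite" and s t \<sigma> :: "real ^ 'j" and M :: real +
  fixes u :: "'n cfunctional" and \<omega> :: "'n cfun" and B :: real and V :: "'n cfunctional" and k :: "'n cfun"
  assumes u: "u \<in> distributions" and w: "\<omega> \<in> test_functions" "\<omega> \<noteq> (\<lambda>x. 0)"
    and cut: "\<And>y. cutoff (translate y \<omega>) u \<in> sobolev b s"
    and bnd: "\<And>y. sobolev_norm b s (cutoff (translate y \<omega>) u) \<le> B"
    and V: "has_spectrum b t V k"
begin

lemma lin: "linear_functional_on test_functions u"
  using u by (simp add: distributions_def)

lemma k: "weighted_L2 b t k"
  by (rule has_spectrum_weighted_L2[OF V])

lemma window: "translate y \<omega> \<in> test_functions" "translate y \<omega> \<in> schwartz_functions"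
  using test_translate[OF w(1)] test_schwartz by auto

lemma local_spectrum:
  assumes p: "\<phi> \<in> test_functions"
  shows "\<exists>h. has_spectrum b s (cutoff \<phi> u) h"
proof -
  obtain x0 where x0: "\<omega> x0 \<noteq> 0" using w(2) by blast
  obtain Y \<Phi> where Y: "finite Y" and P: "\<And>y. \<Phi> y \<in> test_functions" and e: "\<And>x. \<phi> x = (\<Sum>y\<in>Y. translate y \<omega> x * \<Phi> y x)"
    using window_decomposition[OF w(1) x0 p] by blast
  have "\<exists>h. has_spectrum b s (cutoff (translate y \<omega>) u) h" for y using sobolev_spectrum[OF cut] by metis
  then obtain h where h: "\<And>y. has_spectrum b s (cutoff (translate y \<omega>) u) (h y)" by metis
  show ?thesis
    by (rule exI, rule has_spectrum_sum[OF Y cutoff_spectrum(1)[OF h test_schwartz[OF P]]])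
       (rule cutoff_sum[OF lin Y window(1) P e])
qed

text \<open>Only the localizations of \<open>u\<close> have transforms. Pairing that of \<open>\<phi>u\<close> with \<open>k\<close> gives, up to a
  constant, \<open>\<langle>uV, \<phi>\<rangle>\<close>.\<close>

definition local_transform :: "'n cfun \<Rightarrow> 'n cfun" where
  "local_transform \<phi> = (SOME h. has_spectrum b s (cutoff \<phi> u) h)"

lemma local_transform: "\<phi> \<in> test_functions \<Longrightarrow> has_spectrum b s (cutoff \<phi> u) (local_transform \<phi>)"
  unfolding local_transform_def by (rule someI_ex[OF local_spectrum])

lemma local_transform_weighted_L2: "\<phi> \<in> test_functions \<Longrightarrow> weighted_L2 b s (local_transform \<phi>)"
  by (rule has_spectrum_weighted_L2[OF local_transform])

lemma local_transform_window: "weighted_sq b s (local_transform (translate y \<omega>)) \<le> ennreal ((2 * pi) ^ CARD('n) * B\<^sup>2)"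
proof -
  have "weighted_sq b s (local_transform (translate y \<omega>)) \<le> ennreal ((2 * pi) ^ CARD('n) * (sobolev_norm b s (cutoff (translate y \<omega>) u))\<^sup>2)"
    by (rule spectrum_norm[OF cut local_transform[OF window(1)]])
  also have "\<dots> \<le> ennreal ((2 * pi) ^ CARD('n) * B\<^sup>2)"
    using bnd[of y] by (intro ennreal_leI mult_left_mono power_mono) (auto simp: sobolev_norm_def L2_norm_def)
  finally show ?thesis .
qed

text \<open>The pairing tested on \<open>\<phi>\<psi>\<close> is the product of \<open>\<phi>u\<close> and \<open>V\<close>, a genuine element of \<open>H\<^sup>\<sigma>\<close>,
  tested on \<open>\<psi>\<close>.\<close>

lemma transform_pairing_product:
  assumes "\<phi> \<in> test_functions" "\<psi> \<in> test_functions"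
  shows "transform_pairing (local_transform (\<lambda>x. \<phi> x * \<psi> x)) k = of_spectrum (conv (local_transform \<phi>) k) \<psi>"
proof (rule transform_pairing_cutoff[OF local_transform[OF assms(1)] k test_schwartz[OF assms(2)]])
  show "has_spectrum b s (cutoff \<psi> (cutoff \<phi> u)) (local_transform (\<lambda>x. \<phi> x * \<psi> x))"
    unfolding cutoff_cutoff[OF test_schwartz[OF assms(2)]]
    by (intro local_transform test_mult_smooth assms test_smooth)
qed

lemma transform_pairing_decomposition:
  assumes Y: "finite Y" and P: "\<And>y. \<Phi> y \<in> test_functions" and p: "\<phi> \<in> test_functions"
    and e: "\<And>x. \<phi> x = (\<Sum>y\<in>Y. translate y \<omega> x * \<Phi> y x)"
  shows "transform_pairing (local_transform \<phi>) k = (\<Sum>y\<in>Y. of_spectrum (conv (local_transform (translate y \<omega>)) k) (\<Phi> y))"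
proof -
  define h where "h y = local_transform (\<lambda>x. translate y \<omega> x * \<Phi> y x)" for y
  have ht: "(\<lambda>x. translate y \<omega> x * \<Phi> y x) \<in> test_functions" for y
    by (intro test_mult_smooth window test_smooth P)
  have hs: "has_spectrum b s (cutoff (\<Phi> y) (cutoff (translate y \<omega>) u)) (h y)" for y
    unfolding cutoff_cutoff[OF test_schwartz[OF P]] h_def by (rule local_transform[OF ht])
  have S: "has_spectrum b s (cutoff \<phi> u) (\<lambda>\<xi>. \<Sum>y\<in>Y. h y \<xi>)"
    by (rule has_spectrum_sum[OF Y hs]) (rule cutoff_sum[OF lin Y window(1) P e])
  have km: "k \<in> borel_measurable borel" using k by (simp add: weighted_L2_def)
  have kr: "weighted_L2 b (- s) (\<lambda>\<xi>. k (- \<xi>))" by (intro weighted_L2_reflect weighted_L2_mono[OF k t_ge])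
  have "transform_pairing (local_transform \<phi>) k = transform_pairing (\<lambda>\<xi>. \<Sum>y\<in>Y. h y \<xi>) k"
    by (intro transform_pairing_cong_AE spectrum_unique[OF local_transform[OF p] S] has_spectrum_measurable[OF local_transform[OF p]] has_spectrum_measurable[OF S] km)
  also have "\<dots> = (\<Sum>y\<in>Y. transform_pairing (h y) k)"
    unfolding transform_pairing_def sum_distrib_right
    by (intro Bochner_Integration.integral_sum weighted_L2_pair_integrable[OF has_spectrum_weighted_L2[OF hs] kr])
  also have "\<dots> = (\<Sum>y\<in>Y. of_spectrum (conv (local_transform (translate y \<omega>)) k) (\<Phi> y))"
    unfolding h_def by (simp add: transform_pairing_product window P)
  finally show ?thesis .
qed

text \<open>Averaging is known for distributions with a transform. On multiples of \<open>\<phi>\<close> the pairing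
  is a finite sum of such distributions, since finitely many windows suffice for \<open>\<phi>\<close>.\<close>

lemma transform_pairing_average:
  assumes p: "\<phi> \<in> test_functions" and th: "\<theta> \<in> test_functions"
  obtains R where "(LINT x|lborel. \<theta> x) * transform_pairing (local_transform \<phi>) k
    = (LINT y|lborel. indicat_real (ball 0 R) y *\<^sub>R transform_pairing (local_transform (\<lambda>x. translate y \<theta> x * \<phi> x)) k)"
proof -
  obtain x0 where x0: "\<omega> x0 \<noteq> 0" using w(2) by blast
  obtain Y \<Phi> where Y: "finite Y" and P: "\<And>y. \<Phi> y \<in> test_functions" and e: "\<And>x. \<phi> x = (\<Sum>z\<in>Y. translate z \<omega> x * \<Phi> z x)"
    using window_decomposition[OF w(1) x0 p] by blast
  let ?W = "\<lambda>z. of_spectrum (conv (local_transform (translate z \<omega>)) k)"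
  have "bounded (\<Union>z\<in>Y. supp (\<Phi> z))"
    using Y P by (intro bounded_UN) (auto simp: test_functions_def compact_imp_bounded)
  then obtain r1 where r1: "\<And>x. x \<in> (\<Union>z\<in>Y. supp (\<Phi> z)) \<Longrightarrow> norm x \<le> r1" unfolding bounded_iff by blast
  have "bounded (supp \<theta>)" using th by (simp add: test_functions_def compact_imp_bounded)
  then obtain r2 where r2: "\<And>x. x \<in> supp \<theta> \<Longrightarrow> norm x \<le> r2" unfolding bounded_iff by blast
  define R where "R = r1 + r2 + 1"
  have R: "norm y < R" if "z \<in> Y" "\<Phi> z x \<noteq> 0" "\<theta> (x - y) \<noteq> 0" for x y z
  proof -
    have "norm x \<le> r1" using r1[of x] not_in_supp[of x "\<Phi> z"] that by blast
    moreover have "norm (x - y) \<le> r2" using r2[of "x - y"] not_in_supp[of "x - y" \<theta>] that by blast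
    moreover have "norm y \<le> norm x + norm (x - y)" using norm_triangle_ineq4[of x "x - y"] by simp
    ultimately show ?thesis by (simp add: R_def)
  qed
  have Ws: "has_spectrum b \<sigma> (?W z) (conv (local_transform (translate z \<omega>)) k)" for z
    by (intro product_spectrum local_transform_weighted_L2 window k)
  note av = averaging[OF Ws th P R]
  have tP: "(\<lambda>x. translate y \<theta> x * \<Phi> z x) \<in> test_functions" for y z
    by (intro test_mult_smooth test_translate th test_smooth P)
  have tp: "(\<lambda>x. translate y \<theta> x * \<phi> x) \<in> test_functions" for y
    by (intro test_mult_smooth test_translate th test_smooth p)
  have "(LINT x|lborel. \<theta> x) * transform_pairing (local_transform \<phi>) k = (\<Sum>z\<in>Y. (LINT x|lborel. \<theta> x) * ?W z (\<Phi> z))"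
    unfolding transform_pairing_decomposition[OF Y P p e] by (rule sum_distrib_left)
  also have "\<dots> = (\<Sum>z\<in>Y. LINT y|lborel. indicat_real (ball 0 R) y *\<^sub>R ?W z (\<lambda>x. translate y \<theta> x * \<Phi> z x))"
    by (intro sum.cong refl av(2)[symmetric])
  also have "\<dots> = (LINT y|lborel. (\<Sum>z\<in>Y. indicat_real (ball 0 R) y *\<^sub>R ?W z (\<lambda>x. translate y \<theta> x * \<Phi> z x)))"
    by (intro Bochner_Integration.integral_sum[symmetric] av(1))
  also have "\<dots> = (LINT y|lborel. indicat_real (ball 0 R) y *\<^sub>R transform_pairing (local_transform (\<lambda>x. translate y \<theta> x * \<phi> x)) k)"
  proof (intro Bochner_Integration.integral_cong refl)
    fix y
    have "transform_pairing (local_transform (\<lambda>x. translate y \<theta> x * \<phi> x)) k = (\<Sum>z\<in>Y. ?W z (\<lambda>x. translate y \<theta> x * \<Phi> z x))"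
      by (rule transform_pairing_decomposition[OF Y tP tp]) (simp add: e sum_distrib_left mult_ac)
    then show "(\<Sum>z\<in>Y. indicat_real (ball 0 R) y *\<^sub>R ?W z (\<lambda>x. translate y \<theta> x * \<Phi> z x))
      = indicat_real (ball 0 R) y *\<^sub>R transform_pairing (local_transform (\<lambda>x. translate y \<theta> x * \<phi> x)) k"
      by (simp add: scaleR_sum_right)
  qed
  finally show ?thesis by (rule that)
qed

text \<open>One window factor goes to each of \<open>u\<close> and \<open>V\<close>.\<close>

lemma transform_pairing_window:
  assumes p: "\<psi> \<in> test_functions"
  shows "transform_pairing (local_transform (\<lambda>x. translate y \<omega> x * (\<psi> x * translate y \<omega> x))) k
    = of_spectrum (conv (local_transform (translate y \<omega>)) (conv k (\<lambda>\<zeta>. inv_fourier (translate y \<omega>) (- \<zeta>)))) \<psi>"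
proof -
  let ?w = "translate y \<omega>"
  let ?k = "conv k (\<lambda>\<zeta>. inv_fourier ?w (- \<zeta>))"
  have pw: "(\<lambda>x. ?w x * \<psi> x) \<in> test_functions" by (intro test_mult_smooth window test_smooth p)
  have ky: "has_spectrum b t (cutoff ?w V) ?k" by (rule cutoff_spectrum(1)[OF V window(2)])
  have h: "has_spectrum b s (cutoff \<psi> (cutoff ?w u)) (local_transform (\<lambda>x. ?w x * \<psi> x))"
    unfolding cutoff_cutoff[OF test_schwartz[OF p]] by (rule local_transform[OF pw])
  have "transform_pairing (local_transform (\<lambda>x. (?w x * \<psi> x) * ?w x)) k = of_spectrum (conv (local_transform (\<lambda>x. ?w x * \<psi> x)) k) ?w"
    by (rule transform_pairing_product[OF pw window(1)])
  also have "\<dots> = transform_pairing (local_transform (\<lambda>x. ?w x * \<psi> x)) ?k"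
    by (rule transform_pairing_cutoff_right[symmetric, OF local_transform_weighted_L2[OF pw] V window(2) ky])
  also have "\<dots> = of_spectrum (conv (local_transform ?w) ?k) \<psi>"
    by (rule transform_pairing_cutoff[OF local_transform[OF window(1)] has_spectrum_weighted_L2[OF ky] test_schwartz[OF p] h])
  finally show ?thesis by (simp add: mult.assoc)
qed

text \<open>This is \<open>|\<omega>|\<^sup>4\<close>, grouped into a window for \<open>u\<close>, one for the test function, and one for \<open>V\<close>.\<close>

definition \<theta> :: "'n cfun" where "\<theta> x = \<omega> x * (cnj (\<omega> x * \<omega> x) * \<omega> x)"

lemma theta_test: "\<theta> \<in> test_functions"
  unfolding \<theta>_def[abs_def] by (intro test_mult_smooth smooth_mult smooth_cnj test_smooth w)

text \<open>Otherwise \<open>\<omega>\<close> vanishes almost everywhere, so its transform is zero, and by inversion \<open>\<omega>\<close> is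
  zero everywhere.\<close>

lemma theta_integral: "(LINT x|lborel. \<theta> x) \<noteq> 0"
proof
  assume z: "(LINT x|lborel. \<theta> x) = 0"
  have e: "\<theta> x = of_real ((norm (\<omega> x))\<^sup>2 * (norm (\<omega> x))\<^sup>2)" for x
    unfolding \<theta>_def of_real_mult complex_norm_square by simp
  have i: "integrable lborel (\<lambda>x. (norm (\<omega> x))\<^sup>2 * (norm (\<omega> x))\<^sup>2)"
    using integrable_Re[OF schwartz_integrable[OF test_schwartz[OF theta_test]]] unfolding e by simp
  have "complex_of_real (LINT x|lborel. (norm (\<omega> x))\<^sup>2 * (norm (\<omega> x))\<^sup>2) = 0"
    using z unfolding e integral_complex_of_real .
  then have "(LINT x|lborel. (norm (\<omega> x))\<^sup>2 * (norm (\<omega> x))\<^sup>2) = 0" by (simp only: of_real_eq_0_iff)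
  then have "AE x in lborel. (norm (\<omega> x))\<^sup>2 * (norm (\<omega> x))\<^sup>2 = 0"
    by (subst (asm) integral_nonneg_eq_0_iff_AE[OF i]) auto
  then have ae: "AE x in lborel. \<omega> x = 0" by eventually_elim simp
  have wS: "\<omega> \<in> schwartz_functions" by (rule test_schwartz[OF w(1)])
  have [measurable]: "\<omega> \<in> borel_measurable borel" by (rule schwartz_measurable[OF wS])
  have "fourier \<omega> \<xi> = 0" for \<xi>
  proof -
    have "fourier \<omega> \<xi> = (LINT x|(lborel :: (real ^ 'n) measure). 0)"
      unfolding fourier_def using ae by (intro Bochner_Integration.integral_cong_AE) auto
    then show ?thesis by simp
  qed
  then have "inv_fourier (fourier \<omega>) = (\<lambda>x. 0)" by (simp add: inv_fourier_def fun_eq_iff)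
  then show False using w(2) inv_fourier_fourier[OF wS] by simp
qed

text \<open>For every window position \<open>y\<close> the convolution estimate applies to the localized \<open>u\<close> and \<open>V\<close>,
  tested on the localized \<open>\<phi>\<close>. The first norm is bounded uniformly in \<open>y\<close>; the squares of the
  other two, \<open>?F\<close> and \<open>?G\<close> below, have integrals over \<open>y\<close> controlled by the global norms.\<close>

lemma transform_pairing_bound:
  obtains C where "C \<ge> 0" "\<And>\<phi>. \<phi> \<in> test_functions \<Longrightarrow>
    (norm (transform_pairing (local_transform \<phi>) k))\<^sup>2 \<le> C * L2sq (\<lambda>\<xi>. of_real (weight b (- \<sigma>) \<xi>) * inv_fourier \<phi> \<xi>)"
proof -
  define j where "j = (\<lambda>\<zeta>. inv_fourier \<omega> (- \<zeta>))"
  define \<rho> where "\<rho> = (\<lambda>x. cnj (\<omega> x * \<omega> x))"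
  have wS: "\<omega> \<in> schwartz_functions" by (rule test_schwartz[OF w(1)])
  have jS: "j \<in> schwartz_functions" unfolding j_def by (intro schwartz_reflect inv_fourier_schwartz wS)
  have rt: "\<rho> \<in> test_functions" unfolding \<rho>_def by (intro test_cnj test_mult_smooth w test_smooth)
  have rS: "\<rho> \<in> schwartz_functions" by (rule test_schwartz[OF rt])
  have irS: "inv_fourier \<rho> \<in> schwartz_functions" by (rule inv_fourier_schwartz[OF rS])
  have [measurable]: "k \<in> borel_measurable borel" "j \<in> borel_measurable borel" "inv_fourier \<rho> \<in> borel_measurable borel"
    using k jS irS schwartz_measurable by (auto simp: weighted_L2_def)
  obtain C1 where C1: "C1 \<ge> 0" "(\<integral>\<^sup>+y. weighted_sq b t (conv k (\<lambda>\<zeta>. cis (- (y \<bullet> \<zeta>)) * j \<zeta>)) \<partial>lborel) \<le> ennreal C1 * weighted_sq b t k"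
    by (rule localization_bound[OF jS, of b t], rule that, assumption) (use k in blast)
  obtain C2 where C2: "C2 \<ge> 0" "\<And>h. weighted_L2 b (- \<sigma>) h \<Longrightarrow>
      (\<integral>\<^sup>+y. weighted_sq b (- \<sigma>) (conv h (\<lambda>\<zeta>. cis (y \<bullet> \<zeta>) * inv_fourier \<rho> \<zeta>)) \<partial>lborel) \<le> ennreal C2 * weighted_sq b (- \<sigma>) h"
    by (rule localization_bound[OF irS, of b "- \<sigma>"], rule that, assumption) blast
  define S where "S = (2 * pi) ^ CARD('n) * B\<^sup>2"
  have S0: "S \<ge> 0" by (simp add: S_def)
  define \<kappa> where "\<kappa> = L2sq (\<lambda>\<xi>. of_real (weight b t \<xi>) * k \<xi>)"
  have kk: "weighted_sq b t k = ennreal \<kappa>" unfolding \<kappa>_def by (rule weighted_sq_L2sq[OF k])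
  have k0: "\<kappa> \<ge> 0" by (simp add: \<kappa>_def)
  define I where "I = norm (LINT x|lborel. \<theta> x)"
  have I0: "I > 0" using theta_integral by (simp add: I_def)
  define D where "D = (M * S) * (C1 * \<kappa>) * C2"
  have D0: "D \<ge> 0" using M0 S0 C1(1) k0 C2(1) by (simp add: D_def)
  have "(norm (transform_pairing (local_transform \<phi>) k))\<^sup>2 \<le> D / I\<^sup>2 * L2sq (\<lambda>\<xi>. of_real (weight b (- \<sigma>) \<xi>) * inv_fourier \<phi> \<xi>)"
    if p: "\<phi> \<in> test_functions" for \<phi>
  proof -
    have pS: "\<phi> \<in> schwartz_functions" by (rule test_schwartz[OF p])
    have ipS: "inv_fourier \<phi> \<in> schwartz_functions" by (rule inv_fourier_schwartz[OF pS])
    have [measurable]: "inv_fourier \<phi> \<in> borel_measurable borel" by (rule schwartz_measurable[OF ipS])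
    let ?N = "L2sq (\<lambda>\<xi>. of_real (weight b (- \<sigma>) \<xi>) * inv_fourier \<phi> \<xi>)"
    obtain R where R: "(LINT x|lborel. \<theta> x) * transform_pairing (local_transform \<phi>) k
      = (LINT y|lborel. indicat_real (ball 0 R) y *\<^sub>R transform_pairing (local_transform (\<lambda>x. translate y \<theta> x * \<phi> x)) k)"
      using transform_pairing_average[OF p theta_test] by blast
    let ?A = "\<lambda>y. transform_pairing (local_transform (\<lambda>x. translate y \<theta> x * \<phi> x)) k"
    let ?F = "\<lambda>y. weighted_sq b t (conv k (\<lambda>\<zeta>. cis (- (y \<bullet> \<zeta>)) * j \<zeta>))"
    let ?G = "\<lambda>y. weighted_sq b (- \<sigma>) (conv (inv_fourier \<phi>) (\<lambda>\<zeta>. cis (y \<bullet> \<zeta>) * inv_fourier \<rho> \<zeta>))"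
    have [measurable]: "?F \<in> borel_measurable borel" "?G \<in> borel_measurable borel"
      unfolding weighted_sq_def L2sq_nn_def conv_def by measurable
    have A: "(ennreal (norm (?A y)))\<^sup>2 \<le> (ennreal (M * S) * ?F y) * ?G y" and F: "?F y < \<infinity>" and G: "?G y < \<infinity>" for y
    proof -
      define \<psi> where "\<psi> = (\<lambda>x. translate y \<rho> x * \<phi> x)"
      have ps: "\<psi> \<in> test_functions" unfolding \<psi>_def by (intro test_mult_smooth test_translate rt test_smooth p)
      have psS: "\<psi> \<in> schwartz_functions" by (rule test_schwartz[OF ps])
      have jy: "(\<lambda>\<zeta>. inv_fourier (translate y \<omega>) (- \<zeta>)) = (\<lambda>\<zeta>. cis (- (y \<bullet> \<zeta>)) * j \<zeta>)"
        unfolding inv_fourier_translate[OF wS] j_def by simp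
      have ky: "has_spectrum b t (cutoff (translate y \<omega>) V) (conv k (\<lambda>\<zeta>. cis (- (y \<bullet> \<zeta>)) * j \<zeta>))"
        using cutoff_spectrum(1)[OF V window(2)[of y]] unfolding jy .
      show F: "?F y < \<infinity>" using has_spectrum_weighted_L2[OF ky] by (simp add: weighted_L2_def)
      have ip: "inv_fourier \<psi> = conv (inv_fourier \<phi>) (\<lambda>\<zeta>. cis (y \<bullet> \<zeta>) * inv_fourier \<rho> \<zeta>)"
      proof
        fix \<xi>
        show "inv_fourier \<psi> \<xi> = conv (inv_fourier \<phi>) (\<lambda>\<zeta>. cis (y \<bullet> \<zeta>) * inv_fourier \<rho> \<zeta>) \<xi>"
          unfolding \<psi>_def inv_fourier_mult[OF schwartz_translate[OF rS] pS] inv_fourier_translate[OF rS] conv_def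
          by (intro Bochner_Integration.integral_cong refl) (simp only: mult_ac)
      qed
      show "?G y < \<infinity>"
        using schwartz_weighted_L2[OF inv_fourier_schwartz[OF psS], of b "- \<sigma>"] unfolding ip by (simp add: weighted_L2_def)
      have fe: "(\<lambda>x. translate y \<theta> x * \<phi> x) = (\<lambda>x. translate y \<omega> x * (\<psi> x * translate y \<omega> x))"
        unfolding \<psi>_def \<rho>_def translate_def \<theta>_def by (simp add: mult_ac)
      let ?h = "local_transform (translate y \<omega>)" let ?k = "conv k (\<lambda>\<zeta>. cis (- (y \<bullet> \<zeta>)) * j \<zeta>)"
      have Ae: "?A y = of_spectrum (conv ?h ?k) \<psi>"
        unfolding fe transform_pairing_window[OF ps] jy ..
      have hw: "weighted_L2 b s ?h" by (rule local_transform_weighted_L2[OF window(1)])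
      have "(ennreal (norm (?A y)))\<^sup>2 \<le> weighted_sq b \<sigma> (conv ?h ?k) * weighted_sq b (- \<sigma>) (inv_fourier \<psi>)"
        unfolding Ae by (rule spectrum_CS[OF product_spectrum(2)[OF hw has_spectrum_weighted_L2[OF ky]] psS])
      also have "\<dots> \<le> (ennreal M * (weighted_sq b s ?h * ?F y)) * weighted_sq b (- \<sigma>) (inv_fourier \<psi>)"
      proof (intro mult_right_mono)
        show "weighted_sq b \<sigma> (conv ?h ?k) \<le> ennreal M * (weighted_sq b s ?h * ?F y)"
          using weighted_sq_conv_le[of b \<sigma> ?h ?k] est[of ?h ?k] weighted_L2_measurable[OF hw] has_spectrum_measurable[OF ky] by (auto intro: order_trans)
      qed auto
      also have "\<dots> \<le> (ennreal M * (ennreal S * ?F y)) * weighted_sq b (- \<sigma>) (inv_fourier \<psi>)"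
        using local_transform_window[of y] by (intro mult_right_mono mult_left_mono) (auto simp: S_def)
      also have "\<dots> = (ennreal (M * S) * ?F y) * ?G y" unfolding ip using M0 S0 by (simp add: ennreal_mult mult.assoc)
      finally show "(ennreal (norm (?A y)))\<^sup>2 \<le> (ennreal (M * S) * ?F y) * ?G y" .
    qed
    have "ennreal (I * norm (transform_pairing (local_transform \<phi>) k)) = ennreal (norm (LINT y|lborel. indicat_real (ball 0 R) y *\<^sub>R ?A y))"
      unfolding R[symmetric] I_def by (simp add: norm_mult)
    also have "\<dots> \<le> (\<integral>\<^sup>+y. ennreal (norm (indicat_real (ball 0 R) y *\<^sub>R ?A y)) \<partial>lborel)"
      by (rule norm_integral_le_nn)
    also have "\<dots> \<le> (\<integral>\<^sup>+y. ennreal (norm (?A y)) \<partial>lborel)"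
      by (intro nn_integral_mono ennreal_leI) (simp split: split_indicator)
    finally have "(ennreal (I * norm (transform_pairing (local_transform \<phi>) k)))\<^sup>2 \<le> (\<integral>\<^sup>+y. ennreal (norm (?A y)) \<partial>lborel)\<^sup>2"
      by (rule power_mono_ennreal)
    also have "\<dots> \<le> (\<integral>\<^sup>+y. ennreal (M * S) * ?F y \<partial>lborel) * (\<integral>\<^sup>+y. ?G y \<partial>lborel)"
      by (rule nn_CS_pointwise[OF _ _ _ G A]) (use F in \<open>auto simp: ennreal_mult_less_top\<close>)
    also have "(\<integral>\<^sup>+y. ennreal (M * S) * ?F y \<partial>lborel) = ennreal (M * S) * (\<integral>\<^sup>+y. ?F y \<partial>lborel)"
      by (rule nn_integral_cmult) measurable
    also have "ennreal (M * S) * (\<integral>\<^sup>+y. ?F y \<partial>lborel) * (\<integral>\<^sup>+y. ?G y \<partial>lborel)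
       \<le> ennreal (M * S) * (ennreal C1 * ennreal \<kappa>) * (ennreal C2 * ennreal ?N)"
      using C1(2) C2(2)[OF schwartz_weighted_L2[OF ipS]] unfolding kk weighted_sq_L2sq[OF schwartz_weighted_L2[OF ipS]]
      by (intro mult_mono) auto
    also have "\<dots> = ennreal (D * ?N)"
      unfolding D_def using M0 S0 C1(1) k0 C2(1) by (simp add: ennreal_mult mult_ac)
    finally have "ennreal ((I * norm (transform_pairing (local_transform \<phi>) k))\<^sup>2) \<le> ennreal (D * ?N)" using I0 by (simp add: ennreal_power)
    then have "(I * norm (transform_pairing (local_transform \<phi>) k))\<^sup>2 \<le> D * ?N" using D0 by simp
    then show ?thesis using I0 by (simp add: power_mult_distrib field_simps)
  qed
  then show ?thesis using that[of "D / I\<^sup>2"] D0 by simp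
qed

lemma transform_pairing_linear:
  assumes p: "\<phi> \<in> test_functions" "\<psi> \<in> test_functions"
  shows "transform_pairing (local_transform (\<lambda>x. a * \<phi> x + c * \<psi> x)) k = a * transform_pairing (local_transform \<phi>) k + c * transform_pairing (local_transform \<psi>) k"
proof -
  let ?h = "\<lambda>\<xi>. a * local_transform \<phi> \<xi> + c * local_transform \<psi> \<xi>"
  have w1: "weighted_L2 b s (local_transform \<phi>)" and w2: "weighted_L2 b s (local_transform \<psi>)" by (intro local_transform_weighted_L2 p)+
  have S: "has_spectrum b s (cutoff (\<lambda>x. a * \<phi> x + c * \<psi> x) u) ?h"
    unfolding has_spectrum_def
  proof (intro conjI ballI)
    have "square_integrable (\<lambda>\<xi>. a * (of_real (weight b s \<xi>) * local_transform \<phi> \<xi>) + c * (of_real (weight b s \<xi>) * local_transform \<psi> \<xi>))"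
      using w1 w2 unfolding weighted_L2_sqi by (rule sqi_lin)
    then show "weighted_L2 b s ?h" unfolding weighted_L2_sqi by (simp add: algebra_simps)
    fix g :: "'n cfun" assume g: "g \<in> schwartz_functions"
    have t: "(\<lambda>x. \<phi> x * g x) \<in> test_functions" "(\<lambda>x. \<psi> x * g x) \<in> test_functions"
      by (intro test_mult_smooth p schwartz_smooth g)+
    have "cutoff (\<lambda>x. a * \<phi> x + c * \<psi> x) u g = u (\<lambda>x. a * (\<phi> x * g x) + c * (\<psi> x * g x))"
      using g by (simp add: cutoff_def algebra_simps)
    also have "\<dots> = a * cutoff \<phi> u g + c * cutoff \<psi> u g"
      using lin t g unfolding linear_functional_on_def by (simp add: cutoff_def)
    also have "\<dots> = a * (LINT \<xi>|lborel. local_transform \<phi> \<xi> * inv_fourier g \<xi>) + c * (LINT \<xi>|lborel. local_transform \<psi> \<xi> * inv_fourier g \<xi>)"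
      using local_transform[OF p(1)] local_transform[OF p(2)] g by (simp add: has_spectrum_def)
    also have "\<dots> = (LINT \<xi>|lborel. a * (local_transform \<phi> \<xi> * inv_fourier g \<xi>) + c * (local_transform \<psi> \<xi> * inv_fourier g \<xi>))"
    proof -
      have "weighted_L2 b (- s) (inv_fourier g)" by (intro schwartz_weighted_L2 inv_fourier_schwartz g)
      note i = integrable_mult_right[OF weighted_L2_pair_integrable[OF w1 this]] integrable_mult_right[OF weighted_L2_pair_integrable[OF w2 this]]
      show ?thesis by (subst Bochner_Integration.integral_add[OF i]) simp
    qed
    finally show "cutoff (\<lambda>x. a * \<phi> x + c * \<psi> x) u g = (LINT \<xi>|lborel. ?h \<xi> * inv_fourier g \<xi>)"
      by (simp add: algebra_simps)
  qed
  have km: "k \<in> borel_measurable borel" using k by (simp add: weighted_L2_def)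
  have kr: "weighted_L2 b (- s) (\<lambda>\<xi>. k (- \<xi>))" by (intro weighted_L2_reflect weighted_L2_mono[OF k t_ge])
  note spl = local_transform[OF test_lin[OF p, of a c]]
  have "transform_pairing (local_transform (\<lambda>x. a * \<phi> x + c * \<psi> x)) k = transform_pairing ?h k"
    by (intro transform_pairing_cong_AE spectrum_unique[OF spl S] has_spectrum_measurable[OF spl] has_spectrum_measurable[OF S] km)
  also have "\<dots> = (LINT \<xi>|lborel. a * (local_transform \<phi> \<xi> * k (- \<xi>)) + c * (local_transform \<psi> \<xi> * k (- \<xi>)))"
    unfolding transform_pairing_def by (simp add: algebra_simps)
  also have "\<dots> = a * transform_pairing (local_transform \<phi>) k + c * transform_pairing (local_transform \<psi>) k"
    unfolding transform_pairing_def
    by (subst Bochner_Integration.integral_add[OF integrable_mult_right[OF weighted_L2_pair_integrable[OF w1 kr]]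
          integrable_mult_right[OF weighted_L2_pair_integrable[OF w2 kr]]]) simp
  finally show ?thesis .
qed

text \<open>\<open>E\<close> is an isometry from the test functions with the \<open>H\<^bsup>-\<sigma>\<^esup>\<close> norm into \<open>L\<^sup>2\<close> (up to a constant), and \<open>L\<close>
  is the pairing transported to its range, where it is bounded and therefore represented by a
  square-integrable function.\<close>

lemma product_exists:
  obtains H where "weighted_L2 b \<sigma> H" "\<And>\<phi>. \<phi> \<in> test_functions \<Longrightarrow> transform_pairing (local_transform \<phi>) k = (LINT \<xi>|lborel. H \<xi> * inv_fourier \<phi> \<xi>)"
proof -
  obtain C where C: "C \<ge> 0" "\<And>\<phi>. \<phi> \<in> test_functions \<Longrightarrow>
    (norm (transform_pairing (local_transform \<phi>) k))\<^sup>2 \<le> C * L2sq (\<lambda>\<xi>. of_real (weight b (- \<sigma>) \<xi>) * inv_fourier \<phi> \<xi>)"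
    using transform_pairing_bound by blast
  define E where "E = (\<lambda>(\<phi> :: 'n cfun) \<xi>. of_real (weight b (- \<sigma>) \<xi>) * inv_fourier \<phi> \<xi>)"
  define L where "L = (\<lambda>g. transform_pairing (local_transform (fourier (\<lambda>\<xi>. of_real (weight b \<sigma> \<xi>) * g \<xi>))) k)"
  have ES: "E \<phi> \<in> schwartz_functions" if "\<phi> \<in> test_functions" for \<phi>
    unfolding E_def by (intro schwartz_weight inv_fourier_schwartz test_schwartz that)
  have LE: "L (E \<phi>) = transform_pairing (local_transform \<phi>) k" if "\<phi> \<in> test_functions" for \<phi>
  proof -
    have "(\<lambda>\<xi>. of_real (weight b \<sigma> \<xi>) * E \<phi> \<xi>) = inv_fourier \<phi>"
      unfolding E_def using weight_minus[of b \<sigma>] by (simp add: mult.assoc[symmetric] flip: of_real_mult)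
    then show ?thesis unfolding L_def using fourier_inv_fourier[OF test_schwartz[OF that]] by simp
  qed
  have Elin: "(\<lambda>x. a * E \<phi> x + c * E \<psi> x) = E (\<lambda>x. a * \<phi> x + c * \<psi> x)"
    if "\<phi> \<in> test_functions" "\<psi> \<in> test_functions" for \<phi> \<psi> a c
    unfolding E_def by (simp add: inv_fourier_lin test_schwartz that algebra_simps)
  show ?thesis
  proof (rule L2_riesz[of "E ` test_functions" L C])
    fix f
    assume f: "square_integrable f" "\<And>g. g \<in> E ` test_functions \<Longrightarrow> L g = (LINT x|lborel. f x * g x)"
    show thesis
    proof (rule that[of "\<lambda>\<xi>. of_real (weight b (- \<sigma>) \<xi>) * f \<xi>"])
      have "(\<lambda>\<xi>. of_real (weight b \<sigma> \<xi>) * (of_real (weight b (- \<sigma>) \<xi>) * f \<xi>)) = f"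
        using weight_minus[of b \<sigma>] by (simp add: mult.assoc[symmetric] flip: of_real_mult)
      then show "weighted_L2 b \<sigma> (\<lambda>\<xi>. of_real (weight b (- \<sigma>) \<xi>) * f \<xi>)" unfolding weighted_L2_sqi using f(1) by simp
      fix \<phi> :: "'n cfun" assume p: "\<phi> \<in> test_functions"
      have "transform_pairing (local_transform \<phi>) k = (LINT x|lborel. f x * E \<phi> x)" using f(2)[of "E \<phi>"] p LE[OF p] by simp
      then show "transform_pairing (local_transform \<phi>) k = (LINT \<xi>|lborel. (of_real (weight b (- \<sigma>) \<xi>) * f \<xi>) * inv_fourier \<phi> \<xi>)"
        unfolding E_def by (simp add: mult_ac)
    qed
  next
    fix g g' :: "'n cfun" and a c assume "g \<in> E ` test_functions" "g' \<in> E ` test_functions"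
    then obtain \<phi> \<psi> where e: "g = E \<phi>" "g' = E \<psi>" and p: "\<phi> \<in> test_functions" "\<psi> \<in> test_functions" by blast
    show "(\<lambda>x. a * g x + c * g' x) \<in> E ` test_functions"
      unfolding e Elin[OF p] by (intro imageI test_lin p)
    show "L (\<lambda>x. a * g x + c * g' x) = a * L g + c * L g'"
      unfolding e Elin[OF p] LE[OF p(1)] LE[OF p(2)] LE[OF test_lin[OF p]] by (rule transform_pairing_linear[OF p])
  next
    show "E ` test_functions \<noteq> {}" using test_zero by blast
  next
    fix g :: "'n cfun" assume "g \<in> E ` test_functions"
    then obtain \<phi> where e: "g = E \<phi>" and p: "\<phi> \<in> test_functions" by blast
    show "square_integrable g" unfolding e by (intro schwartz_sqi ES p)
    show "(norm (L g))\<^sup>2 \<le> C * L2sq g" unfolding e LE[OF p] using C(2)[OF p] by (simp add: E_def)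
  qed (rule C(1))
qed

end

section \<open>The inclusions\<close>

lemma schwartz_le_test_seminorm:
  fixes \<phi> :: "'n::finite cfun"
  assumes p: "\<phi> \<in> test_functions" and r: "\<And>x. x \<in> supp \<phi> \<Longrightarrow> norm x \<le> r" "r \<ge> 0"
  shows "schwartz_seminorm N \<phi> \<le> (1 + r) ^ N * test_seminorm N \<phi>"
  unfolding schwartz_seminorm_def test_seminorm_def sum_distrib_left
proof (intro sum_mono cSUP_least)
  fix \<alpha> :: "'n list" and x
  have bdd: "bdd_above (range (\<lambda>x. norm (partials \<alpha> \<phi> x)))"
  proof -
    obtain C where "\<And>x. (1 + norm x) ^ 0 * norm (partials \<alpha> \<phi> x) \<le> C" using schwartz_bound[OF test_schwartz[OF p]] by metis
    then show ?thesis by (intro bdd_aboveI2[of _ _ C]) auto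
  qed
  have le: "norm (partials \<alpha> \<phi> x) \<le> (SUP x. norm (partials \<alpha> \<phi> x))" by (intro cSUP_upper bdd) auto
  show "(1 + norm x) ^ N * norm (partials \<alpha> \<phi> x) \<le> (1 + r) ^ N * (SUP x. norm (partials \<alpha> \<phi> x))"
  proof (cases "x \<in> supp \<phi>")
    case True
    then show ?thesis using r le by (intro mult_mono power_mono) auto
  next
    case False
    then have "partials \<alpha> \<phi> x = 0" by (intro partials_outside[of "supp \<phi>"]) (auto simp: not_in_supp)
    then show ?thesis using le r(2) by simp
  qed
qed auto

lemma as_distribution_distribution:
  assumes T: "T \<in> tempered_distributions"
  shows "as_distribution T \<in> distributions"
proof -
  have lin: "linear_functional_on schwartz_functions T" using T by (simp add: tempered_distributions_def)
  obtain C N where C: "\<And>\<phi>. \<phi> \<in> schwartz_functions \<Longrightarrow> norm (T \<phi>) \<le> C * schwartz_seminorm N \<phi>"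
    using T by (auto simp: tempered_distributions_def)
  have "linear_functional_on test_functions (as_distribution T)"
    unfolding linear_functional_on_def
  proof (intro ballI allI)
    fix \<phi> \<psi> :: "'a cfun" and a c assume p: "\<phi> \<in> test_functions" "\<psi> \<in> test_functions"
    have "T (\<lambda>x. a * \<phi> x + c * \<psi> x) = a * T \<phi> + c * T \<psi>"
      by (rule lin[unfolded linear_functional_on_def, rule_format]) (intro test_schwartz p)+
    then show "as_distribution T (\<lambda>x. a * \<phi> x + c * \<psi> x) = a * as_distribution T \<phi> + c * as_distribution T \<psi>"
      using p test_lin[OF p] by (simp add: as_distribution_def)
  qed
  moreover have "\<exists>C N. \<forall>\<phi>\<in>test_functions. supp \<phi> \<subseteq> K \<longrightarrow> norm (as_distribution T \<phi>) \<le> C * test_seminorm N \<phi>"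
    if K: "compact K" for K
  proof -
    obtain r where r: "r \<ge> 0" "\<And>x. x \<in> K \<Longrightarrow> norm x \<le> r"
      using compact_imp_bounded[OF K] unfolding bounded_iff by (metis abs_ge_self abs_ge_zero order_trans)
    have "norm (as_distribution T \<phi>) \<le> (\<bar>C\<bar> * (1 + r) ^ N) * test_seminorm N \<phi>"
      if p: "\<phi> \<in> test_functions" "supp \<phi> \<subseteq> K" for \<phi>
    proof -
      have "norm (as_distribution T \<phi>) \<le> C * schwartz_seminorm N \<phi>"
        using p(1) C[OF test_schwartz[OF p(1)]] by (simp add: as_distribution_def)
      also have "\<dots> \<le> \<bar>C\<bar> * schwartz_seminorm N \<phi>"
        by (intro mult_right_mono seminorm_nonneg test_schwartz p) auto
      also have "\<dots> \<le> \<bar>C\<bar> * ((1 + r) ^ N * test_seminorm N \<phi>)"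
        using r p by (intro mult_left_mono schwartz_le_test_seminorm) auto
      finally show ?thesis by (simp add: mult.assoc)
    qed
    then show ?thesis by blast
  qed
  ultimately show ?thesis by (auto simp: distributions_def as_distribution_def)
qed

lemma cutoff_as_distribution:
  assumes "\<eta> \<in> test_functions" shows "cutoff \<eta> (as_distribution T) = cutoff \<eta> T"
  unfolding cutoff_def as_distribution_def
  by (intro ext) (auto intro: test_mult_smooth[OF assms] schwartz_smooth)

lemma as_distribution_loc:
  assumes T: "T \<in> sobolev b s"
  shows "as_distribution T \<in> sobolev_loc b s"
proof -
  obtain h where h: "has_spectrum b s T h" using sobolev_spectrum[OF T] by blast
  have "cutoff \<eta> (as_distribution T) \<in> sobolev b s" if "\<eta> \<in> test_functions" for \<eta>
    unfolding cutoff_as_distribution[OF that]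
    by (rule spectrum_sobolev[OF cutoff_extensional cutoff_spectrum(1)[OF h test_schwartz[OF that]]])
  moreover have "as_distribution T \<in> distributions"
    using T by (intro as_distribution_distribution) (simp add: sobolev_def)
  ultimately show ?thesis by (simp add: sobolev_loc_def)
qed

context ul_product
begin

lemma u_loc: "u \<in> sobolev_loc b s"
  unfolding sobolev_loc_def using u spectrum_sobolev[OF cutoff_extensional local_transform] by blast

text \<open>The product is the functional just represented, with the constant of Parseval's formula. A
  cut-off \<open>\<eta>\<close> that is one near the support of \<open>\<phi>\<close> disappears because \<open>\<eta>\<phi> = \<phi>\<close>, whichever of
  the two factors it is applied to.\<close>

lemma sobolev_product:
  assumes VT: "V \<in> sobolev b t"
  obtains W where "W \<in> sobolev b \<sigma>" "is_product b s t u (as_distribution V) (as_distribution W)"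
    "is_product b t s (as_distribution V) u (as_distribution W)"
proof -
  let ?c = "complex_of_real (1 / (2 * pi) ^ CARD('n))"
  obtain H where H: "weighted_L2 b \<sigma> H" "\<And>\<phi>. \<phi> \<in> test_functions \<Longrightarrow> transform_pairing (local_transform \<phi>) k = (LINT \<xi>|lborel. H \<xi> * inv_fourier \<phi> \<xi>)"
    using product_exists by blast
  have H': "weighted_L2 b \<sigma> (\<lambda>\<xi>. ?c * H \<xi>)"
    using sqi_cmult[OF H(1)[unfolded weighted_L2_sqi], of ?c] unfolding weighted_L2_sqi by (simp add: mult_ac)
  define W where "W = of_spectrum (\<lambda>\<xi>. ?c * H \<xi>)"
  have W: "W \<in> sobolev b \<sigma>" unfolding W_def by (rule of_spectrum_sobolev[OF H'])
  have wd: "as_distribution W \<in> distributions"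
    using W by (intro as_distribution_distribution) (simp add: sobolev_def)
  have Wp: "as_distribution W \<phi> = ?c * transform_pairing (local_transform \<phi>) k" if "\<phi> \<in> test_functions" for \<phi>
  proof -
    have "as_distribution W \<phi> = (LINT \<xi>|lborel. ?c * (H \<xi> * inv_fourier \<phi> \<xi>))"
      using that test_schwartz[OF that] by (simp add: as_distribution_def W_def of_spectrum_def mult.assoc)
    then show ?thesis using H(2)[OF that] by simp
  qed
  have one: "(\<lambda>x. \<eta> x * \<phi> x) = \<phi>" "(\<lambda>x. \<phi> x * \<eta> x) = \<phi>"
    if "\<exists>U. open U \<and> supp \<phi> \<subseteq> U \<and> (\<forall>x\<in>U. \<eta> x = 1)" for \<phi> \<eta> :: "'n cfun"
  proof -
    have "\<phi> x = 0 \<or> \<eta> x = 1" for x using that not_in_supp[of x \<phi>] by blast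
    then show "(\<lambda>x. \<eta> x * \<phi> x) = \<phi>" "(\<lambda>x. \<phi> x * \<eta> x) = \<phi>" by (auto simp: fun_eq_iff)
  qed
  have cutV: "cutoff \<eta> V \<in> sobolev b t" "has_spectrum b t (cutoff \<eta> V) (conv k (\<lambda>\<zeta>. inv_fourier \<eta> (- \<zeta>)))"
    if "\<eta> \<in> test_functions" for \<eta>
    using cutoff_spectrum(1)[OF V test_schwartz[OF that]] spectrum_sobolev[OF cutoff_extensional] by blast+
  have cutu: "cutoff \<eta> u \<in> sobolev b s" if "\<eta> \<in> test_functions" for \<eta>
    using spectrum_sobolev[OF cutoff_extensional local_transform[OF that]] .
  have s_ge: "(- t) $ l \<le> s $ l" for l using st[of l] by simp
  have A: "is_product b s t u (as_distribution V) (as_distribution W)"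
    unfolding is_product_def
  proof (intro conjI allI ballI impI u_loc as_distribution_loc VT wd st)
    fix \<phi> \<eta> :: "'n cfun" assume p: "\<phi> \<in> test_functions" and e: "\<eta> \<in> test_functions"
      and 1: "\<exists>U. open U \<and> supp \<phi> \<subseteq> U \<and> (\<forall>x\<in>U. \<eta> x = 1)"
    let ?k = "conv k (\<lambda>\<zeta>. inv_fourier \<phi> (- \<zeta>))"
    have m: "has_spectrum b (- s) (cutoff \<phi> V) ?k" by (rule has_spectrum_mono[OF cutV(2)[OF p] t_ge])
    have "sobolev_pairing b s (cutoff \<eta> u) (cutoff \<phi> (as_distribution V)) = ?c * transform_pairing (local_transform \<eta>) ?k"
      unfolding cutoff_as_distribution[OF p]
      by (rule sobolev_pairing_spectrum[OF cutu[OF e] local_transform[OF e] spectrum_sobolev[OF cutoff_extensional m] m])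
    also have "transform_pairing (local_transform \<eta>) ?k = of_spectrum (conv (local_transform \<eta>) k) \<phi>"
      by (rule transform_pairing_cutoff_right[OF local_transform_weighted_L2[OF e] V test_schwartz[OF p] cutV(2)[OF p]])
    also have "\<dots> = transform_pairing (local_transform \<phi>) k" using transform_pairing_product[OF e p] unfolding one(1)[OF 1] by simp
    finally show "as_distribution W \<phi> = sobolev_pairing b s (cutoff \<eta> u) (cutoff \<phi> (as_distribution V))"
      using Wp[OF p] by simp
  qed
  have B: "is_product b t s (as_distribution V) u (as_distribution W)"
    unfolding is_product_def
  proof (intro conjI allI ballI impI u_loc as_distribution_loc VT wd)
    show "0 \<le> t $ l + s $ l" for l using st[of l] by simp
    fix \<phi> \<eta> :: "'n cfun" assume p: "\<phi> \<in> test_functions" and e: "\<eta> \<in> test_functions"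
      and 1: "\<exists>U. open U \<and> supp \<phi> \<subseteq> U \<and> (\<forall>x\<in>U. \<eta> x = 1)"
    let ?k = "conv k (\<lambda>\<zeta>. inv_fourier \<eta> (- \<zeta>))"
    have m: "has_spectrum b (- t) (cutoff \<phi> u) (local_transform \<phi>)" by (rule has_spectrum_mono[OF local_transform[OF p] s_ge])
    have "sobolev_pairing b t (cutoff \<eta> (as_distribution V)) (cutoff \<phi> u) = ?c * transform_pairing ?k (local_transform \<phi>)"
      unfolding cutoff_as_distribution[OF e]
      by (rule sobolev_pairing_spectrum[OF cutV[OF e] spectrum_sobolev[OF cutoff_extensional m] m])
    also have "transform_pairing ?k (local_transform \<phi>) = transform_pairing (local_transform \<phi>) ?k"
      by (intro transform_pairing_commute has_spectrum_measurable[OF cutV(2)[OF e]] has_spectrum_measurable[OF local_transform[OF p]])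
    also have "\<dots> = of_spectrum (conv (local_transform \<phi>) k) \<eta>"
      by (rule transform_pairing_cutoff_right[OF local_transform_weighted_L2[OF p] V test_schwartz[OF e] cutV(2)[OF e]])
    also have "\<dots> = transform_pairing (local_transform \<phi>) k" using transform_pairing_product[OF p e] unfolding one(2)[OF 1] by simp
    finally show "as_distribution W \<phi> = sobolev_pairing b t (cutoff \<eta> (as_distribution V)) (cutoff \<phi> u)"
      using Wp[OF p] by simp
  qed
  show ?thesis by (rule that[OF W A B])
qed

end

lemma (in product_estimate) ul_times_sobolev:
  assumes u: "u \<in> sobolev_ul b s" and VS: "V \<in> sobolev b t"
  obtains W where "W \<in> sobolev b \<sigma>" "is_product b s t u (as_distribution V) (as_distribution W)"
    "is_product b t s (as_distribution V) u (as_distribution W)"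
proof -
  obtain \<omega> where w: "u \<in> distributions" "\<omega> \<in> test_functions" "\<omega> \<noteq> (\<lambda>x. 0)" "\<And>y. cutoff (translate y \<omega>) u \<in> sobolev b s"
    and bdd: "bdd_above (range (\<lambda>y. sobolev_norm b s (cutoff (translate y \<omega>) u)))"
    using u unfolding sobolev_ul_def by blast
  obtain B where B: "\<And>y. sobolev_norm b s (cutoff (translate y \<omega>) u) \<le> B"
    using bdd unfolding bdd_above_def by blast
  obtain k where k: "has_spectrum b t V k" using sobolev_spectrum[OF VS] by blast
  interpret ul_product b s t \<sigma> M u \<omega> B V k
    by unfold_locales (use w B k in auto)
  show ?thesis by (rule sobolev_product[OF VS that])
qed

theorem corollary3p12:
  fixes b :: "'n::finite \<Rightarrow> 'j::finite"
    and s t \<epsilon> \<sigma> :: "real ^ 'j"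
  assumes "surj b"
    and "\<And>l. s $ l + t $ l > real (block_dim b l) / 2"
    and "\<And>l. 0 < \<epsilon> $ l"
    and "\<And>l. \<epsilon> $ l < s $ l + t $ l - real (block_dim b l) / 2"
    and "\<And>l. \<sigma> $ l = Min {s $ l, t $ l, s $ l + t $ l - real (block_dim b l) / 2 - \<epsilon> $ l}"
  shows "products_in b s t (sobolev_ul b s) (as_distribution ` sobolev b t)
           (as_distribution ` sobolev b \<sigma>) \<and>
         products_in b s t (as_distribution ` sobolev b s) (sobolev_ul b t)
           (as_distribution ` sobolev b \<sigma>)"
proof -
  (* The excess of a over half the block dimension makes the kernel integrable. *)
  define a where "a = (\<chi> l. real (block_dim b l) / 2 + \<epsilon> $ l)"
  have n: "block_dim b l > 0" for l
  proof -
    obtain i where "b i = l" using assms(1) by (metis surj_def)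
    then show ?thesis unfolding block_dim_def by (auto simp: card_gt_0_iff)
  qed
  have e: "\<sigma> $ l \<le> s $ l" "\<sigma> $ l \<le> t $ l" "\<sigma> $ l \<le> s $ l + t $ l - a $ l" for l
    unfolding assms(5) a_def by (auto simp: min_def)
  have st: "a $ l \<le> s $ l + t $ l" "a $ l > real (block_dim b l) / 2" "0 \<le> s $ l + t $ l" for l
    using assms(3)[of l] assms(4)[of l] assms(2)[of l] order_trans[of 0 "real (block_dim b l) / 2" "s $ l + t $ l"]
    unfolding a_def by auto
  obtain M where M: "M \<ge> 0"
    "\<And>\<zeta>. (\<integral>\<^sup>+\<xi>. ennreal ((weight b \<sigma> \<zeta> * weight b (- s) \<xi> * weight b (- t) (\<zeta> - \<xi>))\<^sup>2) \<partial>lborel) \<le> ennreal M"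
    using kernel_integral[of b \<sigma> s t a, OF n e st(1,2)] by blast
  interpret P: product_estimate b s t \<sigma> M
    by unfold_locales (use M(1) st(3) bilinear_estimate[OF M(2)] in auto)
  interpret Q: product_estimate b t s \<sigma> M by (rule P.swap)
  show ?thesis
    unfolding products_in_def
  proof (intro conjI ballI)
    fix u v :: "'n cfunctional" assume u: "u \<in> sobolev_ul b s" and "v \<in> as_distribution ` sobolev b t"
    then obtain V where V: "v = as_distribution V" "V \<in> sobolev b t" by blast
    show "\<exists>w\<in>as_distribution ` sobolev b \<sigma>. is_product b s t u v w"
      unfolding V(1) by (rule P.ul_times_sobolev[OF u V(2)]) blast
  next
    fix u v :: "'n cfunctional" assume "u \<in> as_distribution ` sobolev b s" and v: "v \<in> sobolev_ul b t"
    then obtain U where U: "u = as_distribution U" "U \<in> sobolev b s" by blast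
    show "\<exists>w\<in>as_distribution ` sobolev b \<sigma>. is_product b s t u v w"
      unfolding U(1) by (rule Q.ul_times_sobolev[OF v U(2)]) blast
  qed
qed

end
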